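(* Let $\{\Phi^k\}_{k\ge0}$ be a uniformly well posed SCF sequence with gap $\gamma>0$ whose initial function satisfies $\lVert\langle x\rangle\varphi_i^0\rVert_{L^2(\mathbb R^3)}\le C_0$, $1\le i\le N$, for some $C_0>0$. Let $\Xi^\infty,\tilde\Xi^\infty\in\mathcal W$ and $N\times N$ unitary matrices $A_k$ be such that $A_{2k}\Phi^{2k}\to\Xi^\infty$ and $A_{2k+1}\Phi^{2k+1}\to\tilde\Xi^\infty$ in $\bigoplus_{i=1}^NH^2(\mathbb R^3)$ (and $D_{\Phi^{2k}}\to D_{\Xi^\infty}$, $D_{\Phi^{2k+1}}\to D_{\tilde\Xi^\infty}$ in Hilbert–Schmidt norm). Then: (1) The distance between the set of the $N$ smallest eigenvalues (counted with multiplicity) of $\mathcal F(\Xi^\infty)$ and the rest of the spectrum of $\mathcal F(\Xi^\infty)$ is at least $\gamma$, and the same holds for $\mathcal F(\tilde\Xi^\infty)$. In particular one may choose $\hat\Phi^\infty={}^t(\hat\varphi^\infty_1,\dots,\hat\varphi^\infty_N)\in\mathcal W$ with $\mathcal F(\Xi^\infty)\hat\varphi_i^\infty=\hat\epsilon_i^\infty\hat\varphi_i^\infty$, where $\hat\epsilon_1^\infty\le\dots\le\hat\epsilon_N^\infty$ are the $N$ smallest eigenvalues of $\mathcal F(\Xi^\infty)$; fix such a choice. (2) There exists an $N\times N$ unitary matrix $A_\infty$ with $\tilde\Xi^\infty=A_\infty\hat\Phi^\infty$. Moreover $\hat\epsilon_i^\infty=\lim_{k\to\infty}\epsilon_i^{2k+1}$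 for $1\le i\le N$. (3) If there exists an $N\times N$ unitary matrix $\Theta$ with $\Xi^\infty=\Theta\tilde\Xi^\infty$, then $\hat\Phi^\infty$ solves the Hartree–Fock equation $\mathcal F(\hat\Phi^\infty)\hat\varphi_i^\infty=\hat\epsilon_i^\infty\hat\varphi_i^\infty$, $1\le i\le N$. (4) If $\hat\Phi^\infty$ is an orthonormal basis of the direct sum of the eigenspaces of the $N$ smallest eigenvalues of $\mathcal F(\hat\Phi^\infty)$, then there exists an $N\times N$ unitary matrix $\Theta$ with $\Xi^\infty=\Theta\tilde\Xi^\infty$. (5) If $D_{\hat\Phi^\infty}=D_{\Xi^\infty}$, then there exists an $N\times N$ unitary matrix $\Theta$ with $\Xi^\infty=\Theta\tilde\Xi^\infty$.
   Context: Fix $n,N\in\mathbb N$, nuclear positions $R_1,\dots,R_n\in\mathbb R^3$ and charges $Z_1,\dots,Z_n>0$. Let $h:=-\Delta+V$ on $L^2(\mathbb R^3)$ (domain $H^2(\mathbb R^3)$) with $V(x):=-\sum_{l=1}^n Z_l|x-R_l|^{-1}$; $\langle x\rangle:=\sqrt{1+|x|^2}$. Inner products on $L^2(\mathbb R^3)$ are antilinear in the first argument. $\bigoplus_{i=1}^NH^2(\mathbb R^3)$ is the Hilbert space of tuples $\Phi={}^t(\varphi_1,\dots,\varphi_N)$ with inner product $\sum_i\langle\varphi_i,(1-\Delta)^2\tilde\varphi_i\rangle$. Let $\mathcal W:=\{\Phi\in\bigoplus_{i=1}^NH^2(\mathbb R^3):\langle\varphi_i,\varphi_j\rangle=\delta_{ij}\}$.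 For an $N\times N$ matrix $A$, $A\Phi$ has components $\sum_jA_{ij}\varphi_j$. For $\Phi\in\bigoplus_{i=1}^NH^2(\mathbb R^3)$: $R^{\Phi}(x):=\sum_{i}\int|x-y|^{-1}|\varphi_i(y)|^2dy$ (multiplication operator), $(S^{\Phi}w)(x):=\sum_{i}\left(\int|x-y|^{-1}\overline{\varphi_i(y)}w(y)dy\right)\varphi_i(x)$, $\mathcal G(\Phi):=R^\Phi-S^\Phi$, Fock operator $\mathcal F(\Phi):=h+\mathcal G(\Phi)$. For $\Phi\in\mathcal W$, $D_\Phi w:=\sum_i\langle\varphi_i,w\rangle\varphi_i$; $\lVert\cdot\rVert_2$ is the Hilbert–Schmidt norm. An SCF sequence is $\{\Phi^k\}_{k\ge0}\subset\mathcal W$ such that for each $k$, $\mathcal F(\Phi^k)$ has at least $N$ eigenvalues (with multiplicity) below its essential spectrum and $\Phi^{k+1}={}^t(\varphi_1^{k+1},\dots,\varphi_N^{k+1})$ is orthonormal with $\mathcal F(\Phi^k)\varphi_i^{k+1}=\epsilon_i^{k+1}\varphi_i^{k+1}$, where $\epsilon_1^{k+1}\le\dots\le\epsilon_N^{k+1}$ are the $N$ smallest eigenvalues of $\mathcal F(\Phi^k)$ with multiplicity. It is uniformly well posed with gap $\gamma>0$ if for every $k$, $\mathcal F(\Phi^k)$ has at least $N$ isolated eigenvalues below $\inf\sigma_{ess}(\mathcal F(\Phi^k))$ and the distance between the set of its $N$ smallest eigenvalues and the rest of its spectrum is at least $\gamma$. (Under these assumptions such $\Xi^\infty,\tilde\Xi^\infty,A_k$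 exist.) *)

theory Defs
  imports "HOL-Analysis.Analysis"
begin

text \<open>Functions on R^3 (type real^3), complex valued. Tuples of N functions are
  represented as nat-indexed families, components 0..N-1 (paper: 1..N).
  All identities between L^2 functions are understood almost everywhere.\<close>

type_synonym fn3 = "real^3 \<Rightarrow> complex"
type_synonym tup = "nat \<Rightarrow> fn3"

definition ae_eq :: "fn3 \<Rightarrow> fn3 \<Rightarrow> bool" where
  "ae_eq f g \<longleftrightarrow> (AE x in lborel. f x = g x)"

definition L2 :: "fn3 \<Rightarrow> bool" where
  "L2 f \<longleftrightarrow> f \<in> borel_measurable lborel \<and> integrable lborel (\<lambda>x. (cmod (f x))^2)"

definition inner_L2 :: "fn3 \<Rightarrow> fn3 \<Rightarrow> complex" where
  "inner_L2 f g = (LINT x|lborel. cnj (f x) * g x)"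

definition norm_L2 :: "fn3 \<Rightarrow> real" where
  "norm_L2 f = sqrt (LINT x|lborel. (cmod (f x))^2)"

definition pd :: "3 \<Rightarrow> fn3 \<Rightarrow> fn3" where
  "pd i f = (\<lambda>x. frechet_derivative f (at x) (axis i 1))"

fun iter_pd :: "3 list \<Rightarrow> fn3 \<Rightarrow> fn3" where
  "iter_pd [] f = f"
| "iter_pd (i # js) f = pd i (iter_pd js f)"

definition test_fun :: "fn3 \<Rightarrow> bool" where
  "test_fun tf \<longleftrightarrow> (\<forall>js x. iter_pd js tf differentiable (at x))
      \<and> (\<exists>r. \<forall>x. r < norm x \<longrightarrow> tf x = 0)"

definition weak_deriv :: "3 list \<Rightarrow> fn3 \<Rightarrow> fn3 \<Rightarrow> bool" where
  "weak_deriv js f g \<longleftrightarrow> (\<forall>tf. test_fun tf \<longrightarrow>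
      (LINT x|lborel. f x * iter_pd js tf x) = (-1) ^ length js * (LINT x|lborel. g x * tf x))"

definition H2 :: "fn3 \<Rightarrow> bool" where
  "H2 f \<longleftrightarrow> L2 f \<and> (\<forall>js. length js \<le> 2 \<longrightarrow> (\<exists>g. L2 g \<and> weak_deriv js f g))"

text \<open>Weak Laplacian (a representative; unique a.e. for f in H^2).\<close>
definition lap :: "fn3 \<Rightarrow> fn3" where
  "lap f = (\<lambda>x. \<Sum>i\<in>UNIV. (SOME g. L2 g \<and> weak_deriv [i, i] f g) x)"

text \<open>Norm on the direct sum of N copies of H^2 induced by the inner product
  sum_i <phi_i, (1 - Delta)^2 psi_i> = sum_i <(1-Delta) phi_i, (1-Delta) psi_i>.\<close>
definition H2_tup_norm :: "nat \<Rightarrow> tup \<Rightarrow> real" where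
  "H2_tup_norm N \<Phi> = sqrt (\<Sum>i<N. (norm_L2 (\<lambda>x. \<Phi> i x - lap (\<Phi> i) x))^2)"

definition inW :: "nat \<Rightarrow> tup \<Rightarrow> bool" where
  "inW N \<Phi> \<longleftrightarrow> (\<forall>i<N. H2 (\<Phi> i)) \<and>
     (\<forall>i<N. \<forall>j<N. inner_L2 (\<Phi> i) (\<Phi> j) = (if i = j then 1 else 0))"

definition unitary_mat :: "nat \<Rightarrow> (nat \<Rightarrow> nat \<Rightarrow> complex) \<Rightarrow> bool" where
  "unitary_mat N A \<longleftrightarrow> (\<forall>i<N. \<forall>j<N. (\<Sum>l<N. cnj (A l i) * A l j) = (if i = j then 1 else 0))"

definition mat_act :: "nat \<Rightarrow> (nat \<Rightarrow> nat \<Rightarrow> complex) \<Rightarrow> tup \<Rightarrow> tup" where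
  "mat_act N A \<Phi> = (\<lambda>i x. \<Sum>j<N. A i j * \<Phi> j x)"

definition tup_eq :: "nat \<Rightarrow> tup \<Rightarrow> tup \<Rightarrow> bool" where
  "tup_eq N \<Phi> \<Psi> \<longleftrightarrow> (\<forall>i<N. ae_eq (\<Phi> i) (\<Psi> i))"

text \<open>Density matrix D_Phi and Hilbert--Schmidt norm (sup over finite orthonormal
  families of sum ||T e_j||^2, which equals the sum over any orthonormal basis).\<close>
definition Dmat :: "nat \<Rightarrow> tup \<Rightarrow> fn3 \<Rightarrow> fn3" where
  "Dmat N \<Phi> w = (\<lambda>x. \<Sum>i<N. inner_L2 (\<Phi> i) w * \<Phi> i x)"

definition orthonormal_fam :: "nat \<Rightarrow> tup \<Rightarrow> bool" where
  "orthonormal_fam m e \<longleftrightarrow> (\<forall>i<m. L2 (e i)) \<and>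
     (\<forall>i<m. \<forall>j<m. inner_L2 (e i) (e j) = (if i = j then 1 else 0))"

definition hs_norm :: "(fn3 \<Rightarrow> fn3) \<Rightarrow> real" where
  "hs_norm T = sqrt (Sup {(\<Sum>j<m. (norm_L2 (T (e j)))^2) | m e. orthonormal_fam m e})"

definition Vpot :: "nat \<Rightarrow> (nat \<Rightarrow> real^3) \<Rightarrow> (nat \<Rightarrow> real) \<Rightarrow> real^3 \<Rightarrow> real" where
  "Vpot n R Z x = - (\<Sum>l<n. Z l / norm (x - R l))"

definition Rpot :: "nat \<Rightarrow> tup \<Rightarrow> real^3 \<Rightarrow> real" where
  "Rpot N \<Phi> x = (\<Sum>i<N. LINT y|lborel. (cmod (\<Phi> i y))^2 / norm (x - y))"

definition Sop :: "nat \<Rightarrow> tup \<Rightarrow> fn3 \<Rightarrow> fn3" where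
  "Sop N \<Phi> w = (\<lambda>x. \<Sum>i<N. (LINT y|lborel. cnj (\<Phi> i y) * w y / complex_of_real (norm (x - y))) * \<Phi> i x)"

definition Gop :: "nat \<Rightarrow> tup \<Rightarrow> fn3 \<Rightarrow> fn3" where
  "Gop N \<Phi> w = (\<lambda>x. complex_of_real (Rpot N \<Phi> x) * w x - Sop N \<Phi> w x)"

definition hop :: "nat \<Rightarrow> (nat \<Rightarrow> real^3) \<Rightarrow> (nat \<Rightarrow> real) \<Rightarrow> fn3 \<Rightarrow> fn3" where
  "hop n R Z w = (\<lambda>x. - lap w x + complex_of_real (Vpot n R Z x) * w x)"

definition Fock :: "nat \<Rightarrow> (nat \<Rightarrow> real^3) \<Rightarrow> (nat \<Rightarrow> real) \<Rightarrow> nat \<Rightarrow> tup \<Rightarrow> fn3 \<Rightarrow> fn3" where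
  "Fock n R Z N \<Phi> w = (\<lambda>x. hop n R Z w x + Gop N \<Phi> w x)"

text \<open>Spectral notions for an operator T on L^2(R^3) with domain H^2 (self-adjoint in
  our application, so only real spectral parameters are considered).\<close>
definition spec :: "(fn3 \<Rightarrow> fn3) \<Rightarrow> real set" where
  "spec T = {lam. \<not> ((\<forall>g. L2 g \<longrightarrow> (\<exists>u. H2 u \<and> ae_eq (\<lambda>x. T u x - of_real lam * u x) g))
                 \<and> (\<forall>u. H2 u \<and> ae_eq (\<lambda>x. T u x - of_real lam * u x) (\<lambda>x. 0) \<longrightarrow> ae_eq u (\<lambda>x. 0)))}"

definition eigvec :: "(fn3 \<Rightarrow> fn3) \<Rightarrow> real \<Rightarrow> fn3 \<Rightarrow> bool" where
  "eigvec T lam u \<longleftrightarrow> H2 u \<and> ae_eq (T u) (\<lambda>x. of_real lam * u x)"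

definition mult :: "(fn3 \<Rightarrow> fn3) \<Rightarrow> real \<Rightarrow> enat" where
  "mult T lam = Sup {enat m | m. \<exists>e. orthonormal_fam m e \<and> (\<forall>j<m. eigvec T lam (e j))}"

definition disc_spec :: "(fn3 \<Rightarrow> fn3) \<Rightarrow> real set" where
  "disc_spec T = {lam \<in> spec T. (\<exists>\<delta>>0. \<forall>\<mu>\<in>spec T. \<bar>\<mu> - lam\<bar> < \<delta> \<longrightarrow> \<mu> = lam)
                    \<and> 0 < mult T lam \<and> mult T lam < \<infinity>}"

definition ess_spec :: "(fn3 \<Rightarrow> fn3) \<Rightarrow> real set" where
  "ess_spec T = spec T - disc_spec T"

definition below_ess :: "(fn3 \<Rightarrow> fn3) \<Rightarrow> real \<Rightarrow> bool" where
  "below_ess T lam \<longleftrightarrow> (\<forall>\<mu>\<in>ess_spec T. lam < \<mu>)"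

definition N_lowest :: "nat \<Rightarrow> (fn3 \<Rightarrow> fn3) \<Rightarrow> (nat \<Rightarrow> real) \<Rightarrow> bool" where
  "N_lowest N T eps \<longleftrightarrow>
     (\<forall>i j. i \<le> j \<longrightarrow> j < N \<longrightarrow> eps i \<le> eps j)
   \<and> (\<forall>i<N. eps i \<in> disc_spec T \<and> below_ess T (eps i))
   \<and> (\<forall>lam. enat (card {i. i < N \<and> eps i = lam}) \<le> mult T lam)
   \<and> (\<forall>lam\<in>disc_spec T. below_ess T lam \<and> lam < eps (N - 1) \<longrightarrow>
        enat (card {i. i < N \<and> eps i = lam}) = mult T lam)"

definition gap_ok :: "nat \<Rightarrow> (fn3 \<Rightarrow> fn3) \<Rightarrow> (nat \<Rightarrow> real) \<Rightarrow> real \<Rightarrow> bool" where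
  "gap_ok N T eps \<gamma> \<longleftrightarrow>
     (\<forall>\<mu>\<in>spec T. (\<mu> \<notin> eps ` {..<N} \<or> enat (card {i. i < N \<and> eps i = \<mu>}) < mult T \<mu>)
        \<longrightarrow> (\<forall>i<N. \<gamma> \<le> \<bar>\<mu> - eps i\<bar>))"

text \<open>Uniformly well posed SCF sequence with gap gamma (Phi k = Phi^k,
  eps (Suc k) i = epsilon_{i+1}^{k+1}).\<close>
definition uwp_SCF :: "nat \<Rightarrow> (nat \<Rightarrow> real^3) \<Rightarrow> (nat \<Rightarrow> real) \<Rightarrow> nat \<Rightarrow>
    (nat \<Rightarrow> tup) \<Rightarrow> (nat \<Rightarrow> nat \<Rightarrow> real) \<Rightarrow> real \<Rightarrow> bool" where
  "uwp_SCF n R Z N \<Phi> eps \<gamma> \<longleftrightarrow>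
     (\<forall>k. inW N (\<Phi> k))
   \<and> (\<forall>k. N_lowest N (Fock n R Z N (\<Phi> k)) (eps (Suc k)))
   \<and> (\<forall>k. gap_ok N (Fock n R Z N (\<Phi> k)) (eps (Suc k)) \<gamma>)
   \<and> (\<forall>k. \<forall>i<N. ae_eq (Fock n R Z N (\<Phi> k) (\<Phi> (Suc k) i))
                       (\<lambda>x. of_real (eps (Suc k) i) * \<Phi> (Suc k) i x))"

definition in_span :: "nat \<Rightarrow> tup \<Rightarrow> fn3 \<Rightarrow> bool" where
  "in_span N \<Phi> u \<longleftrightarrow> (\<exists>c. ae_eq u (\<lambda>x. \<Sum>i<N. c i * \<Phi> i x))"

definition in_eig_sum :: "nat \<Rightarrow> (fn3 \<Rightarrow> fn3) \<Rightarrow> (nat \<Rightarrow> real) \<Rightarrow> fn3 \<Rightarrow> bool" where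
  "in_eig_sum N T eps u \<longleftrightarrow>
     (\<exists>v. (\<forall>i<N. eigvec T (eps i) (v i)) \<and> ae_eq u (\<lambda>x. \<Sum>i<N. v i x))"

end

theory Submission
  imports Defs
begin

text \<open>
  The operator \<open>\<G>(\<Phi>)\<close> is unchanged when \<open>\<Phi>\<close> is multiplied by a unitary matrix, and by Hardy's
  inequality it depends continuously, in operator norm, on \<open>\<Phi>\<close> in the first-order Sobolev norm.
  Hence \<open>\<F>(\<Phi>\<^sup>2\<^sup>k)\<close> and \<open>\<F>(\<Xi>\<^sup>\<infinity>)\<close> differ by a bounded operator that tends to \<open>0\<close> in norm. Since the
  unitary group is compact and the eigenvalues stay bounded, along subsequences the iterates and
  their eigenvalues converge to eigenpairs of the limiting operator.

  For a self-adjoint operator the norm of the resolvent is the inverse of the distance to the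
  spectrum, so resolvent sets with quantitative margins survive the limit. To see that no further
  eigenvector appears among the lowest eigenvalues, the known eigenvalues are shifted away by adding
  a multiple of the projection onto their eigenvectors, before the limit is taken; the shifted
  operators then have no spectrum left at these places. As the ordered eigenvalues of the limit
  do not depend on the subsequence, the full sequence converges. The remaining claims compare spans
  of orthonormal families, which agree exactly when the families differ by a unitary matrix.

  Spectral theory takes place in the complex space of square-integrable functions regarded as a real
  Hilbert space with the real part of the inner product; this changes neither self-adjointness
  nor the real spectrum.
\<close>

section \<open>Symmetric operators on real Hilbert spaces\<close>

text \<open>Norm convergence of operators controls the spectrum only as a set, whereas
  \<open>mult\<close> counts dimensions. This mismatch is the obstacle behind the shifting of
  eigenvalues: once they are moved away, a surplus eigenvector of the limit would violate a lower
  bound for \<open>T - l\<close>. All spectral facts are drawn from bijectivity of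
  \<open>T - l\<close> on the domain at real \<open>l\<close>. A symmetric operator then has a
  symmetric inverse on the whole space, and symmetry alone makes that inverse bounded. The sharp
  lower bound for \<open>T - l\<close> rests on one fact: a bounded symmetric operator has its norm,
  or minus its norm, in the spectrum. The price of a real Hilbert space is that each complex
  direction counts twice. Orthonormal families are doubled by their multiples by \<i>, while
  multiplicities, being complex dimensions, are counted on the functions themselves. Hardy's
  inequality has two roles: it makes the nuclear potential an operator from the second-order Sobolev
  space to square-integrable functions, and it bounds the potentials generated by the orbitals
  uniformly in space.\<close>

text \<open>Gliding hump: signed increments of norm \<open>(1/3)\<^sup>n\<close> build a point on which the functionals
  \<open>\<lambda>y. A (x n) \<bullet> y\<close> are unbounded, although symmetry bounds them by \<open>\<parallel>A y\<parallel>\<close>.\<close>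

lemma Hellinger_Toeplitz:
  fixes A :: "'a::{real_inner,complete_space} \<Rightarrow> 'a"
  assumes lin: "linear A" and sym: "\<And>x y. A x \<bullet> y = x \<bullet> A y"
  shows "bounded_linear A"
proof -
  have "\<exists>K. \<forall>x. norm (A x) \<le> norm x * K"
  proof (rule ccontr)
    assume neg: "\<nexists>K. \<forall>x. norm (A x) \<le> norm x * K"
    have "\<exists>x. norm x \<le> 1 \<and> 4 ^ n \<le> norm (A x)" for n :: nat
    proof -
      obtain x where x: "norm (A x) > norm x * 4 ^ n"
        using neg by (meson not_le)
      then have x0: "norm x > 0"
        using linear_0[OF lin] by (metis mult_zero_left norm_eq_zero norm_ge_zero less_le)
      have "norm (A (x /\<^sub>R norm x)) = norm (A x) / norm x"
        using linear_scale[OF lin] by (simp add: divide_inverse mult.commute)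
      then have "4 ^ n \<le> norm (A (x /\<^sub>R norm x))"
        using x x0 by (simp add: pos_le_divide_eq mult.commute)
      moreover have "norm (x /\<^sub>R norm x) \<le> 1" using x0 by simp
      ultimately show ?thesis by blast
    qed
    then obtain x where x: "\<And>n::nat. norm (x n) \<le> 1" "\<And>n. 4 ^ n \<le> norm (A (x n))" by metis
    \<comment> \<open>The direction of \<open>A (x n)\<close> is where the functional of index n is
      largest; the factor 4 to the power n in its norm outgrows the radius 1/3 to the power
      \<open>Suc n\<close>.\<close>
    define v where "v n = (1/3) ^ Suc n *\<^sub>R sgn (A (x n))" for n
    have Ax0: "A (x n) \<noteq> 0" for n
      using x(2)[of n] by (metis norm_zero not_le zero_less_numeral zero_less_power)
    have nv: "norm (v n) = (1/3) ^ Suc n" for n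
      using Ax0 by (simp add: v_def norm_sgn)
    have Axv: "A (x n) \<bullet> v n = (1/3) ^ Suc n * norm (A (x n))" for n
      using Ax0[of n] by (simp add: v_def sgn_div_norm dot_square_norm power2_eq_square)
    \<comment> \<open>The larger of |a + b| and |a - b| is at least |b|, so one of the two signs
      keeps the functional at \<open>y (Suc n)\<close> at least as large as on the increment alone,
      whatever \<open>y n\<close> is.\<close>
    define y where "y = rec_nat 0 (\<lambda>n z. if \<bar>A (x n) \<bullet> (z + v n)\<bar> \<ge> \<bar>A (x n) \<bullet> (z - v n)\<bar>
                                            then z + v n else z - v n)"
    have ySuc: "y (Suc n) = (if \<bar>A (x n) \<bullet> (y n + v n)\<bar> \<ge> \<bar>A (x n) \<bullet> (y n - v n)\<bar>
                                            then y n + v n else y n - v n)" for n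
      by (simp add: y_def)
    have big: "\<bar>A (x n) \<bullet> y (Suc n)\<bar> \<ge> (1/3) ^ Suc n * norm (A (x n))" for n
    proof -
      have "\<bar>A (x n) \<bullet> v n\<bar> \<le> \<bar>A (x n) \<bullet> y (Suc n)\<bar>"
        unfolding ySuc by (auto simp: inner_add_right inner_diff_right)
      then show ?thesis unfolding Axv by (metis abs_le_D1)
    qed
    have step: "norm (y (Suc n) - y n) \<le> (1/3) ^ Suc n" for n
      by (simp only: ySuc nv[symmetric]) simp
    \<comment> \<open>The increments starting at \<open>y n\<close> sum to at most (1/3)^n / 2.
      Taken at \<open>Suc n\<close> this is half the size of hump n, so later steps undo at most
      half of it.\<close>
    have far: "norm (y (n + m) - y n) \<le> (1/3) ^ n / 2 * (1 - (1/3) ^ m)" for n m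
    proof (induction m)
      case (Suc m)
      have "norm (y (n + Suc m) - y n) \<le> norm (y (Suc (n + m)) - y (n + m)) + norm (y (n + m) - y n)"
        using norm_triangle_ineq[of "y (Suc (n + m)) - y (n + m)" "y (n + m) - y n"] by simp
      also have "\<dots> \<le> (1/3) ^ Suc (n + m) + (1/3) ^ n / 2 * (1 - (1/3) ^ m)"
        using step Suc by (intro add_mono)
      also have "\<dots> = (1/3) ^ n / 2 * (1 - (1/3) ^ Suc m)"
        by (simp add: power_add field_simps)
      finally show ?case .
    qed simp
    have far': "norm (y k - y n) \<le> (1/3) ^ n / 2" if "n \<le> k" for k n
    proof -
      have "norm (y (n + (k - n)) - y n) \<le> (1/3) ^ n / 2 * (1 - (1/3) ^ (k - n))" by (rule far)
      also have "\<dots> \<le> (1/3) ^ n / 2 * 1" by (intro mult_left_mono) auto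
      finally show ?thesis using that by simp
    qed
    have "Cauchy y"
    proof (rule metric_CauchyI)
      fix e :: real assume "e > 0"
      then obtain n where n: "(1/3) ^ n < e" 
        using real_arch_pow_inv[of e "1/3"] by auto
      have "dist (y k) (y l) < e" if "k \<ge> n" "l \<ge> n" for k l
      proof -
        have "dist (y k) (y l) \<le> norm (y k - y n) + norm (y l - y n)"
          by (metis dist_norm dist_triangle2)
        also have "\<dots> \<le> (1/3) ^ n / 2 + (1/3) ^ n / 2" by (intro add_mono far' that)
        finally show ?thesis using n by simp
      qed
      then show "\<exists>M. \<forall>m\<ge>M. \<forall>n\<ge>M. dist (y m) (y n) < e" by blast
    qed
    then obtain z where z: "y \<longlonglongrightarrow> z" using Cauchy_convergent convergent_def by blast
    have close: "norm (z - y n) \<le> (1/3) ^ n / 2" for n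
    proof (rule Lim_bounded)
      show "(\<lambda>k. norm (y k - y n)) \<longlonglongrightarrow> norm (z - y n)" by (intro tendsto_intros z)
      show "\<forall>k\<ge>n. norm (y k - y n) \<le> (1/3) ^ n / 2" using far' by blast
    qed
    have low: "(4/3) ^ n / 6 \<le> norm (A z)" for n
    proof -
      have "\<bar>A (x n) \<bullet> (z - y (Suc n))\<bar> \<le> norm (A (x n)) * ((1/3) ^ Suc n / 2)"
        by (rule order_trans[OF Cauchy_Schwarz_ineq2]) (intro mult_left_mono close norm_ge_zero)
      moreover have "A (x n) \<bullet> z = A (x n) \<bullet> y (Suc n) + A (x n) \<bullet> (z - y (Suc n))"
        by (simp add: inner_diff_right)
      ultimately have "\<bar>A (x n) \<bullet> z\<bar> \<ge> (1/3) ^ Suc n * norm (A (x n)) - norm (A (x n)) * ((1/3) ^ Suc n / 2)"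
        using big[of n] by linarith
      moreover have "(1/3) ^ Suc n * norm (A (x n)) - norm (A (x n)) * ((1/3) ^ Suc n / 2)
          = (1/3) ^ Suc n / 2 * norm (A (x n))" by (simp add: field_simps)
      moreover have "(1/3) ^ Suc n / 2 * norm (A (x n)) \<ge> (1/3) ^ Suc n / 2 * 4 ^ n"
        by (intro mult_left_mono x) auto
      moreover have "(1/3) ^ Suc n / 2 * 4 ^ n = (4/3) ^ n / (6::real)"
        by (simp add: power_divide)
      moreover have "\<bar>A (x n) \<bullet> z\<bar> \<le> norm (A z)"
      proof -
        have "\<bar>A (x n) \<bullet> z\<bar> \<le> norm (x n) * norm (A z)"
          unfolding sym by (rule Cauchy_Schwarz_ineq2)
        also have "\<dots> \<le> 1 * norm (A z)" by (intro mult_right_mono x) auto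
        finally show ?thesis by simp
      qed
      ultimately show ?thesis by linarith
    qed
    obtain n where "(4/3::real) ^ n > 6 * norm (A z)"
      using real_arch_pow[of "4/3" "6 * norm (A z)"] by auto
    then show False using low[of n] by simp
  qed
  then show ?thesis
    using lin by (auto simp: bounded_linear_def bounded_linear_axioms_def)
qed

section \<open>Closed subspaces and vectors orthogonal to them\<close>

lemma subspace_closure:
  fixes S :: "'a::real_normed_vector set"
  assumes S: "subspace S"
  shows "subspace (closure S)"
proof (rule subspaceI)
  show "0 \<in> closure S" using S closure_subset subspace_0 by blast
  show "x + y \<in> closure S" if xy: "x \<in> closure S" "y \<in> closure S" for x y
  proof -
    obtain f g where "\<And>n. f n \<in> S" "f \<longlonglongrightarrow> x" "\<And>n. g n \<in> S" "g \<longlonglongrightarrow> y"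
      using xy by (metis closure_sequential)
    then show ?thesis
      unfolding closure_sequential
      by (intro exI[of _ "\<lambda>n. f n + g n"]) (auto intro: tendsto_add subspace_add[OF S])
  qed
  show "c *\<^sub>R x \<in> closure S" if "x \<in> closure S" for c x
  proof -
    obtain f where "\<And>n. f n \<in> S" "f \<longlonglongrightarrow> x" using \<open>x \<in> closure S\<close> by (metis closure_sequential)
    then show ?thesis
      unfolding closure_sequential
      by (intro exI[of _ "\<lambda>n. c *\<^sub>R f n"]) (auto intro: tendsto_scaleR subspace_scale[OF S])
  qed
qed

text \<open>The residual of the best approximation in \<open>K\<close> to a point outside
  \<open>K\<close> serves as \<open>q\<close>. A minimizing sequence is Cauchy by the parallelogram
  identity, because midpoints stay in \<open>K\<close>.\<close>

lemma closed_subspace_orthogonal_exists: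
  fixes K :: "'a::{real_inner,complete_space} set"
  assumes K: "subspace K" "closed K" "K \<noteq> UNIV"
  obtains q where "q \<noteq> 0" "\<And>k. k \<in> K \<Longrightarrow> q \<bullet> k = 0"
proof -
  obtain x where x: "x \<notin> K" using K by auto
  define d where "d = (INF k\<in>K. (norm (x - k))\<^sup>2)"
  have ne: "K \<noteq> {}" using K(1) subspace_0 by blast
  have bb: "bdd_below ((\<lambda>k. (norm (x - k))\<^sup>2) ` K)" by (intro bdd_belowI[where m=0]) auto
  have dle: "d \<le> (norm (x - k))\<^sup>2" if "k \<in> K" for k
    unfolding d_def using that bb by (rule cINF_lower[rotated])
  have "\<exists>k\<in>K. (norm (x - k))\<^sup>2 < d + 1 / Suc n" for n
  proof -
    have "(INF k\<in>K. (norm (x - k))\<^sup>2) < d + 1 / Suc n" by (simp add: d_def)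
    then show ?thesis using cINF_less_iff[OF ne bb] by blast
  qed
  then obtain k where k: "\<And>n::nat. k n \<in> K" "\<And>n. (norm (x - k n))\<^sup>2 < d + 1 / Suc n" by metis
  have par: "(norm (k m - k n))\<^sup>2 \<le> 2 / Suc m + 2 / Suc n" for m n
  proof -
    have mid: "(1/2) *\<^sub>R (k m + k n) \<in> K" using K(1) k(1) by (simp add: subspace_add subspace_scale)
    have "(norm (k m - k n))\<^sup>2 = 2 * (norm (x - k m))\<^sup>2 + 2 * (norm (x - k n))\<^sup>2
        - 4 * (norm (x - (1/2) *\<^sub>R (k m + k n)))\<^sup>2"
      unfolding power2_norm_eq_inner
      by (simp add: inner_diff_left inner_diff_right inner_add_left inner_add_right inner_commute algebra_simps)
    also have "\<dots> \<le> 2 * (d + 1 / Suc m) + 2 * (d + 1 / Suc n) - 4 * d"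
      using k(2)[of m] k(2)[of n] dle[OF mid]
      by (intro diff_mono add_mono mult_left_mono less_imp_le) auto
    finally show ?thesis by simp
  qed
  have "Cauchy k"
  proof (rule metric_CauchyI)
    fix e :: real assume e: "e > 0"
    then obtain M where M: "4 / real (Suc M) < e\<^sup>2"
      using reals_Archimedean[of "e\<^sup>2 / 4"] by (auto simp: field_simps)
    have "dist (k m) (k n) < e" if "m \<ge> M" "n \<ge> M" for m n
    proof -
      have "(norm (k m - k n))\<^sup>2 \<le> 2 / Suc M + 2 / Suc M"
        by (rule order_trans[OF par]) (intro add_mono divide_left_mono; use that in simp)
      also have "\<dots> < e\<^sup>2" using M by simp
      finally show ?thesis unfolding dist_norm using e by (metis less_imp_le power2_less_imp_less)
    qed
    then show "\<exists>M. \<forall>m\<ge>M. \<forall>n\<ge>M. dist (k m) (k n) < e" by blast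
  qed
  then obtain p where p: "k \<longlonglongrightarrow> p" using Cauchy_convergent convergent_def by blast
  have pK: "p \<in> K" using K(2) k(1) p closed_sequentially by blast
  have pd: "(norm (x - p))\<^sup>2 \<le> d"
  proof (rule LIMSEQ_le)
    show "(\<lambda>n. (norm (x - k n))\<^sup>2) \<longlonglongrightarrow> (norm (x - p))\<^sup>2" by (intro tendsto_intros p)
    show "(\<lambda>n. d + 1 / Suc n) \<longlonglongrightarrow> d"
      using tendsto_add[OF tendsto_const[of d] LIMSEQ_inverse_real_of_nat]
      by (simp add: inverse_eq_divide)
    show "\<exists>N. \<forall>n\<ge>N. (norm (x - k n))\<^sup>2 \<le> d + 1 / Suc n" using k(2) less_imp_le by blast
  qed
  have "(x - p) \<bullet> h = 0" if h: "h \<in> K" for h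
  proof (rule ccontr)
    assume a: "(x - p) \<bullet> h \<noteq> 0"
    then have h0: "h \<bullet> h > 0" by auto
    \<comment> \<open>This \<open>t\<close> minimizes the distance from \<open>x\<close> to
      \<open>p + t *\<^sub>R h\<close>; a nonzero inner product would push it below the
      infimum.\<close>
    define t where "t = (x - p) \<bullet> h / (h \<bullet> h)"
    have "p + t *\<^sub>R h \<in> K" using K(1) pK h by (simp add: subspace_add subspace_scale)
    then have "(norm (x - p))\<^sup>2 \<le> (norm (x - (p + t *\<^sub>R h)))\<^sup>2" using dle pd by (meson order_trans)
    also have "\<dots> = (norm (x - p))\<^sup>2 - 2 * t * ((x - p) \<bullet> h) + t\<^sup>2 * (h \<bullet> h)"
      unfolding power2_norm_eq_inner
      by (simp add: inner_diff_left inner_diff_right inner_add_left inner_add_right inner_commute algebra_simps power2_eq_square)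
    also have "\<dots> = (norm (x - p))\<^sup>2 - ((x - p) \<bullet> h)\<^sup>2 / (h \<bullet> h)"
      using h0 by (simp add: t_def field_simps power2_eq_square)
    finally show False using a h0 by (simp add: field_simps)
  qed
  moreover have "x - p \<noteq> 0" using x pK by auto
  ultimately show thesis using that by blast
qed

section \<open>Unbounded symmetric operators and their resolvents\<close>

locale sym_op =
  fixes D :: "'a::{real_inner,complete_space} set" and T :: "'a \<Rightarrow> 'a"
  assumes sub: "subspace D"
    and add: "x \<in> D \<Longrightarrow> y \<in> D \<Longrightarrow> T (x + y) = T x + T y"
    and scale: "x \<in> D \<Longrightarrow> T (c *\<^sub>R x) = c *\<^sub>R T x"
    and sym: "x \<in> D \<Longrightarrow> y \<in> D \<Longrightarrow> T x \<bullet> y = x \<bullet> T y"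

text \<open>Only bijectivity is recorded. For symmetric \<open>T\<close> the inverse is symmetric on
  the whole space, and \<open>Hellinger_Toeplitz\<close> turns this into boundedness.\<close>

definition resolvent_set :: "'a::real_vector set \<Rightarrow> ('a \<Rightarrow> 'a) \<Rightarrow> real set" where
  "resolvent_set D T = {l. bij_betw (\<lambda>x. T x - l *\<^sub>R x) D UNIV}"

context sym_op
begin

lemma diff: "x \<in> D \<Longrightarrow> y \<in> D \<Longrightarrow> T (x - y) = T x - T y"
  using add[of x "-1 *\<^sub>R y"] scale[of y "-1"] subspace_scale[OF sub, of y "-1"] by simp

lemma shift: "sym_op D (\<lambda>x. T x - l *\<^sub>R x)"
  by unfold_locales
    (auto simp: sub add scale sym algebra_simps inner_diff_left inner_diff_right)

lemma resolvent:
  assumes "l \<in> resolvent_set D T"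
  obtains R where "bounded_linear R" "\<And>x y. R x \<bullet> y = x \<bullet> R y" "\<And>x. R x \<in> D"
    "\<And>x. T (R x) - l *\<^sub>R R x = x" "\<And>x. x \<in> D \<Longrightarrow> R (T x - l *\<^sub>R x) = x"
proof -
  interpret S: sym_op D "\<lambda>x. T x - l *\<^sub>R x" by (rule shift)
  define S where "S x = T x - l *\<^sub>R x" for x
  have b: "bij_betw S D UNIV" using assms by (simp add: resolvent_set_def S_def[abs_def])
  define R where "R = the_inv_into D S"
  have inj: "inj_on S D" and sur: "S ` D = UNIV" using b by (auto simp: bij_betw_def)
  have RD: "R x \<in> D" for x using the_inv_into_into[OF inj, of x D] sur R_def by auto
  have SR: "S (R x) = x" for x using f_the_inv_into_f[OF inj, of x] sur R_def by auto
  have RS: "R (S x) = x" if "x \<in> D" for x using the_inv_into_f_f[OF inj that] R_def by auto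
  have Sadd: "S (x + y) = S x + S y" if "x \<in> D" "y \<in> D" for x y using S.add that S_def by auto
  have Sscale: "S (c *\<^sub>R x) = c *\<^sub>R S x" if "x \<in> D" for c x using S.scale that S_def by auto
  have lin: "linear R"
  proof (rule linearI)
    show "R (x + y) = R x + R y" for x y
      using RS[of "R x + R y"] Sadd[of "R x" "R y"] RD SR subspace_add[OF sub] by metis
    show "R (c *\<^sub>R x) = c *\<^sub>R R x" for c x
      using RS[of "c *\<^sub>R R x"] Sscale[of "R x" c] RD SR subspace_scale[OF sub] by metis
  qed
  have sy: "R x \<bullet> y = x \<bullet> R y" for x y
    using S.sym[of "R x" "R y"] RD SR S_def by metis
  show thesis
    using that[of R] Hellinger_Toeplitz[OF lin sy] sy RD SR RS by (simp add: S_def)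
qed

end

section \<open>Norm, spectrum and perturbation\<close>

lemma bounded_inverse_symmetric:
  fixes A :: "'a::{real_inner,complete_space} \<Rightarrow> 'a"
  assumes "linear A" and "\<And>x y. A x \<bullet> y = x \<bullet> A y" and "bij (\<lambda>x. A x - s *\<^sub>R x)"
  obtains c where "c > 0" "\<And>x. c * norm x \<le> norm (A x - s *\<^sub>R x)"
proof -
  interpret sym_op UNIV A
    by unfold_locales (auto simp: assms linear_add[OF assms(1)] linear_scale[OF assms(1)])
  have "s \<in> resolvent_set UNIV A" using assms by (simp add: resolvent_set_def)
  then obtain R where R: "bounded_linear R" "\<And>x. R (A x - s *\<^sub>R x) = x" using resolvent by (metis UNIV_I)
  obtain K where K: "K > 0" "\<And>x. norm (R x) \<le> norm x * K"
    using bounded_linear.pos_bounded[OF R(1)] by blast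
  have "inverse K * norm x \<le> norm (A x - s *\<^sub>R x)" for x
    using K(2)[of "A x - s *\<^sub>R x"] K(1) by (simp add: R(2) field_simps)
  then show thesis using that[of "inverse K"] K by simp
qed

text \<open>If both \<open>s\<close> and \<open>- s\<close> were regular,
  \<open>A\<^sup>2 - s\<^sup>2\<close> would be bounded below. Squaring that bound pushes
  \<open>norm (A x)\<close> below a fixed fraction of \<open>s * norm x\<close>, against the choice
  of \<open>s\<close> as operator norm.\<close>

lemma norm_in_spectrum:
  fixes A :: "'a::{real_inner,complete_space} \<Rightarrow> 'a"
  assumes bl: "bounded_linear A" and sym: "\<And>x y. A x \<bullet> y = x \<bullet> A y"
    and s: "s = onorm A" "s > 0"
  shows "\<not> (bij (\<lambda>x. A x - s *\<^sub>R x) \<and> bij (\<lambda>x. A x - (- s) *\<^sub>R x))"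
proof
  assume b: "bij (\<lambda>x. A x - s *\<^sub>R x) \<and> bij (\<lambda>x. A x - (- s) *\<^sub>R x)"
  interpret bounded_linear A by (rule bl)
  have lin: "linear A" by (rule linear_axioms)
  obtain c1 where c1: "c1 > 0" "\<And>x. c1 * norm x \<le> norm (A x - s *\<^sub>R x)"
    using bounded_inverse_symmetric[OF lin sym] b by blast
  obtain c2 where c2: "c2 > 0" "\<And>x. c2 * norm x \<le> norm (A x - (- s) *\<^sub>R x)"
    using bounded_inverse_symmetric[OF lin sym] b by blast
  define c where "c = c1 * c2"
  have c: "c > 0" using c1 c2 c_def by simp
  have ub: "norm (A x) \<le> s * norm x" for x using onorm[OF bl, of x] s by (simp add: mult.commute)
  have low: "c * norm x \<le> norm (A (A x) - s\<^sup>2 *\<^sub>R x)" for x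
  proof -
    have "A (A x) - s\<^sup>2 *\<^sub>R x = A (A x - (- s) *\<^sub>R x) - s *\<^sub>R (A x - (- s) *\<^sub>R x)"
      by (simp add: add scaleR algebra_simps power2_eq_square)
    then have "c1 * norm (A x - (- s) *\<^sub>R x) \<le> norm (A (A x) - s\<^sup>2 *\<^sub>R x)" using c1 by simp
    moreover have "c1 * (c2 * norm x) \<le> c1 * norm (A x - (- s) *\<^sub>R x)"
      using c1 c2 by (intro mult_left_mono) auto
    ultimately show ?thesis by (simp add: c_def mult.assoc)
  qed
  \<comment> \<open>By symmetry the mixed term of the expanded square is a multiple of the squared
    norm of \<open>A x\<close>; bounding \<open>A (A x)\<close> by \<open>s * norm (A x)\<close>
    leaves an inequality between \<open>norm (A x)\<close> and \<open>norm x\<close> alone.\<close>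
  have key: "(norm (A x))\<^sup>2 \<le> (s\<^sup>2 - c\<^sup>2 / s\<^sup>2) * (norm x)\<^sup>2" for x
  proof -
    have "(c * norm x)\<^sup>2 \<le> (norm (A (A x) - s\<^sup>2 *\<^sub>R x))\<^sup>2" using low c by (intro power_mono) auto
    also have "\<dots> = (norm (A (A x)))\<^sup>2 - 2 * s\<^sup>2 * (norm (A x))\<^sup>2 + s^4 * (norm x)\<^sup>2"
      unfolding power2_norm_eq_inner using sym[of "A x" x]
      by (simp add: inner_diff_left inner_diff_right inner_commute algebra_simps power2_eq_square power4_eq_xxxx)
    also have "\<dots> \<le> (s * norm (A x))\<^sup>2 - 2 * s\<^sup>2 * (norm (A x))\<^sup>2 + s^4 * (norm x)\<^sup>2"
      using power_mono[OF ub[of "A x"], of 2] by simp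
    also have "\<dots> = s\<^sup>2 * (s\<^sup>2 * (norm x)\<^sup>2 - (norm (A x))\<^sup>2)"
      by (simp add: power_mult_distrib algebra_simps power4_eq_xxxx power2_eq_square)
    finally have "c\<^sup>2 * (norm x)\<^sup>2 / s\<^sup>2 \<le> s\<^sup>2 * (norm x)\<^sup>2 - (norm (A x))\<^sup>2"
      using s(2) by (simp add: field_simps power_mult_distrib)
    then show ?thesis by (simp add: algebra_simps)
  qed
  \<comment> \<open>The maximum guards the square root, as the difference is not known to be
    nonnegative.\<close>
  define r where "r = sqrt (max 0 (s\<^sup>2 - c\<^sup>2 / s\<^sup>2))"
  have "norm (A x) \<le> r * norm x" for x
  proof -
    have "(norm (A x))\<^sup>2 \<le> max 0 (s\<^sup>2 - c\<^sup>2 / s\<^sup>2) * (norm x)\<^sup>2"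
      by (rule order_trans[OF key mult_right_mono]) auto
    then have "sqrt ((norm (A x))\<^sup>2) \<le> sqrt (max 0 (s\<^sup>2 - c\<^sup>2 / s\<^sup>2) * (norm x)\<^sup>2)"
      by (rule real_sqrt_le_mono)
    then show ?thesis by (simp add: r_def real_sqrt_mult)
  qed
  then have "s \<le> r" unfolding s by (intro onorm_bound) (auto simp: r_def)
  moreover have "r < s"
  proof -
    have "max 0 (s\<^sup>2 - c\<^sup>2 / s\<^sup>2) < s\<^sup>2" using c s(2) by simp
    then show ?thesis unfolding r_def using s(2) by (simp add: real_less_lsqrt)
  qed
  ultimately show False by simp
qed

context sym_op
begin

text \<open>If the norm \<open>s\<close> of the resolvent \<open>R\<close> at \<open>m\<close>
  exceeded \<open>1 / d\<close>, both \<open>m + 1 / s\<close> and \<open>m - 1 / s\<close> would be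
  regular for \<open>T\<close>, hence both \<open>s\<close> and \<open>- s\<close> would be regular
  for \<open>R\<close>, which \<open>norm_in_spectrum\<close> forbids.\<close>

lemma resolvent_bound:
  assumes d: "d > 0" and res: "\<And>l. \<bar>l - m\<bar> < d \<Longrightarrow> l \<in> resolvent_set D T" and x: "x \<in> D"
  shows "d * norm x \<le> norm (T x - m *\<^sub>R x)"
proof -
  have "m \<in> resolvent_set D T" using res d by simp
  then obtain R where R: "bounded_linear R" "\<And>x y. R x \<bullet> y = x \<bullet> R y" "\<And>x. R x \<in> D"
    "\<And>x. T (R x) - m *\<^sub>R R x = x" "\<And>x. x \<in> D \<Longrightarrow> R (T x - m *\<^sub>R x) = x"
    using resolvent by blast
  interpret R: bounded_linear R by (rule R(1))
  define s where "s = onorm R"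
  have s0: "s \<ge> 0" using onorm_pos_le[OF R(1)] s_def by simp
  have nx: "norm x \<le> s * norm (T x - m *\<^sub>R x)"
    using onorm[OF R(1), of "T x - m *\<^sub>R x"] R(5)[OF x] s_def by (simp add: mult.commute)
  have "s * d \<le> 1"
  proof (rule ccontr)
    assume "\<not> s * d \<le> 1"
    then have sd: "s > 1 / d" using d by (simp add: field_simps)
    then have s1: "s > 0" using d by (meson less_trans zero_less_divide_1_iff)
    have bR: "bij_betw R UNIV D"
      by (rule bij_betwI[where g="\<lambda>x. T x - m *\<^sub>R x"]) (auto simp: R)
    have bij: "bij (\<lambda>x. R x - \<nu> *\<^sub>R x)" if nu: "\<bar>\<nu>\<bar> = s" for \<nu>
    proof -
      have nu0: "\<nu> \<noteq> 0" using nu s1 by auto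
      have "\<bar>(m + 1 / \<nu>) - m\<bar> < d" using nu sd s1 d by (simp add: field_simps)
      then have "bij_betw (\<lambda>x. T x - (m + 1 / \<nu>) *\<^sub>R x) D UNIV"
        using res resolvent_set_def by blast
      \<comment> \<open>\<open>R - \<nu>\<close> factors as \<open>- \<nu>\<close> times
        \<open>T - (m + 1 / \<nu>)\<close> applied after \<open>R\<close>.\<close>
      then have "bij_betw ((\<lambda>x. (- \<nu>) *\<^sub>R x) \<circ> ((\<lambda>x. T x - (m + 1 / \<nu>) *\<^sub>R x) \<circ> R)) UNIV UNIV"
        using bR nu0 by (intro bij_betw_trans)
          (auto intro!: o_bij[where g="\<lambda>x. (- 1 / \<nu>) *\<^sub>R x"] simp: o_def)
      also have "(\<lambda>x. (- \<nu>) *\<^sub>R x) \<circ> ((\<lambda>x. T x - (m + 1 / \<nu>) *\<^sub>R x) \<circ> R) = (\<lambda>x. R x - \<nu> *\<^sub>R x)"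
      proof
        fix x
        have "T (R x) = x + m *\<^sub>R R x" using R(4)[of x] by (simp add: algebra_simps)
        then show "((\<lambda>x. (- \<nu>) *\<^sub>R x) \<circ> ((\<lambda>x. T x - (m + 1 / \<nu>) *\<^sub>R x) \<circ> R)) x = R x - \<nu> *\<^sub>R x"
          using nu0 by (simp add: algebra_simps)
      qed
      finally show ?thesis .
    qed
    show False using norm_in_spectrum[OF R(1,2) s_def s1] bij[of s] bij[of "- s"] s1 by simp
  qed
  then have "d * norm x \<le> d * (s * norm (T x - m *\<^sub>R x))" using d nx by simp
  also have "\<dots> = (s * d) * norm (T x - m *\<^sub>R x)" by simp
  also have "\<dots> \<le> 1 * norm (T x - m *\<^sub>R x)" using \<open>s * d \<le> 1\<close> by (intro mult_right_mono) auto
  finally show ?thesis by simp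
qed

text \<open>Writing the unknown as \<open>R z\<close> with the resolvent \<open>R\<close> of
  \<open>T\<close> turns the equation for \<open>S\<close> into a fixed point problem with
  contraction constant \<open>b / d\<close>; the margin \<open>d - b\<close> also yields
  injectivity.\<close>

lemma resolvent_set_perturb:
  assumes S: "sym_op D S" and m: "m \<in> resolvent_set D T"
    and low: "\<And>x. x \<in> D \<Longrightarrow> d * norm x \<le> norm (T x - m *\<^sub>R x)"
    and close: "\<And>x. x \<in> D \<Longrightarrow> norm (S x - T x) \<le> b * norm x"
    and bd: "0 \<le> b" "b < d"
  shows "m \<in> resolvent_set D S"
proof -
  interpret S: sym_op D S by (rule S)
  obtain R where R: "bounded_linear R" "\<And>x. R x \<in> D"
    "\<And>x. T (R x) - m *\<^sub>R R x = x" "\<And>x. x \<in> D \<Longrightarrow> R (T x - m *\<^sub>R x) = x"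
    using resolvent[OF m] by metis
  interpret R: bounded_linear R by (rule R(1))
  have Rn: "d * norm (R x) \<le> norm x" for x using low[OF R(2), of x] R(3) by simp
  have "bij_betw (\<lambda>x. S x - m *\<^sub>R x) D UNIV"
  proof (rule bij_betwI')
    fix x y assume xy: "x \<in> D" "y \<in> D"
    have "x = y" if eq: "S x - m *\<^sub>R x = S y - m *\<^sub>R y"
    proof -
      have D: "x - y \<in> D" using xy sub subspace_diff by blast
      have "S (x - y) = m *\<^sub>R (x - y)" using eq S.diff[OF xy] by (simp add: algebra_simps) (metis add_diff_cancel_left' diff_add_cancel add.commute add_diff_eq)
      then have "norm (T (x - y) - m *\<^sub>R (x - y)) \<le> b * norm (x - y)"
        using close[OF D] by (simp add: norm_minus_commute)
      then have "(d - b) * norm (x - y) \<le> 0" using low[OF D] by (simp add: algebra_simps)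
      then show ?thesis using bd by (simp add: mult_le_0_iff)
    qed
    then show "(S x - m *\<^sub>R x = S y - m *\<^sub>R y) = (x = y)" by auto
  next
    fix g :: 'a
    define f where "f z = g - (S (R z) - T (R z))" for z
    have "dist (f z) (f w) \<le> b / d * dist z w" for z w
    proof -
      have "f z - f w = - (S (R (z - w)) - T (R (z - w)))"
        unfolding f_def R.diff S.diff[OF R(2) R(2)] diff[OF R(2) R(2)] by simp
      then have "norm (f z - f w) \<le> b * norm (R (z - w))"
        using close[OF R(2)] by (metis norm_minus_cancel)
      also have "\<dots> \<le> b * (norm (z - w) / d)"
        using Rn bd by (intro mult_left_mono) (auto simp: pos_le_divide_eq mult.commute)
      finally show ?thesis by (simp add: dist_norm)
    qed
    then obtain z where z: "f z = z" using banach_fix_type[of "b / d" f] bd by auto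
    have "S (R z) - m *\<^sub>R R z = (T (R z) - m *\<^sub>R R z) + (S (R z) - T (R z))" by simp
    also have "\<dots> = f z + (S (R z) - T (R z))" using R(3) z by simp
    also have "\<dots> = g" by (simp add: f_def)
    finally show "\<exists>x\<in>D. g = S x - m *\<^sub>R x" using R(2) by metis
  qed auto
  then show ?thesis by (simp add: resolvent_set_def)
qed

text \<open>With \<open>A = T - \<nu>\<close> and \<open>t = \<delta> / 2\<close>, factoring \<open>A\<^sup>2 - t\<^sup>2 = (A - t) (A + t)\<close> gives
  \<open>\<parallel>A\<^sup>2 x\<parallel>\<^sup>2 \<ge> 2 t\<^sup>2 \<parallel>A x\<parallel>\<^sup>2\<close>, so \<open>A\<close> is bounded below on its range, which is dense as \<open>A\<close> is injective.\<close>

lemma isolated_injective_resolvent_set: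
  assumes del: "\<delta> > 0" and iso: "\<And>l. \<bar>l - \<nu>\<bar> < \<delta> \<Longrightarrow> l \<noteq> \<nu> \<Longrightarrow> l \<in> resolvent_set D T"
    and inj: "\<And>x. x \<in> D \<Longrightarrow> T x = \<nu> *\<^sub>R x \<Longrightarrow> x = 0"
  shows "\<nu> \<in> resolvent_set D T"
proof -
  define t where "t = \<delta> / 2"
  have t: "t > 0" using del t_def by simp
  define A where "A x = T x - \<nu> *\<^sub>R x" for x
  interpret A: sym_op D A unfolding A_def[abs_def] by (rule shift)
  \<comment> \<open>The interval of radius \<open>t\<close> around \<open>\<nu> + t\<close> avoids
    \<open>\<nu>\<close> and stays within distance \<open>\<delta>\<close> of it, so
    \<open>resolvent_bound\<close> applies; the mirror image around \<open>\<nu> - t\<close> gives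
    \<open>b2\<close>.\<close>
  have b1: "t * norm x \<le> norm (A x - t *\<^sub>R x)" if "x \<in> D" for x
  proof -
    have "l \<in> resolvent_set D T" if "\<bar>l - (\<nu> + t)\<bar> < t" for l
      using iso[of l] that t unfolding t_def by (auto simp: abs_if split: if_splits)
    from resolvent_bound[where m="\<nu> + t", OF t this \<open>x \<in> D\<close>] show ?thesis by (simp add: A_def algebra_simps)
  qed
  have b2: "t * norm x \<le> norm (A x + t *\<^sub>R x)" if "x \<in> D" for x
  proof -
    have "l \<in> resolvent_set D T" if "\<bar>l - (\<nu> - t)\<bar> < t" for l
      using iso[of l] that t unfolding t_def by (auto simp: abs_if split: if_splits)
    from resolvent_bound[where m="\<nu> - t", OF t this \<open>x \<in> D\<close>] show ?thesis by (simp add: A_def algebra_simps)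
  qed
  have sq: "2 * t\<^sup>2 * (norm (A x))\<^sup>2 \<le> (norm (A (A x)))\<^sup>2" if x: "x \<in> D" "A x \<in> D" for x
  proof -
    have "t * (t * norm x) \<le> t * norm (A x + t *\<^sub>R x)" using b2[OF x(1)] t by simp
    also have "\<dots> \<le> norm (A (A x + t *\<^sub>R x) - t *\<^sub>R (A x + t *\<^sub>R x))"
      using b1[of "A x + t *\<^sub>R x"] x sub by (simp add: subspace_add subspace_scale)
    also have "A (A x + t *\<^sub>R x) - t *\<^sub>R (A x + t *\<^sub>R x) = A (A x) - t\<^sup>2 *\<^sub>R x"
      using x by (simp add: A.add A.scale subspace_scale[OF sub] algebra_simps power2_eq_square)
    finally have "(t\<^sup>2 * norm x)\<^sup>2 \<le> (norm (A (A x) - t\<^sup>2 *\<^sub>R x))\<^sup>2"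
      by (intro power_mono) (auto simp: power2_eq_square)
    also have "\<dots> = (norm (A (A x)))\<^sup>2 - 2 * t\<^sup>2 * (norm (A x))\<^sup>2 + (t\<^sup>2 * norm x)\<^sup>2"
      unfolding power2_norm_eq_inner power_mult_distrib using A.sym[of "A x" x] x
      by (simp add: inner_diff_left inner_diff_right inner_commute algebra_simps power2_eq_square)
    finally show ?thesis by simp
  qed
  have mu: "\<nu> + t \<in> resolvent_set D T" by (rule iso) (use t in \<open>auto simp: t_def\<close>)
  obtain R where R: "bounded_linear R" "\<And>x y. R x \<bullet> y = x \<bullet> R y" "\<And>x. R x \<in> D"
    "\<And>x. T (R x) - (\<nu> + t) *\<^sub>R R x = x" "\<And>x. x \<in> D \<Longrightarrow> R (T x - (\<nu> + t) *\<^sub>R x) = x"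
    using resolvent[OF mu] by blast
  interpret R: bounded_linear R by (rule R(1))
  \<comment> \<open>\<open>C\<close> is \<open>A\<close> after \<open>R\<close>: a bounded symmetric
    stand-in for the unbounded \<open>A\<close> that commutes with \<open>R\<close>.\<close>
  define C where "C x = x + t *\<^sub>R R x" for x
  have AR: "A (R x) = C x" for x using R(4)[of x] by (simp add: A_def C_def algebra_simps)
  have CR: "C (R x) = R (C x)" for x by (simp add: C_def R.add R.scaleR)
  interpret C: bounded_linear C unfolding C_def[abs_def]
    by (intro bounded_linear_add bounded_linear_scaleR_right bounded_linear_ident
      bounded_linear_compose[OF bounded_linear_scaleR_right R(1)])
  have Csym: "C x \<bullet> y = x \<bullet> C y" for x y by (simp add: C_def inner_add_left inner_add_right R(2))
  have Cinj: "x = 0" if "C x = 0" for x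
  proof -
    have "A (R x) = 0" using AR that by simp
    then have "R x = 0" using inj[OF R(3)] by (simp add: A_def)
    then show ?thesis using that by (simp add: C_def)
  qed
  \<comment> \<open>A vector \<open>q\<close> orthogonal to the range satisfies
    \<open>C q \<bullet> C q = q \<bullet> C (C q) = 0\<close>, and \<open>C\<close> is
    injective.\<close>
  have dense: "closure (range C) = UNIV"
  proof (rule ccontr)
    assume "closure (range C) \<noteq> UNIV"
    moreover have "subspace (closure (range C))"
      by (intro subspace_closure linear_subspace_image C.linear_axioms) auto
    ultimately obtain q where q: "q \<noteq> 0" "\<And>k. k \<in> closure (range C) \<Longrightarrow> q \<bullet> k = 0"
      using closed_subspace_orthogonal_exists[of "closure (range C)"] by blast
    have "C q \<bullet> C q = q \<bullet> C (C q)" by (rule Csym)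
    also have "\<dots> = 0" using q(2) closure_subset by blast
    finally show False using Cinj q(1) by simp
  qed
  \<comment> \<open>On the range of \<open>C\<close> this is \<open>sq\<close> at
    \<open>R (R x)\<close>; both sides are continuous, so it persists on the closure.\<close>
  have bC: "t * norm (R z) \<le> norm (C z)" for z
  proof -
    have "z \<in> closure (range C)" using dense by simp
    moreover have "closure (range C) \<subseteq> {z. t * norm (R z) \<le> norm (C z)}"
    proof (rule closure_minimal)
      show "closed {z. t * norm (R z) \<le> norm (C z)}"
        by (intro closed_Collect_le continuous_intros R.continuous_on C.continuous_on)
      show "range C \<subseteq> {z. t * norm (R z) \<le> norm (C z)}"
      proof clarify
        fix x
        have AD: "A (R (R x)) = R (C x)" by (simp add: AR CR)
        have A2: "A (R (C x)) = C (C x)" by (rule AR)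
        have "(t * norm (R (C x)))\<^sup>2 \<le> 2 * t\<^sup>2 * (norm (R (C x)))\<^sup>2"
          by (simp add: power_mult_distrib)
        also have "\<dots> \<le> (norm (C (C x)))\<^sup>2" using sq[of "R (R x)"] AD A2 R(3) by simp
        finally show "t * norm (R (C x)) \<le> norm (C (C x))" by (rule power2_le_imp_le) simp
      qed
    qed
    ultimately show ?thesis by blast
  qed
  have low: "t * norm x \<le> norm (A x)" if "x \<in> D" for x
    using bC[of "T x - (\<nu> + t) *\<^sub>R x"] R(5)[OF that] AR[of "T x - (\<nu> + t) *\<^sub>R x"] by simp
  \<comment> \<open>\<open>\<nu>\<close> is regular for \<open>T - h\<close> because
    \<open>\<nu> + h\<close> is regular for \<open>T\<close>. The lower bound drops from
    \<open>t\<close> to \<open>t - h = 2 * h\<close>, which still exceeds the distance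
    \<open>h\<close> back to \<open>T\<close>.\<close>
  define h where "h = t / 3"
  have h: "h > 0" "h < \<delta>" "3 * h = t" using t by (auto simp: h_def t_def)
  show ?thesis
  proof -
    have r: "\<nu> + h \<in> resolvent_set D T" using iso[of "\<nu> + h"] h by simp
    interpret T1: sym_op D "\<lambda>x. T x - h *\<^sub>R x" by (rule shift)
    have r1: "\<nu> \<in> resolvent_set D (\<lambda>x. T x - h *\<^sub>R x)"
      using r by (simp add: resolvent_set_def scaleR_left_distrib diff_diff_eq add.commute)
    show ?thesis
    proof (rule T1.resolvent_set_perturb[OF sym_op_axioms r1, of "2 * h" h])
      fix x assume x: "x \<in> D"
      have "norm (A x) \<le> norm (T x - h *\<^sub>R x - \<nu> *\<^sub>R x) + norm (h *\<^sub>R x)"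
        unfolding A_def using norm_triangle_ineq[of "T x - h *\<^sub>R x - \<nu> *\<^sub>R x" "h *\<^sub>R x"] by (simp add: algebra_simps)
      then show "2 * h * norm x \<le> norm (T x - h *\<^sub>R x - \<nu> *\<^sub>R x)"
        using low[OF x, folded h(3)] h(1) by simp
    qed (use h in auto)
  qed
qed

lemma sum_eigen:
  assumes "finite J" "\<And>j. j \<in> J \<Longrightarrow> \<phi> j \<in> D" "\<And>j. j \<in> J \<Longrightarrow> T (\<phi> j) = \<epsilon> j *\<^sub>R \<phi> j"
  shows "(\<Sum>j\<in>J. a j *\<^sub>R \<phi> j) \<in> D \<and> T (\<Sum>j\<in>J. a j *\<^sub>R \<phi> j) = (\<Sum>j\<in>J. (a j * \<epsilon> j) *\<^sub>R \<phi> j)"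
  using assms
proof (induction J rule: finite_induct)
  case empty
  then show ?case using scale[of 0 0] subspace_0[OF sub] by simp
next
  case (insert i J)
  then show ?case by (simp add: add scale subspace_add[OF sub] subspace_scale[OF sub])
qed

text \<open>Adding \<open>c\<close> times the projection onto known eigenvectors moves their eigenvalues out of
  \<open>{..<\<Lambda>}\<close>; what remains of the spectrum there is isolated and carries no eigenvector.\<close>

lemma shift_eigenvalues:
  fixes J :: "'j set" and \<phi> :: "'j \<Rightarrow> 'a" and \<epsilon> :: "'j \<Rightarrow> real" and c :: real
  defines "T' \<equiv> \<lambda>x. T x + c *\<^sub>R (\<Sum>j\<in>J. (\<phi> j \<bullet> x) *\<^sub>R \<phi> j)"
  assumes fin: "finite J" and phi: "\<And>j. j \<in> J \<Longrightarrow> \<phi> j \<in> D"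
    and eig: "\<And>j. j \<in> J \<Longrightarrow> T (\<phi> j) = \<epsilon> j *\<^sub>R \<phi> j"
    and on: "\<And>i j. i \<in> J \<Longrightarrow> j \<in> J \<Longrightarrow> \<phi> i \<bullet> \<phi> j = (if i = j then 1 else 0)"
    and res: "\<And>l. l < \<Lambda> \<Longrightarrow> l \<in> resolvent_set D T \<or> l \<in> \<epsilon> ` J"
    and ker: "\<And>u j. u \<in> D \<Longrightarrow> j \<in> J \<Longrightarrow> T u = \<epsilon> j *\<^sub>R u \<Longrightarrow> (\<And>i. i \<in> J \<Longrightarrow> \<phi> i \<bullet> u = 0) \<Longrightarrow> u = 0"
    and c: "\<And>j. j \<in> J \<Longrightarrow> \<Lambda> \<le> \<epsilon> j + c"
  shows "sym_op D T'" and "\<And>l. l < \<Lambda> \<Longrightarrow> l \<in> resolvent_set D T'"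
proof -
  define P where "P x = (\<Sum>j\<in>J. (\<phi> j \<bullet> x) *\<^sub>R \<phi> j)" for x
  have T'_def: "T' x = T x + c *\<^sub>R P x" for x by (simp add: T'_def P_def)
  have Padd: "P (x + y) = P x + P y" for x y
    by (simp add: P_def inner_add_right scaleR_left_distrib sum.distrib)
  have Pscale: "P (r *\<^sub>R x) = r *\<^sub>R P x" for r x by (simp add: P_def scaleR_right.sum)
  have coef: "\<phi> i \<bullet> (\<Sum>j\<in>J. a j *\<^sub>R \<phi> j) = a i" if "i \<in> J" for a i
  proof -
    have "\<phi> i \<bullet> (\<Sum>j\<in>J. a j *\<^sub>R \<phi> j) = (\<Sum>j\<in>J. if i = j then a i else 0)"
      unfolding inner_sum_right by (intro sum.cong) (use on that in auto)
    then show ?thesis using fin that by simp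
  qed
  show sT': "sym_op D T'"
  proof
    show "T' x \<bullet> y = x \<bullet> T' y" if "x \<in> D" "y \<in> D" for x y
      using sym[OF that] by (simp add: T'_def P_def inner_add_left inner_add_right inner_sum_left
          inner_sum_right inner_commute mult.commute)
  qed (auto simp: T'_def sub add scale Padd Pscale scaleR_add_right)
  interpret T': sym_op D T' by (rule sT')
  have phiT': "\<phi> i \<bullet> T' x = (\<epsilon> i + c) * (\<phi> i \<bullet> x)" if "i \<in> J" "x \<in> D" for i x
    using sym[OF phi[OF that(1)] that(2)] coef[OF that(1)] eig[OF that(1)]
    by (simp add: T'_def P_def inner_add_right algebra_simps)
  have P0: "P x = 0" if "\<And>i. i \<in> J \<Longrightarrow> \<phi> i \<bullet> x = 0" for x
    using that by (simp add: P_def)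
  \<comment> \<open>Pairing with \<open>\<phi> i\<close>, whose eigenvalue under \<open>T'\<close>
    is \<open>\<epsilon> i + c \<ge> \<Lambda> > l\<close>, shows that \<open>x\<close> is
    orthogonal to the family; there \<open>T'\<close> and \<open>T\<close> agree.\<close>
  have inj: "x = 0" if l: "l < \<Lambda>" and x: "x \<in> D" "T' x = l *\<^sub>R x" for l x
  proof -
    have orth: "\<phi> i \<bullet> x = 0" if i: "i \<in> J" for i
    proof -
      have "(\<epsilon> i + c - l) * (\<phi> i \<bullet> x) = 0"
        using phiT'[OF i x(1)] unfolding x(2) by (simp add: algebra_simps)
      then show ?thesis using c[OF i] l by auto
    qed
    have Tx: "T x = l *\<^sub>R x" using x(2) P0[OF orth] by (simp add: T'_def)
    show ?thesis
    proof (cases "l \<in> resolvent_set D T")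
      case True
      then have "inj_on (\<lambda>x. T x - l *\<^sub>R x) D" by (simp add: resolvent_set_def bij_betw_def)
      moreover have "T x - l *\<^sub>R x = T 0 - l *\<^sub>R 0" using Tx scale[of x 0] x(1) by simp
      ultimately show ?thesis using x(1) subspace_0[OF sub] by (meson inj_onD)
    next
      case False
      then obtain j where "j \<in> J" "l = \<epsilon> j" using res[OF l] by auto
      then show ?thesis using ker[OF x(1)] Tx orth by blast
    qed
  qed
  have step: "l \<in> resolvent_set D T'" if l: "l < \<Lambda>" and lres: "l \<in> resolvent_set D T" for l
    unfolding resolvent_set_def mem_Collect_eq
  proof (rule bij_betwI')
    fix x y assume xy: "x \<in> D" "y \<in> D"
    have "x = y" if "T' x - l *\<^sub>R x = T' y - l *\<^sub>R y"
    proof -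
      have "T' (x - y) = l *\<^sub>R (x - y)"
        using that T'.diff[OF xy] by (simp add: algebra_simps) (metis add_diff_cancel_left' diff_add_cancel add.commute add_diff_eq)
      then show ?thesis using inj[OF l, of "x - y"] xy subspace_diff[OF sub] by simp
    qed
    then show "(T' x - l *\<^sub>R x = T' y - l *\<^sub>R y) = (x = y)" by auto
  next
    fix g :: 'a
    \<comment> \<open>The right-hand side is split: \<open>g - P g\<close> is solved with
      \<open>T\<close>, and \<open>P g\<close> explicitly inside the span.\<close>
    have "g - P g \<in> (\<lambda>x. T x - l *\<^sub>R x) ` D"
      using lres by (simp add: resolvent_set_def bij_betw_def)
    then obtain u where u: "u \<in> D" "T u - l *\<^sub>R u = g - P g" by (elim imageE) simp
    have z: "(\<phi> i \<bullet> u) * (\<epsilon> i - l) = 0" if i: "i \<in> J" for i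
    proof -
      have "\<phi> i \<bullet> (T u - l *\<^sub>R u) = (\<epsilon> i - l) * (\<phi> i \<bullet> u)"
        using sym[OF phi[OF i] u(1)] eig[OF i] by (simp add: inner_diff_right algebra_simps)
      moreover have "\<phi> i \<bullet> (g - P g) = 0"
        using coef[OF i] by (simp add: P_def inner_diff_right)
      ultimately show ?thesis using u(2) by (metis mult.commute)
    qed
    \<comment> \<open>Wherever the coefficient of \<open>u\<close> along \<open>\<phi> j\<close> is
      nonzero, \<open>\<epsilon> j = l\<close>. Hence \<open>P u\<close> solves the homogeneous
      equation and may be subtracted from \<open>u\<close>.\<close>
    have PuD: "P u \<in> D" and TPu: "T (P u) = l *\<^sub>R P u"
    proof -
      have *: "P u \<in> D \<and> T (P u) = (\<Sum>j\<in>J. ((\<phi> j \<bullet> u) * \<epsilon> j) *\<^sub>R \<phi> j)"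
        unfolding P_def by (rule sum_eigen[OF fin phi eig])
      then show "P u \<in> D" by simp
      have "(\<Sum>j\<in>J. ((\<phi> j \<bullet> u) * \<epsilon> j) *\<^sub>R \<phi> j) = (\<Sum>j\<in>J. (l * (\<phi> j \<bullet> u)) *\<^sub>R \<phi> j)"
        using z by (intro sum.cong refl) (simp add: algebra_simps)
      then show "T (P u) = l *\<^sub>R P u" using * by (simp add: P_def scaleR_right.sum)
    qed
    \<comment> \<open>On the span \<open>T' - l\<close> is diagonal with entries
      \<open>\<epsilon> j + c - l\<close>, positive because \<open>l < \<Lambda>\<close>.\<close>
    define v where "v = (\<Sum>j\<in>J. ((\<phi> j \<bullet> g) / (\<epsilon> j + c - l)) *\<^sub>R \<phi> j)"
    have vD: "v \<in> D" and Tv: "T v = (\<Sum>j\<in>J. ((\<phi> j \<bullet> g) / (\<epsilon> j + c - l) * \<epsilon> j) *\<^sub>R \<phi> j)"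
      unfolding v_def
      using sum_eigen[of J \<phi> \<epsilon> "\<lambda>j. (\<phi> j \<bullet> g) / (\<epsilon> j + c - l)"] fin phi eig by simp_all
    have Pv: "P v = v" unfolding P_def by (subst (2) v_def) (simp add: v_def coef cong: sum.cong)
    have PPu: "P (P u) = P u" unfolding P_def by (simp add: coef cong: sum.cong)
    have "T' v - l *\<^sub>R v = (\<Sum>j\<in>J. ((\<phi> j \<bullet> g) / (\<epsilon> j + c - l) * (\<epsilon> j + c - l)) *\<^sub>R \<phi> j)"
      unfolding T'_def Pv Tv
      unfolding v_def scaleR_right.sum scaleR_scaleR distrib_left right_diff_distrib
        scaleR_left_distrib scaleR_left_diff_distrib sum.distrib sum_subtractf
      by (simp only: mult.commute)
    also have "\<dots> = P g" unfolding P_def using c l by (intro sum.cong refl) force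
    finally have v: "T' v - l *\<^sub>R v = P g" .
    have u'D: "u - P u \<in> D" using u(1) PuD sub subspace_diff by blast
    have "P (u - P u) = 0" using Padd[of "u - P u" "P u"] PPu by simp
    then have "T' (u - P u) - l *\<^sub>R (u - P u) = g - P g"
      using u diff[OF u(1) PuD] TPu by (simp add: T'_def algebra_simps)
    then have "T' (v + (u - P u)) - l *\<^sub>R (v + (u - P u)) = g"
      using v T'.add[OF vD u'D] by (simp add: algebra_simps)
    then show "\<exists>x\<in>D. g = T' x - l *\<^sub>R x" using vD u'D sub subspace_add by metis
  qed auto
  show "l \<in> resolvent_set D T'" if l: "l < \<Lambda>" for l
  proof -
    \<comment> \<open>Close to \<open>l\<close>, all other points avoid the finitely many old
      eigenvalues and are regular by \<open>step\<close>; \<open>inj\<close> then settles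
      \<open>l\<close> itself, even if it is one of them.\<close>
    obtain d where d: "d > 0" "\<And>x. x \<in> \<epsilon> ` J \<Longrightarrow> x \<noteq> l \<Longrightarrow> d \<le> dist l x"
      using finite_set_avoid[of "\<epsilon> ` J" l] fin by blast
    show ?thesis
    proof (rule T'.isolated_injective_resolvent_set[of "min d (\<Lambda> - l)"])
      show "min d (\<Lambda> - l) > 0" using d l by simp
      show "m \<in> resolvent_set D T'" if m: "\<bar>m - l\<bar> < min d (\<Lambda> - l)" "m \<noteq> l" for m
      proof (rule step)
        show "m < \<Lambda>" using m by linarith
        moreover have "m \<notin> \<epsilon> ` J" using d(2)[of m] m by (auto simp: dist_real_def)
        ultimately show "m \<in> resolvent_set D T" using res by blast
      qed
    qed (use inj[OF l] in auto)
  qed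
qed

end

section \<open>Spectrum and eigenvectors of norm limits\<close>

lemma limit_resolvent_set:
  fixes T :: "'a::{real_inner,complete_space} \<Rightarrow> 'a" and \<epsilon> :: "nat \<Rightarrow> 'j \<Rightarrow> real"
  assumes T: "sym_op D T" and Tk: "\<And>k. sym_op D (Tk k)"
    and close: "\<And>k x. x \<in> D \<Longrightarrow> norm (Tk k x - T x) \<le> b k * norm x" and b: "b \<longlonglongrightarrow> 0"
    and fin: "finite J" and eps: "\<And>j. j \<in> J \<Longrightarrow> (\<lambda>k. \<epsilon> k j) \<longlonglongrightarrow> e j" and Lam: "\<Lambda> \<longlonglongrightarrow> \<Lambda>0"
    and res: "\<And>k l. l < \<Lambda> k \<Longrightarrow> l \<in> resolvent_set D (Tk k) \<or> l \<in> \<epsilon> k ` J"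
    and l: "l < \<Lambda>0" "l \<notin> e ` J"
  shows "l \<in> resolvent_set D T"
proof -
  obtain d0 where d0: "d0 > 0" "\<And>x. x \<in> e ` J \<Longrightarrow> x \<noteq> l \<Longrightarrow> d0 \<le> dist l x"
    using finite_set_avoid[of "e ` J" l] fin by blast
  \<comment> \<open>Half of the distance: the eigenvalues and the threshold of index
    \<open>k\<close> may move by \<open>d\<close> and still leave an interval of radius
    \<open>d\<close> around \<open>l\<close> free of spectrum, wider than the perturbation
    \<open>b k\<close>.\<close>
  define d where "d = min d0 (\<Lambda>0 - l) / 2"
  have d: "d > 0" "2 * d \<le> \<Lambda>0 - l" and de: "\<And>j. j \<in> J \<Longrightarrow> 2 * d \<le> \<bar>l - e j\<bar>"
    using d0 l by (force simp: d_def dist_real_def)+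
  have "eventually (\<lambda>k. \<forall>j\<in>J. dist (\<epsilon> k j) (e j) < d) sequentially"
    using eps d by (intro eventually_ball_finite fin ballI tendstoD)
  moreover have "eventually (\<lambda>k. dist (\<Lambda> k) \<Lambda>0 < d) sequentially" using Lam d by (intro tendstoD)
  moreover have "eventually (\<lambda>k. dist (b k) 0 < d) sequentially" using b d by (intro tendstoD)
  ultimately have "eventually (\<lambda>k. (\<forall>j\<in>J. dist (\<epsilon> k j) (e j) < d) \<and> dist (\<Lambda> k) \<Lambda>0 < d \<and> dist (b k) 0 < d) sequentially"
    by eventually_elim auto
  then obtain k where k: "\<And>j. j \<in> J \<Longrightarrow> dist (\<epsilon> k j) (e j) < d" "dist (\<Lambda> k) \<Lambda>0 < d" "dist (b k) 0 < d"
    using eventually_happens' sequentially_bot by blast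
  interpret Tk: sym_op D "Tk k" by (rule Tk)
  have r: "m \<in> resolvent_set D (Tk k)" if m: "\<bar>m - l\<bar> < d" for m
  proof -
    have "m < \<Lambda> k" using k(2) d m unfolding dist_real_def by linarith
    moreover have "m \<notin> \<epsilon> k ` J" using k(1) de m unfolding dist_real_def by fastforce
    ultimately show ?thesis using res by blast
  qed
  show ?thesis
  proof (rule Tk.resolvent_set_perturb[OF T, of l d "\<bar>b k\<bar>"])
    show "l \<in> resolvent_set D (Tk k)" using r d by simp
    show "d * norm x \<le> norm (Tk k x - l *\<^sub>R x)" if "x \<in> D" for x
      using Tk.resolvent_bound[OF d(1) r that] .
    show "norm (T x - Tk k x) \<le> \<bar>b k\<bar> * norm x" if "x \<in> D" for x
    proof -
      have "norm (T x - Tk k x) \<le> b k * norm x" using close[OF that, of k] by (simp add: norm_minus_commute)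
      also have "\<dots> \<le> \<bar>b k\<bar> * norm x" by (intro mult_right_mono) auto
      finally show ?thesis .
    qed
  qed (use k in auto)
qed

text \<open>The shifted operators have no spectrum below \<open>\<Lambda> k\<close>, so
  \<open>d * norm u\<close> is bounded by the norm of \<open>T' u - l *\<^sub>R u\<close>. That
  vector consists of the perturbation applied to \<open>u\<close> and of the nearly vanishing
  projection of \<open>u\<close>, both of which tend to 0.\<close>

lemma limit_eigenvector_zero:
  fixes T :: "'a::{real_inner,complete_space} \<Rightarrow> 'a" and \<epsilon> :: "nat \<Rightarrow> 'j \<Rightarrow> real"
  assumes T: "sym_op D T" and Tk: "\<And>k. sym_op D (Tk k)"
    and close: "\<And>k x. x \<in> D \<Longrightarrow> norm (Tk k x - T x) \<le> b k * norm x" and b: "b \<longlonglongrightarrow> 0"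
    and fin: "finite J" and eps: "\<And>j. j \<in> J \<Longrightarrow> (\<lambda>k. \<epsilon> k j) \<longlonglongrightarrow> e j" and Lam: "\<Lambda> \<longlonglongrightarrow> \<Lambda>0"
    and res: "\<And>k l. l < \<Lambda> k \<Longrightarrow> l \<in> resolvent_set D (Tk k) \<or> l \<in> \<epsilon> k ` J"
    and phi: "\<And>k j. j \<in> J \<Longrightarrow> \<phi> k j \<in> D"
    and eig: "\<And>k j. j \<in> J \<Longrightarrow> Tk k (\<phi> k j) = \<epsilon> k j *\<^sub>R \<phi> k j"
    and on: "\<And>k i j. i \<in> J \<Longrightarrow> j \<in> J \<Longrightarrow> \<phi> k i \<bullet> \<phi> k j = (if i = j then 1 else 0)"
    and ker: "\<And>k u j. u \<in> D \<Longrightarrow> j \<in> J \<Longrightarrow> Tk k u = \<epsilon> k j *\<^sub>R u \<Longrightarrow> (\<And>i. i \<in> J \<Longrightarrow> \<phi> k i \<bullet> u = 0) \<Longrightarrow> u = 0"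
    and u: "u \<in> D" "T u = l *\<^sub>R u" "l < \<Lambda>0" and orth: "\<And>j. j \<in> J \<Longrightarrow> (\<lambda>k. \<phi> k j \<bullet> u) \<longlonglongrightarrow> 0"
  shows "u = 0"
proof -
  \<comment> \<open>One constant for all \<open>j\<close> and all large \<open>k\<close>: the sum
    dominates each \<open>\<Lambda>0 - e j\<close>, and 2 absorbs a deviation of at most 1 in each
    of \<open>\<Lambda> k\<close> and \<open>\<epsilon> k j\<close>.\<close>
  define c where "c = 2 + (\<Sum>j\<in>J. \<bar>\<Lambda>0 - e j\<bar>)"
  have cj: "\<Lambda>0 - e j + 2 \<le> c" if "j \<in> J" for j
    using member_le_sum[OF that, of "\<lambda>j. \<bar>\<Lambda>0 - e j\<bar>"] fin by (auto simp: c_def)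
  define d where "d = (\<Lambda>0 - l) / 2"
  have d: "d > 0" using u d_def by simp
  have "eventually (\<lambda>k. \<forall>j\<in>J. dist (\<epsilon> k j) (e j) < 1) sequentially"
    using eps by (intro eventually_ball_finite fin ballI tendstoD) auto
  moreover have "eventually (\<lambda>k. dist (\<Lambda> k) \<Lambda>0 < min 1 d) sequentially"
    using Lam d by (intro tendstoD) auto
  ultimately have ev: "eventually (\<lambda>k. d * norm u \<le> \<bar>b k\<bar> * norm u + \<bar>c\<bar> * (\<Sum>j\<in>J. \<bar>\<phi> k j \<bullet> u\<bar>)) sequentially"
  proof eventually_elim
    case (elim k)
    interpret Tk: sym_op D "Tk k" by (rule Tk)
    define T' where "T' x = Tk k x + c *\<^sub>R (\<Sum>j\<in>J. (\<phi> k j \<bullet> x) *\<^sub>R \<phi> k j)" for x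
    have cc: "\<Lambda> k \<le> \<epsilon> k j + c" if "j \<in> J" for j
    proof -
      have "\<bar>\<epsilon> k j - e j\<bar> < 1" "\<bar>\<Lambda> k - \<Lambda>0\<bar> < 1" using elim that by (auto simp: dist_real_def)
      then show ?thesis using cj[OF that] by linarith
    qed
    note * = Tk.shift_eigenvalues[OF fin phi eig on res ker cc, folded T'_def[abs_def]]
    have r: "m \<in> resolvent_set D T'" if "\<bar>m - l\<bar> < d" for m
    proof (rule *(2))
      have "\<Lambda>0 = l + 2 * d" by (simp add: d_def field_simps)
      then show "m < \<Lambda> k" using that elim(2) unfolding dist_real_def by auto
    qed
    have "d * norm u \<le> norm (T' u - l *\<^sub>R u)"
      using sym_op.resolvent_bound[OF *(1) d r u(1)] .
    also have "T' u - l *\<^sub>R u = (Tk k u - T u) + c *\<^sub>R (\<Sum>j\<in>J. (\<phi> k j \<bullet> u) *\<^sub>R \<phi> k j)"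
      by (simp add: T'_def u)
    also have "norm \<dots> \<le> norm (Tk k u - T u) + norm (c *\<^sub>R (\<Sum>j\<in>J. (\<phi> k j \<bullet> u) *\<^sub>R \<phi> k j))"
      by (rule norm_triangle_ineq)
    also have "norm (Tk k u - T u) \<le> \<bar>b k\<bar> * norm u"
      using close[OF u(1), of k] by (meson abs_ge_self mult_right_mono norm_ge_zero order_trans)
    also have "norm (c *\<^sub>R (\<Sum>j\<in>J. (\<phi> k j \<bullet> u) *\<^sub>R \<phi> k j)) \<le> \<bar>c\<bar> * (\<Sum>j\<in>J. \<bar>\<phi> k j \<bullet> u\<bar>)"
    proof -
      have "norm (\<Sum>j\<in>J. (\<phi> k j \<bullet> u) *\<^sub>R \<phi> k j) \<le> (\<Sum>j\<in>J. \<bar>\<phi> k j \<bullet> u\<bar>)"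
        using on by (intro sum_norm_le) (simp add: norm_eq_sqrt_inner)
      then show ?thesis by (simp add: mult_left_mono)
    qed
    finally show ?case by simp
  qed
  have lim: "(\<lambda>k. \<bar>b k\<bar> * norm u + \<bar>c\<bar> * (\<Sum>j\<in>J. \<bar>\<phi> k j \<bullet> u\<bar>)) \<longlonglongrightarrow> \<bar>0\<bar> * norm u + \<bar>c\<bar> * (\<Sum>j\<in>J. \<bar>0\<bar>)"
    by (intro tendsto_intros b orth)
  have "d * norm u \<le> 0"
    using tendsto_lowerbound[OF lim ev] by simp
  then show ?thesis using d by (simp add: mult_le_0_iff)
qed

section \<open>The Hilbert space of square-integrable functions\<close>

lemma ae_eq_refl [simp]: "ae_eq f f"
  by (simp add: ae_eq_def)

lemma ae_eq_sym: "ae_eq f g \<Longrightarrow> ae_eq g f"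
  unfolding ae_eq_def by (erule eventually_mono) simp

lemma ae_eq_trans: "ae_eq f g \<Longrightarrow> ae_eq g h \<Longrightarrow> ae_eq f h"
  unfolding ae_eq_def by (erule (1) eventually_elim2) simp

lemma ae_eq_add: "ae_eq f f' \<Longrightarrow> ae_eq g g' \<Longrightarrow> ae_eq (\<lambda>x. f x + g x) (\<lambda>x. f' x + g' x)"
  unfolding ae_eq_def by (erule (1) eventually_elim2) simp

lemma ae_eq_diff: "ae_eq f f' \<Longrightarrow> ae_eq g g' \<Longrightarrow> ae_eq (\<lambda>x. f x - g x) (\<lambda>x. f' x - g' x)"
  unfolding ae_eq_def by (erule (1) eventually_elim2) simp

lemma ae_eq_mult: "ae_eq f f' \<Longrightarrow> ae_eq (\<lambda>x. h x * f x) (\<lambda>x. h x * f' x)"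
  unfolding ae_eq_def by (erule eventually_mono) simp

lemma ae_eq_sum:
  "(\<And>i. i \<in> I \<Longrightarrow> ae_eq (f i) (g i)) \<Longrightarrow> ae_eq (\<lambda>x. \<Sum>i\<in>I. f i x) (\<lambda>x. \<Sum>i\<in>I. g i x)"
  by (induction I rule: infinite_finite_induct) (simp_all add: ae_eq_add)

lemma borel_measurable_cnj [measurable (raw)]:
  "f \<in> borel_measurable M \<Longrightarrow> (\<lambda>x. cnj (f x)) \<in> borel_measurable M"
  by (rule borel_measurable_continuous_on) (intro continuous_intros)

lemma L2_measurable [measurable_dest]: "L2 f \<Longrightarrow> f \<in> borel_measurable borel"
  by (simp add: L2_def)

lemma L2_integrable: "L2 f \<Longrightarrow> integrable lborel (\<lambda>x. (cmod (f x))\<^sup>2)"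
  by (simp add: L2_def)

lemma L2I: "f \<in> borel_measurable borel \<Longrightarrow> integrable lborel (\<lambda>x. (cmod (f x))\<^sup>2) \<Longrightarrow> L2 f"
  by (simp add: L2_def)

lemma L2_bound:
  assumes f: "f \<in> borel_measurable borel" and g: "integrable lborel g"
    and b: "AE x in lborel. (cmod (f x))\<^sup>2 \<le> g x"
  shows "L2 f"
proof (rule L2I[OF f], rule Bochner_Integration.integrable_bound[OF g])
  show "AE x in lborel. norm ((cmod (f x))\<^sup>2) \<le> norm (g x)" using b by eventually_elim simp
qed (use f in measurable)

lemma sq_add_le: "(cmod (a + b))\<^sup>2 \<le> 2 * (cmod a)\<^sup>2 + 2 * (cmod b)\<^sup>2"
proof -
  have "(cmod (a + b))\<^sup>2 \<le> (cmod a + cmod b)\<^sup>2" by (intro power_mono norm_triangle_ineq) auto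
  also have "\<dots> \<le> 2 * (cmod a)\<^sup>2 + 2 * (cmod b)\<^sup>2"
    using zero_le_power2[of "cmod a - cmod b"] by (simp add: power2_sum power2_diff)
  finally show ?thesis .
qed

lemma L2_add [intro]: "L2 f \<Longrightarrow> L2 g \<Longrightarrow> L2 (\<lambda>x. f x + g x)"
  by (rule L2_bound[where g="\<lambda>x. 2 * (cmod (f x))\<^sup>2 + 2 * (cmod (g x))\<^sup>2"])
    (auto simp: L2_measurable L2_integrable sq_add_le intro: borel_measurable_add)

lemma L2_mult_const [intro]: "L2 f \<Longrightarrow> L2 (\<lambda>x. c * f x)"
  by (rule L2I) (auto simp: L2_measurable L2_integrable norm_mult power_mult_distrib intro: borel_measurable_times)

lemma L2_minus [intro]: "L2 f \<Longrightarrow> L2 (\<lambda>x. - f x)"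
  using L2_mult_const[of f "-1"] by simp

lemma L2_diff [intro]: "L2 f \<Longrightarrow> L2 g \<Longrightarrow> L2 (\<lambda>x. f x - g x)"
  using L2_add[of f "\<lambda>x. - g x"] L2_minus by simp

lemma L2_zero [simp, intro]: "L2 (\<lambda>x. 0)"
  by (rule L2I) auto

lemma L2_sum [intro]: "(\<And>i. i \<in> I \<Longrightarrow> L2 (f i)) \<Longrightarrow> L2 (\<lambda>x. \<Sum>i\<in>I. f i x)"
  by (induction I rule: infinite_finite_induct) auto

lemma L2_cnj [intro]: "L2 f \<Longrightarrow> L2 (\<lambda>x. cnj (f x))"
  by (rule L2I) (auto simp: L2_measurable L2_integrable intro: borel_measurable_cnj)

lemma L2_norm [intro]: "L2 f \<Longrightarrow> L2 (\<lambda>x. complex_of_real (cmod (f x)))"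
  by (rule L2I) (auto simp: L2_integrable dest: L2_measurable)

lemma integrable_mult_L2 [intro]:
  assumes "L2 f" "L2 g" shows "integrable lborel (\<lambda>x. f x * g x)"
proof (rule Bochner_Integration.integrable_bound)
  show "integrable lborel (\<lambda>x. (cmod (f x))\<^sup>2 + (cmod (g x))\<^sup>2)"
    using assms by (auto simp: L2_integrable)
  have "norm (f x * g x) \<le> norm ((cmod (f x))\<^sup>2 + (cmod (g x))\<^sup>2)" for x
  proof -
    have "cmod (f x) * cmod (g x) \<le> (cmod (f x))\<^sup>2 + (cmod (g x))\<^sup>2"
      using zero_le_power2[of "cmod (f x) - cmod (g x)"] zero_le_power2[of "cmod (f x)"]
        zero_le_power2[of "cmod (g x)"] unfolding power2_diff by linarith
    then show ?thesis by (simp add: norm_mult)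
  qed
  then show "AE x in lborel. norm (f x * g x) \<le> norm ((cmod (f x))\<^sup>2 + (cmod (g x))\<^sup>2)" by simp
qed (use assms L2_measurable in measurable)

lemma integrable_inner_L2 [intro]:
  "L2 f \<Longrightarrow> L2 g \<Longrightarrow> integrable lborel (\<lambda>x. cnj (f x) * g x)"
  using integrable_mult_L2 L2_cnj by blast

lemma inner_L2_add_right: "L2 f \<Longrightarrow> L2 g \<Longrightarrow> L2 h \<Longrightarrow> inner_L2 h (\<lambda>x. f x + g x) = inner_L2 h f + inner_L2 h g"
  by (simp add: inner_L2_def distrib_left integrable_inner_L2)

lemma inner_L2_diff_right: "L2 f \<Longrightarrow> L2 g \<Longrightarrow> L2 h \<Longrightarrow> inner_L2 h (\<lambda>x. f x - g x) = inner_L2 h f - inner_L2 h g"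
  by (simp add: inner_L2_def right_diff_distrib integrable_inner_L2)

lemma inner_L2_scale_right: "inner_L2 h (\<lambda>x. c * f x) = c * inner_L2 h f"
proof -
  have "(LINT x|lborel. cnj (h x) * (c * f x)) = (LINT x|lborel. c * (cnj (h x) * f x))"
    by (simp add: mult.left_commute)
  then show ?thesis by (simp add: inner_L2_def)
qed

lemma inner_L2_cnj: "cnj (inner_L2 f g) = inner_L2 g f"
proof -
  have "(LINT x|lborel. cnj (cnj (f x) * g x)) = (LINT x|lborel. cnj (g x) * f x)"
    by (rule Bochner_Integration.integral_cong) auto
  then show ?thesis using Bochner_Integration.integral_cnj[of lborel "\<lambda>x. cnj (f x) * g x"] by (simp only: inner_L2_def)
qed

lemma inner_L2_scale_left: "inner_L2 (\<lambda>x. c * f x) h = cnj c * inner_L2 f h"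
  by (subst (1 2) inner_L2_cnj[symmetric]) (simp add: inner_L2_scale_right)

lemma inner_L2_add_left: "L2 f \<Longrightarrow> L2 g \<Longrightarrow> L2 h \<Longrightarrow> inner_L2 (\<lambda>x. f x + g x) h = inner_L2 f h + inner_L2 g h"
  by (subst (1 2 3) inner_L2_cnj[symmetric]) (simp add: inner_L2_add_right)

lemma inner_L2_sum_right:
  "(\<And>i. i \<in> I \<Longrightarrow> L2 (f i)) \<Longrightarrow> L2 h \<Longrightarrow> inner_L2 h (\<lambda>x. \<Sum>i\<in>I. f i x) = (\<Sum>i\<in>I. inner_L2 h (f i))"
  by (induction I rule: infinite_finite_induct) (simp_all add: inner_L2_add_right L2_sum, simp_all add: inner_L2_def)

lemma inner_L2_sum_left:
  "(\<And>i. i \<in> I \<Longrightarrow> L2 (f i)) \<Longrightarrow> L2 h \<Longrightarrow> inner_L2 (\<lambda>x. \<Sum>i\<in>I. f i x) h = (\<Sum>i\<in>I. inner_L2 (f i) h)"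
  using arg_cong[OF inner_L2_sum_right[of I f h], of cnj] by (simp add: inner_L2_cnj)

lemma inner_L2_cong:
  assumes "ae_eq f f'" "ae_eq g g'" "L2 f" "L2 g" "L2 f'" "L2 g'"
  shows "inner_L2 f g = inner_L2 f' g'"
  unfolding inner_L2_def
proof (rule integral_cong_AE)
  show "AE x in lborel. cnj (f x) * g x = cnj (f' x) * g' x"
    using assms(1,2) unfolding ae_eq_def by eventually_elim simp
qed (use assms(3-6) in \<open>auto dest!: L2_measurable intro!: borel_measurable_times borel_measurable_cnj\<close>)

lemma inner_L2_self: "inner_L2 f f = complex_of_real (LINT x|lborel. (cmod (f x))\<^sup>2)"
  by (simp add: inner_L2_def mult.commute[of "cnj _"] complex_norm_square[symmetric] flip: of_real_power)

lemma norm_L2_sq: "(norm_L2 f)\<^sup>2 = Re (inner_L2 f f)"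
  by (simp add: norm_L2_def inner_L2_self)

lemma norm_L2_nonneg [simp]: "0 \<le> norm_L2 f"
  by (simp add: norm_L2_def)

lemma L2_null_iff: "L2 f \<Longrightarrow> (LINT x|lborel. (cmod (f x))\<^sup>2) = 0 \<longleftrightarrow> ae_eq f (\<lambda>x. 0)"
  by (subst integral_nonneg_eq_0_iff_AE) (auto simp: L2_integrable ae_eq_def)

\<comment> \<open>The relation is reflexive on \<open>L2\<close> functions only, so the quotient is
  partial: a function outside \<open>L2\<close> represents no element.\<close>
quotient_type l2 = fn3 / partial: "\<lambda>f g. L2 f \<and> L2 g \<and> ae_eq f g"
proof (rule part_equivpI)
  show "\<exists>x. L2 x \<and> L2 x \<and> ae_eq x x" using L2_zero ae_eq_refl by blast
qed (auto simp: symp_def transp_def intro: ae_eq_sym ae_eq_trans)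

instantiation l2 :: real_vector
begin

lift_definition zero_l2 :: l2 is "\<lambda>x. 0" by simp
lift_definition plus_l2 :: "l2 \<Rightarrow> l2 \<Rightarrow> l2" is "\<lambda>f g x. f x + g x" by (auto intro: ae_eq_add)
lift_definition minus_l2 :: "l2 \<Rightarrow> l2 \<Rightarrow> l2" is "\<lambda>f g x. f x - g x" by (auto intro: ae_eq_diff)
lift_definition uminus_l2 :: "l2 \<Rightarrow> l2" is "\<lambda>f x. - f x" by (auto simp: ae_eq_def)
lift_definition scaleR_l2 :: "real \<Rightarrow> l2 \<Rightarrow> l2" is "\<lambda>r f x. complex_of_real r * f x"
  by (auto intro: ae_eq_mult)

instance
proof
  fix x y z :: l2 and r s :: real
  show "x + y + z = x + (y + z)" by transfer (auto simp: add.assoc)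
  show "x + y = y + x" by transfer (auto simp: add.commute)
  show "0 + x = x" by transfer auto
  show "- x + x = 0" by transfer auto
  show "x - y = x + - y" by transfer auto
  show "r *\<^sub>R (x + y) = r *\<^sub>R x + r *\<^sub>R y" by transfer (auto simp: distrib_left)
  show "(r + s) *\<^sub>R x = r *\<^sub>R x + s *\<^sub>R x" by transfer (auto simp: distrib_right)
  show "r *\<^sub>R s *\<^sub>R x = (r * s) *\<^sub>R x" by transfer (auto simp: mult.assoc)
  show "1 *\<^sub>R x = x" by transfer auto
qed

end

instantiation l2 :: real_inner
begin

lift_definition inner_l2 :: "l2 \<Rightarrow> l2 \<Rightarrow> real" is "\<lambda>f g. Re (inner_L2 f g)"
  using inner_L2_cong by metis
definition norm_l2 :: "l2 \<Rightarrow> real" where "norm_l2 x = sqrt (x \<bullet> x)"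
definition sgn_l2 :: "l2 \<Rightarrow> l2" where "sgn_l2 x = x /\<^sub>R norm x"
definition dist_l2 :: "l2 \<Rightarrow> l2 \<Rightarrow> real" where "dist_l2 x y = norm (x - y)"
definition uniformity_l2 :: "(l2 \<times> l2) filter" where
  "uniformity_l2 = (INF e\<in>{0<..}. principal {(x, y). dist x y < e})"
definition open_l2 :: "l2 set \<Rightarrow> bool" where
  "open_l2 U = (\<forall>x\<in>U. \<forall>\<^sub>F (x', y) in uniformity. x' = x \<longrightarrow> y \<in> U)"

instance
proof
  fix x y z :: l2 and r :: real
  show "sgn x = x /\<^sub>R norm x" by (rule sgn_l2_def)
  show "dist x y = norm (x - y)" by (rule dist_l2_def)
  show "(uniformity :: (l2 \<times> l2) filter) = (INF e\<in>{0<..}. principal {(x, y). dist x y < e})"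
    by (rule uniformity_l2_def)
  show "x \<bullet> y = y \<bullet> x" by transfer (metis inner_L2_cnj cnj.sel(1))
  show "(x + y) \<bullet> z = x \<bullet> z + y \<bullet> z" by transfer (simp add: inner_L2_add_left)
  show "(r *\<^sub>R x) \<bullet> y = r * (x \<bullet> y)" by transfer (simp add: inner_L2_scale_left)
  show "0 \<le> x \<bullet> x" by transfer (simp add: inner_L2_self)
  show "(x \<bullet> x = 0) = (x = 0)" by transfer (simp add: inner_L2_self L2_null_iff)
  show "norm x = sqrt (x \<bullet> x)" by (rule norm_l2_def)
next
  fix U :: "l2 set"
  show "open U = (\<forall>x\<in>U. \<forall>\<^sub>F (x', y) in uniformity. x' = x \<longrightarrow> y \<in> U)" by (rule open_l2_def)
qed

end

abbreviation cls :: "fn3 \<Rightarrow> l2" where "cls \<equiv> abs_l2"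

lemma cls_eq_iff: "L2 f \<Longrightarrow> L2 g \<Longrightarrow> cls f = cls g \<longleftrightarrow> ae_eq f g"
  using Quotient3_rel[OF Quotient3_l2] by (metis ae_eq_refl)

lemma rep_l2 [simp]: "L2 (rep_l2 x)" "cls (rep_l2 x) = x"
  using Quotient3_rep_reflp[OF Quotient3_l2] Quotient3_abs_rep[OF Quotient3_l2] by auto

lemma rep_cls: "L2 f \<Longrightarrow> ae_eq (rep_l2 (cls f)) f"
  using cls_eq_iff rep_l2 by blast

lemma cls_add: "L2 f \<Longrightarrow> L2 g \<Longrightarrow> cls f + cls g = cls (\<lambda>x. f x + g x)"
  by (simp add: plus_l2.abs_eq)

lemma cls_diff: "L2 f \<Longrightarrow> L2 g \<Longrightarrow> cls f - cls g = cls (\<lambda>x. f x - g x)"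
  by (simp add: minus_l2.abs_eq)

lemma cls_scaleR: "L2 f \<Longrightarrow> r *\<^sub>R cls f = cls (\<lambda>x. complex_of_real r * f x)"
  by (simp add: scaleR_l2.abs_eq)

lemma cls_zero: "cls (\<lambda>x. 0) = 0"
  by (simp add: zero_l2.abs_eq)

lemma cls_inner: "L2 f \<Longrightarrow> L2 g \<Longrightarrow> cls f \<bullet> cls g = Re (inner_L2 f g)"
  by (simp add: inner_l2.abs_eq)

lemma cls_norm: "L2 f \<Longrightarrow> norm (cls f) = norm_L2 f"
  by (simp add: norm_l2_def cls_inner norm_L2_def inner_L2_self)

lemma norm_L2_triangle: "L2 f \<Longrightarrow> L2 g \<Longrightarrow> norm_L2 (\<lambda>x. f x + g x) \<le> norm_L2 f + norm_L2 g"
  using norm_triangle_ineq[of "cls f" "cls g"] by (simp add: cls_add cls_norm L2_add)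

lemma norm_L2_triangle_diff: "L2 f \<Longrightarrow> L2 g \<Longrightarrow> norm_L2 (\<lambda>x. f x - g x) \<le> norm_L2 f + norm_L2 g"
  using norm_triangle_ineq4[of "cls f" "cls g"] by (simp add: cls_diff cls_norm L2_diff)

lemma norm_L2_mult_const: "norm_L2 (\<lambda>x. c * f x) = cmod c * norm_L2 f"
  by (simp add: norm_L2_def norm_mult power_mult_distrib real_sqrt_mult)

lemma norm_L2_sum:
  "(\<And>i. i \<in> I \<Longrightarrow> L2 (f i)) \<Longrightarrow> norm_L2 (\<lambda>x. \<Sum>i\<in>I. f i x) \<le> (\<Sum>i\<in>I. norm_L2 (f i))"
proof (induction I rule: infinite_finite_induct)
  case (insert i I)
  then have "norm_L2 (\<lambda>x. f i x + (\<Sum>i\<in>I. f i x)) \<le> norm_L2 (f i) + norm_L2 (\<lambda>x. \<Sum>i\<in>I. f i x)"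
    by (intro norm_L2_triangle L2_sum) auto
  with insert show ?case by simp
qed (simp_all add: norm_L2_def)

lemma norm_L2_cong: "ae_eq f g \<Longrightarrow> L2 f \<Longrightarrow> L2 g \<Longrightarrow> norm_L2 f = norm_L2 g"
  by (metis cls_eq_iff cls_norm)

lemma norm_L2_eq_0_iff: "L2 f \<Longrightarrow> norm_L2 f = 0 \<longleftrightarrow> ae_eq f (\<lambda>x. 0)"
  by (simp add: norm_L2_def L2_null_iff)

text \<open>Cauchy-Schwarz in \<open>l2\<close>, applied to the moduli so that phases cannot
  cancel.\<close>

lemma integral_norm_mult_le:
  assumes "L2 f" "L2 g"
  shows "(LINT x|lborel. cmod (f x) * cmod (g x)) \<le> norm_L2 f * norm_L2 g"
proof -
  have "inner_L2 (\<lambda>x. complex_of_real (cmod (f x))) (\<lambda>x. complex_of_real (cmod (g x)))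
      = complex_of_real (LINT x|lborel. cmod (f x) * cmod (g x))"
    by (simp add: inner_L2_def flip: of_real_mult)
  then have "(LINT x|lborel. cmod (f x) * cmod (g x))
      = cls (\<lambda>x. complex_of_real (cmod (f x))) \<bullet> cls (\<lambda>x. complex_of_real (cmod (g x)))"
    using assms by (simp add: cls_inner L2_norm)
  also have "\<dots> \<le> norm (cls (\<lambda>x. complex_of_real (cmod (f x)))) * norm (cls (\<lambda>x. complex_of_real (cmod (g x))))"
    by (rule norm_cauchy_schwarz)
  also have "\<dots> = norm_L2 f * norm_L2 g" using assms by (simp add: cls_norm L2_norm) (simp add: norm_L2_def)
  finally show ?thesis .
qed

lemma integral_mult_le:
  assumes "L2 f" "L2 g"
  shows "cmod (LINT x|lborel. f x * g x) \<le> norm_L2 f * norm_L2 g"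
proof -
  have "cmod (LINT x|lborel. f x * g x) \<le> (LINT x|lborel. cmod (f x * g x))"
    by (rule integral_norm_bound)
  then show ?thesis using integral_norm_mult_le[OF assms] by (simp add: norm_mult)
qed

lemma inner_L2_le: "L2 f \<Longrightarrow> L2 g \<Longrightarrow> cmod (inner_L2 f g) \<le> norm_L2 f * norm_L2 g"
  using integral_mult_le[of "\<lambda>x. cnj (f x)" g] by (simp add: inner_L2_def L2_cnj) (simp add: norm_L2_def)

lemma nn_integral_sq: "L2 f \<Longrightarrow> (\<integral>\<^sup>+x. ennreal ((cmod (f x))\<^sup>2) \<partial>lborel) = ennreal ((norm_L2 f)\<^sup>2)"
  by (simp add: nn_integral_eq_integral L2_integrable norm_L2_def)

text \<open>Shaped for use after Fatou's lemma: one bound on the nonnegative integral yields both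
  integrability and the norm estimate.\<close>

lemma L2_nn_integral:
  assumes "f \<in> borel_measurable borel" "(\<integral>\<^sup>+x. ennreal ((cmod (f x))\<^sup>2) \<partial>lborel) \<le> ennreal (c\<^sup>2)" "c \<ge> 0"
  shows "L2 f" "norm_L2 f \<le> c"
proof -
  have "integrable lborel (\<lambda>x. (cmod (f x))\<^sup>2)"
    by (rule integrableI_nonneg) (use assms(1,2) in \<open>auto simp: le_less_trans[OF assms(2)]\<close>)
  then show L: "L2 f" using assms(1) by (intro L2I)
  have "ennreal ((norm_L2 f)\<^sup>2) \<le> ennreal (c\<^sup>2)" using assms(2) nn_integral_sq[OF L] by simp
  then show "norm_L2 f \<le> c" using assms(3) power2_le_imp_le by (simp add: ennreal_le_iff)
qed

text \<open>Riesz--Fischer: along a subsequence whose increments have norm at most \<open>(1/4)\<^sup>n\<close>, the series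
  \<open>\<Sum> 4\<^sup>n |f\<^sub>n\<^sub>+\<^sub>1 - f\<^sub>n|\<^sup>2\<close> has finite integral, which forces pointwise convergence almost everywhere.\<close>

instance l2 :: complete_space
proof
  fix X :: "nat \<Rightarrow> l2" assume X: "Cauchy X"
  have "\<exists>m. \<forall>k\<ge>m. norm (X k - X m) \<le> (1/4) ^ n" for n
    using CauchyD[OF X, of "(1/4)^n"] by (metis less_imp_le zero_less_power zero_less_divide_iff zero_less_numeral zero_less_one order_refl)
  then obtain r0 where r0: "\<And>n k. k \<ge> r0 n \<Longrightarrow> norm (X k - X (r0 n)) \<le> (1/4) ^ n" by metis
  \<comment> \<open>The sum dominates every earlier threshold, and the added \<open>n\<close> makes
    the sequence strictly increasing.\<close>
  define r where "r n = (\<Sum>i\<le>n. r0 i) + n" for n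
  have r0r: "r0 n \<le> r m" if "n \<le> m" for n m
    using member_le_sum[of n "{..m}" r0] that by (simp add: r_def)
  define f where "f n = rep_l2 (X (r n))" for n
  have f: "L2 (f n)" "cls (f n) = X (r n)" for n by (simp_all add: f_def)
  have fm [measurable]: "f n \<in> borel_measurable borel" for n using f L2_measurable by blast
  have near: "norm_L2 (\<lambda>x. f m x - f n x) \<le> 2 * (1/4) ^ n" if "n \<le> m" for m n
  proof -
    have "norm_L2 (\<lambda>x. f m x - f n x) = norm (X (r m) - X (r n))"
      using f by (metis cls_diff cls_norm L2_diff)
    also have "\<dots> \<le> norm (X (r m) - X (r0 n)) + norm (X (r n) - X (r0 n))"
      using norm_triangle_ineq4[of "X (r m) - X (r0 n)" "X (r n) - X (r0 n)"] by simp
    also have "\<dots> \<le> (1/4) ^ n + (1/4) ^ n" by (intro add_mono r0 r0r that order_refl)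
    finally show ?thesis by simp
  qed
  define d where "d n x = f (Suc n) x - f n x" for n x
  have d: "L2 (d n)" "norm_L2 (d n) \<le> 2 * (1/4) ^ n" for n
    unfolding d_def using f near[of n "Suc n"] by auto
  have dm [measurable]: "d n \<in> borel_measurable borel" for n using d L2_measurable by blast
  have "(\<integral>\<^sup>+x. (\<Sum>n. ennreal (4 ^ n * (cmod (d n x))\<^sup>2)) \<partial>lborel) = (\<Sum>n. \<integral>\<^sup>+x. ennreal (4 ^ n * (cmod (d n x))\<^sup>2) \<partial>lborel)"
    by (rule nn_integral_suminf) measurable
  also have "\<dots> \<le> (\<Sum>n. ennreal (4 * (1/4) ^ n))"
  proof (rule suminf_le)
    fix n
    have "(\<integral>\<^sup>+x. ennreal (4 ^ n * (cmod (d n x))\<^sup>2) \<partial>lborel) = ennreal (4 ^ n) * ennreal ((norm_L2 (d n))\<^sup>2)"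
      by (simp add: ennreal_mult nn_integral_cmult nn_integral_sq[OF d(1)])
    also have "\<dots> \<le> ennreal (4 ^ n) * ennreal ((2 * (1/4) ^ n)\<^sup>2)"
      by (intro mult_left_mono ennreal_leI power_mono d) auto
    also have "\<dots> = ennreal (4 * (1/4) ^ n)"
    proof -
      have "(4::real) ^ n * (1/4) ^ n = 1" by (simp flip: power_mult_distrib)
      then have "4 ^ n * (2 * (1/4) ^ n)\<^sup>2 = 4 * (1/4::real) ^ n"
        by (simp add: power2_eq_square)
      then show ?thesis by (simp add: ennreal_mult[symmetric])
    qed
    finally show "(\<integral>\<^sup>+x. ennreal (4 ^ n * (cmod (d n x))\<^sup>2) \<partial>lborel) \<le> ennreal (4 * (1/4) ^ n)" .
  qed auto
  also have "\<dots> < \<infinity>"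
    by (subst suminf_ennreal2) (auto intro!: summable_mult)
  finally have "AE x in lborel. (\<Sum>n. ennreal (4 ^ n * (cmod (d n x))\<^sup>2)) \<noteq> \<infinity>"
    by (intro nn_integral_PInf_AE) auto
  then have conv: "AE x in lborel. convergent (\<lambda>n. f n x)"
  proof eventually_elim
    case (elim x)
    then have s: "summable (\<lambda>n. 4 ^ n * (cmod (d n x))\<^sup>2)"
      by (intro summable_suminf_not_top) auto
    then obtain C where C: "\<And>n. norm (4 ^ n * (cmod (d n x))\<^sup>2) \<le> C"
      using summable_imp_Bseq[OF s] unfolding Bseq_def by blast
    \<comment> \<open>Boundedness of the weighted terms already gives decay like (1/2)^n, hence a
      summable series of increments.\<close>
    have "cmod (d n x) \<le> sqrt C * (1/2) ^ n" for n
    proof -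
      have "(4::real) ^ n = (2 ^ n)\<^sup>2" by (simp add: power2_eq_square flip: power_mult_distrib)
      then have "(2 ^ n * cmod (d n x))\<^sup>2 \<le> C" using C[of n] by (simp add: power_mult_distrib)
      then have "2 ^ n * cmod (d n x) \<le> sqrt C" by (rule real_le_rsqrt)
      then show ?thesis by (simp add: power_divide field_simps)
    qed
    moreover have "summable (\<lambda>n. sqrt C * (1/2) ^ n)" by (rule summable_mult) simp
    ultimately have "summable (\<lambda>n. d n x)"
      using summable_comparison_test'[of "\<lambda>n. sqrt C * (1/2) ^ n" 0 "\<lambda>n. d n x"] by blast
    then have "convergent (\<lambda>n. \<Sum>i<n. d i x)" by (simp add: summable_iff_convergent)
    then have "convergent (\<lambda>n. f n x - f 0 x)" 
      unfolding d_def by (subst (asm) sum_lessThan_telescope)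
    then show ?case using convergent_add[OF _ convergent_const[of "f 0 x"]] by fastforce
  qed
  define g where "g x = lim (\<lambda>n. f n x)" for x
  have gm [measurable]: "g \<in> borel_measurable borel" unfolding g_def by measurable
  \<comment> \<open>Fatou's lemma in \<open>m\<close> with \<open>n\<close> fixed shows at once that
    \<open>g - f n\<close> is square integrable and small.\<close>
  have gL: "L2 (\<lambda>x. g x - f n x)" "norm_L2 (\<lambda>x. g x - f n x) \<le> 2 * (1/4) ^ n" for n
  proof -
    have "(\<integral>\<^sup>+x. ennreal ((cmod (g x - f n x))\<^sup>2) \<partial>lborel)
        = (\<integral>\<^sup>+x. liminf (\<lambda>m. ennreal ((cmod (f m x - f n x))\<^sup>2)) \<partial>lborel)"
    proof (rule nn_integral_cong_AE)
      show "AE x in lborel. ennreal ((cmod (g x - f n x))\<^sup>2) = liminf (\<lambda>m. ennreal ((cmod (f m x - f n x))\<^sup>2))"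
        using conv
      proof eventually_elim
        case (elim x)
        then have "(\<lambda>m. f m x) \<longlonglongrightarrow> g x" unfolding g_def by (simp add: convergent_LIMSEQ_iff)
        then have "(\<lambda>m. ennreal ((cmod (f m x - f n x))\<^sup>2)) \<longlonglongrightarrow> ennreal ((cmod (g x - f n x))\<^sup>2)"
          by (intro tendsto_intros)
        then show ?case by (rule lim_imp_Liminf[OF sequentially_bot, symmetric])
      qed
    qed
    also have "\<dots> \<le> liminf (\<lambda>m. \<integral>\<^sup>+x. ennreal ((cmod (f m x - f n x))\<^sup>2) \<partial>lborel)"
      by (rule nn_integral_liminf) measurable
    also have "\<dots> \<le> liminf (\<lambda>m. ennreal ((2 * (1/4) ^ n)\<^sup>2))"
    proof (rule Liminf_mono)
      show "\<forall>\<^sub>F m in sequentially. (\<integral>\<^sup>+x. ennreal ((cmod (f m x - f n x))\<^sup>2) \<partial>lborel) \<le> ennreal ((2 * (1/4) ^ n)\<^sup>2)"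
        using eventually_ge_at_top[of n]
      proof eventually_elim
        case (elim m)
        show ?case
          unfolding nn_integral_sq[OF L2_diff[OF f(1) f(1)]]
          by (intro ennreal_leI power_mono near elim norm_L2_nonneg)
      qed
    qed
    also have "\<dots> = ennreal ((2 * (1/4) ^ n)\<^sup>2)" by (simp add: Liminf_const)
    finally show "L2 (\<lambda>x. g x - f n x)" "norm_L2 (\<lambda>x. g x - f n x) \<le> 2 * (1/4) ^ n"
      using L2_nn_integral[of "\<lambda>x. g x - f n x" "2 * (1/4) ^ n"] by auto
  qed
  have g: "L2 g" using L2_add[OF gL(1)[of 0] f(1)[of 0]] by simp
  have "(\<lambda>n. X (r n)) \<longlonglongrightarrow> cls g"
  proof (rule LIM_zero_cancel, rule Lim_null_comparison)
    show "\<forall>\<^sub>F n in sequentially. norm (X (r n) - cls g) \<le> 2 * (1/4) ^ n"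
    proof (rule always_eventually, rule allI)
      fix n
      have "norm (X (r n) - cls g) = norm (cls g - cls (f n))" by (simp add: f norm_minus_commute)
      then show "norm (X (r n) - cls g) \<le> 2 * (1/4) ^ n"
        using gL by (simp add: cls_diff[OF g f(1)] cls_norm)
    qed
    show "(\<lambda>n. 2 * (1/4) ^ n) \<longlonglongrightarrow> (0::real)" by (intro tendsto_eq_intros LIMSEQ_power_zero) auto
  qed
  moreover have "strict_mono r" by (rule strict_mono_Suc_iff[THEN iffD2]) (simp add: r_def)
  ultimately have "X \<longlonglongrightarrow> cls g" using Cauchy_converges_subseq[OF X, of r "cls g"] by (simp add: comp_def)
  then show "convergent X" unfolding convergent_def by blast
qed

section \<open>Test functions\<close>

definition smooth :: "fn3 \<Rightarrow> bool" where
  "smooth f \<longleftrightarrow> (\<forall>js x. iter_pd js f differentiable (at x))"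

lemma pd_eq: "(f has_derivative f') (at x) \<Longrightarrow> pd i f x = f' (axis i 1)"
  unfolding pd_def using frechet_derivative_at by metis

lemma has_derivative_frechet: "f differentiable (at x) \<Longrightarrow> (f has_derivative frechet_derivative f (at x)) (at x)"
  using frechet_derivative_works by blast

lemma pd_add: "f differentiable (at x) \<Longrightarrow> g differentiable (at x) \<Longrightarrow> pd i (\<lambda>x. f x + g x) x = pd i f x + pd i g x"
  by (subst pd_eq[OF has_derivative_add[OF has_derivative_frechet has_derivative_frechet]]) (auto simp: pd_def)

lemma pd_mult: "f differentiable (at x) \<Longrightarrow> g differentiable (at x) \<Longrightarrow>
    pd i (\<lambda>x. f x * g x) x = f x * pd i g x + pd i f x * g x"
  by (subst pd_eq[OF has_derivative_mult[OF has_derivative_frechet has_derivative_frechet]]) (auto simp: pd_def)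

text \<open>All derivatives of exp(-1/t), extended by zero, are combinations of these functions: the
  power in the denominator makes the family closed under differentiation.\<close>

definition flat_exp :: "nat \<Rightarrow> real \<Rightarrow> real" where
  "flat_exp m t = (if t \<le> 0 then 0 else exp (- 1 / t) / t ^ m)"

text \<open>The single term of degree \<open>Suc m\<close> in the exponential series dominates the
  power of \<open>1 / t\<close>. Such a bound for every index is what makes the derivative at 0
  vanish.\<close>

lemma flat_exp_le: "\<bar>flat_exp m t\<bar> \<le> fact (Suc m) * \<bar>t\<bar>"
proof (cases "t \<le> 0")
  case False
  then have t: "t > 0" by simp
  have "(1 / t) ^ Suc m / fact (Suc m) \<le> exp (1 / t)"
    using t sum_le_suminf[OF summable_exp_generic[of "1 / t"], of "{Suc m}"]
    by (simp add: exp_def divide_inverse mult.commute del: fact_Suc power_Suc)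
  then have "(1 / t) ^ Suc m \<le> exp (1 / t) * fact (Suc m)"
    by (simp only: pos_divide_le_eq fact_gt_zero)
  then have "(1 / t) ^ Suc m * exp (- 1 / t) \<le> exp (1 / t) * fact (Suc m) * exp (- 1 / t)"
    by (rule mult_right_mono) simp
  also have "\<dots> = fact (Suc m)" by (simp add: exp_minus del: fact_Suc)
  finally have "(1 / t) ^ Suc m * exp (- 1 / t) \<le> fact (Suc m)" .
  then have "t * ((1 / t) ^ Suc m * exp (- 1 / t)) \<le> t * fact (Suc m)" using t by (intro mult_left_mono) auto
  moreover have "flat_exp m t = t * ((1 / t) ^ Suc m * exp (- 1 / t))"
    using t by (simp add: flat_exp_def power_divide)
  moreover have "flat_exp m t \<ge> 0" using t by (simp add: flat_exp_def)
  ultimately show ?thesis using t by (simp add: mult.commute)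
qed (simp add: flat_exp_def mult_le_0_iff del: fact_Suc)

lemma DERIV_flat_exp: "(flat_exp m has_real_derivative (flat_exp (m + 2) t - m * flat_exp (m + 1) t)) (at t)"
proof -
  consider "t < 0" | "t = 0" | "t > 0" by linarith
  then show ?thesis
  proof cases
    case 1
    have "((\<lambda>x. 0) has_real_derivative 0) (at t)" by simp
    then have "(flat_exp m has_real_derivative 0) (at t)"
      by (rule has_field_derivative_transform_within_open[where S="{..<0}"]) (use 1 in \<open>auto simp: flat_exp_def\<close>)
    then show ?thesis using 1 by (simp add: flat_exp_def)
  next
    case 2
    have "((\<lambda>h. flat_exp m h / h) \<longlongrightarrow> 0) (at 0)"
    proof (rule Lim_null_comparison)
      show "\<forall>\<^sub>F h in at 0. norm (flat_exp m h / h) \<le> fact (Suc (Suc m)) * \<bar>h\<bar>"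
      proof (rule eventuallyI)
        fix h :: real
        \<comment> \<open>Division by the variable raises the index, so the difference quotient at 0
          belongs to the same family.\<close>
        have "flat_exp m h / h = flat_exp (Suc m) h" by (simp add: flat_exp_def)
        then show "norm (flat_exp m h / h) \<le> fact (Suc (Suc m)) * \<bar>h\<bar>" using flat_exp_le[of "Suc m" h] by simp
      qed
      show "((\<lambda>h. fact (Suc (Suc m)) * \<bar>h\<bar>) \<longlongrightarrow> 0) (at (0::real))"
        by (intro tendsto_eq_intros) auto
    qed
    then show ?thesis using 2 by (simp add: DERIV_def flat_exp_def)
  next
    case 3
    have "((\<lambda>x. exp (- 1 / x) / x ^ m) has_real_derivative
        exp (- 1 / t) / t ^ (m + 2) - m * (exp (- 1 / t) / t ^ (m + 1))) (at t)"
    proof (cases m)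
      case 0
      then show ?thesis using 3 by (auto intro!: derivative_eq_intros simp: power2_eq_square)
    next
      case (Suc k)
      then show ?thesis using 3
        by (auto intro!: derivative_eq_intros simp: divide_simps) (cases k; simp add: algebra_simps power2_eq_square)
    qed
    then have "(flat_exp m has_real_derivative
        exp (- 1 / t) / t ^ (m + 2) - m * (exp (- 1 / t) / t ^ (m + 1))) (at t)"
      by (rule has_field_derivative_transform_within_open[where S="{0<..}"]) (use 3 in \<open>auto simp: flat_exp_def\<close>)
    then show ?thesis using 3 by (simp add: flat_exp_def)
  qed
qed

text \<open>Chosen to be closed under \<open>pd\<close>, so that differentiability of all orders
  follows by induction on the list of directions.\<close>

inductive_set bumps :: "fn3 set" where
  const: "(\<lambda>x. c) \<in> bumps"
| flat: "(\<lambda>x. complex_of_real (flat_exp m (c * x $ i + d))) \<in> bumps"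
| add: "f \<in> bumps \<Longrightarrow> g \<in> bumps \<Longrightarrow> (\<lambda>x. f x + g x) \<in> bumps"
| mult: "f \<in> bumps \<Longrightarrow> g \<in> bumps \<Longrightarrow> (\<lambda>x. f x * g x) \<in> bumps"

lemma bumps_pd:
  assumes "f \<in> bumps" shows "f differentiable (at x) \<and> pd i f \<in> bumps"
  using assms
proof (induction arbitrary: x i)
  case (const c)
  have "pd i (\<lambda>x. c) = (\<lambda>x. 0)" by (rule ext, subst pd_eq[OF has_derivative_const]) simp
  then show ?case using bumps.const by simp
next
  case (flat m c j d)
  have der: "((\<lambda>x::real^3. complex_of_real (flat_exp m (c * x $ j + d))) has_derivative
      (\<lambda>h. complex_of_real ((flat_exp (m + 2) (c * x $ j + d) - m * flat_exp (m + 1) (c * x $ j + d)) * (c * h $ j)))) (at x)"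
    for x :: "real^3"
  proof -
    have *: "((\<lambda>x. c * x $ j + d) has_derivative (\<lambda>h. c * h $ j)) (at x)"
      by (auto intro!: derivative_eq_intros bounded_linear.has_derivative[OF bounded_linear_vec_nth])
    have "((\<lambda>x. flat_exp m (c * x $ j + d)) has_derivative
        (\<lambda>h. (flat_exp (m + 2) (c * x $ j + d) - m * flat_exp (m + 1) (c * x $ j + d)) * (c * h $ j))) (at x)"
      using has_derivative_compose[OF * DERIV_flat_exp[THEN has_field_derivative_imp_has_derivative]] by simp
    then show ?thesis by (rule has_derivative_of_real)
  qed
  have "pd i (\<lambda>x. complex_of_real (flat_exp m (c * x $ j + d))) =
     (\<lambda>x. (\<lambda>x. complex_of_real (flat_exp (m + 2) (c * x $ j + d)) + (- of_nat m) * complex_of_real (flat_exp (m + 1) (c * x $ j + d))) x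
            * complex_of_real (c * axis i 1 $ j))"
    by (rule ext, subst pd_eq[OF der]) (simp add: algebra_simps)
  also have "\<dots> \<in> bumps" by (intro bumps.intros)
  finally show ?case using der differentiableI by blast
next
  case (add f g)
  have "pd i (\<lambda>x. f x + g x) = (\<lambda>x. pd i f x + pd i g x)" by (rule ext) (use add in \<open>auto simp: pd_add\<close>)
  then show ?case using add by (auto intro: bumps.intros)
next
  case (mult f g)
  have "pd i (\<lambda>x. f x * g x) = (\<lambda>x. f x * pd i g x + pd i f x * g x)" by (rule ext) (use mult in \<open>auto simp: pd_mult\<close>)
  moreover have "(\<lambda>x. f x * pd i g x + pd i f x * g x) \<in> bumps"
    by (intro bumps.add bumps.mult) (use mult in auto)
  ultimately show ?case using mult by (simp add: differentiable_mult)
qed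

lemma bumps_smooth: "f \<in> bumps \<Longrightarrow> smooth f"
proof -
  assume f: "f \<in> bumps"
  have "iter_pd js f \<in> bumps" for js by (induction js) (use f bumps_pd in auto)
  then show ?thesis using bumps_pd by (simp add: smooth_def)
qed

lemma bumps_prod: "finite I \<Longrightarrow> (\<And>i. i \<in> I \<Longrightarrow> f i \<in> bumps) \<Longrightarrow> (\<lambda>x. \<Prod>i\<in>I. f i x) \<in> bumps"
  by (induction I rule: finite_induct) (auto intro: bumps.intros)

text \<open>In each coordinate two factors of type exp(-1/t) vanish outside the open interval;
  scaling their arguments by \<open>Suc n\<close> drives them to 1 inside.\<close>

lemma box_indicator_approximation:
  fixes a b :: "real^3"
  obtains tf where "\<And>n. test_fun (tf n)" "\<And>n x. cmod (tf n x) \<le> indicator (box a b) x"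
    "\<And>x. (\<lambda>n. tf n x) \<longlonglongrightarrow> indicator (box a b) x"
proof -
  define r where "r n i x = flat_exp 0 (Suc n * x $ i + (- (Suc n * a $ i))) * flat_exp 0 (- real (Suc n) * x $ i + Suc n * b $ i)"
    for n i and x :: "real^3"
  define tf where "tf n x = (\<Prod>i\<in>UNIV. complex_of_real (r n i x))" for n x
  have inbox: "x \<in> box a b \<longleftrightarrow> (\<forall>i. a $ i < x $ i \<and> x $ i < b $ i)" for x by (auto simp: mem_box_cart)
  have r_out: "r n i x = 0" if "\<not> (a $ i < x $ i \<and> x $ i < b $ i)" for n i x
  proof (cases "a $ i < x $ i")
    case True
    then have "b $ i \<le> x $ i" using that by simp
    then have "- real (Suc n) * x $ i + Suc n * b $ i \<le> 0" by (simp add: mult_left_mono del: of_nat_Suc)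
    then show ?thesis by (simp add: r_def flat_exp_def)
  next
    case False
    then have "Suc n * x $ i + (- (Suc n * a $ i)) \<le> 0" by (simp add: mult_left_mono del: of_nat_Suc)
    then show ?thesis by (simp add: r_def flat_exp_def)
  qed
  have f01: "0 \<le> flat_exp 0 t" "flat_exp 0 t \<le> 1" for t by (auto simp: flat_exp_def)
  have r01: "0 \<le> r n i x" "r n i x \<le> 1" for n i x
    unfolding r_def using f01 by (auto intro: mult_le_one)
  have r_in: "(\<lambda>n. r n i x) \<longlonglongrightarrow> 1" if "a $ i < x $ i" "x $ i < b $ i" for i x
  proof -
    have fl: "(\<lambda>n. flat_exp 0 (real (Suc n) * s)) \<longlonglongrightarrow> 1" if "s > 0" for s :: real
    proof -
      have "(\<lambda>n. exp (- (inverse s * inverse (real (Suc n))))) \<longlonglongrightarrow> exp (- (inverse s * 0))"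
        by (intro tendsto_intros LIMSEQ_inverse_real_of_nat)
      moreover have "flat_exp 0 (real (Suc n) * s) = exp (- (inverse s * inverse (real (Suc n))))" for n
      proof -
        have "real (Suc n) * s > 0" using that by simp
        then show ?thesis by (simp add: flat_exp_def divide_inverse del: of_nat_Suc)
      qed
      ultimately show ?thesis by simp
    qed
    have "(\<lambda>n. flat_exp 0 (real (Suc n) * (x $ i - a $ i)) * flat_exp 0 (real (Suc n) * (b $ i - x $ i))) \<longlonglongrightarrow> 1 * 1"
      using that by (intro tendsto_mult fl) auto
    then show ?thesis by (simp add: r_def algebra_simps)
  qed
  have zero: "tf n x = 0" if nb: "x \<notin> box a b" for n x
  proof -
    obtain i where "\<not> (a $ i < x $ i \<and> x $ i < b $ i)" using nb inbox[of x] by blast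
    then show ?thesis unfolding tf_def using r_out[of i x n] by (intro prod_zero) auto
  qed
  show thesis
  proof
    fix n
    have "tf n \<in> bumps"
      unfolding tf_def[abs_def] r_def of_real_mult by (intro bumps_prod bumps.intros finite)
    then have "smooth (tf n)" by (rule bumps_smooth)
    moreover obtain B where "\<And>x. x \<in> box a b \<Longrightarrow> norm x \<le> B"
      using bounded_box[of a b] bounded_iff by blast
    then have "\<forall>x. B < norm x \<longrightarrow> tf n x = 0" using zero by fastforce
    ultimately show "test_fun (tf n)" unfolding test_fun_def smooth_def by blast
    fix x
    have "cmod (tf n x) \<le> 1"
      unfolding tf_def using r01 by (simp add: prod_norm[symmetric] prod_le_1)
    then show "cmod (tf n x) \<le> indicator (box a b) x" using zero by (auto simp: indicator_def)
  next
    fix x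
    show "(\<lambda>n. tf n x) \<longlonglongrightarrow> indicator (box a b) x"
    proof (cases "x \<in> box a b")
      case True
      then have "(\<lambda>n. complex_of_real (r n i x)) \<longlonglongrightarrow> complex_of_real 1" for i
        using inbox[of x] r_in[of i x] by (intro tendsto_of_real) simp
      then have "(\<lambda>n. tf n x) \<longlonglongrightarrow> (\<Prod>i\<in>(UNIV :: 3 set). complex_of_real 1)"
        unfolding tf_def by (rule tendsto_prod)
      then show ?thesis using True by simp
    qed (simp add: zero)
  qed
qed

section \<open>Translations and operations on test functions\<close>

lemma lborel_translate: "distr lborel borel (\<lambda>x. x + c) = (lborel :: (real^3) measure)"
proof -
  have "distr lborel borel (\<lambda>x. c + x) = (lborel :: (real^3) measure)"
    using lborel_affine[of 1 c] by (simp add: density_1)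
  then show ?thesis by (simp add: add.commute)
qed

lemma integral_translate:
  fixes f :: "real^3 \<Rightarrow> 'b::{banach,second_countable_topology}"
  assumes [measurable]: "f \<in> borel_measurable borel"
  shows "(LINT x|lborel. f (x + c)) = (LINT x|lborel. f x)"
proof -
  have "(LINT x|lborel. f (x + c)) = (LINT x|distr lborel borel (\<lambda>x. x + c). f x)"
    by (subst integral_distr) auto
  then show ?thesis by (simp add: lborel_translate)
qed

lemma integrable_translate:
  fixes f :: "real^3 \<Rightarrow> 'b::{banach,second_countable_topology}"
  assumes "integrable lborel f"
  shows "integrable lborel (\<lambda>x. f (x + c))"
proof -
  have m [measurable]: "f \<in> borel_measurable borel" using assms by auto
  have "integrable (distr lborel borel (\<lambda>x. x + c)) f" using assms by (simp add: lborel_translate)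
  then show ?thesis by (subst (asm) integrable_distr_eq) auto
qed

lemma L2_translate:
  assumes "L2 f" shows "L2 (\<lambda>x. f (x + c))" "norm_L2 (\<lambda>x. f (x + c)) = norm_L2 f"
proof -
  have m [measurable]: "f \<in> borel_measurable borel" using assms L2_measurable by blast
  show "L2 (\<lambda>x. f (x + c))"
    by (rule L2I) (use integrable_translate[OF L2_integrable[OF assms]] in auto)
  show "norm_L2 (\<lambda>x. f (x + c)) = norm_L2 f"
    using integral_translate[of "\<lambda>x. (cmod (f x))\<^sup>2" c] by (simp add: norm_L2_def)
qed

lemma test_fun_smooth: "test_fun tf \<longleftrightarrow> smooth tf \<and> (\<exists>r. \<forall>x. r < norm x \<longrightarrow> tf x = 0)"
  by (auto simp: test_fun_def smooth_def)

lemma smooth_differentiable: "smooth f \<Longrightarrow> f differentiable (at x)"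
  unfolding smooth_def by (metis iter_pd.simps(1))

lemma iter_pd_snoc: "iter_pd (js @ [i]) f = iter_pd js (pd i f)"
  by (induction js) auto

lemma smooth_pd: "smooth f \<Longrightarrow> smooth (pd i f)"
  unfolding smooth_def by (metis iter_pd_snoc)

lemma test_fun_pd:
  assumes "test_fun tf" shows "test_fun (pd i tf)"
proof -
  obtain r where r: "\<And>x. r < norm x \<Longrightarrow> tf x = 0" using assms test_fun_def by blast
  have "pd i tf x = 0" if "r < norm x" for x
  proof -
    have "((\<lambda>x. 0) has_derivative (\<lambda>h. 0)) (at x)" by simp
    moreover have "open {y::real^3. r < norm y}" by (intro open_Collect_less continuous_intros)
    ultimately have "(tf has_derivative (\<lambda>h. 0)) (at x)"
      by (rule has_derivative_transform_within_open) (use that r in auto)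
    then show ?thesis using pd_eq by blast
  qed
  then show ?thesis using assms smooth_pd test_fun_smooth by blast
qed

lemma test_fun_iter_pd: "test_fun tf \<Longrightarrow> test_fun (iter_pd js tf)"
  by (induction js) (auto intro: test_fun_pd)

lemma test_fun_continuous: "test_fun tf \<Longrightarrow> continuous_on S tf"
  unfolding test_fun_smooth
  by (meson smooth_differentiable differentiable_imp_continuous_within continuous_at_imp_continuous_on)

lemma test_fun_support:
  assumes "test_fun tf"
  obtains r M where "r > 0" "M > 0" "\<And>x. r < norm x \<Longrightarrow> tf x = 0" "\<And>x. cmod (tf x) \<le> M"
proof -
  obtain r where r: "\<And>x. r < norm x \<Longrightarrow> tf x = 0" using assms test_fun_def by blast
  have "bounded (tf ` cball 0 r)"
    by (intro compact_imp_bounded compact_continuous_image test_fun_continuous assms) auto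
  then obtain M where M: "\<And>x. x \<in> cball 0 r \<Longrightarrow> cmod (tf x) \<le> M" unfolding bounded_iff by blast
  show thesis
  proof (rule that[of "max r 1" "max M 1"])
    show "cmod (tf x) \<le> max M 1" for x
      using M[of x] r[of x] by (cases "norm x \<le> r") auto
  qed (use r in auto)
qed

lemma test_fun_L2:
  assumes "test_fun tf" shows "L2 tf"
proof -
  obtain r M where rM: "r > 0" "M > 0" "\<And>x. r < norm x \<Longrightarrow> tf x = 0" "\<And>x. cmod (tf x) \<le> M"
    using test_fun_support[OF assms] by blast
  show ?thesis
  proof (rule L2_bound[where g="\<lambda>x. M\<^sup>2 * indicator (cball 0 r) x"])
    show "tf \<in> borel_measurable borel"
      by (rule borel_measurable_continuous_onI) (rule test_fun_continuous[OF assms])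
    show "integrable lborel (\<lambda>x::real^3. M\<^sup>2 * indicator (cball 0 r) x)"
      by (intro integrable_mult_right integrable_real_indicator) (use emeasure_bounded_finite[OF bounded_cball] in auto)
    show "AE x in lborel. (cmod (tf x))\<^sup>2 \<le> M\<^sup>2 * indicator (cball 0 r) x"
      using rM by (intro AE_I2) (auto simp: indicator_def power_mono not_le)
  qed
qed

lemma test_fun_translate:
  assumes "test_fun tf"
  shows "test_fun (\<lambda>x. tf (x + c))" "iter_pd js (\<lambda>x. tf (x + c)) = (\<lambda>x. iter_pd js tf (x + c))"
proof -
  have d: "((\<lambda>x. f (x + c)) has_derivative frechet_derivative f (at (x + c))) (at x)"
    if "smooth f" for f :: fn3 and x
  proof -
    have "((\<lambda>x. x + c) has_derivative (\<lambda>h. h)) (at x)" by (auto intro!: derivative_eq_intros)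
    from has_derivative_compose[OF this has_derivative_frechet[OF smooth_differentiable[OF that]]]
    show ?thesis .
  qed
  have sm: "smooth (iter_pd js tf)" for js using assms test_fun_iter_pd test_fun_smooth by blast
  have it: "iter_pd js (\<lambda>x. tf (x + c)) = (\<lambda>x. iter_pd js tf (x + c))" for js
  proof (induction js)
    case (Cons i js)
    show ?case
    proof
      fix x
      show "iter_pd (i # js) (\<lambda>x. tf (x + c)) x = iter_pd (i # js) tf (x + c)"
        using pd_eq[OF d[OF sm[of js]]] by (simp add: Cons pd_def)
    qed
  qed simp
  then show "iter_pd js (\<lambda>x. tf (x + c)) = (\<lambda>x. iter_pd js tf (x + c))" .
  have "smooth (\<lambda>x. tf (x + c))" unfolding smooth_def it using d[OF sm] differentiableI by blast
  moreover obtain r where r: "\<And>x. r < norm x \<Longrightarrow> tf x = 0" using assms test_fun_def by blast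
  have "tf (x + c) = 0" if "r + norm c < norm x" for x
  proof (rule r)
    show "r < norm (x + c)" using that norm_diff_ineq[of x c] by linarith
  qed
  ultimately show "test_fun (\<lambda>x. tf (x + c))" unfolding test_fun_smooth by blast
qed

lemma test_fun_cnj:
  assumes "test_fun tf"
  shows "test_fun (\<lambda>x. cnj (tf x))" "iter_pd js (\<lambda>x. cnj (tf x)) = (\<lambda>x. cnj (iter_pd js tf x))"
proof -
  have d: "((\<lambda>x. cnj (f x)) has_derivative (\<lambda>h. cnj (frechet_derivative f (at x) h))) (at x)"
    if "smooth f" for f :: fn3 and x
    using bounded_linear.has_derivative[OF bounded_linear_cnj has_derivative_frechet[OF smooth_differentiable[OF that]]] .
  have sm: "smooth (iter_pd js tf)" for js using assms test_fun_iter_pd test_fun_smooth by blast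
  have it: "iter_pd js (\<lambda>x. cnj (tf x)) = (\<lambda>x. cnj (iter_pd js tf x))" for js
  proof (induction js)
    case (Cons i js)
    show ?case
    proof
      fix x
      show "iter_pd (i # js) (\<lambda>x. cnj (tf x)) x = cnj (iter_pd (i # js) tf x)"
        using pd_eq[OF d[OF sm[of js]]] by (simp add: Cons pd_def)
    qed
  qed simp
  then show "iter_pd js (\<lambda>x. cnj (tf x)) = (\<lambda>x. cnj (iter_pd js tf x))" .
  have "smooth (\<lambda>x. cnj (tf x))" unfolding smooth_def it using d[OF sm] differentiableI by blast
  then show "test_fun (\<lambda>x. cnj (tf x))" using assms unfolding test_fun_smooth by auto
qed

lemma test_fun_add:
  assumes "test_fun f" "test_fun g"
  shows "test_fun (\<lambda>x. f x + g x)"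
proof -
  have sm: "smooth (iter_pd js f)" "smooth (iter_pd js g)" for js
    using assms test_fun_iter_pd test_fun_smooth by blast+
  have it: "iter_pd js (\<lambda>x. f x + g x) = (\<lambda>x. iter_pd js f x + iter_pd js g x)" for js
    by (induction js) (auto simp: pd_add smooth_differentiable sm)
  have "smooth (\<lambda>x. f x + g x)" unfolding smooth_def it
    using sm smooth_differentiable by (auto intro: differentiable_add)
  moreover obtain r s where "\<And>x. r < norm x \<Longrightarrow> f x = 0" "\<And>x. s < norm x \<Longrightarrow> g x = 0"
    using assms test_fun_def by blast
  then have "\<forall>x. max r s < norm x \<longrightarrow> f x + g x = 0" by simp
  ultimately show ?thesis unfolding test_fun_smooth by blast
qed

lemma test_fun_scale:
  assumes "test_fun f" shows "test_fun (\<lambda>x. c * f x)"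
proof -
  have sm: "smooth (iter_pd js f)" for js
    using assms test_fun_iter_pd test_fun_smooth by blast+
  have p0: "pd i (\<lambda>x. c) x = 0" for i x by (subst pd_eq[OF has_derivative_const]) simp
  have it: "iter_pd js (\<lambda>x. c * f x) = (\<lambda>x. c * iter_pd js f x)" for js
    by (induction js) (auto simp: pd_mult smooth_differentiable sm p0)
  have "smooth (\<lambda>x. c * f x)" unfolding smooth_def it
    using sm smooth_differentiable by (auto intro: differentiable_mult)
  then show ?thesis using assms unfolding test_fun_smooth by auto
qed

lemma L2_indicator:
  assumes "bounded S" "S \<in> sets borel"
  shows "L2 (indicator S)"
proof (rule L2_bound[where g="indicator S"])
  show "indicator S \<in> borel_measurable borel" using assms(2) by (rule borel_measurable_indicator)
  show "integrable lborel (indicator S :: real^3 \<Rightarrow> real)"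
    using assms emeasure_bounded_finite[OF assms(1)] by (intro integrable_real_indicator) auto
qed (auto simp: indicator_def)

text \<open>The fundamental lemma of the calculus of variations: integrals over boxes vanish by
  approximation, hence over all bounded Borel sets by a Dynkin argument.\<close>

lemma ae_zero_if_orthogonal_to_test_funs:
  assumes h: "L2 h" and orth: "\<And>tf. test_fun tf \<Longrightarrow> (LINT x|lborel. h x * tf x) = 0"
  shows "ae_eq h (\<lambda>x. 0)"
proof -
  have hm [measurable]: "h \<in> borel_measurable borel" using h L2_measurable by blast
  have intbox: "integrable lborel (\<lambda>x. h x * indicator (box a b) x)" for a b :: "real^3"
    by (intro integrable_mult_L2[OF h] L2_indicator) auto
  have box0: "(LINT x|lborel. h x * indicator (box a b) x) = 0" for a b :: "real^3"
  proof -
    obtain tf where tf: "\<And>n. test_fun (tf n)" "\<And>n x. cmod (tf n x) \<le> indicator (box a b) x"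
      "\<And>x. (\<lambda>n. tf n x) \<longlonglongrightarrow> indicator (box a b) x"
      using box_indicator_approximation by blast
    have [measurable]: "tf n \<in> borel_measurable borel" for n using tf(1) test_fun_L2 L2_measurable by blast
    have "(\<lambda>n. LINT x|lborel. h x * tf n x) \<longlonglongrightarrow> (LINT x|lborel. h x * indicator (box a b) x)"
    proof (rule integral_dominated_convergence)
      show "integrable lborel (\<lambda>x. cmod (h x * indicator (box a b) x))" using intbox by (rule integrable_norm)
      show "AE x in lborel. (\<lambda>n. h x * tf n x) \<longlonglongrightarrow> h x * indicator (box a b) x"
        by (intro AE_I2 tendsto_mult tendsto_const tf)
      show "AE x in lborel. norm (h x * tf n x) \<le> cmod (h x * indicator (box a b) x)" for n
      proof (rule AE_I2)
        fix x
        have "cmod (h x) * cmod (tf n x) \<le> cmod (h x) * indicator (box a b) x" by (intro mult_left_mono tf) auto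
        then show "norm (h x * tf n x) \<le> cmod (h x * indicator (box a b) x)"
          by (auto simp: norm_mult indicator_def)
      qed
    qed auto
    then show ?thesis using orth[OF tf(1)] by (simp add: LIMSEQ_const_iff)
  qed
  have sets0: "(LINT x:(A \<inter> box a b)|lborel. h x) = 0" if A: "A \<in> sets borel" for A and a b :: "real^3"
  proof -
    \<comment> \<open>Boxes are stable under intersection and generate the Borel sets; cutting with
      the fixed box \<open>box a b\<close> keeps \<open>h\<close> integrable.\<close>
    let ?G = "range (\<lambda>(a, b). box a b :: (real^3) set)"
    have G: "sets borel = sigma_sets UNIV ?G" by (subst borel_eq_box) simp
    have int: "set_integrable lborel (B \<inter> box a b) h" if "B \<in> sets borel" for B
    proof -
      have "integrable lborel (\<lambda>x. indicator (B \<inter> box a b) x *\<^sub>R h x)"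
        by (rule Bochner_Integration.integrable_bound[OF intbox[of a b]]) (use that in \<open>auto simp: indicator_def\<close>)
      then show ?thesis by (simp add: set_integrable_def)
    qed
    have boxI: "(LINT x:(box c d)|lborel. h x) = 0" for c d :: "real^3"
    proof -
      have "(LINT x:(box c d)|lborel. h x) = (LINT x|lborel. h x * indicator (box c d) x)"
        unfolding set_lebesgue_integral_def
        by (rule Bochner_Integration.integral_cong) (auto simp: indicator_def)
      then show ?thesis using box0 by simp
    qed
    have "Int_stable ?G" unfolding Int_stable_def by (auto simp: box_Int_box)
    moreover have "?G \<subseteq> Pow UNIV" by simp
    moreover have "A \<in> sigma_sets UNIV ?G" using A unfolding G .
    ultimately show ?thesis
    proof (induction A rule: sigma_sets_induct_disjoint)
      case (basic A)
      then obtain c d where "A = box c d" by auto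
      then show ?case using boxI by (simp add: box_Int_box)
    next
      case (compl A)
      have A: "A \<in> sets borel" using compl(1) G by simp
      have "(LINT x:(box a b)|lborel. h x) = (LINT x:(A \<inter> box a b)|lborel. h x) + (LINT x:((UNIV - A) \<inter> box a b)|lborel. h x)"
        by (subst set_integral_Un[symmetric]) (use A int in \<open>auto intro!: arg_cong2[where f="\<lambda>S f. set_lebesgue_integral lborel S f"]\<close>)
      then show ?case using compl boxI by simp
    next
      case (union A)
      have A: "A i \<in> sets borel" for i using union(2) G by auto
      have "(LINT x:(\<Union>i. A i \<inter> box a b)|lborel. h x) = (\<Sum>i. LINT x:(A i \<inter> box a b)|lborel. h x)"
      proof (rule lebesgue_integral_countable_add)
        show "set_integrable lborel (\<Union>i. A i \<inter> box a b) h"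
          using int[of "\<Union>i. A i"] A by (simp add: Int_UN_distrib2)
        show "i \<noteq> j \<Longrightarrow> A i \<inter> box a b \<inter> (A j \<inter> box a b) = {}" for i j
          using union(1) by (auto simp: disjoint_family_on_def)
      qed (use A in auto)
      also have "\<dots> = 0" using union by simp
      finally show ?case by (simp add: Int_UN_distrib2)
    qed (auto simp: set_lebesgue_integral_def)
  qed
  \<comment> \<open>On the set where \<open>Re (c * h x)\<close> is positive the integral vanishes,
    so that set is null within the box. The values 1, -1, \<i>, -\<i> of \<open>c\<close> together
    leave only \<open>h x = 0\<close>.\<close>
  have pos: "AE x in lborel. x \<in> box a b \<longrightarrow> Re (c * h x) \<le> 0" for c and a b :: "real^3"
  proof -
    define A where "A = {x. Re (c * h x) > 0}"
    have A [measurable]: "A \<in> sets borel" unfolding A_def by measurable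
    have int: "integrable lborel (\<lambda>x. indicator (A \<inter> box a b) x *\<^sub>R h x)"
      by (rule Bochner_Integration.integrable_bound[OF intbox[of a b]]) (auto simp: indicator_def)
    define k where "k x = c * (indicator (A \<inter> box a b) x *\<^sub>R h x)" for x
    have k: "integrable lborel k" unfolding k_def[abs_def] using int by (intro integrable_mult_right)
    have k0: "Re (k x) \<ge> 0" for x by (auto simp: k_def A_def indicator_def)
    have "(LINT x|lborel. k x) = c * (LINT x:(A \<inter> box a b)|lborel. h x)"
      unfolding k_def set_lebesgue_integral_def by (rule integral_mult_right_zero)
    then have "(LINT x|lborel. k x) = 0" using sets0[OF A] by simp
    then have "(LINT x|lborel. Re (k x)) = 0" using integral_Re[OF k] by simp
    then have "AE x in lborel. Re (k x) = 0"
      using integral_nonneg_eq_0_iff_AE[OF integrable_Re[OF k]] k0 by simp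
    then show ?thesis by eventually_elim (auto simp: k_def A_def indicator_def split: if_splits)
  qed
  have zb: "AE x in lborel. x \<in> box a b \<longrightarrow> h x = 0" for a b :: "real^3"
    using pos[of a b 1] pos[of a b "-1"] pos[of a b \<i>] pos[of a b "-\<i>"]
    by eventually_elim (auto simp: complex_eq_iff)
  have "AE x in lborel. \<forall>n::nat. x \<in> box (\<chi> i. - real n) (\<chi> i. real n) \<longrightarrow> h x = 0"
    unfolding AE_all_countable using zb by blast
  then show ?thesis unfolding ae_eq_def
  proof eventually_elim
    case (elim x)
    obtain n :: nat where n: "norm x < n" using reals_Archimedean2 by blast
    have "- real n < x $ i \<and> x $ i < n" for i using component_le_norm_cart[of x i] n by linarith
    then have "x \<in> box (\<chi> i. - real n) (\<chi> i. real n)" by (simp add: mem_box_cart)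
    then show ?case using elim by blast
  qed
qed

text \<open>A vector orthogonal to all test functions vanishes by the fundamental lemma. The real
  inner product controls only a real part; the imaginary part comes from test functions multiplied
  by \<i>.\<close>

lemma test_funs_dense: "closure {cls tf |tf. test_fun tf} = UNIV"
proof (rule ccontr)
  let ?S = "{cls tf |tf. test_fun tf}"
  assume ne: "closure ?S \<noteq> UNIV"
  have t0: "test_fun (\<lambda>x. 0)"
  proof -
    have "(\<lambda>x. 0) \<in> bumps" by (rule bumps.const)
    then show ?thesis using bumps_smooth test_fun_smooth by blast
  qed
  have "subspace ?S"
  proof (rule subspaceI)
    show "0 \<in> ?S" using t0 cls_zero by force
    show "x + y \<in> ?S" if "x \<in> ?S" "y \<in> ?S" for x y
      using that cls_add test_fun_L2 test_fun_add by fastforce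
    show "c *\<^sub>R x \<in> ?S" if "x \<in> ?S" for x c
      using that cls_scaleR test_fun_L2 test_fun_scale by fastforce
  qed
  then obtain q where q: "q \<noteq> 0" "\<And>k. k \<in> closure ?S \<Longrightarrow> q \<bullet> k = 0"
    using closed_subspace_orthogonal_exists[OF subspace_closure closed_closure ne] by blast
  define h where "h x = cnj (rep_l2 q x)" for x
  have h: "L2 h" unfolding h_def by (intro L2_cnj) simp
  have re: "Re (LINT x|lborel. h x * tf x) = 0" if "test_fun tf" for tf
  proof -
    have "cls tf \<in> closure ?S" by (rule subsetD[OF closure_subset]) (use that in auto)
    then have "q \<bullet> cls tf = 0" by (rule q(2))
    moreover have "q \<bullet> cls tf = Re (inner_L2 (rep_l2 q) tf)"
      using cls_inner[OF rep_l2(1) test_fun_L2[OF that], of q] by simp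
    ultimately show ?thesis by (simp add: inner_L2_def h_def)
  qed
  have "(LINT x|lborel. h x * tf x) = 0" if "test_fun tf" for tf
  proof -
    have "(LINT x|lborel. h x * (\<i> * tf x)) = \<i> * (LINT x|lborel. h x * tf x)"
      by (subst integral_mult_right_zero[symmetric]) (simp add: mult.left_commute)
    then show ?thesis
      using re[OF that] re[OF test_fun_scale[OF that, of \<i>]] by (simp add: complex_eq_iff)
  qed
  then have "ae_eq h (\<lambda>x. 0)" using ae_zero_if_orthogonal_to_test_funs[OF h] by blast
  then have "ae_eq (rep_l2 q) (\<lambda>x. 0)" by (simp add: ae_eq_def h_def)
  then have "cls (rep_l2 q) = cls (\<lambda>x. 0)" using cls_eq_iff rep_l2(1) by blast
  then show False using q(1) cls_zero by simp
qed

section \<open>Weak derivatives and the Hardy inequality\<close>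

lemma vector_derivative_bound:
  fixes \<phi> :: "real \<Rightarrow> 'b::real_normed_vector"
  assumes "\<And>s. (\<phi> has_vector_derivative \<phi>' s) (at s)" "\<And>s. norm (\<phi>' s) \<le> B"
  shows "norm (\<phi> b - \<phi> a) \<le> B * \<bar>b - a\<bar>"
proof -
  have B: "B \<ge> 0" using assms(2) norm_ge_zero order_trans by blast
  have "norm (\<phi> b - \<phi> a) \<le> B * norm (b - a)"
  proof (rule differentiable_bound[where S=UNIV and f'="\<lambda>s h. h *\<^sub>R \<phi>' s"])
    show "(\<phi> has_derivative (\<lambda>h. h *\<^sub>R \<phi>' s)) (at s within UNIV)" for s
      using assms(1) by (simp add: has_vector_derivative_def)
    show "onorm (\<lambda>h. h *\<^sub>R \<phi>' s) \<le> B" for s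
      by (rule onorm_bound[OF B]) (use assms(2)[of s] in \<open>simp add: mult.commute[of B] mult_left_mono\<close>)
  qed auto
  then show ?thesis by simp
qed

lemma norm_divideR_le:
  fixes x :: "'a::real_normed_vector"
  assumes "norm x \<le> M * \<bar>h\<bar>" "h \<noteq> 0"
  shows "norm (x /\<^sub>R h) \<le> M"
proof -
  have "norm (x /\<^sub>R h) = norm x / \<bar>h\<bar>" by (simp add: divide_inverse mult.commute)
  then show ?thesis using assms by (simp add: pos_divide_le_eq)
qed

lemma test_fun_line:
  assumes "test_fun tf"
  shows "((\<lambda>s. tf (x + s *\<^sub>R axis i 1)) has_vector_derivative pd i tf (x + s *\<^sub>R axis i 1)) (at s)"
proof -
  have 1: "((\<lambda>s. x + s *\<^sub>R axis i 1) has_derivative (\<lambda>h. h *\<^sub>R axis i 1)) (at s)"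
    by (auto intro!: derivative_eq_intros)
  have 2: "(tf has_derivative frechet_derivative tf (at (x + s *\<^sub>R axis i 1))) (at (x + s *\<^sub>R axis i 1))"
    using assms has_derivative_frechet smooth_differentiable test_fun_smooth by blast
  have "frechet_derivative tf (at (x + s *\<^sub>R axis i 1)) (h *\<^sub>R axis i 1) = h *\<^sub>R pd i tf (x + s *\<^sub>R axis i 1)" for h
    unfolding pd_def using has_derivative_linear[OF 2] linear_scale by blast
  then show ?thesis
    using has_derivative_compose[OF 1 2] by (simp add: has_vector_derivative_def)
qed

lemma line_quotient_limit:
  fixes f :: "'a::real_normed_vector \<Rightarrow> 'b::real_normed_vector"
  assumes "((\<lambda>s. f (x + s *\<^sub>R e)) has_vector_derivative d) (at (0::real))"
    and h: "h \<longlonglongrightarrow> 0" "\<And>n. h n \<noteq> 0"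
  shows "(\<lambda>n. (f (x + h n *\<^sub>R e) - f x) /\<^sub>R h n) \<longlonglongrightarrow> d"
proof -
  have "(\<lambda>s. norm (f (x + (0 + s) *\<^sub>R e) - f (x + 0 *\<^sub>R e) - s *\<^sub>R d) / norm s) \<midarrow>0\<rightarrow> 0"
    using assms(1) unfolding has_vector_derivative_def has_derivative_at by blast
  then have "(\<lambda>n. norm (f (x + h n *\<^sub>R e) - f x - h n *\<^sub>R d) / norm (h n)) \<longlonglongrightarrow> 0"
    using h by (auto simp: tendsto_at_iff_sequentially o_def)
  moreover have "norm (f (x + h n *\<^sub>R e) - f x - h n *\<^sub>R d) / norm (h n) = norm ((f (x + h n *\<^sub>R e) - f x) /\<^sub>R h n - d)" for n
  proof -
    have "(f (x + h n *\<^sub>R e) - f x) /\<^sub>R h n - d = (f (x + h n *\<^sub>R e) - f x - h n *\<^sub>R d) /\<^sub>R h n"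
      using h(2) by (simp add: scaleR_right_diff_distrib)
    then show ?thesis by (simp add: divide_inverse mult.commute)
  qed
  ultimately show ?thesis by (simp add: LIM_zero_iff tendsto_norm_zero_iff)
qed

lemma test_fun_difference_quotient:
  assumes u: "L2 u" and tf: "test_fun tf" and h: "h \<longlonglongrightarrow> 0" "\<And>n. h n \<noteq> 0"
  shows "(\<lambda>n. LINT x|lborel. u x * ((tf (x + h n *\<^sub>R axis i 1) - tf x) /\<^sub>R h n)) \<longlonglongrightarrow> (LINT x|lborel. u x * pd i tf x)"
proof -
  obtain r M where r: "r > 0" "\<And>x. r < norm x \<Longrightarrow> tf x = 0"
    using test_fun_support[OF tf] by metis
  obtain M where M: "M > 0" "\<And>x. cmod (pd i tf x) \<le> M"
    using test_fun_support[OF test_fun_pd[OF tf]] by metis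
  obtain B where B: "B > 0" "\<And>n. norm (h n) \<le> B"
    using h(1) convergent_def convergent_imp_Bseq BseqE by metis
  have um [measurable]: "u \<in> borel_measurable borel" using u L2_measurable by blast
  have tm [measurable]: "tf \<in> borel_measurable borel" using tf test_fun_L2 L2_measurable by blast
  have pm [measurable]: "pd i tf \<in> borel_measurable borel" using test_fun_pd[OF tf] test_fun_L2 L2_measurable by blast
  \<comment> \<open>As \<open>h\<close> is bounded by \<open>B\<close>, every difference quotient
    vanishes outside the ball of radius \<open>r + B\<close>, which supplies the dominating
    function.\<close>
  have iL: "L2 (indicator (cball 0 (r + B)))"
    by (rule L2_indicator) auto
  show ?thesis
  proof (rule integral_dominated_convergence[where w="\<lambda>x. M * cmod (u x * indicator (cball 0 (r + B)) x)"])
    show "integrable lborel (\<lambda>x. M * cmod (u x * indicator (cball 0 (r + B)) x))"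
      by (intro integrable_mult_right integrable_norm integrable_mult_L2 u iL)
    show "AE x in lborel. (\<lambda>n. u x * ((tf (x + h n *\<^sub>R axis i 1) - tf x) /\<^sub>R h n)) \<longlonglongrightarrow> u x * pd i tf x"
    proof (rule AE_I2)
      fix x
      show "(\<lambda>n. u x * ((tf (x + h n *\<^sub>R axis i 1) - tf x) /\<^sub>R h n)) \<longlonglongrightarrow> u x * pd i tf x"
        using line_quotient_limit[OF _ h, of tf x "axis i 1" "pd i tf x"] test_fun_line[OF tf, of x i 0]
        by (intro tendsto_mult tendsto_const) simp
    qed
    show "AE x in lborel. norm (u x * ((tf (x + h n *\<^sub>R axis i 1) - tf x) /\<^sub>R h n))
        \<le> M * cmod (u x * indicator (cball 0 (r + B)) x)" for n
    proof (rule AE_I2)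
      fix x
      show "norm (u x * ((tf (x + h n *\<^sub>R axis i 1) - tf x) /\<^sub>R h n)) \<le> M * cmod (u x * indicator (cball 0 (r + B)) x)"
      proof (cases "norm x \<le> r + B")
        case True
        have "cmod (tf (x + h n *\<^sub>R axis i 1) - tf (x + 0 *\<^sub>R axis i 1)) \<le> M * \<bar>h n - 0\<bar>"
          by (rule vector_derivative_bound[OF test_fun_line[OF tf] M(2)])
        then have "cmod ((tf (x + h n *\<^sub>R axis i 1) - tf x) /\<^sub>R h n) \<le> M"
          using h(2)[of n] by (intro norm_divideR_le) simp_all
        then have "cmod (u x) * cmod ((tf (x + h n *\<^sub>R axis i 1) - tf x) /\<^sub>R h n) \<le> cmod (u x) * M"
          by (rule mult_left_mono) simp
        then show ?thesis using True by (simp add: norm_mult mult_ac)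
      next
        case False
        have "norm (h n *\<^sub>R axis i (1::real)) \<le> B" using B(2)[of n] by (simp add: norm_axis_1)
        then have "r < norm (x + h n *\<^sub>R axis i 1)" using False norm_diff_ineq[of x "h n *\<^sub>R axis i 1"] by linarith
        then show ?thesis using False B r by simp
      qed
    qed
  qed measurable
qed

lemma weak_derivD:
  assumes "weak_deriv [i] u g" "test_fun tf"
  shows "(LINT x|lborel. u x * pd i tf x) = - (LINT x|lborel. g x * tf x)"
  using assms by (auto simp: weak_deriv_def)

lemma L2_shift: "L2 u \<Longrightarrow> L2 (\<lambda>x. u (x + t *\<^sub>R axis i 1) - u x)"
  by (intro L2_diff L2_translate)

lemma integral_shift_mult:
  assumes "L2 u" "L2 v"
  shows "(LINT x|lborel. (u (x + c) - u x) * v x) = (LINT x|lborel. u x * (v (x + (- c)) - v x))"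
proof -
  have [measurable]: "u \<in> borel_measurable borel" "v \<in> borel_measurable borel" using assms L2_measurable by auto
  have "(LINT x|lborel. u (x + c) * v x) = (LINT x|lborel. u x * v (x + (- c)))"
    using integral_translate[of "\<lambda>x. u (x + c) * v x" "- c"] by simp
  moreover have "(LINT x|lborel. (u (x + c) - u x) * v x) = (LINT x|lborel. u (x + c) * v x) - (LINT x|lborel. u x * v x)"
    unfolding left_diff_distrib by (intro Bochner_Integration.integral_diff integrable_mult_L2 L2_translate assms)
  moreover have "(LINT x|lborel. u x * (v (x + (- c)) - v x)) = (LINT x|lborel. u x * v (x + (- c))) - (LINT x|lborel. u x * v x)"
    unfolding right_diff_distrib by (intro Bochner_Integration.integral_diff integrable_mult_L2 L2_translate assms)
  ultimately show ?thesis by simp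
qed

context
  fixes u g :: fn3 and i :: 3
  assumes u: "L2 u" and g: "L2 g" and wd: "weak_deriv [i] u g"
begin

text \<open>The shift is moved onto the test function. As a function of the shift, the integral then
  has a derivative expressible by \<open>g\<close>; Cauchy-Schwarz bounds it, and the mean value
  estimate integrates the bound.\<close>

lemma weak_shift_bound:
  assumes tf: "test_fun tf"
  shows "cmod (LINT x|lborel. (u (x + t *\<^sub>R axis i 1) - u x) * tf x) \<le> \<bar>t\<bar> * norm_L2 g * norm_L2 tf"
proof -
  define ts where "ts s x = tf (x + s *\<^sub>R axis i 1)" for s x
  have ts: "test_fun (ts s)" for s unfolding ts_def by (rule test_fun_translate[OF tf])
  have pts: "pd i (ts s) = (\<lambda>x. pd i tf (x + s *\<^sub>R axis i 1))" for s
    unfolding ts_def using test_fun_translate(2)[OF tf, of "[i]"] by simp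
  define F where "F s = (LINT x|lborel. u x * ts s x)" for s
  have dF: "(F has_vector_derivative (LINT x|lborel. u x * pd i (ts s) x)) (at s)" for s
    unfolding has_vector_derivative_def has_derivative_at
  proof (intro conjI)
    show "bounded_linear (\<lambda>h. h *\<^sub>R (LINT x|lborel. u x * pd i (ts s) x))" by (rule bounded_linear_scaleR_left)
    show "(\<lambda>h. norm (F (s + h) - F s - h *\<^sub>R (LINT x|lborel. u x * pd i (ts s) x)) / norm h) \<midarrow>0\<rightarrow> 0"
      unfolding tendsto_at_iff_sequentially
    proof (intro allI impI)
      fix h :: "nat \<Rightarrow> real" assume h: "\<forall>n. h n \<in> UNIV - {0}" "h \<longlonglongrightarrow> 0"
      let ?D = "LINT x|lborel. u x * pd i (ts s) x"
      have q: "(LINT x|lborel. u x * ((ts s (x + h n *\<^sub>R axis i 1) - ts s x) /\<^sub>R h n)) = (F (s + h n) - F s) /\<^sub>R h n" for n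
      proof -
        have "ts s (x + h n *\<^sub>R axis i 1) = ts (s + h n) x" for x
          by (simp add: ts_def scaleR_left_distrib add_ac)
        then have "(LINT x|lborel. u x * ((ts s (x + h n *\<^sub>R axis i 1) - ts s x) /\<^sub>R h n))
            = (LINT x|lborel. (u x * ts (s + h n) x - u x * ts s x) /\<^sub>R h n)"
          by (simp add: right_diff_distrib scaleR_right_diff_distrib)
        also have "\<dots> = (F (s + h n) - F s) /\<^sub>R h n"
          unfolding F_def integral_scaleR_right
          by (subst Bochner_Integration.integral_diff) (auto intro!: integrable_mult_L2 u test_fun_L2 ts)
        finally show ?thesis .
      qed
      have "(\<lambda>n. (F (s + h n) - F s) /\<^sub>R h n) \<longlonglongrightarrow> ?D"
        using test_fun_difference_quotient[OF u ts[of s], of h i] h unfolding q by auto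
      then have "(\<lambda>n. norm ((F (s + h n) - F s) /\<^sub>R h n - ?D)) \<longlonglongrightarrow> 0"
        by (simp add: LIM_zero tendsto_norm_zero)
      moreover have "norm ((F (s + h n) - F s) /\<^sub>R h n - ?D) = norm (F (s + h n) - F s - h n *\<^sub>R ?D) / norm (h n)" for n
      proof -
        have "(F (s + h n) - F s) /\<^sub>R h n - ?D = (F (s + h n) - F s - h n *\<^sub>R ?D) /\<^sub>R h n"
          using h(1) by (simp add: scaleR_right_diff_distrib)
        then show ?thesis by (simp add: divide_inverse mult.commute)
      qed
      ultimately show "((\<lambda>h. norm (F (s + h) - F s - h *\<^sub>R ?D) / norm h) \<circ> h) \<longlonglongrightarrow> 0" by (simp add: o_def)
    qed
  qed
  have bF: "norm (LINT x|lborel. u x * pd i (ts s) x) \<le> norm_L2 g * norm_L2 tf" for s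
  proof -
    have "norm (LINT x|lborel. u x * pd i (ts s) x) = norm (LINT x|lborel. g x * ts s x)"
      using weak_derivD[OF wd ts] by simp
    also have "\<dots> \<le> norm_L2 g * norm_L2 (ts s)" by (intro integral_mult_le g test_fun_L2 ts)
    also have "norm_L2 (ts s) = norm_L2 tf" unfolding ts_def by (intro L2_translate test_fun_L2 tf)
    finally show ?thesis .
  qed
  have "norm (F (- t) - F 0) \<le> norm_L2 g * norm_L2 tf * \<bar>- t - 0\<bar>"
    by (rule vector_derivative_bound[OF dF bF])
  moreover have "(LINT x|lborel. (u (x + t *\<^sub>R axis i 1) - u x) * tf x) = F (- t) - F 0"
  proof -
    have "(LINT x|lborel. (u (x + t *\<^sub>R axis i 1) - u x) * tf x)
        = (LINT x|lborel. u x * tf (x + - (t *\<^sub>R axis i 1)) - u x * tf x)"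
      unfolding integral_shift_mult[OF u test_fun_L2[OF tf]] right_diff_distrib ..
    also have "\<dots> = (LINT x|lborel. u x * tf (x + - (t *\<^sub>R axis i 1))) - (LINT x|lborel. u x * tf x)"
      by (intro Bochner_Integration.integral_diff integrable_mult_L2 u L2_translate test_fun_L2 tf)
    finally show ?thesis by (simp add: F_def ts_def)
  qed
  ultimately show ?thesis by (simp add: mult_ac)
qed

text \<open>Duality: the bound against test functions extends by density to all vectors, in
  particular to the difference itself.\<close>

lemma norm_shift_le: "norm_L2 (\<lambda>x. u (x + t *\<^sub>R axis i 1) - u x) \<le> \<bar>t\<bar> * norm_L2 g"
proof -
  define d where "d x = u (x + t *\<^sub>R axis i 1) - u x" for x
  have d: "L2 d" unfolding d_def by (rule L2_shift[OF u])
  have "closure {cls tf |tf. test_fun tf} \<subseteq> {v. cls d \<bullet> v \<le> \<bar>t\<bar> * norm_L2 g * norm v}"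
  proof (rule closure_minimal)
    show "closed {v. cls d \<bullet> v \<le> \<bar>t\<bar> * norm_L2 g * norm v}"
      by (intro closed_Collect_le continuous_intros)
    show "{cls tf |tf. test_fun tf} \<subseteq> {v. cls d \<bullet> v \<le> \<bar>t\<bar> * norm_L2 g * norm v}"
    proof clarify
      fix tf assume tf: "test_fun tf"
      have "cls d \<bullet> cls tf = Re (inner_L2 tf d)"
        using cls_inner[OF test_fun_L2[OF tf] d] by (simp add: inner_commute)
      also have "\<dots> \<le> cmod (LINT x|lborel. d x * cnj (tf x))"
        unfolding inner_L2_def by (subst mult.commute) (rule complex_Re_le_cmod)
      also have "\<dots> \<le> \<bar>t\<bar> * norm_L2 g * norm_L2 (\<lambda>x. cnj (tf x))"
        unfolding d_def by (rule weak_shift_bound[OF test_fun_cnj(1)[OF tf]])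
      also have "norm_L2 (\<lambda>x. cnj (tf x)) = norm (cls tf)"
        by (simp add: cls_norm[OF test_fun_L2[OF tf]]) (simp add: norm_L2_def)
      finally show "cls d \<bullet> cls tf \<le> \<bar>t\<bar> * norm_L2 g * norm (cls tf)" .
    qed
  qed
  then have "cls d \<bullet> cls d \<le> \<bar>t\<bar> * norm_L2 g * norm (cls d)"
    unfolding test_funs_dense by auto
  then have "norm (cls d) * norm (cls d) \<le> (\<bar>t\<bar> * norm_L2 g) * norm (cls d)"
    by (simp add: dot_square_norm power2_eq_square)
  then have "norm (cls d) \<le> \<bar>t\<bar> * norm_L2 g"
  proof (cases "norm (cls d) = 0")
    case False
    then have "norm (cls d) > 0" by simp
    then show ?thesis using mult_right_le_imp_le[OF \<open>norm (cls d) * norm (cls d) \<le> _\<close>] by blast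
  qed simp
  then show ?thesis unfolding cls_norm[OF d] by (simp add: d_def[abs_def])
qed

text \<open>For test functions the limit comes from the definition of the weak derivative. By
  \<open>norm_shift_le\<close> the functionals are bounded uniformly in \<open>n\<close>, so
  convergence extends from a dense set to every \<open>v\<close>.\<close>

lemma weak_difference_quotient:
  assumes v: "L2 v" and h: "h \<longlonglongrightarrow> 0" "\<And>n. h n \<noteq> 0"
  shows "(\<lambda>n. (LINT x|lborel. (u (x + h n *\<^sub>R axis i 1) - u x) * v x) /\<^sub>R h n) \<longlonglongrightarrow> (LINT x|lborel. g x * v x)"
proof -
  define L where "L n v = (LINT x|lborel. (u (x + h n *\<^sub>R axis i 1) - u x) * v x) /\<^sub>R h n" for n v
  have Lt: "(\<lambda>n. L n tf) \<longlonglongrightarrow> (LINT x|lborel. g x * tf x)" if tf: "test_fun tf" for tf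
  proof -
    have "(\<lambda>n. LINT x|lborel. u x * ((tf (x + (- h n) *\<^sub>R axis i 1) - tf x) /\<^sub>R (- h n))) \<longlonglongrightarrow> (LINT x|lborel. u x * pd i tf x)"
      by (rule test_fun_difference_quotient[OF u tf]) (use tendsto_minus[OF h(1)] h(2) in auto)
    moreover have "(LINT x|lborel. u x * ((tf (x + (- h n) *\<^sub>R axis i 1) - tf x) /\<^sub>R (- h n))) = - L n tf" for n
    proof -
      have "(LINT x|lborel. u x * ((tf (x + (- h n) *\<^sub>R axis i 1) - tf x) /\<^sub>R (- h n)))
          = (LINT x|lborel. (u x * (tf (x + (- h n) *\<^sub>R axis i 1) - tf x)) /\<^sub>R (- h n))" by simp
      also have "\<dots> = (LINT x|lborel. u x * (tf (x + (- h n) *\<^sub>R axis i 1) - tf x)) /\<^sub>R (- h n)"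
        by (rule integral_scaleR_right)
      finally show ?thesis unfolding L_def integral_shift_mult[OF u test_fun_L2[OF tf]] by simp
    qed
    ultimately have "(\<lambda>n. - L n tf) \<longlonglongrightarrow> - (LINT x|lborel. g x * tf x)"
      using weak_derivD[OF wd tf] by simp
    then show ?thesis by (rule tendsto_minus_cancel)
  qed
  have Lb: "cmod (L n w) \<le> norm_L2 g * norm_L2 w" if "L2 w" for n w
  proof -
    have "cmod (LINT x|lborel. (u (x + h n *\<^sub>R axis i 1) - u x) * w x) \<le> \<bar>h n\<bar> * norm_L2 g * norm_L2 w"
      by (rule order_trans[OF integral_mult_le[OF L2_shift[OF u] that]
          mult_right_mono[OF norm_shift_le norm_L2_nonneg]])
    then show ?thesis unfolding L_def using h(2)[of n] by (intro norm_divideR_le) (simp_all add: mult_ac)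
  qed
  have Ldiff: "L n (\<lambda>x. v x - w x) = L n v - L n w" if "L2 w" for n w
    unfolding L_def right_diff_distrib scaleR_right_diff_distrib[symmetric]
    by (subst Bochner_Integration.integral_diff) (auto intro!: integrable_mult_L2 L2_shift u v that)
  have "(\<lambda>n. L n v) \<longlonglongrightarrow> (LINT x|lborel. g x * v x)"
  proof (rule metric_LIMSEQ_I)
    fix e :: real assume e: "e > 0"
    \<comment> \<open>The added 1 avoids a division by zero when the norm of \<open>g\<close>
      vanishes.\<close>
    define \<delta> where "\<delta> = e / (3 * (norm_L2 g + 1))"
    have g1: "norm_L2 g + 1 > 0" using norm_L2_nonneg[of g] by linarith
    have del: "\<delta> > 0" using e g1 by (simp add: \<delta>_def)
    have "cls v \<in> closure {cls tf |tf. test_fun tf}" by (simp add: test_funs_dense)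
    then obtain tf where tf: "test_fun tf" "dist (cls tf) (cls v) < \<delta>"
      unfolding closure_approachable using del by blast
    have tL: "L2 tf" using tf test_fun_L2 by blast
    have dv: "norm_L2 (\<lambda>x. v x - tf x) < \<delta>"
    proof -
      have "norm (cls v - cls tf) < \<delta>" using tf(2) by (simp add: dist_norm norm_minus_commute)
      then show ?thesis unfolding cls_diff[OF v tL] cls_norm[OF L2_diff[OF v tL]] .
    qed
    have small: "norm_L2 g * norm_L2 (\<lambda>x. v x - tf x) \<le> e / 3"
    proof -
      have "norm_L2 g * norm_L2 (\<lambda>x. v x - tf x) \<le> (norm_L2 g + 1) * \<delta>"
        using dv g1 by (intro mult_mono) auto
      moreover have "(norm_L2 g + 1) * \<delta> = e / 3" using g1 unfolding \<delta>_def by (simp add: divide_simps)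
      ultimately show ?thesis by simp
    qed
    obtain n0 where n0: "\<And>n. n \<ge> n0 \<Longrightarrow> dist (L n tf) (LINT x|lborel. g x * tf x) < e / 3"
      using metric_LIMSEQ_D[OF Lt[OF tf(1)], of "e / 3"] e by auto
    have "dist (L n v) (LINT x|lborel. g x * v x) < e" if n: "n \<ge> n0" for n
    proof -
      have 1: "cmod (L n v - L n tf) \<le> e / 3"
        using Lb[OF L2_diff[OF v tL]] small unfolding Ldiff[OF tL] by (meson order_trans)
      have eqd: "(LINT x|lborel. g x * (v x - tf x)) = (LINT x|lborel. g x * v x) - (LINT x|lborel. g x * tf x)"
        unfolding right_diff_distrib by (intro Bochner_Integration.integral_diff integrable_mult_L2 g v tL)
      have 2: "cmod ((LINT x|lborel. g x * v x) - (LINT x|lborel. g x * tf x)) \<le> e / 3"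
        using order_trans[OF integral_mult_le[OF g L2_diff[OF v tL]] small] unfolding eqd .
      let ?a = "L n v - L n tf" and ?b = "L n tf - (LINT x|lborel. g x * tf x)"
        and ?c = "(LINT x|lborel. g x * v x) - (LINT x|lborel. g x * tf x)"
      have "cmod (?a + ?b - ?c) \<le> cmod ?a + cmod ?b + cmod ?c"
        by (rule order_trans[OF norm_triangle_ineq4 add_right_mono[OF norm_triangle_ineq]])
      also have "\<dots> < e" using 1 2 n0[OF n] by (simp add: dist_norm)
      finally have "cmod (?a + ?b - ?c) < e" .
      moreover have "?a + ?b - ?c = L n v - (LINT x|lborel. g x * v x)" by simp
      ultimately show ?thesis unfolding dist_norm by (simp only:)
    qed
    then show "\<exists>no. \<forall>n\<ge>no. dist (L n v) (LINT x|lborel. g x * v x) < e" by blast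
  qed
  then show ?thesis by (simp add: L_def)
qed

end

text \<open>The definition of a weak derivative admits only test functions as partners. Difference
  quotients satisfy the identity exactly, with step \<open>- h\<close> on the other factor, and both
  sides converge.\<close>

lemma integral_by_parts:
  assumes "L2 u" "L2 g" "weak_deriv [i] u g" "L2 v" "L2 k" "weak_deriv [i] v k"
  shows "(LINT x|lborel. g x * v x) = - (LINT x|lborel. u x * k x)"
proof -
  define h where "h n = inverse (real (Suc n))" for n
  have h: "h \<longlonglongrightarrow> 0" "\<And>n. h n \<noteq> 0" unfolding h_def by (rule LIMSEQ_inverse_real_of_nat) simp
  have h': "(\<lambda>n. - h n) \<longlonglongrightarrow> 0" using tendsto_minus[OF h(1)] by simp
  have 1: "(\<lambda>n. (LINT x|lborel. (u (x + h n *\<^sub>R axis i 1) - u x) * v x) /\<^sub>R h n) \<longlonglongrightarrow> (LINT x|lborel. g x * v x)"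
    by (rule weak_difference_quotient[OF assms(1-4) h])
  have 2: "(\<lambda>n. (LINT x|lborel. (v (x + (- h n) *\<^sub>R axis i 1) - v x) * u x) /\<^sub>R (- h n)) \<longlonglongrightarrow> (LINT x|lborel. k x * u x)"
    by (rule weak_difference_quotient[OF assms(4-6,1) h']) (use h in simp)
  have eq: "(LINT x|lborel. (v (x + (- h n) *\<^sub>R axis i 1) - v x) * u x) /\<^sub>R (- h n)
      = - ((LINT x|lborel. (u (x + h n *\<^sub>R axis i 1) - u x) * v x) /\<^sub>R h n)" for n
    unfolding integral_shift_mult[OF assms(1,4)] by (simp add: mult.commute)
  have "(\<lambda>n. - ((LINT x|lborel. (u (x + h n *\<^sub>R axis i 1) - u x) * v x) /\<^sub>R h n)) \<longlonglongrightarrow> (LINT x|lborel. k x * u x)"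
    using 2 unfolding eq .
  then have "- (LINT x|lborel. g x * v x) = (LINT x|lborel. k x * u x)"
    using tendsto_minus[OF 1] LIMSEQ_unique by blast
  then have "(LINT x|lborel. g x * v x) = - (LINT x|lborel. k x * u x)" by (metis minus_minus)
  then show ?thesis by (simp only: mult.commute)
qed

lemma L2_mult_bounded:
  assumes u: "L2 u" and F: "F \<in> borel_measurable borel" "\<And>x. cmod (F x) \<le> K"
  shows "L2 (\<lambda>x. F x * u x)" "norm_L2 (\<lambda>x. F x * u x) \<le> K * norm_L2 u"
proof -
  have K: "K \<ge> 0" using F(2)[of 0] norm_ge_zero[of "F 0"] by linarith
  have [measurable]: "u \<in> borel_measurable borel" "F \<in> borel_measurable borel" using u F L2_measurable by auto
  have le: "(cmod (F x * u x))\<^sup>2 \<le> K\<^sup>2 * (cmod (u x))\<^sup>2" for x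
    unfolding norm_mult power_mult_distrib using F(2)[of x]
    by (intro mult_right_mono power_mono) auto
  show L: "L2 (\<lambda>x. F x * u x)"
    by (rule L2_bound[where g="\<lambda>x. K\<^sup>2 * (cmod (u x))\<^sup>2"]) (use le L2_integrable[OF u] in auto)
  have "(LINT x|lborel. (cmod (F x * u x))\<^sup>2) \<le> (LINT x|lborel. K\<^sup>2 * (cmod (u x))\<^sup>2)"
    by (intro integral_mono L2_integrable[OF L] le integrable_mult_right L2_integrable[OF u])
  also have "\<dots> = K\<^sup>2 * (LINT x|lborel. (cmod (u x))\<^sup>2)" by simp
  finally have "sqrt (LINT x|lborel. (cmod (F x * u x))\<^sup>2) \<le> sqrt (K\<^sup>2 * (LINT x|lborel. (cmod (u x))\<^sup>2))"
    by (rule real_sqrt_le_mono)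
  then show "norm_L2 (\<lambda>x. F x * u x) \<le> K * norm_L2 u"
    using K by (simp add: norm_L2_def real_sqrt_mult)
qed

lemma L2_mult_bounded_real:
  fixes F :: "real^3 \<Rightarrow> real"
  assumes "L2 u" "F \<in> borel_measurable borel" "\<And>x. \<bar>F x\<bar> \<le> K"
  shows "L2 (\<lambda>x. complex_of_real (F x) * u x)"
  by (rule L2_mult_bounded[where K=K]) (use assms in auto)

text \<open>Both sides are the limit of \<open>\<integral> (|u(x + h e\<^sub>i)|\<^sup>2 - |u(x)|\<^sup>2) F(x) dx / h\<close>.\<close>

lemma weak_square_by_parts:
  fixes F F' :: "real^3 \<Rightarrow> real"
  assumes u: "L2 u" "L2 g" "weak_deriv [i] u g"
    and F: "F \<in> borel_measurable borel" "\<And>x. \<bar>F x\<bar> \<le> K"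
    and F': "F' \<in> borel_measurable borel" "\<And>x. \<bar>F' x\<bar> \<le> L"
    and der: "\<And>x s. ((\<lambda>s. F (x + s *\<^sub>R axis i 1)) has_vector_derivative F' (x + s *\<^sub>R axis i 1)) (at s)"
  shows "2 * Re (LINT x|lborel. g x * (complex_of_real (F x) * cnj (u x))) = - (LINT x|lborel. (cmod (u x))\<^sup>2 * F' x)"
proof -
  define h where "h n = inverse (real (Suc n))" for n
  have h: "h \<longlonglongrightarrow> 0" "\<And>n. h n > 0" unfolding h_def by (rule LIMSEQ_inverse_real_of_nat) simp
  then have h0: "\<And>n. h n \<noteq> 0" by (metis less_irrefl)
  have K: "K \<ge> 0" using F(2)[of 0] by linarith
  have [measurable]: "u \<in> borel_measurable borel" "F \<in> borel_measurable borel" "F' \<in> borel_measurable borel"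
    using u F F' L2_measurable by auto
  have bint: "integrable lborel (\<lambda>x. (cmod (w x))\<^sup>2 * G x)"
    if w: "L2 w" and G: "G \<in> borel_measurable borel" "\<And>x. \<bar>G x\<bar> \<le> C" for w :: fn3 and G C
  proof (rule Bochner_Integration.integrable_bound[OF integrable_mult_right[OF L2_integrable[OF w], of C]])
    have [measurable]: "w \<in> borel_measurable borel" using w L2_measurable by auto
    show "(\<lambda>x. (cmod (w x))\<^sup>2 * G x) \<in> borel_measurable lborel" using G by measurable
    have "norm ((cmod (w x))\<^sup>2 * G x) \<le> norm (C * (cmod (w x))\<^sup>2)" for x
      using G(2)[of x] by (simp add: abs_mult mult.commute[of C] mult_left_mono)
    then show "AE x in lborel. norm ((cmod (w x))\<^sup>2 * G x) \<le> norm (C * (cmod (w x))\<^sup>2)" by simp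
  qed
  define e :: "real^3" where "e = axis i 1"
  define uh where "uh n x = u (x + h n *\<^sub>R e)" for n x
  have uh: "L2 (uh n)" for n unfolding uh_def by (rule L2_translate[OF u(1)])
  have duh: "L2 (\<lambda>x. uh n x - u x)" for n by (intro L2_diff uh u)
  define S where "S n = (LINT x|lborel. (cmod (uh n x))\<^sup>2 * F x - (cmod (u x))\<^sup>2 * F x) / h n" for n
  have eqS: "S n = (LINT x|lborel. (cmod (u x))\<^sup>2 * ((F (x + (- h n) *\<^sub>R e) - F x) / h n))" for n
  proof -
    have "(LINT x|lborel. (cmod (uh n x))\<^sup>2 * F x) = (LINT x|lborel. (cmod (u x))\<^sup>2 * F (x + (- h n) *\<^sub>R e))"
      using integral_translate[of "\<lambda>x. (cmod (uh n x))\<^sup>2 * F x" "(- h n) *\<^sub>R e"] L2_measurable[OF uh]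
      by (simp add: uh_def)
    moreover have "integrable lborel (\<lambda>x. (cmod (u x))\<^sup>2 * F (x + (- h n) *\<^sub>R e))"
      by (rule bint[OF u(1)]) (use F(2) in auto)
    ultimately have "(LINT x|lborel. (cmod (uh n x))\<^sup>2 * F x - (cmod (u x))\<^sup>2 * F x)
       = (LINT x|lborel. (cmod (u x))\<^sup>2 * F (x + (- h n) *\<^sub>R e) - (cmod (u x))\<^sup>2 * F x)"
      using bint[OF uh F] bint[OF u(1) F] by (simp only: Bochner_Integration.integral_diff)
    then show ?thesis unfolding S_def
      by (simp add: right_diff_distrib[symmetric] flip: integral_divide_zero)
  qed
  have limS: "(\<lambda>n. LINT x|lborel. (cmod (u x))\<^sup>2 * ((F (x + (- h n) *\<^sub>R e) - F x) / h n)) \<longlonglongrightarrow> (LINT x|lborel. (cmod (u x))\<^sup>2 * (- F' x))"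
  proof (rule integral_dominated_convergence[where w="\<lambda>x. L * (cmod (u x))\<^sup>2"])
    show "integrable lborel (\<lambda>x. L * (cmod (u x))\<^sup>2)" by (intro integrable_mult_right L2_integrable u)
    show "AE x in lborel. (\<lambda>n. (cmod (u x))\<^sup>2 * ((F (x + (- h n) *\<^sub>R e) - F x) / h n)) \<longlonglongrightarrow> (cmod (u x))\<^sup>2 * (- F' x)"
    proof (rule AE_I2)
      fix x
      have "(\<lambda>n. (F (x + (- h n) *\<^sub>R e) - F x) /\<^sub>R (- h n)) \<longlonglongrightarrow> F' x"
        by (rule line_quotient_limit) (use der[of x 0] tendsto_minus[OF h(1)] h0 in \<open>auto simp: e_def\<close>)
      then have "(\<lambda>n. - ((F (x + (- h n) *\<^sub>R e) - F x) /\<^sub>R (- h n))) \<longlonglongrightarrow> - F' x" by (rule tendsto_minus)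
      moreover have "- ((F (x + (- h n) *\<^sub>R e) - F x) /\<^sub>R (- h n)) = (F (x + (- h n) *\<^sub>R e) - F x) / h n" for n
        by (simp add: divide_inverse mult.commute)
      ultimately have "(\<lambda>n. (F (x + (- h n) *\<^sub>R e) - F x) / h n) \<longlonglongrightarrow> - F' x" by (simp only:)
      then show "(\<lambda>n. (cmod (u x))\<^sup>2 * ((F (x + (- h n) *\<^sub>R e) - F x) / h n)) \<longlonglongrightarrow> (cmod (u x))\<^sup>2 * (- F' x)"
        by (rule tendsto_mult_left)
    qed
    show "AE x in lborel. norm ((cmod (u x))\<^sup>2 * ((F (x + (- h n) *\<^sub>R e) - F x) / h n)) \<le> L * (cmod (u x))\<^sup>2" for n
    proof (rule AE_I2)
      fix x
      have "norm (F (x + (- h n) *\<^sub>R axis i 1) - F (x + 0 *\<^sub>R axis i 1)) \<le> L * \<bar>- h n - 0\<bar>"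
        by (rule vector_derivative_bound[OF der]) (use F'(2) in auto)
      then have "\<bar>F (x + (- h n) *\<^sub>R e) - F x\<bar> \<le> L * h n" using h(2)[of n] by (simp add: e_def)
      then have "\<bar>(F (x + (- h n) *\<^sub>R e) - F x) / h n\<bar> \<le> L" using h(2)[of n] by (simp add: abs_divide pos_divide_le_eq)
      then have "(cmod (u x))\<^sup>2 * \<bar>(F (x + (- h n) *\<^sub>R e) - F x) / h n\<bar> \<le> (cmod (u x))\<^sup>2 * L"
        by (rule mult_left_mono) simp
      then show "norm ((cmod (u x))\<^sup>2 * ((F (x + (- h n) *\<^sub>R e) - F x) / h n)) \<le> L * (cmod (u x))\<^sup>2"
        unfolding real_norm_def abs_mult by (simp only: abs_of_nonneg zero_le_power2 mult.commute)
    qed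
  qed measurable
  have "S = (\<lambda>n. LINT x|lborel. (cmod (u x))\<^sup>2 * ((F (x + (- h n) *\<^sub>R e) - F x) / h n))"
    using eqS by (rule ext)
  then have "S \<longlonglongrightarrow> (LINT x|lborel. (cmod (u x))\<^sup>2 * (- F' x))" using limS by (simp only:)
  then have lim1: "S \<longlonglongrightarrow> - (LINT x|lborel. (cmod (u x))\<^sup>2 * F' x)" by simp
  define v where "v x = complex_of_real (F x) * cnj (u x)" for x
  have v: "L2 v" unfolding v_def by (rule L2_mult_bounded_real[OF L2_cnj[OF u(1)] F])
  \<comment> \<open>The quadratic remainder in the difference of squares;
    \<open>norm_shift_le\<close> makes it of order \<open>h n\<close>.\<close>
  define Q where "Q n = (LINT x|lborel. (cmod (uh n x - u x))\<^sup>2 * F x) / h n" for n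
  have Seq: "S n = 2 * Re ((LINT x|lborel. (uh n x - u x) * v x) /\<^sub>R h n) + Q n" for n
  proof -
    have pt: "(cmod (uh n x))\<^sup>2 * F x - (cmod (u x))\<^sup>2 * F x = 2 * Re ((uh n x - u x) * v x) + (cmod (uh n x - u x))\<^sup>2 * F x" for x
      unfolding cmod_power2 v_def by (simp add: algebra_simps power2_eq_square)
    have i1: "integrable lborel (\<lambda>x. (uh n x - u x) * v x)" by (intro integrable_mult_L2 duh v)
    have "(LINT x|lborel. (cmod (uh n x))\<^sup>2 * F x - (cmod (u x))\<^sup>2 * F x)
        = 2 * Re (LINT x|lborel. (uh n x - u x) * v x) + (LINT x|lborel. (cmod (uh n x - u x))\<^sup>2 * F x)"
      unfolding pt
      by (subst Bochner_Integration.integral_add[OF integrable_mult_right[OF integrable_Re[OF i1]] bint[OF duh F]])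
        (simp only: integral_mult_right_zero integral_Re[OF i1])
    then show ?thesis using h0[of n] by (simp add: S_def Q_def divide_inverse algebra_simps)
  qed
  have "(\<lambda>n. (LINT x|lborel. (uh n x - u x) * v x) /\<^sub>R h n) \<longlonglongrightarrow> (LINT x|lborel. g x * v x)"
    unfolding uh_def e_def by (rule weak_difference_quotient[OF u v h(1) h0])
  then have "(\<lambda>n. 2 * Re ((LINT x|lborel. (uh n x - u x) * v x) /\<^sub>R h n)) \<longlonglongrightarrow> 2 * Re (LINT x|lborel. g x * v x)"
    by (intro tendsto_mult tendsto_const tendsto_Re)
  moreover have "Q \<longlonglongrightarrow> 0"
  proof (rule Lim_null_comparison)
    show "\<forall>\<^sub>F n in sequentially. norm (Q n) \<le> K * (norm_L2 g)\<^sup>2 * h n"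
    proof (intro always_eventually allI)
      fix n
      have "norm (LINT x|lborel. (cmod (uh n x - u x))\<^sup>2 * F x) \<le> (LINT x|lborel. K * (cmod (uh n x - u x))\<^sup>2)"
      proof (rule order_trans[OF integral_norm_bound integral_mono])
        show "integrable lborel (\<lambda>x. norm ((cmod (uh n x - u x))\<^sup>2 * F x))"
          by (intro integrable_norm bint[OF duh F])
        show "integrable lborel (\<lambda>x. K * (cmod (uh n x - u x))\<^sup>2)"
          by (intro integrable_mult_right L2_integrable duh)
        show "norm ((cmod (uh n x - u x))\<^sup>2 * F x) \<le> K * (cmod (uh n x - u x))\<^sup>2" for x
          using F(2)[of x] by (simp add: abs_mult mult.commute[of K] mult_left_mono)
      qed
      also have "\<dots> = K * (norm_L2 (\<lambda>x. uh n x - u x))\<^sup>2" by (simp add: norm_L2_def)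
      also have "\<dots> \<le> K * (\<bar>h n\<bar> * norm_L2 g)\<^sup>2"
        unfolding uh_def e_def by (intro mult_left_mono power_mono norm_shift_le[OF u] K) auto
      finally have "norm (LINT x|lborel. (cmod (uh n x - u x))\<^sup>2 * F x) \<le> K * (norm_L2 g)\<^sup>2 * h n * h n"
        by (simp add: power_mult_distrib power2_eq_square mult_ac)
      then show "norm (Q n) \<le> K * (norm_L2 g)\<^sup>2 * h n"
        unfolding Q_def using h(2)[of n] by (simp add: pos_divide_le_eq)
    qed
    show "(\<lambda>n. K * (norm_L2 g)\<^sup>2 * h n) \<longlonglongrightarrow> 0" using tendsto_mult_right_zero[OF h(1)] by simp
  qed
  ultimately have "S \<longlonglongrightarrow> 2 * Re (LINT x|lborel. g x * v x) + 0"
    unfolding Seq by (rule tendsto_add)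
  then show ?thesis using lim1 LIMSEQ_unique by (simp add: v_def) blast
qed

text \<open>The square of \<open>g i + F i / 2 * u\<close> has nonnegative integral, and
  \<open>weak_square_by_parts\<close> evaluates its cross term. The field \<open>F\<close> is half
  the gradient of the logarithm of \<open>q\<close>; \<open>\<epsilon>\<close> keeps it and its
  derivatives bounded. The factor 1/2 maximizes \<open>c - c\<^sup>2\<close>, whose value 1/4 gives
  the constant 4.\<close>

lemma Hardy_regularized:
  fixes a :: "real^3"
  assumes u: "L2 u" and g: "\<And>i. L2 (g i)" "\<And>i. weak_deriv [i] u (g i)" and eps: "\<epsilon> > 0"
  shows "integrable lborel (\<lambda>x. (cmod (u x))\<^sup>2 * (1 / ((norm (x - a))\<^sup>2 + \<epsilon>)))"
    and "(LINT x|lborel. (cmod (u x))\<^sup>2 * (1 / ((norm (x - a))\<^sup>2 + \<epsilon>))) \<le> 4 * (\<Sum>i\<in>UNIV. (norm_L2 (g i))\<^sup>2)"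
proof -
  define q where "q x = (norm (x - a))\<^sup>2 + \<epsilon>" for x
  define F where "F i x = (x - a) $ i / q x" for i x
  define F' where "F' i x = 1 / q x - 2 * ((x - a) $ i)\<^sup>2 / (q x)\<^sup>2" for i x
  have q: "q x > 0" "q x \<ge> \<epsilon>" for x using eps by (auto simp: q_def add_nonneg_pos)
  have comp: "((x - a) $ i)\<^sup>2 \<le> (norm (x - a))\<^sup>2" for x i
    using component_le_norm_cart[of "x - a" i] by (metis abs_le_square_iff abs_norm_cancel)
  have qm [measurable]: "q \<in> borel_measurable borel" unfolding q_def[abs_def] by measurable
  have nth [measurable]: "(\<lambda>x. (x - a) $ i) \<in> borel_measurable borel" for i
    by (intro borel_measurable_continuous_onI continuous_intros)
  have Fm [measurable]: "F i \<in> borel_measurable borel" "F' i \<in> borel_measurable borel" for i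
    unfolding F_def[abs_def] F'_def[abs_def]
    by (intro borel_measurable_divide borel_measurable_diff borel_measurable_times borel_measurable_power
        borel_measurable_const nth qm)+
  have Fb: "\<bar>F i x\<bar> \<le> 1 + 1 / \<epsilon>" for i x
  proof -
    have "\<bar>t\<bar> \<le> 1 + t\<^sup>2" for t :: real
    proof -
      have "2 * \<bar>t\<bar> \<le> t\<^sup>2 + 1" using zero_le_power2[of "\<bar>t\<bar> - 1"] by (simp add: power2_diff)
      then show ?thesis using abs_ge_zero[of t] by linarith
    qed
    then have "\<bar>(x - a) $ i\<bar> \<le> 1 + ((x - a) $ i)\<^sup>2" .
    also have "\<dots> \<le> 1 + q x" using comp[of x i] eps by (simp add: q_def)
    finally have "\<bar>F i x\<bar> \<le> (1 + q x) / q x"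
      unfolding F_def abs_divide using q(1)[of x] by (simp add: divide_right_mono)
    also have "\<dots> = 1 / q x + 1" using q(1)[of x] by (simp add: field_simps)
    also have "1 / q x \<le> 1 / \<epsilon>" using q(2)[of x] eps by (simp add: frac_le)
    finally show ?thesis by simp
  qed
  have F'b: "\<bar>F' i x\<bar> \<le> 3 / \<epsilon>" for i x
  proof -
    have "((x - a) $ i)\<^sup>2 / (q x)\<^sup>2 \<le> q x / (q x)\<^sup>2"
      using comp[of x i] eps by (intro divide_right_mono) (auto simp: q_def)
    also have "\<dots> = 1 / q x" using q(1)[of x] by (simp add: power2_eq_square)
    finally have "((x - a) $ i)\<^sup>2 / (q x)\<^sup>2 \<le> 1 / q x" .
    moreover have "0 \<le> ((x - a) $ i)\<^sup>2 / (q x)\<^sup>2" by simp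
    moreover have "1 / q x \<le> 1 / \<epsilon>" "0 \<le> 1 / q x" using q(1,2)[of x] eps by (simp_all add: frac_le)
    ultimately have "\<bar>1 / q x - 2 * (((x - a) $ i)\<^sup>2 / (q x)\<^sup>2)\<bar> \<le> 3 * (1 / \<epsilon>)" unfolding abs_le_iff by linarith
    then show ?thesis by (simp add: F'_def)
  qed
  have der: "((\<lambda>s. F i (x + s *\<^sub>R axis i 1)) has_vector_derivative F' i (x + s *\<^sub>R axis i 1)) (at s)" for i x s
  proof -
    have qs: "q (x + s *\<^sub>R axis i 1) = (norm (x - a))\<^sup>2 + 2 * s * (x - a) $ i + s\<^sup>2 + \<epsilon>" for s
    proof -
      have "(norm (x + s *\<^sub>R axis i 1 - a))\<^sup>2 = (norm ((x - a) + s *\<^sub>R axis i 1))\<^sup>2" by (simp add: algebra_simps)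
      also have "\<dots> = (norm (x - a))\<^sup>2 + 2 * s * (x - a) $ i + s\<^sup>2"
        unfolding power2_norm_eq_inner
        by (simp add: inner_add_left inner_add_right inner_axis inner_axis' inner_axis_axis power2_eq_square algebra_simps)
      finally show ?thesis by (simp add: q_def)
    qed
    have cs: "(x + s *\<^sub>R axis i 1 - a) $ i = (x - a) $ i + s" for s by simp
    have qp: "(norm (x - a))\<^sup>2 + 2 * s * (x - a) $ i + s\<^sup>2 + \<epsilon> > 0" using q(1)[of "x + s *\<^sub>R axis i 1"] unfolding qs .
    have d1: "((\<lambda>s. ((x - a) $ i + s) / ((norm (x - a))\<^sup>2 + 2 * s * (x - a) $ i + s\<^sup>2 + \<epsilon>)) has_real_derivative
       (1 * ((norm (x - a))\<^sup>2 + 2 * s * (x - a) $ i + s\<^sup>2 + \<epsilon>) - ((x - a) $ i + s) * (2 * (x - a) $ i + 2 * s))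
        / ((norm (x - a))\<^sup>2 + 2 * s * (x - a) $ i + s\<^sup>2 + \<epsilon>)\<^sup>2) (at s)"
      using qp by (auto intro!: derivative_eq_intros simp: power2_eq_square)
    have alg: "(1 * Q - y * (2 * z + 2 * s)) / Q\<^sup>2 = 1 / Q - 2 * y\<^sup>2 / Q\<^sup>2" if "Q > 0" "y = z + s" for Q y z s :: real
      using that by (simp add: field_simps power2_eq_square)
    have "((\<lambda>s. ((x - a) $ i + s) / ((norm (x - a))\<^sup>2 + 2 * s * (x - a) $ i + s\<^sup>2 + \<epsilon>)) has_real_derivative
       F' i (x + s *\<^sub>R axis i 1)) (at s)"
      using d1 unfolding F'_def qs cs alg[OF qp refl] .
    then show ?thesis unfolding F_def qs cs has_real_derivative_iff_has_vector_derivative .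
  qed
  have [measurable]: "u \<in> borel_measurable borel" using u L2_measurable by blast
  have bint: "integrable lborel (\<lambda>x. (cmod (u x))\<^sup>2 * G x)"
    if G: "G \<in> borel_measurable borel" "\<And>x. \<bar>G x\<bar> \<le> C" for G C
  proof (rule Bochner_Integration.integrable_bound[OF integrable_mult_right[OF L2_integrable[OF u], of C]])
    show "(\<lambda>x. (cmod (u x))\<^sup>2 * G x) \<in> borel_measurable lborel" using G by measurable
    have "norm ((cmod (u x))\<^sup>2 * G x) \<le> norm (C * (cmod (u x))\<^sup>2)" for x
      using G(2)[of x] by (simp add: abs_mult mult.commute[of C] mult_left_mono)
    then show "AE x in lborel. norm ((cmod (u x))\<^sup>2 * G x) \<le> norm (C * (cmod (u x))\<^sup>2)" by simp
  qed
  have i0: "integrable lborel (\<lambda>x. (cmod (u x))\<^sup>2 * (1 / q x))"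
    by (rule bint[where C="1 / \<epsilon>"]) (use q eps in \<open>auto simp: abs_of_pos[OF q(1)] frac_le\<close>)
  then show "integrable lborel (\<lambda>x. (cmod (u x))\<^sup>2 * (1 / ((norm (x - a))\<^sup>2 + \<epsilon>)))" by (simp add: q_def)
  have i1: "integrable lborel (\<lambda>x. (cmod (u x))\<^sup>2 * F' i x)" for i by (rule bint[OF Fm(2) F'b])
  have i2: "integrable lborel (\<lambda>x. (cmod (u x))\<^sup>2 * (F i x)\<^sup>2)" for i
    by (rule bint[where C="(1 + 1 / \<epsilon>)\<^sup>2"]) (use Fb eps in \<open>auto simp: abs_le_square_iff[symmetric]\<close>)
  have termwise: "(LINT x|lborel. (cmod (u x))\<^sup>2 * (F' i x / 2 - (F i x)\<^sup>2 / 4)) \<le> (norm_L2 (g i))\<^sup>2" for i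
  proof -
    let ?v = "\<lambda>x. complex_of_real (F i x) * cnj (u x)"
    have v: "L2 ?v" by (rule L2_mult_bounded_real[OF L2_cnj[OF u] Fm(1) Fb])
    have ig: "integrable lborel (\<lambda>x. g i x * ?v x)" by (intro integrable_mult_L2 g v)
    have pt: "(cmod (g i x + complex_of_real (F i x / 2) * u x))\<^sup>2 = (cmod (g i x))\<^sup>2 + Re (g i x * ?v x) + (cmod (u x))\<^sup>2 * (F i x)\<^sup>2 / 4" for x
      unfolding cmod_power2 by (simp add: power2_eq_square algebra_simps)
    have "0 \<le> (LINT x|lborel. (cmod (g i x + complex_of_real (F i x / 2) * u x))\<^sup>2)" by simp
    also have "\<dots> = (LINT x|lborel. (cmod (g i x))\<^sup>2) + (LINT x|lborel. Re (g i x * ?v x)) + (LINT x|lborel. (cmod (u x))\<^sup>2 * (F i x)\<^sup>2 / 4)"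
      unfolding pt using i2[of i] L2_integrable[OF g(1)[of i]] integrable_Re[OF ig]
      by (simp add: Bochner_Integration.integral_add Bochner_Integration.integrable_add)
    also have "(LINT x|lborel. Re (g i x * ?v x)) = - (LINT x|lborel. (cmod (u x))\<^sup>2 * F' i x) / 2"
      using weak_square_by_parts[OF u g(1,2) Fm(1) Fb Fm(2) F'b der, of i] integral_Re[OF ig] by simp
    also have "(LINT x|lborel. (cmod (g i x))\<^sup>2) = (norm_L2 (g i))\<^sup>2" by (simp add: norm_L2_def)
    finally have "(LINT x|lborel. (cmod (u x))\<^sup>2 * F' i x) / 2 - (LINT x|lborel. (cmod (u x))\<^sup>2 * (F i x)\<^sup>2 / 4) \<le> (norm_L2 (g i))\<^sup>2"
      by simp
    moreover have "(LINT x|lborel. (cmod (u x))\<^sup>2 * (F' i x / 2 - (F i x)\<^sup>2 / 4))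
       = (LINT x|lborel. (cmod (u x))\<^sup>2 * F' i x / 2 - (cmod (u x))\<^sup>2 * (F i x)\<^sup>2 / 4)"
      by (simp add: algebra_simps)
    ultimately show ?thesis using i1[of i] i2[of i] by simp
  qed
  have it: "integrable lborel (\<lambda>x. (cmod (u x))\<^sup>2 * (F' i x / 2 - (F i x)\<^sup>2 / 4))" for i
  proof -
    have "integrable lborel (\<lambda>x. (cmod (u x))\<^sup>2 * F' i x / 2 - (cmod (u x))\<^sup>2 * (F i x)\<^sup>2 / 4)"
      using i1[of i] i2[of i] by simp
    then show ?thesis by (simp add: algebra_simps)
  qed
  \<comment> \<open>The sum over the three directions has numerator
    \<open>3 / 2 * q x - 5 / 4 * (norm (x - a))\<^sup>2\<close>, and the squared distance is at most
    \<open>q x\<close>: the dimension enters through 3/2 - 5/4 = 1/4.\<close>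
  have pw: "1 / (4 * q x) \<le> (\<Sum>i\<in>UNIV. F' i x / 2 - (F i x)\<^sup>2 / 4)" for x
  proof -
    have n2: "(norm (x - a))\<^sup>2 = (\<Sum>i\<in>UNIV. ((x - a) $ i)\<^sup>2)"
      unfolding power2_norm_eq_inner by (simp add: inner_vec_def power2_eq_square)
    have "(\<Sum>i\<in>UNIV. F' i x / 2 - (F i x)\<^sup>2 / 4) = (\<Sum>i\<in>(UNIV :: 3 set). 1 / (2 * q x) - 5 / 4 * ((x - a) $ i)\<^sup>2 / (q x)\<^sup>2)"
    proof (intro sum.cong refl)
      fix i :: 3
      have alg: "(1 / Q - 2 * y / P) / 2 - y / P / 4 = 1 / (2 * Q) - 5 / 4 * y / P" for Q y P :: real
        by (simp add: diff_divide_distrib)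
      show "F' i x / 2 - (F i x)\<^sup>2 / 4 = 1 / (2 * q x) - 5 / 4 * ((x - a) $ i)\<^sup>2 / (q x)\<^sup>2"
        unfolding F_def F'_def power_divide by (rule alg)
    qed
    also have "\<dots> = 3 / (2 * q x) - 5 / 4 * (norm (x - a))\<^sup>2 / (q x)\<^sup>2"
      by (simp add: sum_subtractf n2 sum_divide_distrib[symmetric] sum_distrib_left[symmetric])
    also have "\<dots> = (3 / 2 * q x - 5 / 4 * (norm (x - a))\<^sup>2) / (q x)\<^sup>2"
      using q(1)[of x] by (simp add: field_simps power2_eq_square)
    also have "\<dots> \<ge> (1 / 4 * q x) / (q x)\<^sup>2"
      using eps by (intro divide_right_mono) (auto simp: q_def)
    moreover have "(1 / 4 * q x) / (q x)\<^sup>2 = 1 / (4 * q x)" using q(1)[of x] by (simp add: power2_eq_square)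
    ultimately show ?thesis by simp
  qed
  have "(LINT x|lborel. (cmod (u x))\<^sup>2 * (1 / q x)) / 4 = (LINT x|lborel. (cmod (u x))\<^sup>2 * (1 / q x) / 4)"
    by (rule integral_divide_zero[symmetric])
  also have "\<dots> \<le> (LINT x|lborel. (\<Sum>i\<in>UNIV. (cmod (u x))\<^sup>2 * (F' i x / 2 - (F i x)\<^sup>2 / 4)))"
  proof (rule integral_mono)
    show "integrable lborel (\<lambda>x. (cmod (u x))\<^sup>2 * (1 / q x) / 4)" by (rule integrable_divide) (rule i0)
    show "integrable lborel (\<lambda>x. \<Sum>i\<in>UNIV. (cmod (u x))\<^sup>2 * (F' i x / 2 - (F i x)\<^sup>2 / 4))"
      by (intro Bochner_Integration.integrable_sum it)
    show "(cmod (u x))\<^sup>2 * (1 / q x) / 4 \<le> (\<Sum>i\<in>UNIV. (cmod (u x))\<^sup>2 * (F' i x / 2 - (F i x)\<^sup>2 / 4))" for x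
      using mult_left_mono[OF pw[of x], of "(cmod (u x))\<^sup>2"] by (simp add: sum_distrib_left)
  qed
  also have "\<dots> = (\<Sum>i\<in>UNIV. LINT x|lborel. (cmod (u x))\<^sup>2 * (F' i x / 2 - (F i x)\<^sup>2 / 4))"
    by (intro Bochner_Integration.integral_sum it)
  also have "\<dots> \<le> (\<Sum>i\<in>UNIV. (norm_L2 (g i))\<^sup>2)" by (intro sum_mono termwise)
  finally show "(LINT x|lborel. (cmod (u x))\<^sup>2 * (1 / ((norm (x - a))\<^sup>2 + \<epsilon>))) \<le> 4 * (\<Sum>i\<in>UNIV. (norm_L2 (g i))\<^sup>2)"
    by (simp add: q_def)
qed

text \<open>The bound in \<open>Hardy_regularized\<close> does not depend on the regularization, so
  Fatou's lemma removes it.\<close>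

lemma Hardy_inequality:
  fixes a :: "real^3"
  assumes u: "L2 u" and g: "\<And>i. L2 (g i)" "\<And>i. weak_deriv [i] u (g i)"
  shows "L2 (\<lambda>x. u x / complex_of_real (norm (x - a)))"
    and "norm_L2 (\<lambda>x. u x / complex_of_real (norm (x - a))) \<le> 2 * sqrt (\<Sum>i\<in>UNIV. (norm_L2 (g i))\<^sup>2)"
proof -
  have [measurable]: "u \<in> borel_measurable borel" using u L2_measurable by blast
  define c where "c = 2 * sqrt (\<Sum>i\<in>UNIV. (norm_L2 (g i))\<^sup>2)"
  have c: "c \<ge> 0" "c\<^sup>2 = 4 * (\<Sum>i\<in>UNIV. (norm_L2 (g i))\<^sup>2)"
    by (auto simp: c_def power_mult_distrib sum_nonneg)
  define f where "f n x = (cmod (u x))\<^sup>2 * (1 / ((norm (x - a))\<^sup>2 + inverse (real (Suc n))))" for n x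
  have "(\<integral>\<^sup>+x. ennreal ((cmod (u x / complex_of_real (norm (x - a))))\<^sup>2) \<partial>lborel) \<le> (\<integral>\<^sup>+x. liminf (\<lambda>n. ennreal (f n x)) \<partial>lborel)"
  proof (rule nn_integral_mono)
    fix x
    show "ennreal ((cmod (u x / complex_of_real (norm (x - a))))\<^sup>2) \<le> liminf (\<lambda>n. ennreal (f n x))"
    \<comment> \<open>At the centre the quotient is a division by zero and hence 0.\<close>
    proof (cases "x = a")
      case False
      have "(\<lambda>n. f n x) \<longlonglongrightarrow> (cmod (u x))\<^sup>2 * (1 / ((norm (x - a))\<^sup>2 + 0))"
        unfolding f_def using False by (intro tendsto_intros LIMSEQ_inverse_real_of_nat) auto
      then have "(\<lambda>n. ennreal (f n x)) \<longlonglongrightarrow> ennreal ((cmod (u x))\<^sup>2 * (1 / ((norm (x - a))\<^sup>2 + 0)))"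
        by (rule tendsto_ennrealI)
      from lim_imp_Liminf[OF sequentially_bot this] show ?thesis
        by (simp add: norm_divide power_divide)
    qed simp
  qed
  also have "\<dots> \<le> liminf (\<lambda>n. \<integral>\<^sup>+x. ennreal (f n x) \<partial>lborel)"
    by (rule nn_integral_liminf) (unfold f_def, measurable)
  also have "\<dots> \<le> liminf (\<lambda>n. ennreal (c\<^sup>2))"
  proof (intro Liminf_mono always_eventually allI)
    fix n
    have "inverse (real (Suc n)) > 0" by simp
    note H = Hardy_regularized[OF u g this, of a]
    have "(\<integral>\<^sup>+x. ennreal (f n x) \<partial>lborel) = ennreal (LINT x|lborel. f n x)"
      by (rule nn_integral_eq_integral) (use H(1) in \<open>auto simp: f_def[abs_def]\<close>)
    also have "\<dots> \<le> ennreal (c\<^sup>2)" using H(2) c(2) by (intro ennreal_leI) (simp add: f_def)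
    finally show "(\<integral>\<^sup>+x. ennreal (f n x) \<partial>lborel) \<le> ennreal (c\<^sup>2)" .
  qed
  also have "\<dots> = ennreal (c\<^sup>2)" by (simp add: Liminf_const)
  finally have *: "(\<integral>\<^sup>+x. ennreal ((cmod (u x / complex_of_real (norm (x - a))))\<^sup>2) \<partial>lborel) \<le> ennreal (c\<^sup>2)" .
  have m: "(\<lambda>x. u x / complex_of_real (norm (x - a))) \<in> borel_measurable borel" by measurable
  show "L2 (\<lambda>x. u x / complex_of_real (norm (x - a)))"
    and "norm_L2 (\<lambda>x. u x / complex_of_real (norm (x - a))) \<le> 2 * sqrt (\<Sum>i\<in>UNIV. (norm_L2 (g i))\<^sup>2)"
    using L2_nn_integral[OF m * c(1)] by (simp_all add: c_def)
qed

section \<open>The space of twice weakly differentiable functions\<close>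

text \<open>The choice made inside \<open>lap\<close>, for arbitrary lists. It is determined only up
  to null sets, so rules for it are stated with \<open>ae_eq\<close>.\<close>

definition wd :: "3 list \<Rightarrow> fn3 \<Rightarrow> fn3" where
  "wd js f = (SOME g. L2 g \<and> weak_deriv js f g)"

lemma lap_wd: "lap f = (\<lambda>x. \<Sum>i\<in>UNIV. wd [i, i] f x)"
  by (simp add: lap_def wd_def)

lemma H2_L2 [dest]: "H2 f \<Longrightarrow> L2 f"
  by (simp add: H2_def)

lemma H2_wd:
  assumes "H2 f" "length js \<le> 2" shows "L2 (wd js f)" "weak_deriv js f (wd js f)"
proof -
  have "\<exists>g. L2 g \<and> weak_deriv js f g" using assms by (auto simp: H2_def)
  from someI_ex[OF this] show "L2 (wd js f)" "weak_deriv js f (wd js f)" by (auto simp: wd_def)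
qed

lemma weak_deriv_unique:
  assumes "L2 g" "L2 g'" "weak_deriv js f g" "weak_deriv js f g'" shows "ae_eq g g'"
proof -
  have "(LINT x|lborel. (g x - g' x) * tf x) = 0" if tf: "test_fun tf" for tf
  proof -
    have "(-1) ^ length js * (LINT x|lborel. g x * tf x) = (-1) ^ length js * (LINT x|lborel. g' x * tf x)"
      using assms(3,4) tf by (simp add: weak_deriv_def)
    then have "(LINT x|lborel. g x * tf x) = (LINT x|lborel. g' x * tf x)" by simp
    moreover have "(LINT x|lborel. (g x - g' x) * tf x) = (LINT x|lborel. g x * tf x) - (LINT x|lborel. g' x * tf x)"
      unfolding left_diff_distrib by (intro Bochner_Integration.integral_diff integrable_mult_L2 assms test_fun_L2 tf)
    ultimately show ?thesis by simp
  qed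
  then have "ae_eq (\<lambda>x. g x - g' x) (\<lambda>x. 0)"
    using ae_zero_if_orthogonal_to_test_funs[of "\<lambda>x. g x - g' x"] assms by auto
  then show ?thesis by (simp add: ae_eq_def)
qed

lemma weak_deriv_lin:
  assumes L: "L2 f" "L2 f'" "L2 g" "L2 g'" and w: "weak_deriv js f g" "weak_deriv js f' g'"
  shows "weak_deriv js (\<lambda>x. f x + c * f' x) (\<lambda>x. g x + c * g' x)"
  unfolding weak_deriv_def
proof (intro allI impI)
  fix tf assume tf: "test_fun tf"
  have lin: "(LINT x|lborel. (a x + c * b x) * t x) = (LINT x|lborel. a x * t x) + c * (LINT x|lborel. b x * t x)"
    if "L2 a" "L2 b" "L2 t" for a b t
  proof -
    have "(LINT x|lborel. (a x + c * b x) * t x) = (LINT x|lborel. a x * t x + c * (b x * t x))"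
      by (simp add: algebra_simps)
    also have "\<dots> = (LINT x|lborel. a x * t x) + (LINT x|lborel. c * (b x * t x))"
      by (intro Bochner_Integration.integral_add integrable_mult_right integrable_mult_L2 that)
    finally show ?thesis by simp
  qed
  show "(LINT x|lborel. (f x + c * f' x) * iter_pd js tf x) = (-1) ^ length js * (LINT x|lborel. (g x + c * g' x) * tf x)"
    unfolding lin[OF L(1,2) test_fun_L2[OF test_fun_iter_pd[OF tf]]] lin[OF L(3,4) test_fun_L2[OF tf]]
    using w tf by (simp add: weak_deriv_def algebra_simps)
qed

lemma weak_deriv_cong:
  assumes "L2 f" "L2 f'" "ae_eq f f'" "weak_deriv js f g" shows "weak_deriv js f' g"
  unfolding weak_deriv_def
proof (intro allI impI)
  fix tf assume tf: "test_fun tf"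
  have "(LINT x|lborel. f x * iter_pd js tf x) = (LINT x|lborel. f' x * iter_pd js tf x)"
  proof (rule integral_cong_AE)
    show "AE x in lborel. f x * iter_pd js tf x = f' x * iter_pd js tf x"
      using assms(3) unfolding ae_eq_def by (rule eventually_mono) simp
  qed (intro borel_measurable_integrable integrable_mult_L2 test_fun_L2 test_fun_iter_pd tf assms)+
  then show "(LINT x|lborel. f' x * iter_pd js tf x) = (-1) ^ length js * (LINT x|lborel. g x * tf x)"
    using assms(4) tf by (simp add: weak_deriv_def)
qed

text \<open>The first-order identity is tested against \<open>pd i tf\<close>. This allows second
  derivatives to be integrated by parts one at a time.\<close>

lemma weak_deriv_second:
  assumes "weak_deriv [i] f g" "weak_deriv [i, i] f k" shows "weak_deriv [i] g k"
  unfolding weak_deriv_def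
proof (intro allI impI)
  fix tf assume tf: "test_fun tf"
  have "(LINT x|lborel. f x * pd i (pd i tf) x) = - (LINT x|lborel. g x * pd i tf x)"
    using assms(1) test_fun_pd[OF tf] by (simp add: weak_deriv_def)
  moreover have "(LINT x|lborel. f x * pd i (pd i tf) x) = (LINT x|lborel. k x * tf x)"
    using assms(2) tf by (simp add: weak_deriv_def)
  ultimately have "(LINT x|lborel. g x * pd i tf x) = - (LINT x|lborel. k x * tf x)" by (metis minus_minus)
  then show "(LINT x|lborel. g x * iter_pd [i] tf x) = (-1) ^ length [i] * (LINT x|lborel. k x * tf x)" by simp
qed

lemma weak_deriv_cnj:
  assumes "weak_deriv js f g" shows "weak_deriv js (\<lambda>x. cnj (f x)) (\<lambda>x. cnj (g x))"
  unfolding weak_deriv_def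
proof (intro allI impI)
  fix tf assume tf: "test_fun tf"
  have c: "(LINT x|lborel. cnj (a x) * t x) = cnj (LINT x|lborel. a x * cnj (t x))" for a t :: fn3
  proof -
    have "(LINT x|lborel. cnj (a x) * t x) = (LINT x|lborel. cnj (a x * cnj (t x)))" by simp
    also have "\<dots> = cnj (LINT x|lborel. a x * cnj (t x))" by (rule Bochner_Integration.integral_cnj)
    finally show ?thesis .
  qed
  have "(LINT x|lborel. f x * cnj (iter_pd js tf x)) = (-1) ^ length js * (LINT x|lborel. g x * cnj (tf x))"
    using assms[unfolded weak_deriv_def, rule_format, OF test_fun_cnj(1)[OF tf]] unfolding test_fun_cnj(2)[OF tf] .
  then show "(LINT x|lborel. cnj (f x) * iter_pd js tf x) = (-1) ^ length js * (LINT x|lborel. cnj (g x) * tf x)"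
    unfolding c by simp
qed

lemma H2_lin:
  assumes "H2 f" "H2 f'" shows "H2 (\<lambda>x. f x + c * f' x)"
  unfolding H2_def
proof (intro conjI allI impI)
  show "L2 (\<lambda>x. f x + c * f' x)" by (intro L2_add L2_mult_const H2_L2 assms)
  fix js :: "3 list" assume "length js \<le> 2"
  note js = this
  have "L2 (\<lambda>x. wd js f x + c * wd js f' x)" by (intro L2_add L2_mult_const H2_wd assms js)
  moreover have "weak_deriv js (\<lambda>x. f x + c * f' x) (\<lambda>x. wd js f x + c * wd js f' x)"
    by (intro weak_deriv_lin H2_L2 H2_wd assms js)
  ultimately show "\<exists>g. L2 g \<and> weak_deriv js (\<lambda>x. f x + c * f' x) g" by blast
qed

lemma wd_lin:
  assumes "H2 f" "H2 f'" "length js \<le> 2"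
  shows "ae_eq (wd js (\<lambda>x. f x + c * f' x)) (\<lambda>x. wd js f x + c * wd js f' x)"
proof (rule weak_deriv_unique)
  show "weak_deriv js (\<lambda>x. f x + c * f' x) (\<lambda>x. wd js f x + c * wd js f' x)"
    by (intro weak_deriv_lin H2_L2 H2_wd assms)
qed (intro L2_add L2_mult_const H2_wd H2_lin assms)+

lemma H2_zero: "H2 (\<lambda>x. 0)"
  unfolding H2_def
proof (intro conjI allI impI)
  show "\<exists>g. L2 g \<and> weak_deriv js (\<lambda>x. 0) g" for js
    by (intro exI[of _ "\<lambda>x. 0"]) (auto simp: weak_deriv_def)
qed auto

lemma H2_scale: "H2 f \<Longrightarrow> H2 (\<lambda>x. c * f x)"
  using H2_lin[OF H2_zero, of f c] by simp

lemma H2_add: "H2 f \<Longrightarrow> H2 g \<Longrightarrow> H2 (\<lambda>x. f x + g x)"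
  using H2_lin[of f g 1] by simp

lemma H2_diff: "H2 f \<Longrightarrow> H2 g \<Longrightarrow> H2 (\<lambda>x. f x - g x)"
  using H2_lin[of f g "-1"] by simp

lemma H2_sum: "(\<And>i. i \<in> I \<Longrightarrow> H2 (f i)) \<Longrightarrow> H2 (\<lambda>x. \<Sum>i\<in>I. f i x)"
  by (induction I rule: infinite_finite_induct) (auto simp: H2_zero H2_add)

lemma H2_cong: "H2 f \<Longrightarrow> L2 f' \<Longrightarrow> ae_eq f f' \<Longrightarrow> H2 f'"
  unfolding H2_def using weak_deriv_cong by blast

lemma L2_lap: "H2 f \<Longrightarrow> L2 (lap f)"
  unfolding lap_wd by (intro L2_sum H2_wd) auto

lemma lap_lin:
  assumes "H2 f" "H2 f'"
  shows "ae_eq (lap (\<lambda>x. f x + c * f' x)) (\<lambda>x. lap f x + c * lap f' x)"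
proof -
  have "ae_eq (\<lambda>x. \<Sum>i\<in>UNIV. wd [i, i] (\<lambda>x. f x + c * f' x) x) (\<lambda>x. \<Sum>i\<in>UNIV. wd [i, i] f x + c * wd [i, i] f' x)"
    by (intro ae_eq_sum wd_lin assms) auto
  then show ?thesis unfolding lap_wd by (simp add: sum.distrib sum_distrib_left)
qed

lemma lap_cong:
  assumes "H2 f" "H2 f'" "ae_eq f f'" shows "ae_eq (lap f) (lap f')"
  unfolding lap_wd
  by (intro ae_eq_sum weak_deriv_unique[OF _ _ weak_deriv_cong[OF _ _ assms(3) H2_wd(2)] H2_wd(2)])
    (use assms H2_wd(1) in auto)

lemma Green:
  assumes u: "H2 u" and v: "H2 v"
  shows "inner_L2 v (lap u) = - (\<Sum>i\<in>UNIV. inner_L2 (wd [i] v) (wd [i] u))"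
proof -
  have "inner_L2 v (lap u) = (\<Sum>i\<in>UNIV. inner_L2 v (wd [i, i] u))"
    unfolding lap_wd by (intro inner_L2_sum_right H2_wd) (use u v in auto)
  also have "\<dots> = (\<Sum>i\<in>UNIV. - inner_L2 (wd [i] v) (wd [i] u))"
  proof (intro sum.cong refl)
    fix i :: 3
    have "(LINT x|lborel. wd [i, i] u x * cnj (v x)) = - (LINT x|lborel. wd [i] u x * cnj (wd [i] v x))"
      by (rule integral_by_parts[OF _ _ weak_deriv_second[OF H2_wd(2) H2_wd(2)] _ _ weak_deriv_cnj[OF H2_wd(2)]])
        (use u v H2_wd(1) in auto)
    then show "inner_L2 v (wd [i, i] u) = - inner_L2 (wd [i] v) (wd [i] u)"
      by (simp add: inner_L2_def mult.commute)
  qed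
  finally show ?thesis by (simp add: sum_negf)
qed

lemma lap_symmetric:
  assumes "H2 u" "H2 v" shows "inner_L2 v (lap u) = inner_L2 (lap v) u"
proof -
  have "inner_L2 (lap v) u = cnj (inner_L2 u (lap v))" by (simp add: inner_L2_cnj)
  also have "\<dots> = inner_L2 v (lap u)" unfolding Green[OF assms] Green[OF assms(2,1)]
    by (simp add: inner_L2_cnj)
  finally show ?thesis by simp
qed

section \<open>The norm of the second-order Sobolev space\<close>

definition h2norm :: "fn3 \<Rightarrow> real" where
  "h2norm u = norm_L2 (\<lambda>x. u x - lap u x)"

lemma h2norm_nonneg [simp]: "0 \<le> h2norm u"
  by (simp add: h2norm_def)

text \<open>By \<open>Green\<close> the cross term between \<open>u\<close> and
  \<open>- lap u\<close> is the squared norm of the gradient. The square of \<open>h2norm u\<close>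
  is therefore a sum of nonnegative parts, each of which it controls.\<close>

lemma h2norm_bounds:
  assumes u: "H2 u"
  shows "norm_L2 u \<le> h2norm u" "norm_L2 (lap u) \<le> h2norm u"
    "sqrt (\<Sum>i\<in>UNIV. (norm_L2 (wd [i] u))\<^sup>2) \<le> h2norm u"
proof -
  have L: "L2 u" "L2 (lap u)" using u L2_lap by auto
  define G where "G = (\<Sum>i\<in>UNIV. (norm_L2 (wd [i] u))\<^sup>2)"
  have "Re (inner_L2 u (lap u)) = - G"
    unfolding Green[OF u u] G_def norm_L2_sq by simp
  then have "cls u \<bullet> cls (lap u) = - G" using L by (simp add: cls_inner)
  moreover have "(h2norm u)\<^sup>2 = (norm (cls u - cls (lap u)))\<^sup>2"
    using L by (simp add: h2norm_def cls_diff cls_norm L2_diff)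
  moreover have "(norm (x - y))\<^sup>2 = (norm x)\<^sup>2 - 2 * (x \<bullet> y) + (norm y)\<^sup>2" for x y :: l2
    unfolding power2_norm_eq_inner by (simp add: inner_diff_left inner_diff_right inner_commute)
  ultimately have sq: "(h2norm u)\<^sup>2 = (norm_L2 u)\<^sup>2 + 2 * G + (norm_L2 (lap u))\<^sup>2"
    using L by (simp add: cls_norm)
  have G0: "G \<ge> 0" by (simp add: G_def sum_nonneg)
  show "norm_L2 u \<le> h2norm u" "norm_L2 (lap u) \<le> h2norm u"
    using sq G0 by (auto intro!: power2_le_imp_le[OF _ h2norm_nonneg])
  have "G \<le> (h2norm u)\<^sup>2" using sq G0 by simp
  then show "sqrt (\<Sum>i\<in>UNIV. (norm_L2 (wd [i] u))\<^sup>2) \<le> h2norm u"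
    unfolding G_def[symmetric] by (simp add: real_le_lsqrt G0)
qed

lemma h2norm_lin:
  assumes "H2 f" "H2 f'"
  shows "h2norm (\<lambda>x. f x + c * f' x) \<le> h2norm f + cmod c * h2norm f'"
proof -
  have "h2norm (\<lambda>x. f x + c * f' x) = norm_L2 (\<lambda>x. (f x - lap f x) + c * (f' x - lap f' x))"
    unfolding h2norm_def
  proof (rule norm_L2_cong)
    show "ae_eq (\<lambda>x. f x + c * f' x - lap (\<lambda>x. f x + c * f' x) x) (\<lambda>x. f x - lap f x + c * (f' x - lap f' x))"
      using lap_lin[OF assms, of c] unfolding ae_eq_def by (rule eventually_mono) (simp add: algebra_simps)
  qed (intro L2_diff L2_add L2_mult_const L2_lap H2_L2 H2_lin assms)+
  also have "\<dots> \<le> norm_L2 (\<lambda>x. f x - lap f x) + norm_L2 (\<lambda>x. c * (f' x - lap f' x))"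
    by (intro norm_L2_triangle L2_diff L2_mult_const L2_lap H2_L2 assms)
  also have "norm_L2 (\<lambda>x. c * (f' x - lap f' x)) = cmod c * norm_L2 (\<lambda>x. f' x - lap f' x)" by (rule norm_L2_mult_const)
  finally show ?thesis by (simp add: h2norm_def)
qed

lemma h2norm_zero: "h2norm (\<lambda>x. 0) = 0"
proof -
  have "ae_eq (lap (\<lambda>x. 0)) (\<lambda>x. 0)"
    using lap_lin[OF H2_zero H2_zero, of "-1"] by (simp add: ae_eq_def)
  then have "ae_eq (\<lambda>x. 0 - lap (\<lambda>x. 0) x) (\<lambda>x. 0)" by (simp add: ae_eq_def)
  moreover have "L2 (\<lambda>x. 0 - lap (\<lambda>x. 0) x)" by (intro L2_diff L2_zero L2_lap H2_zero)
  ultimately show ?thesis unfolding h2norm_def by (simp only: norm_L2_eq_0_iff)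
qed

lemma h2norm_sum:
  assumes "\<And>i. i \<in> I \<Longrightarrow> H2 (f i)"
  shows "h2norm (\<lambda>x. \<Sum>i\<in>I. c i * f i x) \<le> (\<Sum>i\<in>I. cmod (c i) * h2norm (f i))"
  using assms
proof (induction I rule: infinite_finite_induct)
  case (insert i I)
  have "h2norm (\<lambda>x. (\<Sum>i\<in>I. c i * f i x) + c i * f i x) \<le> h2norm (\<lambda>x. \<Sum>i\<in>I. c i * f i x) + cmod (c i) * h2norm (f i)"
    by (intro h2norm_lin H2_sum H2_scale) (use insert in auto)
  with insert show ?case by (simp add: add.commute)
qed (simp_all add: h2norm_zero)

lemma H2_Hardy:
  assumes u: "H2 u"
  shows "L2 (\<lambda>x. u x / complex_of_real (norm (x - a)))"
    "norm_L2 (\<lambda>x. u x / complex_of_real (norm (x - a))) \<le> 2 * h2norm u"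
proof -
  have g: "L2 (wd [i] u)" "weak_deriv [i] u (wd [i] u)" for i using H2_wd[OF u, of "[i]"] by auto
  note H = Hardy_inequality[OF H2_L2[OF u] g, of a]
  show "L2 (\<lambda>x. u x / complex_of_real (norm (x - a)))" by (rule H(1))
  show "norm_L2 (\<lambda>x. u x / complex_of_real (norm (x - a))) \<le> 2 * h2norm u"
    using H(2) h2norm_bounds(3)[OF u] by linarith
qed

section \<open>The Fock operator\<close>

text \<open>The Coulomb potential of a mixed density: \<open>f = g = \<Phi> i\<close> gives the
  direct term, and \<open>f = \<Phi> i\<close>, \<open>g = w\<close> the exchange term.\<close>

definition coul :: "fn3 \<Rightarrow> fn3 \<Rightarrow> fn3" where
  "coul f g x = (LINT y|lborel. cnj (f y) * g y / complex_of_real (norm (x - y)))"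

lemma coul_integrable:
  assumes "H2 f" "L2 g"
  shows "integrable lborel (\<lambda>y. cnj (f y) * g y / complex_of_real (norm (x - y)))"
proof -
  have "integrable lborel (\<lambda>y. cnj (f y / complex_of_real (norm (y - x))) * g y)"
    by (intro integrable_inner_L2 H2_Hardy assms)
  then show ?thesis by (simp add: norm_minus_commute)
qed

text \<open>The singularity is absorbed by \<open>f\<close> through Hardy's inequality, uniformly in
  its centre \<open>x\<close>; the second argument need only be square integrable.\<close>

lemma coul_bound:
  assumes "H2 f" "L2 g"
  shows "cmod (coul f g x) \<le> 2 * h2norm f * norm_L2 g"
proof -
  have "coul f g x = inner_L2 (\<lambda>y. f y / complex_of_real (norm (y - x))) g"
    by (simp add: coul_def inner_L2_def norm_minus_commute)
  then have "cmod (coul f g x) \<le> norm_L2 (\<lambda>y. f y / complex_of_real (norm (y - x))) * norm_L2 g"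
    using inner_L2_le[OF H2_Hardy(1)[OF assms(1)] assms(2)] by simp
  also have "\<dots> \<le> 2 * h2norm f * norm_L2 g"
    by (intro mult_right_mono H2_Hardy assms) auto
  finally show ?thesis .
qed

lemma coul_measurable_pair:
  assumes "L2 f" "L2 g"
  shows "(\<lambda>(x, y). cnj (f y) * g y / complex_of_real (norm (x - y))) \<in> borel_measurable (borel \<Otimes>\<^sub>M borel)"
proof -
  have [measurable]: "f \<in> borel_measurable borel" "g \<in> borel_measurable borel" using assms L2_measurable by auto
  show ?thesis by measurable
qed

lemma coul_measurable:
  assumes "L2 f" "L2 g" shows "coul f g \<in> borel_measurable borel"
proof -
  have "(\<lambda>(x, y). cnj (f y) * g y / complex_of_real (norm (x - y))) \<in> borel_measurable (borel \<Otimes>\<^sub>M lborel)"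
    using coul_measurable_pair[OF assms] by (simp add: measurable_cong_sets[OF sets_pair_measure_cong[OF refl sets_lborel] refl])
  then show ?thesis unfolding coul_def[abs_def] by (rule lborel.borel_measurable_lebesgue_integral)
qed

lemma coul_lin_right:
  assumes "H2 f" "L2 g" "L2 g'"
  shows "coul f (\<lambda>x. g x + c * g' x) x = coul f g x + c * coul f g' x"
proof -
  have "coul f (\<lambda>x. g x + c * g' x) x = (LINT y|lborel. cnj (f y) * g y / complex_of_real (norm (x - y))
      + c * (cnj (f y) * g' y / complex_of_real (norm (x - y))))"
    unfolding coul_def by (simp add: algebra_simps add_divide_distrib)
  also have "\<dots> = coul f g x + (LINT y|lborel. c * (cnj (f y) * g' y / complex_of_real (norm (x - y))))"
    unfolding coul_def by (intro Bochner_Integration.integral_add integrable_mult_right coul_integrable assms)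
  also have "(LINT y|lborel. c * (cnj (f y) * g' y / complex_of_real (norm (x - y)))) = c * coul f g' x"
    unfolding coul_def by (rule integral_mult_right_zero)
  finally show ?thesis .
qed

lemma coul_diff_right:
  "H2 f \<Longrightarrow> L2 g \<Longrightarrow> L2 g' \<Longrightarrow> coul f (\<lambda>x. g x - g' x) x = coul f g x - coul f g' x"
  using coul_lin_right[of f g g' "-1" x] by simp

lemma coul_diff_left:
  assumes "H2 f" "H2 f'" "L2 g"
  shows "coul (\<lambda>x. f x - f' x) g x = coul f g x - coul f' g x"
proof -
  have "coul (\<lambda>x. f x - f' x) g x = (LINT y|lborel. cnj (f y) * g y / complex_of_real (norm (x - y))
      - cnj (f' y) * g y / complex_of_real (norm (x - y)))"
    unfolding coul_def by (simp add: left_diff_distrib diff_divide_distrib)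
  also have "\<dots> = coul f g x - coul f' g x"
    unfolding coul_def by (intro Bochner_Integration.integral_diff coul_integrable assms)
  finally show ?thesis .
qed

lemma coul_cong:
  assumes "ae_eq f f'" "ae_eq g g'" "L2 f" "L2 g" "L2 f'" "L2 g'"
  shows "coul f g x = coul f' g' x"
  unfolding coul_def
proof (rule integral_cong_AE)
  have [measurable]: "f \<in> borel_measurable borel" "g \<in> borel_measurable borel"
    "f' \<in> borel_measurable borel" "g' \<in> borel_measurable borel" using assms L2_measurable by auto
  show "(\<lambda>y. cnj (f y) * g y / complex_of_real (norm (x - y))) \<in> borel_measurable lborel"
    "(\<lambda>y. cnj (f' y) * g' y / complex_of_real (norm (x - y))) \<in> borel_measurable lborel" by measurable
  show "AE y in lborel. cnj (f y) * g y / complex_of_real (norm (x - y)) = cnj (f' y) * g' y / complex_of_real (norm (x - y))"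
    using assms(1,2) unfolding ae_eq_def by (rule eventually_elim2) simp
qed

lemma Rpot_coul: "complex_of_real (Rpot N \<Phi> x) = (\<Sum>i<N. coul (\<Phi> i) (\<Phi> i) x)"
proof -
  have "complex_of_real (LINT y|lborel. (cmod (\<Phi> i y))\<^sup>2 / norm (x - y)) = coul (\<Phi> i) (\<Phi> i) x" for i
  proof -
    have "complex_of_real (LINT y|lborel. (cmod (\<Phi> i y))\<^sup>2 / norm (x - y))
        = (LINT y|lborel. complex_of_real ((cmod (\<Phi> i y))\<^sup>2 / norm (x - y)))" by (rule integral_complex_of_real[symmetric])
    also have "\<dots> = coul (\<Phi> i) (\<Phi> i) x"
      unfolding coul_def
      by (rule Bochner_Integration.integral_cong) (simp_all only: of_real_divide complex_norm_square mult.commute)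
    finally show ?thesis .
  qed
  then show ?thesis by (simp add: Rpot_def)
qed

lemma Gop_coul: "Gop N \<Phi> w x = (\<Sum>i<N. coul (\<Phi> i) (\<Phi> i) x * w x - coul (\<Phi> i) w x * \<Phi> i x)"
  by (simp add: Gop_def Rpot_coul Sop_def coul_def[symmetric] sum_subtractf sum_distrib_right)

lemma L2_coul_mult:
  assumes "H2 f" "L2 g" "L2 w"
  shows "L2 (\<lambda>x. coul f g x * w x)" "norm_L2 (\<lambda>x. coul f g x * w x) \<le> 2 * h2norm f * norm_L2 g * norm_L2 w"
  using L2_mult_bounded[OF assms(3) coul_measurable[OF H2_L2[OF assms(1)] assms(2)] coul_bound[OF assms(1,2)]] by auto

lemma L2_Gop:
  assumes "\<And>i. i < N \<Longrightarrow> H2 (\<Phi> i)" "L2 w" shows "L2 (Gop N \<Phi> w)"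
proof -
  have "L2 (\<lambda>x. \<Sum>i<N. coul (\<Phi> i) (\<Phi> i) x * w x - coul (\<Phi> i) w x * \<Phi> i x)"
    by (intro L2_sum L2_diff L2_coul_mult) (use assms in auto)
  then show ?thesis by (simp add: Gop_coul[abs_def])
qed

text \<open>Telescoping the products leaves terms with one factor \<open>d i\<close> each. Two of
  them, with constant 2 from \<open>coul_bound\<close>, carry \<open>h2norm (\<Phi> i)\<close> and
  two carry \<open>h2norm (\<Xi> i)\<close>, whence the 4.\<close>

lemma Gop_difference:
  assumes P: "\<And>i. i < N \<Longrightarrow> H2 (\<Phi> i)" and X: "\<And>i. i < N \<Longrightarrow> H2 (\<Xi> i)" and w: "L2 w"
  shows "norm_L2 (\<lambda>x. Gop N \<Phi> w x - Gop N \<Xi> w x)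
    \<le> (\<Sum>i<N. 4 * h2norm (\<lambda>x. \<Phi> i x - \<Xi> i x) * (h2norm (\<Phi> i) + h2norm (\<Xi> i))) * norm_L2 w"
proof -
  define d where "d i x = \<Phi> i x - \<Xi> i x" for i x
  define t where "t i x = (coul (d i) (\<Phi> i) x * w x + coul (\<Xi> i) (d i) x * w x)
      - (coul (d i) w x * \<Phi> i x + coul (\<Xi> i) w x * d i x)" for i x
  have d: "H2 (d i)" if "i < N" for i unfolding d_def by (intro H2_diff P X that)
  have eq: "Gop N \<Phi> w x - Gop N \<Xi> w x = (\<Sum>i<N. t i x)" for x
    unfolding Gop_coul sum_subtractf[symmetric]
  proof (intro sum.cong refl)
    fix i assume "i \<in> {..<N}"
    then have i: "H2 (\<Phi> i)" "H2 (\<Xi> i)" "L2 (\<Phi> i)" "L2 (\<Xi> i)" using P X by auto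
    show "coul (\<Phi> i) (\<Phi> i) x * w x - coul (\<Phi> i) w x * \<Phi> i x - (coul (\<Xi> i) (\<Xi> i) x * w x - coul (\<Xi> i) w x * \<Xi> i x) = t i x"
      unfolding t_def d_def[abs_def] coul_diff_left[OF i(1,2) i(3)] coul_diff_left[OF i(1,2) w] coul_diff_right[OF i(2) i(3,4)]
      by (simp add: algebra_simps)
  qed
  have tb: "L2 (t i) \<and> norm_L2 (t i) \<le> 4 * h2norm (d i) * (h2norm (\<Phi> i) + h2norm (\<Xi> i)) * norm_L2 w" if "i < N" for i
  proof -
    have i: "H2 (\<Phi> i)" "H2 (\<Xi> i)" "L2 (\<Phi> i)" "L2 (\<Xi> i)" "H2 (d i)" "L2 (d i)" using P X d that by auto
    let ?a = "\<lambda>x. coul (d i) (\<Phi> i) x * w x" and ?b = "\<lambda>x. coul (\<Xi> i) (d i) x * w x"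
      and ?c = "\<lambda>x. coul (d i) w x * \<Phi> i x" and ?e = "\<lambda>x. coul (\<Xi> i) w x * d i x"
    have L: "L2 ?a" "L2 ?b" "L2 ?c" "L2 ?e" by (intro L2_coul_mult i w)+
    have a: "norm_L2 ?a \<le> 2 * h2norm (d i) * norm_L2 (\<Phi> i) * norm_L2 w"
      and b: "norm_L2 ?b \<le> 2 * h2norm (\<Xi> i) * norm_L2 (d i) * norm_L2 w"
      and c: "norm_L2 ?c \<le> 2 * h2norm (d i) * norm_L2 w * norm_L2 (\<Phi> i)"
      and e: "norm_L2 ?e \<le> 2 * h2norm (\<Xi> i) * norm_L2 w * norm_L2 (d i)" by (intro L2_coul_mult i w)+
    have p: "h2norm (d i) * norm_L2 (\<Phi> i) * norm_L2 w \<le> h2norm (d i) * h2norm (\<Phi> i) * norm_L2 w"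
      and q: "h2norm (\<Xi> i) * norm_L2 (d i) * norm_L2 w \<le> h2norm (\<Xi> i) * h2norm (d i) * norm_L2 w"
      by (intro mult_right_mono mult_left_mono h2norm_bounds i h2norm_nonneg norm_L2_nonneg)+
    have "norm_L2 (t i) \<le> norm_L2 (\<lambda>x. ?a x + ?b x) + norm_L2 (\<lambda>x. ?c x + ?e x)"
      unfolding t_def by (intro norm_L2_triangle_diff L2_add L)
    also have "\<dots> \<le> (norm_L2 ?a + norm_L2 ?b) + (norm_L2 ?c + norm_L2 ?e)"
      by (intro add_mono norm_L2_triangle L)
    also have "\<dots> \<le> 4 * (h2norm (d i) * h2norm (\<Phi> i) * norm_L2 w) + 4 * (h2norm (\<Xi> i) * h2norm (d i) * norm_L2 w)"
      using a b c e p q by (simp add: mult_ac)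
    also have "\<dots> = 4 * h2norm (d i) * (h2norm (\<Phi> i) + h2norm (\<Xi> i)) * norm_L2 w" by (simp add: algebra_simps)
    finally show ?thesis unfolding t_def using L by (intro conjI L2_diff L2_add) (simp_all add: t_def)
  qed
  have "norm_L2 (\<lambda>x. Gop N \<Phi> w x - Gop N \<Xi> w x) \<le> (\<Sum>i<N. norm_L2 (t i))"
    unfolding eq by (rule norm_L2_sum) (use tb in auto)
  also have "\<dots> \<le> (\<Sum>i<N. 4 * h2norm (d i) * (h2norm (\<Phi> i) + h2norm (\<Xi> i)) * norm_L2 w)"
    using tb by (intro sum_mono) auto
  finally show ?thesis by (simp add: sum_distrib_right d_def[abs_def])
qed

lemma Gop_lin:
  assumes "\<And>i. i < N \<Longrightarrow> H2 (\<Phi> i)" "L2 w" "L2 w'"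
  shows "Gop N \<Phi> (\<lambda>x. w x + c * w' x) x = Gop N \<Phi> w x + c * Gop N \<Phi> w' x"
  unfolding Gop_coul sum_distrib_left sum.distrib[symmetric]
  by (intro sum.cong refl) (use assms in \<open>auto simp: coul_lin_right algebra_simps\<close>)

lemma Gop_cong:
  assumes "\<And>i. i < N \<Longrightarrow> L2 (\<Phi> i) \<and> L2 (\<Psi> i) \<and> ae_eq (\<Phi> i) (\<Psi> i)" "L2 w" "L2 w'" "ae_eq w w'"
  shows "ae_eq (Gop N \<Phi> w) (Gop N \<Psi> w')"
  unfolding Gop_coul[abs_def]
proof (rule ae_eq_sum)
  fix i assume "i \<in> {..<N}"
  then have i: "L2 (\<Phi> i)" "L2 (\<Psi> i)" "ae_eq (\<Phi> i) (\<Psi> i)" using assms by auto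
  have "coul (\<Phi> i) (\<Phi> i) x = coul (\<Psi> i) (\<Psi> i) x" "coul (\<Phi> i) w x = coul (\<Psi> i) w' x" for x
    using coul_cong i assms by metis+
  then show "ae_eq (\<lambda>x. coul (\<Phi> i) (\<Phi> i) x * w x - coul (\<Phi> i) w x * \<Phi> i x) (\<lambda>x. coul (\<Psi> i) (\<Psi> i) x * w' x - coul (\<Psi> i) w' x * \<Psi> i x)"
    using assms(4) i(3) by (auto intro: ae_eq_diff ae_eq_mult)
qed

text \<open>Exchange of the order of integration. Hardy's inequality bounds the inner integral of
  the modulus by a multiple of \<open>cmod (v x * f x)\<close>, which makes the double integral
  absolutely convergent.\<close>

lemma exchange_symmetric:
  assumes f: "H2 f" and v: "L2 v" and w: "L2 w"
  shows "inner_L2 v (\<lambda>x. coul f w x * f x) = inner_L2 (\<lambda>x. coul f v x * f x) w"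
proof -
  define k where "k x y = cnj (v x) * f x * (cnj (f y) * w y / complex_of_real (norm (x - y)))" for x y
  have fL: "L2 f" using f by auto
  have [measurable]: "f \<in> borel_measurable borel" "v \<in> borel_measurable borel" "w \<in> borel_measurable borel"
    using fL v w L2_measurable by auto
  have km: "case_prod k \<in> borel_measurable (lborel \<Otimes>\<^sub>M lborel)"
  proof -
    have "case_prod k \<in> borel_measurable (borel \<Otimes>\<^sub>M borel)" unfolding k_def by measurable
    then show ?thesis
      by (simp add: measurable_cong_sets[OF sets_pair_measure_cong[OF sets_lborel sets_lborel] refl])
  qed
  have ki: "integrable (lborel \<Otimes>\<^sub>M lborel) (case_prod k)"
  proof (rule lborel_pair.Fubini_integrable[OF km])
    show "AE x in lborel. integrable lborel (\<lambda>y. case_prod k (x, y))"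
      unfolding k_def case_prod_conv by (intro AE_I2 integrable_mult_right coul_integrable f w)
    show "integrable lborel (\<lambda>x. LINT y|lborel. norm (case_prod k (x, y)))"
    proof (rule Bochner_Integration.integrable_bound)
      show "integrable lborel (\<lambda>x. 2 * h2norm f * norm_L2 w * cmod (v x * f x))"
        by (intro integrable_mult_right integrable_norm integrable_mult_L2 v fL)
      show "(\<lambda>x. LINT y|lborel. norm (case_prod k (x, y))) \<in> borel_measurable lborel"
      proof -
        have "(\<lambda>(x, y). norm (case_prod k (x, y))) \<in> borel_measurable (lborel \<Otimes>\<^sub>M lborel)"
          using measurable_compose[OF km borel_measurable_norm] by (simp add: case_prod_beta')
        then show ?thesis by (rule lborel.borel_measurable_lebesgue_integral)
      qed
      show "AE x in lborel. norm (LINT y|lborel. norm (case_prod k (x, y))) \<le> norm (2 * h2norm f * norm_L2 w * cmod (v x * f x))"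
      proof (rule AE_I2)
        fix x
        have "(LINT y|lborel. norm (k x y)) = (LINT y|lborel. cmod (v x * f x) * (cmod (f y / complex_of_real (norm (y - x))) * cmod (w y)))"
          by (simp add: k_def norm_mult norm_divide norm_minus_commute)
        also have "\<dots> = cmod (v x * f x) * (LINT y|lborel. cmod (f y / complex_of_real (norm (y - x))) * cmod (w y))"
          by (rule integral_mult_right_zero)
        also have "\<dots> \<le> cmod (v x * f x) * (norm_L2 (\<lambda>y. f y / complex_of_real (norm (y - x))) * norm_L2 w)"
          by (intro mult_left_mono integral_norm_mult_le H2_Hardy f w) auto
        also have "\<dots> \<le> cmod (v x * f x) * (2 * h2norm f * norm_L2 w)"
          by (intro mult_left_mono mult_right_mono H2_Hardy f) auto
        finally show "norm (LINT y|lborel. norm (case_prod k (x, y))) \<le> norm (2 * h2norm f * norm_L2 w * cmod (v x * f x))"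
          by (simp add: mult_ac)
      qed
    qed
  qed
  have "inner_L2 v (\<lambda>x. coul f w x * f x) = (LINT x|lborel. LINT y|lborel. k x y)"
  proof -
    have "(LINT y|lborel. k x y) = cnj (v x) * (coul f w x * f x)" for x
    proof -
      have "(LINT y|lborel. k x y) = cnj (v x) * f x * coul f w x"
        unfolding k_def coul_def by (rule integral_mult_right_zero)
      then show ?thesis by (simp add: mult_ac)
    qed
    then show ?thesis by (simp add: inner_L2_def)
  qed
  also have "\<dots> = (LINT y|lborel. LINT x|lborel. k x y)"
    using lborel_pair.Fubini_integral[OF ki] by simp
  also have "\<dots> = inner_L2 (\<lambda>x. coul f v x * f x) w"
  proof -
    have "(LINT x|lborel. k x y) = cnj (coul f v y * f y) * w y" for y
    proof -
      have "cnj (coul f v y) = (LINT x|lborel. cnj (cnj (f x) * v x / complex_of_real (norm (y - x))))"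
        unfolding coul_def by (rule Bochner_Integration.integral_cnj[symmetric])
      then have "cnj (coul f v y * f y) * w y = (cnj (f y) * w y) * (LINT x|lborel. cnj (cnj (f x) * v x / complex_of_real (norm (y - x))))"
        by (simp add: mult_ac)
      also have "\<dots> = (LINT x|lborel. (cnj (f y) * w y) * cnj (cnj (f x) * v x / complex_of_real (norm (y - x))))"
        by (rule integral_mult_right_zero[symmetric])
      also have "\<dots> = (LINT x|lborel. k x y)"
        by (rule Bochner_Integration.integral_cong) (simp_all add: k_def norm_minus_commute mult_ac)
      finally show ?thesis by simp
    qed
    then show ?thesis by (simp add: inner_L2_def)
  qed
  finally show ?thesis .
qed

lemma Gop_symmetric:
  assumes P: "\<And>i. i < N \<Longrightarrow> H2 (\<Phi> i)" and v: "L2 v" and w: "L2 w"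
  shows "inner_L2 v (Gop N \<Phi> w) = inner_L2 (Gop N \<Phi> v) w"
proof -
  have L: "L2 (\<lambda>x. complex_of_real (Rpot N \<Phi> x) * u x)" "L2 (Sop N \<Phi> u)" if "L2 u" for u
  proof -
    have "L2 (\<lambda>x. \<Sum>i<N. coul (\<Phi> i) (\<Phi> i) x * u x)" "L2 (\<lambda>x. \<Sum>i<N. coul (\<Phi> i) u x * \<Phi> i x)"
      by (intro L2_sum L2_coul_mult; use P that in auto)+
    then show "L2 (\<lambda>x. complex_of_real (Rpot N \<Phi> x) * u x)" "L2 (Sop N \<Phi> u)"
      by (simp_all add: Rpot_coul sum_distrib_right Sop_def coul_def)
  qed
  have S: "inner_L2 v (Sop N \<Phi> w) = inner_L2 (Sop N \<Phi> v) w"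
  proof -
    have "inner_L2 v (Sop N \<Phi> w) = (\<Sum>i<N. inner_L2 v (\<lambda>x. coul (\<Phi> i) w x * \<Phi> i x))"
      unfolding Sop_def coul_def[symmetric] by (intro inner_L2_sum_right L2_coul_mult) (use P v w in auto)
    also have "\<dots> = (\<Sum>i<N. inner_L2 (\<lambda>x. coul (\<Phi> i) v x * \<Phi> i x) w)"
      using P v w by (intro sum.cong refl exchange_symmetric) auto
    also have "\<dots> = inner_L2 (Sop N \<Phi> v) w"
      unfolding Sop_def coul_def[symmetric] by (intro inner_L2_sum_left[symmetric] L2_coul_mult) (use P v w in auto)
    finally show ?thesis .
  qed
  have R: "inner_L2 v (\<lambda>x. complex_of_real (Rpot N \<Phi> x) * w x) = inner_L2 (\<lambda>x. complex_of_real (Rpot N \<Phi> x) * v x) w"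
    by (simp add: inner_L2_def mult_ac)
  have "inner_L2 v (Gop N \<Phi> w) = inner_L2 v (\<lambda>x. complex_of_real (Rpot N \<Phi> x) * w x) - inner_L2 v (Sop N \<Phi> w)"
    unfolding Gop_def by (intro inner_L2_diff_right L v w)
  moreover have "inner_L2 w (Gop N \<Phi> v) = inner_L2 w (\<lambda>x. complex_of_real (Rpot N \<Phi> x) * v x) - inner_L2 w (Sop N \<Phi> v)"
    unfolding Gop_def by (intro inner_L2_diff_right L v w)
  then have "inner_L2 (Gop N \<Phi> v) w = inner_L2 (\<lambda>x. complex_of_real (Rpot N \<Phi> x) * v x) w - inner_L2 (Sop N \<Phi> v) w"
    by (metis complex_cnj_diff inner_L2_cnj)
  ultimately show ?thesis using R S by simp
qed

section \<open>The Fock operator with domain \<open>H2\<close>\<close>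

lemma Vpot_H2:
  assumes "H2 w"
  shows "L2 (\<lambda>x. complex_of_real (Vpot n R Z x) * w x)"
    "norm_L2 (\<lambda>x. complex_of_real (Vpot n R Z x) * w x) \<le> (\<Sum>l<n. 2 * \<bar>Z l\<bar>) * h2norm w"
proof -
  have eq: "(\<lambda>x. complex_of_real (Vpot n R Z x) * w x) = (\<lambda>x. \<Sum>l<n. complex_of_real (- Z l) * (w x / complex_of_real (norm (x - R l))))"
    by (rule ext) (simp add: Vpot_def sum_negf mult.commute[of _ "w _"] sum_distrib_left)
  have L: "L2 (\<lambda>x. complex_of_real (- Z l) * (w x / complex_of_real (norm (x - R l))))" for l
    by (intro L2_mult_const H2_Hardy assms)
  show "L2 (\<lambda>x. complex_of_real (Vpot n R Z x) * w x)" unfolding eq by (intro L2_sum L)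
  have "norm_L2 (\<lambda>x. complex_of_real (Vpot n R Z x) * w x)
      \<le> (\<Sum>l<n. norm_L2 (\<lambda>x. complex_of_real (- Z l) * (w x / complex_of_real (norm (x - R l)))))"
    unfolding eq by (intro norm_L2_sum L)
  also have "\<dots> \<le> (\<Sum>l<n. 2 * \<bar>Z l\<bar> * h2norm w)"
  proof (rule sum_mono)
    fix l
    have "norm_L2 (\<lambda>x. complex_of_real (- Z l) * (w x / complex_of_real (norm (x - R l))))
        = \<bar>Z l\<bar> * norm_L2 (\<lambda>x. w x / complex_of_real (norm (x - R l)))"
      unfolding norm_L2_mult_const by simp
    also have "\<dots> \<le> \<bar>Z l\<bar> * (2 * h2norm w)" by (intro mult_left_mono H2_Hardy assms) auto
    finally show "norm_L2 (\<lambda>x. complex_of_real (- Z l) * (w x / complex_of_real (norm (x - R l)))) \<le> 2 * \<bar>Z l\<bar> * h2norm w"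
      by simp
  qed
  finally show "norm_L2 (\<lambda>x. complex_of_real (Vpot n R Z x) * w x) \<le> (\<Sum>l<n. 2 * \<bar>Z l\<bar>) * h2norm w"
    by (simp add: sum_distrib_right)
qed

definition H2tup :: "nat \<Rightarrow> tup \<Rightarrow> bool" where
  "H2tup N \<Phi> \<longleftrightarrow> (\<forall>i<N. H2 (\<Phi> i))"

lemma inW_H2tup: "inW N \<Phi> \<Longrightarrow> H2tup N \<Phi>"
  by (simp add: inW_def H2tup_def)

lemma Fock_eq: "Fock n R Z N \<Phi> w = (\<lambda>x. - lap w x + complex_of_real (Vpot n R Z x) * w x + Gop N \<Phi> w x)"
  by (simp add: Fock_def hop_def)

lemma L2_Fock: "H2tup N \<Phi> \<Longrightarrow> H2 w \<Longrightarrow> L2 (Fock n R Z N \<Phi> w)"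
  unfolding Fock_eq by (intro L2_add L2_minus L2_lap Vpot_H2 L2_Gop) (auto simp: H2tup_def)

lemma Fock_bound:
  assumes "H2tup N \<Phi>"
  obtains C where "C \<ge> 0" "\<And>w. H2 w \<Longrightarrow> norm_L2 (Fock n R Z N \<Phi> w) \<le> C * h2norm w"
proof -
  \<comment> \<open>The zero tuple generates no interaction, so \<open>Gop_difference\<close>
    against it bounds \<open>Gop N \<Phi>\<close> itself.\<close>
  define c where "c = (\<Sum>i<N. 4 * h2norm (\<lambda>x. \<Phi> i x - 0) * (h2norm (\<Phi> i) + h2norm (\<lambda>x. 0)))"
  have c0: "c \<ge> 0" unfolding c_def by (intro sum_nonneg mult_nonneg_nonneg add_nonneg_nonneg) auto
  have P: "\<And>i. i < N \<Longrightarrow> H2 (\<Phi> i)" using assms by (simp add: H2tup_def)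
  have G0: "Gop N (\<lambda>i x. 0) w x = 0" for w x by (simp add: Gop_coul coul_def)
  show thesis
  proof (rule that[of "1 + (\<Sum>l<n. 2 * \<bar>Z l\<bar>) + c"])
    show "1 + (\<Sum>l<n. 2 * \<bar>Z l\<bar>) + c \<ge> 0" using c0 by (intro add_nonneg_nonneg sum_nonneg) auto
    fix w assume w: "H2 w"
    have wL: "L2 w" using w by auto
    have L: "L2 (\<lambda>x. - lap w x)" "L2 (\<lambda>x. complex_of_real (Vpot n R Z x) * w x)" "L2 (Gop N \<Phi> w)"
      by (intro L2_minus L2_lap Vpot_H2 L2_Gop w P wL)+
    have 1: "norm_L2 (\<lambda>x. - lap w x) \<le> h2norm w" using h2norm_bounds(2)[OF w] by (simp add: norm_L2_def)
    have "norm_L2 (\<lambda>x. Gop N \<Phi> w x - Gop N (\<lambda>i x. 0) w x) \<le> c * norm_L2 w"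
      unfolding c_def by (rule Gop_difference[OF P H2_zero wL])
    also have "\<dots> \<le> c * h2norm w" by (intro mult_left_mono h2norm_bounds w c0)
    finally have 2: "norm_L2 (Gop N \<Phi> w) \<le> c * h2norm w" by (simp add: G0)
    have "norm_L2 (Fock n R Z N \<Phi> w) \<le> norm_L2 (\<lambda>x. - lap w x + complex_of_real (Vpot n R Z x) * w x) + norm_L2 (Gop N \<Phi> w)"
      unfolding Fock_eq by (intro norm_L2_triangle L2_add L)
    also have "\<dots> \<le> (norm_L2 (\<lambda>x. - lap w x) + norm_L2 (\<lambda>x. complex_of_real (Vpot n R Z x) * w x)) + norm_L2 (Gop N \<Phi> w)"
      by (intro add_right_mono norm_L2_triangle L)
    also have "\<dots> \<le> (h2norm w + (\<Sum>l<n. 2 * \<bar>Z l\<bar>) * h2norm w) + c * h2norm w"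
      by (intro add_mono 1 2 Vpot_H2 w)
    finally show "norm_L2 (Fock n R Z N \<Phi> w) \<le> (1 + (\<Sum>l<n. 2 * \<bar>Z l\<bar>) + c) * h2norm w"
      by (simp add: algebra_simps)
  qed
qed

lemma Fock_lin:
  assumes "H2tup N \<Phi>" "H2 w" "H2 w'"
  shows "ae_eq (Fock n R Z N \<Phi> (\<lambda>x. w x + c * w' x)) (\<lambda>x. Fock n R Z N \<Phi> w x + c * Fock n R Z N \<Phi> w' x)"
proof -
  have G: "Gop N \<Phi> (\<lambda>x. w x + c * w' x) x = Gop N \<Phi> w x + c * Gop N \<Phi> w' x" for x
    using assms by (intro Gop_lin) (auto simp: H2tup_def)
  show ?thesis
    using lap_lin[OF assms(2,3), of c] unfolding ae_eq_def Fock_eq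
    by (rule eventually_mono) (simp add: G algebra_simps)
qed

lemma Fock_cong:
  assumes "\<And>i. i < N \<Longrightarrow> L2 (\<Phi> i) \<and> L2 (\<Psi> i) \<and> ae_eq (\<Phi> i) (\<Psi> i)" "H2 w" "H2 w'" "ae_eq w w'"
  shows "ae_eq (Fock n R Z N \<Phi> w) (Fock n R Z N \<Psi> w')"
proof -
  have "ae_eq (Gop N \<Phi> w) (Gop N \<Psi> w')" by (rule Gop_cong) (use assms in auto)
  moreover have "ae_eq (\<lambda>x. - lap w x) (\<lambda>x. - lap w' x)"
    using lap_cong[OF assms(2-4)] by (auto simp: ae_eq_def)
  ultimately show ?thesis unfolding Fock_eq using assms(4) by (intro ae_eq_add ae_eq_mult) auto
qed

lemma Fock_symmetric:
  assumes P: "H2tup N \<Phi>" and v: "H2 v" and w: "H2 w"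
  shows "inner_L2 v (Fock n R Z N \<Phi> w) = inner_L2 (Fock n R Z N \<Phi> v) w"
proof -
  have L: "L2 (\<lambda>x. - lap u x)" "L2 (\<lambda>x. complex_of_real (Vpot n R Z x) * u x)" "L2 (Gop N \<Phi> u)" "L2 u" if "H2 u" for u
    by (intro L2_minus L2_lap Vpot_H2 L2_Gop that H2_L2; use P in \<open>auto simp: H2tup_def\<close>)+
  have exp: "inner_L2 a (Fock n R Z N \<Phi> b) = inner_L2 a (\<lambda>x. - lap b x)
      + inner_L2 a (\<lambda>x. complex_of_real (Vpot n R Z x) * b x) + inner_L2 a (Gop N \<Phi> b)" if "H2 a" "H2 b" for a b
    unfolding Fock_eq
    by (simp only: inner_L2_add_right[OF L2_add[OF L(1,2)[OF that(2)]] L(3)[OF that(2)] L(4)[OF that(1)]]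
        inner_L2_add_right[OF L(1,2)[OF that(2)] L(4)[OF that(1)]])
  have m: "inner_L2 a (\<lambda>x. - lap b x) = - inner_L2 a (lap b)" for a b by (simp add: inner_L2_def)
  have "inner_L2 v (\<lambda>x. - lap w x) = cnj (inner_L2 w (\<lambda>x. - lap v x))"
    unfolding m by (simp add: inner_L2_cnj lap_symmetric[OF w v])
  moreover have "inner_L2 v (\<lambda>x. complex_of_real (Vpot n R Z x) * w x) = cnj (inner_L2 w (\<lambda>x. complex_of_real (Vpot n R Z x) * v x))"
    unfolding inner_L2_cnj by (simp add: inner_L2_def mult_ac)
  moreover have "inner_L2 v (Gop N \<Phi> w) = cnj (inner_L2 w (Gop N \<Phi> v))"
    unfolding inner_L2_cnj using Gop_symmetric[of N \<Phi> v w] P v w by (auto simp: H2tup_def)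
  ultimately have "inner_L2 v (Fock n R Z N \<Phi> w) = cnj (inner_L2 w (Fock n R Z N \<Phi> v))"
    unfolding exp[OF v w] exp[OF w v] by simp
  then show ?thesis by (simp only: inner_L2_cnj)
qed

lemma Fock_difference:
  assumes "H2tup N \<Phi>" "H2tup N \<Xi>" "H2 w"
  shows "norm_L2 (\<lambda>x. Fock n R Z N \<Phi> w x - Fock n R Z N \<Xi> w x)
    \<le> (\<Sum>i<N. 4 * h2norm (\<lambda>x. \<Phi> i x - \<Xi> i x) * (h2norm (\<Phi> i) + h2norm (\<Xi> i))) * norm_L2 w"
  using Gop_difference[of N \<Phi> \<Xi> w] assms by (auto simp: Fock_eq H2tup_def)

section \<open>Passage from functions to equivalence classes\<close>

definition H2cls :: "l2 set" where
  "H2cls = {cls u |u. H2 u}"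

text \<open>Evaluated on a chosen representative; that the choice is immaterial for Fock operators
  on \<open>H2cls\<close> is \<open>lift_Fock\<close>.\<close>

definition lift_op :: "(fn3 \<Rightarrow> fn3) \<Rightarrow> l2 \<Rightarrow> l2" where
  "lift_op T x = cls (T (rep_l2 x))"

lemma H2_rep: "x \<in> H2cls \<Longrightarrow> H2 (rep_l2 x)"
  unfolding H2cls_def using H2_cong rep_l2(1) rep_cls ae_eq_sym by blast

lemma cls_in_H2cls: "H2 u \<Longrightarrow> cls u \<in> H2cls"
  by (auto simp: H2cls_def)

lemma lift_Fock:
  assumes "H2tup N \<Phi>" "H2 u"
  shows "lift_op (Fock n R Z N \<Phi>) (cls u) = cls (Fock n R Z N \<Phi> u)"
proof -
  have r: "H2 (rep_l2 (cls u))" using assms cls_in_H2cls H2_rep by blast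
  have "ae_eq (Fock n R Z N \<Phi> (rep_l2 (cls u))) (Fock n R Z N \<Phi> u)"
    by (rule Fock_cong) (use assms r rep_cls in \<open>auto simp: H2tup_def\<close>)
  then show ?thesis unfolding lift_op_def using cls_eq_iff[OF L2_Fock[OF assms(1) r] L2_Fock[OF assms]] by simp
qed

lemma sym_op_Fock:
  assumes P: "H2tup N \<Phi>"
  shows "sym_op H2cls (lift_op (Fock n R Z N \<Phi>))"
proof
  let ?T = "lift_op (Fock n R Z N \<Phi>)"
  have lin: "cls u + c *\<^sub>R cls v = cls (\<lambda>x. u x + complex_of_real c * v x)" if "L2 u" "L2 v" for u v c
    using that by (simp add: cls_scaleR cls_add L2_mult_const)
  have Tlin: "cls u + c *\<^sub>R cls v \<in> H2cls \<and> ?T (cls u + c *\<^sub>R cls v) = ?T (cls u) + c *\<^sub>R ?T (cls v)" if u: "H2 u" and v: "H2 v" for u v c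
  proof -
    have L: "L2 u" "L2 v" "L2 (Fock n R Z N \<Phi> u)" "L2 (Fock n R Z N \<Phi> v)" using u v L2_Fock[OF P] by auto
    have H: "H2 (\<lambda>x. u x + complex_of_real c * v x)" by (intro H2_lin u v)
    have "?T (cls u + c *\<^sub>R cls v) = cls (Fock n R Z N \<Phi> (\<lambda>x. u x + complex_of_real c * v x))"
      unfolding lin[OF L(1,2)] by (rule lift_Fock[OF P H])
    also have "\<dots> = cls (\<lambda>x. Fock n R Z N \<Phi> u x + complex_of_real c * Fock n R Z N \<Phi> v x)"
      using Fock_lin[OF P u v] L2_Fock[OF P H] L by (subst cls_eq_iff) (auto intro: L2_add L2_mult_const)
    finally show ?thesis
      unfolding lin[OF L(1,2)] lift_Fock[OF P u] lift_Fock[OF P v] lin[OF L(3,4)] using cls_in_H2cls[OF H] by simp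
  qed
  have z: "0 \<in> H2cls" using cls_in_H2cls[OF H2_zero] by (simp add: cls_zero)
  have T0: "?T 0 = 0" using Tlin[OF H2_zero H2_zero, of 1] by (simp add: cls_zero)
  have sc: "c *\<^sub>R x \<in> H2cls \<and> ?T (c *\<^sub>R x) = c *\<^sub>R ?T x" if "x \<in> H2cls" for c x
    using that Tlin[OF H2_zero, of _ c] T0 by (auto simp: H2cls_def cls_zero)
  have ad: "x + y \<in> H2cls \<and> ?T (x + y) = ?T x + ?T y" if "x \<in> H2cls" "y \<in> H2cls" for x y
    using that Tlin[of _ _ 1] by (auto simp: H2cls_def)
  show "subspace H2cls" by (rule subspaceI) (use z sc ad in auto)
  show "?T (x + y) = ?T x + ?T y" if "x \<in> H2cls" "y \<in> H2cls" for x y using ad[OF that] by simp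
  show "?T (c *\<^sub>R x) = c *\<^sub>R ?T x" if "x \<in> H2cls" for c x using sc[OF that] by simp
  show "?T x \<bullet> y = x \<bullet> ?T y" if xy: "x \<in> H2cls" "y \<in> H2cls" for x y
  proof -
    obtain u v where u: "x = cls u" "H2 u" and v: "y = cls v" "H2 v" using xy by (auto simp: H2cls_def)
    show ?thesis unfolding u(1) v(1) lift_Fock[OF P u(2)] lift_Fock[OF P v(2)]
      using Fock_symmetric[OF P u(2) v(2)] L2_Fock[OF P] u v by (simp add: cls_inner H2_L2)
  qed
qed

text \<open>The bridge between the functionwise spectrum and the abstract theory; the two halves of
  bijectivity are matched separately, each up to null sets.\<close>

lemma spec_iff_resolvent_set:
  assumes P: "H2tup N \<Phi>"
  shows "lam \<in> spec (Fock n R Z N \<Phi>) \<longleftrightarrow> lam \<notin> resolvent_set H2cls (lift_op (Fock n R Z N \<Phi>))"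
proof -
  let ?F = "Fock n R Z N \<Phi>" and ?T = "lift_op (Fock n R Z N \<Phi>)"
  interpret sym_op H2cls ?T by (rule sym_op_Fock[OF P])
  have eq: "?T (cls u) - lam *\<^sub>R cls u = cls (\<lambda>x. ?F u x - of_real lam * u x)" if "H2 u" for u
    using that L2_Fock[OF P that] H2_L2[OF that] by (simp add: lift_Fock[OF P that] cls_scaleR cls_diff L2_mult_const)
  have L: "L2 (\<lambda>x. ?F u x - of_real lam * u x)" if "H2 u" for u
    using that L2_Fock[OF P that] by (intro L2_diff L2_mult_const) auto
  have surj: "(\<forall>g. L2 g \<longrightarrow> (\<exists>u. H2 u \<and> ae_eq (\<lambda>x. ?F u x - of_real lam * u x) g)) \<longleftrightarrow> (\<lambda>x. ?T x - lam *\<^sub>R x) ` H2cls = UNIV"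
  proof
    assume a: "\<forall>g. L2 g \<longrightarrow> (\<exists>u. H2 u \<and> ae_eq (\<lambda>x. ?F u x - of_real lam * u x) g)"
    have "y \<in> (\<lambda>x. ?T x - lam *\<^sub>R x) ` H2cls" for y
    proof -
      obtain u where u: "H2 u" "ae_eq (\<lambda>x. ?F u x - of_real lam * u x) (rep_l2 y)" using a rep_l2(1) by blast
      then have "cls (\<lambda>x. ?F u x - of_real lam * u x) = y" using cls_eq_iff[OF L[OF u(1)] rep_l2(1)] by simp
      then have "y = ?T (cls u) - lam *\<^sub>R cls u" using eq[OF u(1)] by simp
      then show ?thesis using cls_in_H2cls[OF u(1)] by blast
    qed
    then show "(\<lambda>x. ?T x - lam *\<^sub>R x) ` H2cls = UNIV" by blast
  next
    assume a: "(\<lambda>x. ?T x - lam *\<^sub>R x) ` H2cls = UNIV"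
    show "\<forall>g. L2 g \<longrightarrow> (\<exists>u. H2 u \<and> ae_eq (\<lambda>x. ?F u x - of_real lam * u x) g)"
    proof (intro allI impI)
      fix g assume g: "L2 g"
      have "cls g \<in> (\<lambda>x. ?T x - lam *\<^sub>R x) ` H2cls" using a by simp
      then obtain u where u: "H2 u" "cls g = ?T (cls u) - lam *\<^sub>R cls u" by (auto simp: H2cls_def)
      then show "\<exists>u. H2 u \<and> ae_eq (\<lambda>x. ?F u x - of_real lam * u x) g"
        using cls_eq_iff[OF L[OF u(1)] g] eq[OF u(1)] by auto
    qed
  qed
  have inj: "(\<forall>u. H2 u \<and> ae_eq (\<lambda>x. ?F u x - of_real lam * u x) (\<lambda>x. 0) \<longrightarrow> ae_eq u (\<lambda>x. 0)) \<longleftrightarrow> inj_on (\<lambda>x. ?T x - lam *\<^sub>R x) H2cls"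
  proof
    assume a: "\<forall>u. H2 u \<and> ae_eq (\<lambda>x. ?F u x - of_real lam * u x) (\<lambda>x. 0) \<longrightarrow> ae_eq u (\<lambda>x. 0)"
    show "inj_on (\<lambda>x. ?T x - lam *\<^sub>R x) H2cls"
    proof (rule inj_onI)
      fix x y assume xy: "x \<in> H2cls" "y \<in> H2cls" "?T x - lam *\<^sub>R x = ?T y - lam *\<^sub>R y"
      have "x - y \<in> H2cls" using xy sub subspace_diff by blast
      then obtain u where u: "H2 u" "x - y = cls u" by (auto simp: H2cls_def)
      have "?T (x - y) - lam *\<^sub>R (x - y) = (?T x - lam *\<^sub>R x) - (?T y - lam *\<^sub>R y)"
        unfolding diff[OF xy(1,2)] by (simp add: scaleR_right_diff_distrib)
      then have "cls (\<lambda>x. ?F u x - of_real lam * u x) = cls (\<lambda>x. 0)" using xy(3) eq[OF u(1)] u(2) by (simp add: cls_zero)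
      then have "ae_eq u (\<lambda>x. 0)" using a u(1) cls_eq_iff[OF L[OF u(1)] L2_zero] by blast
      then have "cls u = 0" using cls_eq_iff[OF H2_L2[OF u(1)] L2_zero] by (simp add: cls_zero)
      then show "x = y" using u(2) by simp
    qed
  next
    assume a: "inj_on (\<lambda>x. ?T x - lam *\<^sub>R x) H2cls"
    show "\<forall>u. H2 u \<and> ae_eq (\<lambda>x. ?F u x - of_real lam * u x) (\<lambda>x. 0) \<longrightarrow> ae_eq u (\<lambda>x. 0)"
    proof (intro allI impI)
      fix u assume u: "H2 u \<and> ae_eq (\<lambda>x. ?F u x - of_real lam * u x) (\<lambda>x. 0)"
      then have "?T (cls u) - lam *\<^sub>R cls u = 0"
        using eq[of u] cls_eq_iff[OF L[of u] L2_zero] by (simp add: cls_zero)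
      moreover have "?T 0 - lam *\<^sub>R 0 = 0" using scale[of 0 0] subspace_0[OF sub] by simp
      ultimately have "cls u = 0"
        using inj_onD[OF a, of "cls u" 0] u cls_in_H2cls[of u] subspace_0[OF sub] by simp
      then show "ae_eq u (\<lambda>x. 0)" using cls_eq_iff[of u "\<lambda>x. 0"] u by (auto simp: cls_zero)
    qed
  qed
  show ?thesis unfolding spec_def mem_Collect_eq resolvent_set_def bij_betw_def surj inj by blast
qed

lemma eigvec_iff:
  assumes P: "H2tup N \<Phi>" and u: "H2 u"
  shows "eigvec (Fock n R Z N \<Phi>) lam u \<longleftrightarrow> lift_op (Fock n R Z N \<Phi>) (cls u) = lam *\<^sub>R cls u"
proof -
  have "cls (Fock n R Z N \<Phi> u) = cls (\<lambda>x. of_real lam * u x) \<longleftrightarrow> ae_eq (Fock n R Z N \<Phi> u) (\<lambda>x. of_real lam * u x)"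
    by (rule cls_eq_iff[OF L2_Fock[OF P u] L2_mult_const[OF H2_L2[OF u]]])
  then show ?thesis using u by (simp add: eigvec_def lift_Fock[OF P u] cls_scaleR[OF H2_L2[OF u]])
qed

section \<open>Unitary matrices and spans\<close>

text \<open>A one-sided inverse of a square matrix is two-sided: \<open>P = U\<^sup>* U\<close> satisfies \<open>tr ((P - 1)\<^sup>2) = 0\<close>.\<close>

lemma unitary_if_rows_orthonormal:
  assumes U: "\<And>i j. i < N \<Longrightarrow> j < N \<Longrightarrow> (\<Sum>l<N. U i l * cnj (U j l)) = (if i = j then 1 else (0::complex))"
  shows "unitary_mat N U"
proof -
  define P where "P i j = (\<Sum>l<N. cnj (U l i) * U l j)" for i j
  define \<delta> where "\<delta> i j = (if i = j then 1 else (0::complex))" for i j :: nat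
  have herm: "cnj (P i j) = P j i" for i j by (simp add: P_def mult.commute)
  have tr: "(\<Sum>i<N. P i i) = of_nat N"
  proof -
    have "(\<Sum>i<N. P i i) = (\<Sum>l<N. \<Sum>i<N. U l i * cnj (U l i))"
      unfolding P_def by (subst sum.swap) (simp add: mult.commute)
    also have "\<dots> = (\<Sum>l<N. 1)" using U by (intro sum.cong) auto
    finally show ?thesis by simp
  qed
  have tr2: "(\<Sum>i<N. \<Sum>j<N. P i j * P j i) = of_nat N"
  proof -
    have "(\<Sum>i<N. \<Sum>j<N. P i j * P j i)
        = (\<Sum>i<N. \<Sum>j<N. \<Sum>l<N. \<Sum>m<N. (U l j * cnj (U m j)) * (U m i * cnj (U l i)))"
      unfolding P_def sum_product by (simp add: mult_ac)
    also have "\<dots> = (\<Sum>i<N. \<Sum>l<N. \<Sum>m<N. \<Sum>j<N. (U l j * cnj (U m j)) * (U m i * cnj (U l i)))"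
    proof (rule sum.cong[OF refl])
      fix i
      show "(\<Sum>j<N. \<Sum>l<N. \<Sum>m<N. (U l j * cnj (U m j)) * (U m i * cnj (U l i)))
        = (\<Sum>l<N. \<Sum>m<N. \<Sum>j<N. (U l j * cnj (U m j)) * (U m i * cnj (U l i)))"
        by (rule trans[OF sum.swap], rule sum.cong[OF refl], rule sum.swap)
    qed
    also have "\<dots> = (\<Sum>i<N. \<Sum>l<N. U l i * cnj (U l i))"
    proof (intro sum.cong refl)
      fix i l assume l: "l \<in> {..<N}"
      have "(\<Sum>m<N. \<Sum>j<N. (U l j * cnj (U m j)) * (U m i * cnj (U l i)))
          = (\<Sum>m<N. (\<Sum>j<N. U l j * cnj (U m j)) * (U m i * cnj (U l i)))" by (simp add: sum_distrib_right)
      also have "\<dots> = (\<Sum>m<N. if l = m then U m i * cnj (U l i) else 0)"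
        using U l by (intro sum.cong) auto
      also have "\<dots> = U l i * cnj (U l i)" using l by simp
      finally show "(\<Sum>m<N. \<Sum>j<N. (U l j * cnj (U m j)) * (U m i * cnj (U l i))) = U l i * cnj (U l i)" .
    qed
    also have "\<dots> = (\<Sum>l<N. \<Sum>i<N. U l i * cnj (U l i))" by (rule sum.swap)
    also have "\<dots> = (\<Sum>l<N. 1)" using U by (intro sum.cong) auto
    finally show ?thesis by simp
  qed
  \<comment> \<open>Since \<open>P\<close> is Hermitian, the squared moduli of the entries of
    \<open>P - 1\<close> sum to the trace of its square, here \<open>N - 2 * N + N\<close>.\<close>
  have "(\<Sum>i<N. \<Sum>j<N. complex_of_real ((cmod (P i j - \<delta> i j))\<^sup>2)) = (\<Sum>i<N. \<Sum>j<N. P i j * P j i - (\<delta> i j * P i j + \<delta> i j * P j i) + \<delta> i j)"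
  proof (intro sum.cong refl)
    fix i j
    show "complex_of_real ((cmod (P i j - \<delta> i j))\<^sup>2) = P i j * P j i - (\<delta> i j * P i j + \<delta> i j * P j i) + \<delta> i j"
      unfolding complex_norm_square complex_cnj_diff herm by (simp add: \<delta>_def algebra_simps)
  qed
  also have "\<dots> = (\<Sum>i<N. \<Sum>j<N. P i j * P j i) - ((\<Sum>i<N. \<Sum>j<N. \<delta> i j * P i j) + (\<Sum>i<N. \<Sum>j<N. \<delta> i j * P j i)) + (\<Sum>i<N. \<Sum>j<N. \<delta> i j)"
    by (simp add: sum.distrib sum_subtractf)
  also have "(\<Sum>i<N. \<Sum>j<N. \<delta> i j * P i j) = (\<Sum>i<N. P i i)"
    by (intro sum.cong refl) (simp add: \<delta>_def if_distrib[where f="\<lambda>x. x * _"] cong: if_cong)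
  also have "(\<Sum>i<N. \<Sum>j<N. \<delta> i j * P j i) = (\<Sum>i<N. P i i)"
    by (intro sum.cong refl) (simp add: \<delta>_def if_distrib[where f="\<lambda>x. x * _"] cong: if_cong)
  also have "(\<Sum>i<N. \<Sum>j<N. \<delta> i j) = of_nat N" by (simp add: \<delta>_def)
  finally have "complex_of_real (\<Sum>i<N. \<Sum>j<N. (cmod (P i j - \<delta> i j))\<^sup>2) = 0" by (simp add: tr tr2)
  then have z: "(\<Sum>i<N. \<Sum>j<N. (cmod (P i j - \<delta> i j))\<^sup>2) = 0" by (simp only: of_real_eq_0_iff)
  have "P i j = \<delta> i j" if "i < N" "j < N" for i j
  proof -
    have "(\<Sum>j<N. (cmod (P i j - \<delta> i j))\<^sup>2) = 0"
      using z that(1) by (subst (asm) sum_nonneg_eq_0_iff) (auto intro: sum_nonneg)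
    then have "(cmod (P i j - \<delta> i j))\<^sup>2 = 0"
      using that(2) by (subst (asm) sum_nonneg_eq_0_iff) auto
    then show ?thesis by simp
  qed
  then show ?thesis by (simp add: unitary_mat_def P_def \<delta>_def)
qed

text \<open>The conjugate transpose of \<open>A\<close> has orthonormal rows, so
  \<open>unitary_if_rows_orthonormal\<close> applies to it.\<close>

lemma unitary_rows:
  assumes "unitary_mat N A" "i < N" "j < N"
  shows "(\<Sum>l<N. A i l * cnj (A j l)) = (if i = j then 1 else 0)"
proof -
  have "unitary_mat N (\<lambda>i j. cnj (A j i))"
    by (rule unitary_if_rows_orthonormal) (use assms(1) in \<open>auto simp: unitary_mat_def\<close>)
  then show ?thesis using assms(2,3) by (simp add: unitary_mat_def)
qed

lemma unitary_entry_le: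
  assumes "unitary_mat N A" "i < N" "j < N" shows "cmod (A i j) \<le> 1"
proof -
  have "(\<Sum>l<N. cnj (A l j) * A l j) = 1" using assms by (auto simp: unitary_mat_def)
  moreover have "(\<Sum>l<N. cnj (A l j) * A l j) = complex_of_real (\<Sum>l<N. (cmod (A l j))\<^sup>2)"
    unfolding of_real_sum complex_norm_square by (simp add: mult.commute)
  ultimately have "(\<Sum>l<N. (cmod (A l j))\<^sup>2) = 1" by (metis of_real_eq_1_iff)
  moreover have "(cmod (A i j))\<^sup>2 \<le> (\<Sum>l<N. (cmod (A l j))\<^sup>2)" using assms by (intro member_le_sum) auto
  ultimately show ?thesis using power2_le_imp_le[of "cmod (A i j)" 1] by simp
qed

text \<open>Read with \<open>a\<close> and \<open>b\<close> as the values of the orbitals at two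
  points, this is the invariance of the density kernel under rotations.\<close>

lemma unitary_kernel:
  assumes "unitary_mat N A"
  shows "(\<Sum>i<N. cnj (\<Sum>l<N. A i l * a l) * (\<Sum>l<N. A i l * b l)) = (\<Sum>l<N. cnj (a l) * b l)"
proof -
  have "(\<Sum>i<N. cnj (\<Sum>l<N. A i l * a l) * (\<Sum>l<N. A i l * b l))
      = (\<Sum>i<N. \<Sum>l<N. \<Sum>m<N. (cnj (A i l) * A i m) * (cnj (a l) * b m))"
    unfolding cnj_sum sum_product by (simp add: mult_ac)
  also have "\<dots> = (\<Sum>l<N. \<Sum>m<N. \<Sum>i<N. (cnj (A i l) * A i m) * (cnj (a l) * b m))"
    by (rule trans[OF sum.swap], rule sum.cong[OF refl], rule sum.swap)
  also have "\<dots> = (\<Sum>l<N. \<Sum>m<N. if l = m then cnj (a l) * b m else 0)"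
  proof (intro sum.cong refl)
    fix l m assume "l \<in> {..<N}" "m \<in> {..<N}"
    then have "(\<Sum>i<N. cnj (A i l) * A i m) = (if l = m then 1 else 0)" using assms by (simp add: unitary_mat_def)
    then show "(\<Sum>i<N. (cnj (A i l) * A i m) * (cnj (a l) * b m)) = (if l = m then cnj (a l) * b m else 0)"
      by (simp add: sum_distrib_right[symmetric])
  qed
  finally show ?thesis by simp
qed

lemma unitary_inverse:
  assumes "unitary_mat N A" "i < N"
  shows "(\<Sum>j<N. cnj (A j i) * (\<Sum>l<N. A j l * a l)) = a i"
proof -
  have "(\<Sum>j<N. cnj (A j i) * (\<Sum>l<N. A j l * a l)) = (\<Sum>l<N. (\<Sum>j<N. cnj (A j i) * A j l) * a l)"
    unfolding sum_distrib_left sum_distrib_right by (subst sum.swap) (simp add: mult_ac)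
  also have "\<dots> = (\<Sum>l<N. if i = l then a l else 0)"
    using assms by (intro sum.cong) (auto simp: unitary_mat_def)
  finally show ?thesis using assms(2) by simp
qed

lemma unitary_inverse':
  assumes "unitary_mat N A" "i < N"
  shows "(\<Sum>j<N. A i j * (\<Sum>l<N. cnj (A l j) * a l)) = a i"
proof -
  have "(\<Sum>j<N. A i j * (\<Sum>l<N. cnj (A l j) * a l)) = (\<Sum>l<N. (\<Sum>j<N. A i j * cnj (A l j)) * a l)"
    unfolding sum_distrib_left sum_distrib_right by (subst sum.swap) (simp add: mult_ac)
  also have "\<dots> = (\<Sum>l<N. if i = l then a l else 0)"
    using assms unitary_rows[OF assms(1)] by (intro sum.cong) auto
  finally show ?thesis using assms(2) by simp
qed

lemma inner_lincomb_right:
  assumes "orthonormal_fam N \<Phi>" "i < N"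
  shows "inner_L2 (\<Phi> i) (\<lambda>x. \<Sum>j<N. b j * \<Phi> j x) = b i"
proof -
  have L: "\<And>i. i < N \<Longrightarrow> L2 (\<Phi> i)" using assms by (simp add: orthonormal_fam_def)
  have "inner_L2 (\<Phi> i) (\<lambda>x. \<Sum>j<N. b j * \<Phi> j x) = (\<Sum>j<N. b j * inner_L2 (\<Phi> i) (\<Phi> j))"
    by (subst inner_L2_sum_right) (use L assms in \<open>auto simp: inner_L2_scale_right\<close>)
  also have "\<dots> = (\<Sum>j<N. if i = j then b j else 0)"
    using assms by (intro sum.cong refl) (auto simp: orthonormal_fam_def)
  finally show ?thesis using assms(2) by simp
qed

lemma inner_lincomb:
  assumes P: "orthonormal_fam N \<Phi>"
  shows "inner_L2 (\<lambda>x. \<Sum>i<N. a i * \<Phi> i x) (\<lambda>x. \<Sum>i<N. b i * \<Phi> i x) = (\<Sum>i<N. cnj (a i) * b i)"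
proof -
  have L: "\<And>i. i \<in> {..<N} \<Longrightarrow> L2 (\<Phi> i)" using assms by (simp add: orthonormal_fam_def)
  have "inner_L2 (\<lambda>x. \<Sum>i<N. a i * \<Phi> i x) (\<lambda>x. \<Sum>i<N. b i * \<Phi> i x)
      = (\<Sum>i<N. inner_L2 (\<lambda>x. a i * \<Phi> i x) (\<lambda>x. \<Sum>i<N. b i * \<Phi> i x))"
    by (intro inner_L2_sum_left L2_sum L2_mult_const L)
  also have "\<dots> = (\<Sum>i<N. cnj (a i) * b i)"
    by (intro sum.cong refl) (simp add: inner_L2_scale_left inner_lincomb_right[OF P])
  finally show ?thesis .
qed

lemma inW_orthonormal: "inW N \<Phi> \<Longrightarrow> orthonormal_fam N \<Phi>"
  by (auto simp: inW_def orthonormal_fam_def)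

text \<open>As both families are orthonormal, the matrix of coefficients has orthonormal rows, and
  it is square because both have \<open>N\<close> members.\<close>

lemma span_unitary:
  assumes P: "orthonormal_fam N \<Phi>" and Q: "orthonormal_fam N \<Psi>" and sp: "\<And>i. i < N \<Longrightarrow> in_span N \<Phi> (\<Psi> i)"
  shows "\<exists>A. unitary_mat N A \<and> tup_eq N \<Psi> (mat_act N A \<Phi>)"
proof -
  have "\<exists>c. \<forall>i<N. ae_eq (\<Psi> i) (\<lambda>x. \<Sum>j<N. c i j * \<Phi> j x)"
    using sp unfolding in_span_def by metis
  then obtain c where c: "\<And>i. i < N \<Longrightarrow> ae_eq (\<Psi> i) (\<lambda>x. \<Sum>j<N. c i j * \<Phi> j x)" by blast
  have L: "\<And>i. i < N \<Longrightarrow> L2 (\<Phi> i)" "\<And>i. i < N \<Longrightarrow> L2 (\<Psi> i)" using P Q by (auto simp: orthonormal_fam_def)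
  have Ls: "L2 (\<lambda>x. \<Sum>j<N. d j * \<Phi> j x)" for d by (intro L2_sum L2_mult_const L) auto
  have "(\<Sum>l<N. c i l * cnj (c j l)) = (if i = j then 1 else 0)" if "i < N" "j < N" for i j
  proof -
    have "inner_L2 (\<Psi> j) (\<Psi> i) = inner_L2 (\<lambda>x. \<Sum>l<N. c j l * \<Phi> l x) (\<lambda>x. \<Sum>l<N. c i l * \<Phi> l x)"
      by (intro inner_L2_cong c L Ls that)
    also have "\<dots> = (\<Sum>l<N. cnj (c j l) * c i l)" by (rule inner_lincomb[OF P])
    finally show ?thesis using Q that by (simp add: orthonormal_fam_def mult.commute split: if_splits)
  qed
  then have "unitary_mat N c" by (rule unitary_if_rows_orthonormal)
  then show ?thesis using c by (auto simp: tup_eq_def mat_act_def)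
qed

lemma unitary_in_span: "tup_eq N \<Psi> (mat_act N A \<Phi>) \<Longrightarrow> i < N \<Longrightarrow> in_span N \<Phi> (\<Psi> i)"
  unfolding tup_eq_def mat_act_def in_span_def by (intro exI[of _ "A i"]) simp

lemma unitary_in_span_sym:
  assumes A: "unitary_mat N A" and eq: "tup_eq N \<Psi> (mat_act N A \<Phi>)" and i: "i < N"
  shows "in_span N \<Psi> (\<Phi> i)"
  unfolding in_span_def
proof (intro exI)
  have "ae_eq (\<lambda>x. \<Sum>j<N. cnj (A j i) * \<Psi> j x) (\<lambda>x. \<Sum>j<N. cnj (A j i) * mat_act N A \<Phi> j x)"
    by (intro ae_eq_sum ae_eq_mult) (use eq in \<open>auto simp: tup_eq_def\<close>)
  then show "ae_eq (\<Phi> i) (\<lambda>x. \<Sum>j<N. cnj (A j i) * \<Psi> j x)"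
    unfolding mat_act_def unitary_inverse[OF A i] by (rule ae_eq_sym)
qed

lemma in_span_trans:
  assumes "in_span N \<Phi> u" "\<And>i. i < N \<Longrightarrow> in_span N \<Psi> (\<Phi> i)"
  shows "in_span N \<Psi> u"
proof -
  obtain c where c: "ae_eq u (\<lambda>x. \<Sum>i<N. c i * \<Phi> i x)" using assms(1) by (auto simp: in_span_def)
  have "\<exists>d. \<forall>i<N. ae_eq (\<Phi> i) (\<lambda>x. \<Sum>j<N. d i j * \<Psi> j x)"
    using assms(2) unfolding in_span_def by metis
  then obtain d where d: "\<And>i. i < N \<Longrightarrow> ae_eq (\<Phi> i) (\<lambda>x. \<Sum>j<N. d i j * \<Psi> j x)" by blast
  have "ae_eq (\<lambda>x. \<Sum>i<N. c i * \<Phi> i x) (\<lambda>x. \<Sum>i<N. c i * (\<Sum>j<N. d i j * \<Psi> j x))"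
    by (intro ae_eq_sum ae_eq_mult d) auto
  moreover have "(\<Sum>i<N. c i * (\<Sum>j<N. d i j * \<Psi> j x)) = (\<Sum>j<N. (\<Sum>i<N. c i * d i j) * \<Psi> j x)" for x
    unfolding sum_distrib_left sum_distrib_right by (subst sum.swap) (simp add: mult.assoc)
  ultimately have "ae_eq u (\<lambda>x. \<Sum>j<N. (\<Sum>i<N. c i * d i j) * \<Psi> j x)" using ae_eq_trans[OF c] by simp
  then show ?thesis unfolding in_span_def by (rule exI[of _ "\<lambda>j. \<Sum>i<N. c i * d i j"])
qed

section \<open>Invariance of the Fock operator under rotations\<close>

lemma H2tup_mat_act: "H2tup N \<Phi> \<Longrightarrow> H2tup N (mat_act N A \<Phi>)"
  unfolding H2tup_def mat_act_def by (auto intro!: H2_sum H2_scale)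

text \<open>\<open>\<Phi>\<close> enters only through the kernel
  \<open>\<Sum>i<N. cnj (\<Phi> i y) * \<Phi> i x\<close> and its diagonal, which
  \<open>unitary_kernel\<close> preserves.\<close>

lemma Gop_kernel:
  assumes P: "H2tup N \<Phi>" and w: "L2 w"
  shows "Gop N \<Phi> w x = (LINT y|lborel. (\<Sum>i<N. cnj (\<Phi> i y) * \<Phi> i y) / complex_of_real (norm (x - y))) * w x
    - (LINT y|lborel. (\<Sum>i<N. cnj (\<Phi> i y) * \<Phi> i x) * w y / complex_of_real (norm (x - y)))"
proof -
  have P': "\<And>i. i \<in> {..<N} \<Longrightarrow> H2 (\<Phi> i)" using P by (simp add: H2tup_def)
  have 1: "(LINT y|lborel. (\<Sum>i<N. cnj (\<Phi> i y) * \<Phi> i y) / complex_of_real (norm (x - y))) = (\<Sum>i<N. coul (\<Phi> i) (\<Phi> i) x)"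
    unfolding sum_divide_distrib coul_def
    by (rule Bochner_Integration.integral_sum) (intro coul_integrable P' H2_L2)
  have "(LINT y|lborel. (\<Sum>i<N. cnj (\<Phi> i y) * \<Phi> i x) * w y / complex_of_real (norm (x - y)))
      = (LINT y|lborel. (\<Sum>i<N. (cnj (\<Phi> i y) * w y / complex_of_real (norm (x - y))) * \<Phi> i x))"
    unfolding sum_distrib_right sum_divide_distrib by (simp add: mult_ac)
  also have "\<dots> = (\<Sum>i<N. (LINT y|lborel. (cnj (\<Phi> i y) * w y / complex_of_real (norm (x - y))) * \<Phi> i x))"
    by (rule Bochner_Integration.integral_sum) (intro integrable_mult_left coul_integrable P' w)
  also have "\<dots> = (\<Sum>i<N. coul (\<Phi> i) w x * \<Phi> i x)"
    unfolding coul_def by (intro sum.cong refl integral_mult_left_zero)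
  finally show ?thesis unfolding 1 Gop_coul by (simp add: sum_subtractf sum_distrib_right)
qed

lemma Gop_unitary:
  assumes "H2tup N \<Phi>" "unitary_mat N A" "L2 w"
  shows "Gop N (mat_act N A \<Phi>) w = Gop N \<Phi> w"
proof
  fix x
  have k: "(\<Sum>i<N. cnj (mat_act N A \<Phi> i y) * mat_act N A \<Phi> i z) = (\<Sum>i<N. cnj (\<Phi> i y) * \<Phi> i z)" for y z
    unfolding mat_act_def by (rule unitary_kernel[OF assms(2)])
  show "Gop N (mat_act N A \<Phi>) w x = Gop N \<Phi> w x"
    unfolding Gop_kernel[OF H2tup_mat_act[OF assms(1)] assms(3)] Gop_kernel[OF assms(1,3)] k ..
qed

lemma Fock_mat_act:
  assumes "H2tup N \<Phi>" "unitary_mat N A" "H2 w"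
  shows "Fock n R Z N (mat_act N A \<Phi>) w = Fock n R Z N \<Phi> w"
  unfolding Fock_eq Gop_unitary[OF assms(1,2) H2_L2[OF assms(3)]] ..

lemma Fock_unitary:
  assumes P: "H2tup N \<Phi>" and Q: "H2tup N \<Psi>" and A: "unitary_mat N A" and eq: "tup_eq N \<Psi> (mat_act N A \<Phi>)" and w: "H2 w"
  shows "ae_eq (Fock n R Z N \<Psi> w) (Fock n R Z N \<Phi> w)"
proof -
  have "ae_eq (Fock n R Z N \<Psi> w) (Fock n R Z N (mat_act N A \<Phi>) w)"
    by (rule Fock_cong) (use Q H2tup_mat_act[OF P] eq w in \<open>auto simp: H2tup_def tup_eq_def\<close>)
  then show ?thesis unfolding Fock_mat_act[OF P A w] .
qed

section \<open>Discrete spectrum and gap\<close>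

lemma Bessel:
  assumes e: "orthonormal_fam m e" and u: "L2 u"
  shows "(\<Sum>k<m. (cmod (inner_L2 (e k) u))\<^sup>2) \<le> (norm_L2 u)\<^sup>2"
proof -
  define p where "p x = (\<Sum>k<m. inner_L2 (e k) u * e k x)" for x
  have eL: "\<And>k. k \<in> {..<m} \<Longrightarrow> L2 (e k)" using e by (simp add: orthonormal_fam_def)
  have p: "L2 p" unfolding p_def by (intro L2_sum L2_mult_const eL)
  define S where "S = (\<Sum>k<m. (cmod (inner_L2 (e k) u))\<^sup>2)"
  have sq: "cnj z * z = complex_of_real ((cmod z)\<^sup>2)" for z
    unfolding complex_norm_square by (rule mult.commute)
  have pp: "inner_L2 p p = complex_of_real S"
  proof -
    have "inner_L2 p p = (\<Sum>k<m. cnj (inner_L2 (e k) u) * inner_L2 (e k) u)"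
      unfolding p_def by (rule inner_lincomb[OF e])
    then show ?thesis by (simp only: sq S_def of_real_sum)
  qed
  have "inner_L2 p u = (\<Sum>k<m. inner_L2 (\<lambda>x. inner_L2 (e k) u * e k x) u)"
    unfolding p_def by (intro inner_L2_sum_left L2_mult_const eL u)
  then have pu: "inner_L2 p u = complex_of_real S"
    by (simp only: inner_L2_scale_left S_def of_real_sum sq)
  have "0 \<le> (norm (cls u - cls p))\<^sup>2" by simp
  also have "\<dots> = (norm (cls u))\<^sup>2 - 2 * (cls p \<bullet> cls u) + (norm (cls p))\<^sup>2"
    unfolding power2_norm_eq_inner by (simp add: inner_diff_left inner_diff_right inner_commute)
  also have "cls p \<bullet> cls u = S" using pu by (simp add: cls_inner[OF p u])
  also have "(norm (cls p))\<^sup>2 = S" using pp by (simp add: cls_norm[OF p] norm_L2_sq)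
  finally show ?thesis by (simp add: S_def cls_norm[OF u])
qed

text \<open>This works on functions rather than classes, since \<open>mult\<close> counts
  complex-orthonormal families and \<open>l2\<close> keeps only the real structure.\<close>

locale fn_op =
  fixes T :: "fn3 \<Rightarrow> fn3"
  assumes TL2: "H2 u \<Longrightarrow> L2 (T u)"
    and Tlin: "H2 u \<Longrightarrow> H2 v \<Longrightarrow> ae_eq (T (\<lambda>x. u x + c * v x)) (\<lambda>x. T u x + c * T v x)"
    and Tsym: "H2 u \<Longrightarrow> H2 v \<Longrightarrow> inner_L2 u (T v) = inner_L2 (T u) v"
begin

lemma eigvec_lin:
  assumes "eigvec T lam u" "eigvec T lam v" shows "eigvec T lam (\<lambda>x. u x + c * v x)"
proof -
  have H: "H2 u" "H2 v" and E: "ae_eq (T u) (\<lambda>x. of_real lam * u x)" "ae_eq (T v) (\<lambda>x. of_real lam * v x)"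
    using assms by (auto simp: eigvec_def)
  have "ae_eq (\<lambda>x. T u x + c * T v x) (\<lambda>x. of_real lam * u x + c * (of_real lam * v x))"
    by (intro ae_eq_add ae_eq_mult E)
  then have "ae_eq (\<lambda>x. T u x + c * T v x) (\<lambda>x. of_real lam * (u x + c * v x))"
    by (simp add: algebra_simps)
  then show ?thesis unfolding eigvec_def using H2_lin[OF H] ae_eq_trans[OF Tlin[OF H]] by blast
qed

lemma eigvec_zero: "eigvec T lam (\<lambda>x. 0)"
proof -
  have "ae_eq (T (\<lambda>x. 0)) (\<lambda>x. 0)" using Tlin[OF H2_zero H2_zero, of "-1"] by simp
  then show ?thesis by (simp add: eigvec_def H2_zero)
qed

lemma eigvec_scale: "eigvec T lam u \<Longrightarrow> eigvec T lam (\<lambda>x. c * u x)"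
  using eigvec_lin[OF eigvec_zero, of lam u c] by simp

lemma eigvec_lincomb:
  "(\<And>i. i \<in> I \<Longrightarrow> eigvec T lam (u i)) \<Longrightarrow> eigvec T lam (\<lambda>x. \<Sum>i\<in>I. c i * u i x)"
proof (induction I rule: infinite_finite_induct)
  case (insert i I)
  then have "eigvec T lam (\<lambda>x. (\<Sum>i\<in>I. c i * u i x) + c i * u i x)" by (intro eigvec_lin) auto
  with insert show ?case by (simp add: add.commute)
qed (simp_all add: eigvec_zero)

lemma eigvec_orthogonal:
  assumes u: "eigvec T a u" and v: "eigvec T b v" and ne: "a \<noteq> b"
  shows "inner_L2 u v = 0"
proof -
  have H: "H2 u" "H2 v" and E: "ae_eq (T u) (\<lambda>x. of_real a * u x)" "ae_eq (T v) (\<lambda>x. of_real b * v x)"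
    using u v by (auto simp: eigvec_def)
  have "of_real b * inner_L2 u v = inner_L2 u (T v)"
    using inner_L2_cong[OF ae_eq_refl E(2) H2_L2[OF H(1)] TL2[OF H(2)] H2_L2[OF H(1)] L2_mult_const[OF H2_L2[OF H(2)]]]
    by (simp add: inner_L2_scale_right)
  also have "\<dots> = inner_L2 (T u) v" by (rule Tsym[OF H])
  also have "\<dots> = of_real a * inner_L2 u v"
    using inner_L2_cong[OF E(1) ae_eq_refl TL2[OF H(1)] H2_L2[OF H(2)] L2_mult_const[OF H2_L2[OF H(1)]] H2_L2[OF H(2)]]
    by (simp add: inner_L2_scale_left)
  finally show ?thesis using ne by simp
qed

lemma eigvec_in_spec:
  assumes "eigvec T lam u" "\<not> ae_eq u (\<lambda>x. 0)" shows "lam \<in> spec T"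
proof -
  have "ae_eq (\<lambda>x. T u x - of_real lam * u x) (\<lambda>x. 0)"
    using assms(1) unfolding eigvec_def ae_eq_def by (auto elim: eventually_mono)
  then show ?thesis using assms unfolding spec_def eigvec_def by blast
qed

text \<open>For orthonormal eigenvectors \<open>\<Psi>\<close> this is completeness in the
  eigenspaces of all listed eigenvalues, phrased without dimensions so that it can be proved by a
  limit argument.\<close>

definition exhausts :: "nat \<Rightarrow> (nat \<Rightarrow> real) \<Rightarrow> tup \<Rightarrow> bool" where
  "exhausts N e \<Psi> \<longleftrightarrow> (\<forall>i<N. \<forall>u. eigvec T (e i) u \<and> (\<forall>j<N. inner_L2 (\<Psi> j) u = 0) \<longrightarrow> ae_eq u (\<lambda>x. 0))"

context
  fixes N e \<Psi>
  assumes on: "orthonormal_fam N \<Psi>" and eig: "\<And>i. i < N \<Longrightarrow> eigvec T (e i) (\<Psi> i)"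
begin

lemma card_le_mult: "enat (card {i. i < N \<and> e i = lam}) \<le> mult T lam"
proof -
  define J where "J = {i. i < N \<and> e i = lam}"
  have "finite J" by (simp add: J_def)
  then obtain f where f: "bij_betw f {0..<card J} J" using ex_bij_betw_nat_finite by blast
  have fJ: "f k \<in> J" if "k < card J" for k using f that by (auto simp: bij_betw_def)
  have inj: "f k = f l \<longleftrightarrow> k = l" if "k < card J" "l < card J" for k l
    using f that by (auto simp: bij_betw_def inj_on_def)
  have "orthonormal_fam (card J) (\<lambda>k. \<Psi> (f k))"
    unfolding orthonormal_fam_def
  proof (intro conjI allI impI)
    show "L2 (\<Psi> (f k))" if "k < card J" for k using fJ[OF that] on by (auto simp: J_def orthonormal_fam_def)
    show "inner_L2 (\<Psi> (f k)) (\<Psi> (f l)) = (if k = l then 1 else 0)" if "k < card J" "l < card J" for k l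
      using fJ[OF that(1)] fJ[OF that(2)] inj[OF that] on by (simp add: J_def orthonormal_fam_def)
  qed
  moreover have "\<forall>k<card J. eigvec T lam (\<Psi> (f k))" using fJ eig by (auto simp: J_def)
  ultimately have "enat (card J) \<in> {enat m |m. \<exists>e. orthonormal_fam m e \<and> (\<forall>j<m. eigvec T lam (e j))}" by blast
  then show ?thesis unfolding mult_def J_def[symmetric] by (rule Sup_upper)
qed

text \<open>A further eigenvector, normalized and appended to the listed ones with the same
  eigenvalue, would be an orthonormal family one longer than the multiplicity allows.\<close>

lemma exhaustsI:
  assumes m: "\<And>i. i < N \<Longrightarrow> mult T (e i) \<le> enat (card {j. j < N \<and> e j = e i})"
  shows "exhausts N e \<Psi>"
  unfolding exhausts_def
proof (intro allI impI)
  fix i u assume i: "i < N" and "eigvec T (e i) u \<and> (\<forall>j<N. inner_L2 (\<Psi> j) u = 0)"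
  then have u: "eigvec T (e i) u" and orth: "\<And>j. j < N \<Longrightarrow> inner_L2 (\<Psi> j) u = 0" by auto
  have uL: "L2 u" using u by (auto simp: eigvec_def)
  show "ae_eq u (\<lambda>x. 0)"
  proof (rule ccontr)
    assume "\<not> ae_eq u (\<lambda>x. 0)"
    then have n0: "norm_L2 u > 0" using norm_L2_eq_0_iff[OF uL] norm_L2_nonneg[of u] by linarith
    define v where "v x = complex_of_real (1 / norm_L2 u) * u x" for x
    have v: "eigvec T (e i) v" unfolding v_def by (rule eigvec_scale[OF u])
    have vL: "L2 v" using v by (auto simp: eigvec_def)
    have uu: "inner_L2 u u = complex_of_real ((norm_L2 u)\<^sup>2)" by (simp add: inner_L2_self norm_L2_def)
    have vv: "inner_L2 v v = 1"
      unfolding v_def inner_L2_scale_left inner_L2_scale_right uu using n0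
      by (simp add: power2_eq_square flip: of_real_mult)
    have ov: "inner_L2 (\<Psi> j) v = 0" "inner_L2 v (\<Psi> j) = 0" if "j < N" for j
    proof -
      show 1: "inner_L2 (\<Psi> j) v = 0" unfolding v_def inner_L2_scale_right using orth[OF that] by simp
      show "inner_L2 v (\<Psi> j) = 0" using inner_L2_cnj[of "\<Psi> j" v] 1 by simp
    qed
    define J where "J = {j. j < N \<and> e j = e i}"
    have "finite J" by (simp add: J_def)
    then obtain f where f: "bij_betw f {0..<card J} J" using ex_bij_betw_nat_finite by blast
    have fJ: "f k < N" "e (f k) = e i" if "k < card J" for k
    proof -
      have "f k \<in> J" using f that by (auto simp: bij_betw_def)
      then show "f k < N" "e (f k) = e i" by (auto simp: J_def)
    qed
    have inj: "f k = f l \<longleftrightarrow> k = l" if "k < card J" "l < card J" for k l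
      using f that by (auto simp: bij_betw_def inj_on_def)
    define E where "E k = (if k < card J then \<Psi> (f k) else v)" for k
    have "orthonormal_fam (Suc (card J)) E"
      unfolding orthonormal_fam_def
    proof (intro conjI allI impI)
      show "L2 (E k)" if "k < Suc (card J)" for k
        using fJ on vL by (auto simp: E_def orthonormal_fam_def)
      show "inner_L2 (E k) (E l) = (if k = l then 1 else 0)" if "k < Suc (card J)" "l < Suc (card J)" for k l
      proof (cases "k < card J"; cases "l < card J")
        assume kl: "k < card J" "l < card J"
        then show ?thesis using fJ[OF kl(1)] fJ[OF kl(2)] inj[OF kl] on by (simp add: E_def orthonormal_fam_def)
      qed (use that fJ ov vv in \<open>auto simp: E_def\<close>)
    qed
    moreover have "\<forall>k<Suc (card J). eigvec T (e i) (E k)"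
      using eig[OF fJ(1)] fJ(2) v by (auto simp: E_def)
    ultimately have "enat (Suc (card J)) \<in> {enat m |m. \<exists>e'. orthonormal_fam m e' \<and> (\<forall>j<m. eigvec T (e i) (e' j))}" by blast
    then have "enat (Suc (card J)) \<le> mult T (e i)" unfolding mult_def by (rule Sup_upper)
    also have "\<dots> \<le> enat (card J)" using m[OF i] by (simp add: J_def)
    finally show False by simp
  qed
qed

text \<open>Components of \<open>u\<close> along other eigenvalues vanish by orthogonality, so the
  projection of \<open>u\<close> onto the family is again an eigenvector; the difference is
  orthogonal to the family and hence null.\<close>

lemma eigvec_expansion:
  assumes ex: "exhausts N e \<Psi>" and i: "i < N" and u: "eigvec T (e i) u"
  shows "ae_eq u (\<lambda>x. \<Sum>j<N. inner_L2 (\<Psi> j) u * \<Psi> j x)"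
proof -
  define c where "c j = inner_L2 (\<Psi> j) u" for j
  have L: "\<And>j. j < N \<Longrightarrow> L2 (\<Psi> j)" "L2 u" using on u by (auto simp: orthonormal_fam_def eigvec_def)
  have c0: "c j = 0" if "j < N" "e j \<noteq> e i" for j
    unfolding c_def using eigvec_orthogonal[OF eig[OF that(1)] u that(2)] .
  have "eigvec T (e i) (\<lambda>x. \<Sum>j\<in>{j. j < N \<and> e j = e i}. c j * \<Psi> j x)"
  proof (rule eigvec_lincomb)
    fix j assume "j \<in> {j. j < N \<and> e j = e i}"
    then show "eigvec T (e i) (\<Psi> j)" using eig[of j] by simp
  qed
  moreover have "(\<Sum>j\<in>{j. j < N \<and> e j = e i}. c j * \<Psi> j x) = (\<Sum>j<N. c j * \<Psi> j x)" for x
    by (rule sum.mono_neutral_left) (use c0 in auto)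
  ultimately have "eigvec T (e i) (\<lambda>x. \<Sum>j<N. c j * \<Psi> j x)" by simp
  from eigvec_lin[OF u this, of "-1"]
  have d: "eigvec T (e i) (\<lambda>x. u x - (\<Sum>j<N. c j * \<Psi> j x))" by simp
  have "inner_L2 (\<Psi> j) (\<lambda>x. u x - (\<Sum>j<N. c j * \<Psi> j x)) = 0" if j: "j < N" for j
  proof -
    have "inner_L2 (\<Psi> j) (\<lambda>x. u x - (\<Sum>j<N. c j * \<Psi> j x)) = inner_L2 (\<Psi> j) u - inner_L2 (\<Psi> j) (\<lambda>x. \<Sum>j<N. c j * \<Psi> j x)"
      by (intro inner_L2_diff_right L2_sum L2_mult_const L j) auto
    also have "\<dots> = 0" unfolding inner_lincomb_right[OF on j] by (simp add: c_def)
    finally show ?thesis .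
  qed
  then have "ae_eq (\<lambda>x. u x - (\<Sum>j<N. c j * \<Psi> j x)) (\<lambda>x. 0)" using ex i d unfolding exhausts_def by blast
  then show ?thesis by (simp add: ae_eq_def c_def)
qed

text \<open>The sum of all squared overlaps between \<open>E\<close> and the listed eigenvectors is
  counted twice: it equals \<open>m\<close> by the expansion of each \<open>E k\<close>, and is at
  most \<open>card J\<close> by Bessel's inequality.\<close>

lemma mult_le_card:
  assumes ex: "exhausts N e \<Psi>" and i: "i < N"
  shows "mult T (e i) \<le> enat (card {j. j < N \<and> e j = e i})"
  unfolding mult_def
proof (rule Sup_least)
  fix y assume "y \<in> {enat m |m. \<exists>e'. orthonormal_fam m e' \<and> (\<forall>j<m. eigvec T (e i) (e' j))}"
  then obtain m E where y: "y = enat m" and E: "orthonormal_fam m E" "\<And>k. k < m \<Longrightarrow> eigvec T (e i) (E k)" by blast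
  define J where "J = {j. j < N \<and> e j = e i}"
  have fin: "finite J" by (simp add: J_def)
  have EL: "L2 (E k)" if "k < m" for k using E(1) that by (simp add: orthonormal_fam_def)
  have one: "(\<Sum>j\<in>J. (cmod (inner_L2 (E k) (\<Psi> j)))\<^sup>2) = 1" if k: "k < m" for k
  proof -
    define c where "c j = inner_L2 (\<Psi> j) (E k)" for j
    have PL: "\<And>j. j \<in> {..<N} \<Longrightarrow> L2 (\<Psi> j)" using on by (simp add: orthonormal_fam_def)
    have Ls: "L2 (\<lambda>x. \<Sum>j<N. c j * \<Psi> j x)" by (intro L2_sum L2_mult_const PL)
    have "1 = inner_L2 (E k) (E k)" using E(1) k by (simp add: orthonormal_fam_def)
    also have "\<dots> = inner_L2 (\<lambda>x. \<Sum>j<N. c j * \<Psi> j x) (\<lambda>x. \<Sum>j<N. c j * \<Psi> j x)"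
      unfolding c_def using eigvec_expansion[OF ex i E(2)[OF k]] EL[OF k] Ls[unfolded c_def] by (intro inner_L2_cong)
    also have "\<dots> = complex_of_real (\<Sum>j<N. (cmod (c j))\<^sup>2)"
      unfolding inner_lincomb[OF on] of_real_sum complex_norm_square by (simp add: mult.commute)
    finally have "(\<Sum>j<N. (cmod (c j))\<^sup>2) = 1" by (metis of_real_eq_1_iff)
    moreover have "(\<Sum>j\<in>J. (cmod (c j))\<^sup>2) = (\<Sum>j<N. (cmod (c j))\<^sup>2)"
    proof (rule sum.mono_neutral_left)
      show "\<forall>j\<in>{..<N} - J. (cmod (c j))\<^sup>2 = 0"
        unfolding c_def using eigvec_orthogonal[OF eig E(2)[OF k]] by (auto simp: J_def)
    qed (auto simp: J_def)
    moreover have "cmod (inner_L2 (E k) (\<Psi> j)) = cmod (c j)" for j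
      unfolding c_def by (metis complex_mod_cnj inner_L2_cnj)
    ultimately show ?thesis by simp
  qed
  have "real m = (\<Sum>k<m. \<Sum>j\<in>J. (cmod (inner_L2 (E k) (\<Psi> j)))\<^sup>2)" using one by simp
  also have "\<dots> = (\<Sum>j\<in>J. \<Sum>k<m. (cmod (inner_L2 (E k) (\<Psi> j)))\<^sup>2)" by (rule sum.swap)
  also have "\<dots> \<le> (\<Sum>j\<in>J. 1)"
  proof (rule sum_mono)
    fix j assume "j \<in> J"
    then have j: "j < N" by (simp add: J_def)
    have "L2 (\<Psi> j)" "inner_L2 (\<Psi> j) (\<Psi> j) = 1" using on j by (simp_all add: orthonormal_fam_def)
    then show "(\<Sum>k<m. (cmod (inner_L2 (E k) (\<Psi> j)))\<^sup>2) \<le> 1"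
      using Bessel[OF E(1), of "\<Psi> j"] by (simp add: norm_L2_sq)
  qed
  finally have "m \<le> card J" by simp
  then show "y \<le> enat (card {j. j < N \<and> e j = e i})" using y by (simp add: J_def)
qed

text \<open>A limit argument delivers the position of the spectrum and \<open>exhausts\<close>; this
  turns such data back into \<open>N_lowest\<close> and \<open>gap_ok\<close>.\<close>

lemma N_lowest_gapI:
  assumes N: "N \<ge> 1" and g: "\<gamma> > 0" and ex: "exhausts N e \<Psi>"
    and mono: "\<And>i j. i \<le> j \<Longrightarrow> j < N \<Longrightarrow> e i \<le> e j"
    and sp: "\<And>\<mu>. \<mu> \<in> spec T \<Longrightarrow> \<mu> \<in> e ` {..<N} \<or> e (N - 1) + \<gamma> \<le> \<mu>"
  shows "N_lowest N T e" "gap_ok N T e \<gamma>"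
proof -
  have mult: "mult T (e i) = enat (card {j. j < N \<and> e j = e i})" if "i < N" for i
    using mult_le_card[OF ex that] card_le_mult by (rule antisym)
  have top: "e i \<le> e (N - 1)" if "i < N" for i using mono[of i "N - 1"] that N by simp
  have inspec: "e i \<in> spec T" if i: "i < N" for i
  proof (rule eigvec_in_spec[OF eig[OF i]])
    have "inner_L2 (\<Psi> i) (\<Psi> i) = 1" "L2 (\<Psi> i)" using on i by (simp_all add: orthonormal_fam_def)
    then have "norm_L2 (\<Psi> i) \<noteq> 0" using norm_L2_sq[of "\<Psi> i"] by auto
    then show "\<not> ae_eq (\<Psi> i) (\<lambda>x. 0)" using norm_L2_eq_0_iff \<open>L2 (\<Psi> i)\<close> by blast
  qed
  have disc: "e i \<in> disc_spec T" if i: "i < N" for i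
  proof -
    \<comment> \<open>\<open>d\<close> separates \<open>e i\<close> from the other listed
      eigenvalues, \<open>\<gamma>\<close> from the remaining spectrum.\<close>
    obtain d where d: "d > 0" "\<And>x. x \<in> e ` {..<N} \<Longrightarrow> x \<noteq> e i \<Longrightarrow> d \<le> dist (e i) x"
      using finite_set_avoid[of "e ` {..<N}" "e i"] by blast
    have "\<forall>\<mu>\<in>spec T. \<bar>\<mu> - e i\<bar> < min d \<gamma> \<longrightarrow> \<mu> = e i"
    proof (intro ballI impI, rule ccontr)
      fix \<mu> assume mu: "\<mu> \<in> spec T" "\<bar>\<mu> - e i\<bar> < min d \<gamma>" "\<mu> \<noteq> e i"
      from sp[OF mu(1)] show False
      proof
        assume "\<mu> \<in> e ` {..<N}"
        then show False using d(2)[of \<mu>] mu by (simp add: dist_real_def abs_minus_commute)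
      next
        assume "e (N - 1) + \<gamma> \<le> \<mu>"
        then show False using top[OF i] mu(2) by linarith
      qed
    qed
    moreover have "min d \<gamma> > 0" using d g by simp
    moreover have "card {j. j < N \<and> e j = e i} > 0" using i by (auto simp: card_gt_0_iff)
    then have "0 < mult T (e i)" "mult T (e i) < \<infinity>" unfolding mult[OF i] by (auto simp: zero_enat_def)
    ultimately show ?thesis unfolding disc_spec_def using inspec[OF i] by blast
  qed
  show "N_lowest N T e" unfolding N_lowest_def
  proof (intro conjI allI impI ballI)
    show "e i \<in> disc_spec T" if "i < N" for i by (rule disc[OF that])
    show "below_ess T (e i)" if "i < N" for i
      unfolding below_ess_def
    proof
      fix \<mu> assume "\<mu> \<in> ess_spec T"
      then have "\<mu> \<in> spec T" "\<mu> \<notin> e ` {..<N}" using disc by (auto simp: ess_spec_def)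
      then show "e i < \<mu>" using sp[of \<mu>] top[OF that] g by auto
    qed
    show "enat (card {i. i < N \<and> e i = lam}) \<le> mult T lam" for lam by (rule card_le_mult)
    show "enat (card {i. i < N \<and> e i = lam}) = mult T lam"
      if lam: "lam \<in> disc_spec T" "below_ess T lam \<and> lam < e (N - 1)" for lam
    proof -
      have "lam \<in> spec T" using lam by (simp add: disc_spec_def)
      then have "lam \<in> e ` {..<N}" using sp[of lam] lam(2) g by linarith
      then obtain i where "i < N" "lam = e i" by blast
      then show ?thesis using mult by simp
    qed
  qed (use mono in auto)
  show "gap_ok N T e \<gamma>" unfolding gap_ok_def
  proof (intro ballI impI allI)
    fix \<mu> i assume mu: "\<mu> \<in> spec T" "\<mu> \<notin> e ` {..<N} \<or> enat (card {i. i < N \<and> e i = \<mu>}) < mult T \<mu>" and i: "i < N"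
    have "\<mu> \<notin> e ` {..<N}" using mu(2) mult by auto
    then have "e (N - 1) + \<gamma> \<le> \<mu>" using sp[OF mu(1)] by auto
    then show "\<gamma> \<le> \<bar>\<mu> - e i\<bar>" using top[OF i] by linarith
  qed
qed

end

end

section \<open>Position, multiplicity and uniqueness of the lowest eigenvalues\<close>

lemma N_lowestD:
  assumes "N_lowest N T e"
  shows "i \<le> j \<Longrightarrow> j < N \<Longrightarrow> e i \<le> e j"
    and "i < N \<Longrightarrow> e i \<in> disc_spec T" and "i < N \<Longrightarrow> below_ess T (e i)"
    and "enat (card {i. i < N \<and> e i = lam}) \<le> mult T lam"
    and "lam \<in> disc_spec T \<Longrightarrow> below_ess T lam \<Longrightarrow> lam < e (N - 1) \<Longrightarrow>
      enat (card {i. i < N \<and> e i = lam}) = mult T lam"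
    and "i < N \<Longrightarrow> e i \<in> spec T"
  using assms by (simp_all add: N_lowest_def disc_spec_def)

text \<open>Below the top eigenvalue the counts in \<open>N_lowest\<close> are exact. An unlisted
  spectral point there would be essential, which \<open>below_ess\<close> forbids, or discrete with
  multiplicity zero. So the gap of an unlisted point opens upward.\<close>

lemma spec_structure:
  assumes nl: "N_lowest N T e" and gap: "gap_ok N T e \<gamma>" and N: "N \<ge> 1" and mu: "\<mu> \<in> spec T"
  shows "\<mu> \<in> e ` {..<N} \<or> e (N - 1) + \<gamma> \<le> \<mu>"
proof (cases "\<mu> \<in> e ` {..<N}")
  case n: False
  have last: "N - 1 < N" using N by simp
  have gd: "\<gamma> \<le> \<bar>\<mu> - e (N - 1)\<bar>" using gap mu n last unfolding gap_ok_def by blast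
  have "\<not> \<mu> < e (N - 1)"
  proof
    assume lt: "\<mu> < e (N - 1)"
    have be: "below_ess T (e (N - 1))" using N_lowestD(3)[OF nl last] .
    have d: "\<mu> \<in> disc_spec T"
    proof (rule ccontr)
      assume "\<mu> \<notin> disc_spec T"
      then have "\<mu> \<in> ess_spec T" using mu by (simp add: ess_spec_def)
      then show False using be lt unfolding below_ess_def by (meson less_asym)
    qed
    have "below_ess T \<mu>" using be lt unfolding below_ess_def by (meson less_trans)
    then have "enat (card {i. i < N \<and> e i = \<mu>}) = mult T \<mu>" using N_lowestD(5)[OF nl d _ lt] by blast
    moreover have "{i. i < N \<and> e i = \<mu>} = {}" using n by auto
    moreover have "0 < mult T \<mu>" using d by (simp add: disc_spec_def)
    ultimately show False by (simp add: zero_enat_def)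
  qed
  moreover have "\<mu> \<noteq> e (N - 1)" using n last by auto
  ultimately have "e (N - 1) + \<gamma> \<le> \<mu>" using gd by linarith
  then show ?thesis ..
qed simp

text \<open>If the count fell short, \<open>gap_ok\<close> would apply to \<open>e i\<close> and put
  it at distance \<open>\<gamma>\<close> from itself.\<close>

lemma mult_exact:
  assumes nl: "N_lowest N T e" and gap: "gap_ok N T e \<gamma>" and g: "\<gamma> > 0" and i: "i < N"
  shows "mult T (e i) = enat (card {j. j < N \<and> e j = e i})"
proof -
  have "e i \<in> spec T" using N_lowestD(6)[OF nl i] .
  then have "\<not> enat (card {j. j < N \<and> e j = e i}) < mult T (e i)"
    using gap[unfolded gap_ok_def, rule_format, of "e i" i] i g by auto
  moreover have "enat (card {j. j < N \<and> e j = e i}) \<le> mult T (e i)" using N_lowestD(4)[OF nl] .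
  ultimately show ?thesis by simp
qed

lemma sum_card_fibres:
  fixes f :: "nat \<Rightarrow> real"
  assumes "finite S"
  shows "(\<Sum>l\<in>S. card {i. i < N \<and> f i = l}) = card {i. i < N \<and> f i \<in> S}"
proof -
  have "(\<Sum>l\<in>S. card {i. i < N \<and> f i = l}) = card (\<Union>l\<in>S. {i. i < N \<and> f i = l})"
    by (rule card_UN_disjoint[symmetric]) (use assms in auto)
  also have "(\<Union>l\<in>S. {i. i < N \<and> f i = l}) = {i. i < N \<and> f i \<in> S}" by auto
  finally show ?thesis .
qed

text \<open>Equal fibres mean equal multisets, and a sorted list is determined by its
  multiset.\<close>

lemma sorted_eq_if_fibres_eq:
  fixes e f :: "nat \<Rightarrow> real"
  assumes me: "\<And>i j. i \<le> j \<Longrightarrow> j < N \<Longrightarrow> e i \<le> e j" and mf: "\<And>i j. i \<le> j \<Longrightarrow> j < N \<Longrightarrow> f i \<le> f j"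
    and card: "\<And>l. card {i. i < N \<and> e i = l} = card {i. i < N \<and> f i = l}" and i: "i < N"
  shows "e i = f i"
proof -
  have cnt: "count (mset (map h [0..<N])) l = card {i. i < N \<and> h i = l}" for h :: "nat \<Rightarrow> real" and l
  proof -
    have "count (mset (map h [0..<N])) l = length (filter (\<lambda>y. l = y) (map h [0..<N]))"
      by (simp only: count_mset count_list_eq_length_filter)
    also have "\<dots> = card {i. i < length (map h [0..<N]) \<and> l = map h [0..<N] ! i}" by (rule length_filter_conv_card)
    also have "{i. i < length (map h [0..<N]) \<and> l = map h [0..<N] ! i} = {i. i < N \<and> h i = l}" by auto
    finally show ?thesis .
  qed
  have "mset (map e [0..<N]) = mset (map f [0..<N])"
    by (rule multiset_eqI) (simp only: cnt card)
  moreover have "sorted (map e [0..<N])" "sorted (map f [0..<N])"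
    using me mf by (auto simp: sorted_iff_nth_mono)
  ultimately have "map e [0..<N] = map f [0..<N]" by (metis properties_for_sort)
  then show ?thesis using i by (auto simp: list_eq_iff_nth_eq)
qed

text \<open>The gap is assumed for \<open>e\<close> alone. Once all values of \<open>f\<close> are
  known to be values of \<open>e\<close>, its counts are bounded by the exact counts of
  \<open>e\<close>, and equal totals \<open>N\<close> force equality.\<close>

lemma N_lowest_unique:
  assumes nl: "N_lowest N T e" and gap: "gap_ok N T e \<gamma>" and g: "\<gamma> > 0" and N: "N \<ge> 1"
    and nf: "N_lowest N T f" and i: "i < N"
  shows "f i = e i"
proof -
  let ?ce = "\<lambda>l. card {i. i < N \<and> e i = l}" and ?cf = "\<lambda>l. card {i. i < N \<and> f i = l}"
  let ?S = "e ` {..<N}"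
  have last: "N - 1 < N" using N by simp
  note me = N_lowestD(1)[OF nl] and mf = N_lowestD(1)[OF nf]
  have ce: "mult T l = enat (?ce l)" if "l \<in> ?S" for l using mult_exact[OF nl gap g] that by auto
  have cf: "enat (?cf l) \<le> mult T l" for l using N_lowestD(4)[OF nf] .
  have sume: "(\<Sum>l\<in>?S. ?ce l) = N"
  proof -
    have "{i. i < N \<and> e i \<in> ?S} = {..<N}" by auto
    then show ?thesis by (subst sum_card_fibres) auto
  qed
  have fin: "f j \<in> ?S" if j: "j < N" for j
  \<comment> \<open>If the top of \<open>f\<close> lies above that of \<open>e\<close>, then
    \<open>f\<close> lists every value of \<open>e\<close> with full multiplicity and all
    \<open>N\<close> places are taken; otherwise the gap confines \<open>f\<close> to the values of
    \<open>e\<close>.\<close>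
  proof (cases "e (N - 1) < f (N - 1)")
    case True
    have "?cf l = ?ce l" if l: "l \<in> ?S" for l
    proof -
      obtain k where k: "k < N" "l = e k" using l by auto
      have "l \<in> disc_spec T" "below_ess T l" using N_lowestD(2,3)[OF nl k(1)] k(2) by simp_all
      moreover have "e k \<le> e (N - 1)" by (rule me) (use k N in auto)
      then have "l < f (N - 1)" using k True by simp
      ultimately have "enat (?cf l) = mult T l" by (rule N_lowestD(5)[OF nf])
      then show ?thesis using ce[OF l] by simp
    qed
    then have "card {i. i < N \<and> f i \<in> ?S} = N" using sume sum_card_fibres[of ?S N f] by simp
    then have "{i. i < N \<and> f i \<in> ?S} = {..<N}" by (intro card_subset_eq) auto
    then show ?thesis using j by blast
  next
    case False
    have "f j \<in> spec T" using N_lowestD(6)[OF nf j] .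
    then have "f j \<in> ?S \<or> e (N - 1) + \<gamma> \<le> f j" by (rule spec_structure[OF nl gap N])
    moreover have "f j \<le> f (N - 1)" by (rule mf) (use j N in auto)
    ultimately show ?thesis using False g by auto
  qed
  have sumf: "(\<Sum>l\<in>?S. ?cf l) = N"
  proof -
    have "{i. i < N \<and> f i \<in> ?S} = {..<N}" using fin by auto
    then show ?thesis by (subst sum_card_fibres) auto
  qed
  have le: "?cf l \<le> ?ce l" if "l \<in> ?S" for l using cf[of l] ce[OF that] by simp
  have fib: "?cf l = ?ce l" for l
  proof (cases "l \<in> ?S")
    case True
    show ?thesis
    proof (rule ccontr)
      assume "?cf l \<noteq> ?ce l"
      then have "?cf l < ?ce l" using le[OF True] by simp
      then have "(\<Sum>l\<in>?S. ?cf l) < (\<Sum>l\<in>?S. ?ce l)"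
        using le True by (intro sum_strict_mono_ex1) auto
      then show False using sume sumf by simp
    qed
  next
    case False
    then have "{i. i < N \<and> e i = l} = {}" "{i. i < N \<and> f i = l} = {}" using fin by auto
    then show ?thesis by (simp only:)
  qed
  show ?thesis by (rule sorted_eq_if_fibres_eq[where e=f and f=e, OF mf me fib i])
qed

lemma fn_op_Fock: "H2tup N \<Phi> \<Longrightarrow> fn_op (Fock n R Z N \<Phi>)"
  by unfold_locales (auto intro: L2_Fock Fock_lin Fock_symmetric)

text \<open>The spectral notions see an operator only on \<open>H2\<close> and up to null sets, so
  they can be carried between tuples that differ by a rotation.\<close>

lemma N_lowest_cong:
  assumes eq: "\<And>w. H2 w \<Longrightarrow> ae_eq (T w) (T' w)"
  shows "N_lowest N T e \<longleftrightarrow> N_lowest N T' e" "eigvec T lam u \<longleftrightarrow> eigvec T' lam u"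
proof -
  have ev: "eigvec T = eigvec T'"
    unfolding eigvec_def using eq ae_eq_sym ae_eq_trans by (intro ext) blast
  have sh: "ae_eq (\<lambda>x. T u x - of_real lam * u x) g \<longleftrightarrow> ae_eq (\<lambda>x. T' u x - of_real lam * u x) g" if "H2 u" for u lam g
  proof -
    have "ae_eq (\<lambda>x. T u x - of_real lam * u x) (\<lambda>x. T' u x - of_real lam * u x)"
      using eq[OF that] by (intro ae_eq_diff) auto
    then show ?thesis using ae_eq_sym ae_eq_trans by blast
  qed
  have "spec T = spec T'" unfolding spec_def using sh by (intro Collect_cong) blast
  moreover have "mult T = mult T'" unfolding mult_def[abs_def] ev ..
  ultimately show "N_lowest N T e \<longleftrightarrow> N_lowest N T' e"
    unfolding N_lowest_def below_ess_def ess_spec_def disc_spec_def by simp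
  show "eigvec T lam u \<longleftrightarrow> eigvec T' lam u" using ev by simp
qed

section \<open>Limits of the iteration\<close>

lemma finite_common_subseq:
  fixes X :: "'i \<Rightarrow> nat \<Rightarrow> complex"
  assumes "finite I" "\<And>i. i \<in> I \<Longrightarrow> bounded (range (X i))"
  shows "\<exists>r. strict_mono r \<and> (\<forall>i\<in>I. convergent (\<lambda>n. X i (r n)))"
  using assms
proof (induction I rule: finite_induct)
  case empty
  then show ?case by (intro exI[of _ id]) (auto simp: strict_mono_def)
next
  case (insert i I)
  then obtain r where r: "strict_mono r" "\<forall>j\<in>I. convergent (\<lambda>n. X j (r n))" by auto
  have "bounded (range (\<lambda>n. X i (r n)))" using insert.prems[of i] by (auto intro: bounded_subset)
  then obtain l s where s: "strict_mono s" "((\<lambda>n. X i (r n)) \<circ> s) \<longlonglongrightarrow> l"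
    using bounded_imp_convergent_subsequence by blast
  have "convergent (\<lambda>n. X j (r (s n)))" if "j \<in> I" for j
    using convergent_subseq_convergent[of "\<lambda>n. X j (r n)" s] r(2) s(1) that by (simp add: o_def)
  moreover have "convergent (\<lambda>n. X i (r (s n)))" using s(2) by (auto simp: o_def convergent_def)
  moreover have "strict_mono (r \<circ> s)" using r s by (simp add: strict_mono_o)
  ultimately show ?case by (intro exI[of _ "r \<circ> s"]) (auto simp: o_def)
qed

lemma tendsto_if_subseqs:
  fixes X :: "nat \<Rightarrow> real"
  assumes "\<And>s :: nat \<Rightarrow> nat. strict_mono s \<Longrightarrow> \<exists>r :: nat \<Rightarrow> nat. strict_mono r \<and> (\<lambda>n. X (s (r n))) \<longlonglongrightarrow> l"
  shows "X \<longlonglongrightarrow> l"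
proof (rule ccontr)
  assume "\<not> X \<longlonglongrightarrow> l"
  then obtain e where e: "e > 0" "\<not> (\<forall>\<^sub>F n in sequentially. dist (X n) l < e)"
    unfolding tendsto_iff by blast
  then have "infinite {n. \<not> dist (X n) l < e}"
    unfolding cofinite_eq_sequentially[symmetric] eventually_cofinite by simp
  then obtain s :: "nat \<Rightarrow> nat" where s: "strict_mono s" "\<And>n. s n \<in> {n. \<not> dist (X n) l < e}"
    using infinite_enumerate by blast
  obtain r where r: "strict_mono r" "(\<lambda>n. X (s (r n))) \<longlonglongrightarrow> l" using assms[OF s(1)] by blast
  then have "\<forall>\<^sub>F n in sequentially. dist (X (s (r n))) l < e" using tendstoD e(1) by blast
  then show False using s(2) by auto
qed

lemma h2norm_component_le:
  assumes "i < N" shows "h2norm (\<Phi> i) \<le> H2_tup_norm N \<Phi>"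
proof -
  have "(h2norm (\<Phi> i))\<^sup>2 \<le> (\<Sum>i<N. (norm_L2 (\<lambda>x. \<Phi> i x - lap (\<Phi> i) x))\<^sup>2)"
    unfolding h2norm_def using assms by (intro member_le_sum) auto
  then show ?thesis unfolding H2_tup_norm_def by (rule real_le_rsqrt)
qed

lemma h2norm_tendsto_zero:
  assumes "(\<lambda>k. H2_tup_norm N (\<lambda>i x. F k i x - \<Xi> i x)) \<longlonglongrightarrow> 0" "i < N"
  shows "(\<lambda>k. h2norm (\<lambda>x. F k i x - \<Xi> i x)) \<longlonglongrightarrow> 0"
  by (rule tendsto_sandwich[OF _ _ tendsto_const assms(1)])
    (use h2norm_component_le[OF assms(2)] in \<open>auto intro!: always_eventually\<close>)

text \<open>By rotation invariance the iterate may be replaced by its rotated form, which is the one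
  that converges; the bound then involves only the errors \<open>d i\<close> and the fixed
  limit.\<close>

lemma Fock_rotation_difference:
  assumes P: "H2tup N \<Phi>" and X: "H2tup N \<Xi>" and A: "unitary_mat N A" and w: "H2 w"
  defines "d \<equiv> \<lambda>i. h2norm (\<lambda>x. mat_act N A \<Phi> i x - \<Xi> i x)"
  shows "norm_L2 (\<lambda>x. Fock n R Z N \<Phi> w x - Fock n R Z N \<Xi> w x) \<le> (\<Sum>i<N. 4 * d i * (d i + 2 * h2norm (\<Xi> i))) * norm_L2 w"
proof -
  have H: "H2tup N (mat_act N A \<Phi>)" by (rule H2tup_mat_act[OF P])
  have "norm_L2 (\<lambda>x. Fock n R Z N (mat_act N A \<Phi>) w x - Fock n R Z N \<Xi> w x)
    \<le> (\<Sum>i<N. 4 * d i * (h2norm (mat_act N A \<Phi> i) + h2norm (\<Xi> i))) * norm_L2 w"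
    unfolding d_def by (rule Fock_difference[OF H X w])
  also have "\<dots> \<le> (\<Sum>i<N. 4 * d i * (d i + 2 * h2norm (\<Xi> i))) * norm_L2 w"
  proof (intro mult_right_mono sum_mono mult_left_mono)
    fix i assume "i \<in> {..<N}"
    then have i: "H2 (mat_act N A \<Phi> i)" "H2 (\<Xi> i)" using H X by (auto simp: H2tup_def)
    have "h2norm (\<lambda>x. (mat_act N A \<Phi> i x - \<Xi> i x) + 1 * \<Xi> i x) \<le> d i + cmod 1 * h2norm (\<Xi> i)"
      unfolding d_def by (intro h2norm_lin H2_diff i)
    then show "h2norm (mat_act N A \<Phi> i) + h2norm (\<Xi> i) \<le> d i + 2 * h2norm (\<Xi> i)" by simp
  qed (auto simp: d_def)
  finally show ?thesis unfolding Fock_mat_act[OF P A w] .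
qed

lemma unitary_recover: "unitary_mat N A \<Longrightarrow> i < N \<Longrightarrow> (\<Sum>j<N. cnj (A j i) * mat_act N A \<Phi> j x) = \<Phi> i x"
  unfolding mat_act_def by (rule unitary_inverse)

text \<open>Along a subsequence the rotations and eigenvalues converge, so that the iterates themselves
  converge to eigenfunctions of the limiting operator.\<close>

lemma limit_of_iteration:
  fixes n N :: nat and R :: "nat \<Rightarrow> real^3" and Z :: "nat \<Rightarrow> real"
  assumes N: "1 \<le> N" and g: "0 < \<gamma>"
    and P: "\<And>k. inW N (\<Phi> k)" and P': "\<And>k. inW N (\<Phi>' k)"
    and low: "\<And>k. N_lowest N (Fock n R Z N (\<Phi> k)) (eps k)"
    and gap: "\<And>k. gap_ok N (Fock n R Z N (\<Phi> k)) (eps k) \<gamma>"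
    and eig: "\<And>k i. i < N \<Longrightarrow> ae_eq (Fock n R Z N (\<Phi> k) (\<Phi>' k i)) (\<lambda>x. of_real (eps k i) * \<Phi>' k i x)"
    and X: "inW N \<Xi>" and X': "inW N \<Xi>'" and A: "\<And>k. unitary_mat N (A k)" and A': "\<And>k. unitary_mat N (A' k)"
    and conv: "(\<lambda>k. H2_tup_norm N (\<lambda>i x. mat_act N (A k) (\<Phi> k) i x - \<Xi> i x)) \<longlonglongrightarrow> 0"
    and conv': "(\<lambda>k. H2_tup_norm N (\<lambda>i x. mat_act N (A' k) (\<Phi>' k) i x - \<Xi>' i x)) \<longlonglongrightarrow> 0"
  shows "\<exists>e \<Psi> r. strict_mono r \<and> inW N \<Psi> \<and> N_lowest N (Fock n R Z N \<Xi>) e \<and> gap_ok N (Fock n R Z N \<Xi>) e \<gamma>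
    \<and> (\<forall>i<N. eigvec (Fock n R Z N \<Xi>) (e i) (\<Psi> i)) \<and> (\<forall>i<N. in_span N \<Psi> (\<Xi>' i))
    \<and> (\<forall>i<N. (\<lambda>k. eps (r k) i) \<longlonglongrightarrow> e i)"
proof -
  let ?F = "Fock n R Z N \<Xi>" and ?T = "lift_op (Fock n R Z N \<Xi>)"
  let ?Fk = "\<lambda>k. Fock n R Z N (\<Phi> k)" and ?Tk = "\<lambda>k. lift_op (Fock n R Z N (\<Phi> k))"
  have HP: "H2tup N (\<Phi> k)" and HP': "H2tup N (\<Phi>' k)" for k using P P' inW_H2tup by auto
  have HX: "H2tup N \<Xi>" and HX': "H2tup N \<Xi>'" using X X' inW_H2tup by auto
  have H': "H2 (\<Phi>' k i)" "L2 (\<Phi>' k i)" "H2 (\<Xi>' i)" "H2 (mat_act N (A' k) (\<Phi>' k) i)" if "i < N" for k i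
    using that HP' HX' H2tup_mat_act[OF HP'] by (auto simp: H2tup_def)
  define d where "d k i = h2norm (\<lambda>x. mat_act N (A k) (\<Phi> k) i x - \<Xi> i x)" for k i
  define d' where "d' k i = h2norm (\<lambda>x. mat_act N (A' k) (\<Phi>' k) i x - \<Xi>' i x)" for k i
  have d: "(\<lambda>k. d k i) \<longlonglongrightarrow> 0" and d': "(\<lambda>k. d' k i) \<longlonglongrightarrow> 0" if "i < N" for i
    unfolding d_def d'_def using h2norm_tendsto_zero[OF conv that] h2norm_tendsto_zero[OF conv' that] by auto
  \<comment> \<open>Bounds the operator norm of the difference between the Fock operator of index
    \<open>k\<close> and the limit, through the errors of the rotated tuples.\<close>
  define b where "b k = (\<Sum>i<N. 4 * d k i * (d k i + 2 * h2norm (\<Xi> i)))" for k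
  have b0: "b \<longlonglongrightarrow> 0"
  proof -
    have "b \<longlonglongrightarrow> (\<Sum>i<N. 4 * 0 * (0 + 2 * h2norm (\<Xi> i)))"
      unfolding b_def[abs_def] by (intro tendsto_intros d) auto
    then show ?thesis by simp
  qed
  have close: "norm_L2 (\<lambda>x. ?Fk k w x - ?F w x) \<le> b k * norm_L2 w" if "H2 w" for k w
    unfolding b_def d_def by (rule Fock_rotation_difference[OF HP HX A that])
  have on': "inner_L2 (\<Phi>' k i) (\<Phi>' k j) = (if i = j then 1 else 0)" if "i < N" "j < N" for k i j
    using P' that by (simp add: inW_def)
  have n1: "norm_L2 (\<Phi>' k i) = 1" if "i < N" for k i
    using norm_L2_sq[of "\<Phi>' k i"] on'[OF that that] norm_L2_nonneg[of "\<Phi>' k i"] by (simp add: power2_eq_1_iff)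
  obtain C where C: "C \<ge> 0" "\<And>w. H2 w \<Longrightarrow> norm_L2 (?F w) \<le> C * h2norm w" using Fock_bound[OF HX] by blast
  have rec: "\<Phi>' k i x = (\<Sum>j<N. cnj (A' k j i) * mat_act N (A' k) (\<Phi>' k) j x)" if "i < N" for k i x
    using unitary_recover[OF A' that] by simp
  \<comment> \<open>The iterates themselves need not converge, but entries of unitary matrices have
    modulus at most 1, so rotating back keeps them bounded in the Sobolev norm.\<close>
  have h2': "h2norm (\<Phi>' k i) \<le> (\<Sum>j<N. d' k j + h2norm (\<Xi>' j))" if i: "i < N" for k i
  proof -
    have "\<Phi>' k i = (\<lambda>x. \<Sum>j<N. cnj (A' k j i) * mat_act N (A' k) (\<Phi>' k) j x)" using rec[OF i] by (rule ext)
    then have "h2norm (\<Phi>' k i) = h2norm (\<lambda>x. \<Sum>j<N. cnj (A' k j i) * mat_act N (A' k) (\<Phi>' k) j x)" by simp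
    also have "\<dots> \<le> (\<Sum>j<N. cmod (cnj (A' k j i)) * h2norm (mat_act N (A' k) (\<Phi>' k) j))"
      by (rule h2norm_sum) (use H' in auto)
    also have "\<dots> \<le> (\<Sum>j<N. 1 * (d' k j + h2norm (\<Xi>' j)))"
    proof (intro sum_mono mult_mono)
      fix j assume "j \<in> {..<N}"
      then have j: "j < N" by simp
      show "cmod (cnj (A' k j i)) \<le> 1" using unitary_entry_le[OF A' j i] by simp
      have "h2norm (\<lambda>x. (mat_act N (A' k) (\<Phi>' k) j x - \<Xi>' j x) + 1 * \<Xi>' j x) \<le> d' k j + cmod 1 * h2norm (\<Xi>' j)"
        unfolding d'_def by (intro h2norm_lin H2_diff H' j)
      then show "h2norm (mat_act N (A' k) (\<Phi>' k) j) \<le> d' k j + h2norm (\<Xi>' j)" by simp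
    qed auto
    finally show ?thesis by simp
  qed
  \<comment> \<open>The modulus of the eigenvalue is the norm of \<open>?Fk k (\<Phi>' k i)\<close>,
    controlled by the bound of \<open>?F\<close> on the Sobolev space and by
    \<open>b k\<close>.\<close>
  have beps: "bounded (range (\<lambda>k. complex_of_real (eps k i)))" if i: "i < N" for i
  proof -
    have le: "cmod (complex_of_real (eps k i)) \<le> C * (\<Sum>j<N. d' k j + h2norm (\<Xi>' j)) + b k" for k
    proof -
      have L: "L2 (?Fk k (\<Phi>' k i))" "L2 (?F (\<Phi>' k i))" using L2_Fock HP HX H'[OF i] by auto
      have "cmod (complex_of_real (eps k i)) = norm_L2 (\<lambda>x. of_real (eps k i) * \<Phi>' k i x)"
        unfolding norm_L2_mult_const n1[OF i] by simp
      also have "\<dots> = norm_L2 (?Fk k (\<Phi>' k i))"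
        using norm_L2_cong[OF eig[OF i] L(1) L2_mult_const[OF H'(2)[OF i]]] by simp
      also have "\<dots> = norm_L2 (\<lambda>x. (?Fk k (\<Phi>' k i) x - ?F (\<Phi>' k i) x) + ?F (\<Phi>' k i) x)" by simp
      also have "\<dots> \<le> norm_L2 (\<lambda>x. ?Fk k (\<Phi>' k i) x - ?F (\<Phi>' k i) x) + norm_L2 (?F (\<Phi>' k i))"
        by (intro norm_L2_triangle L2_diff L)
      also have "\<dots> \<le> b k * 1 + C * (\<Sum>j<N. d' k j + h2norm (\<Xi>' j))"
        using close[OF H'(1)[OF i], of k k] n1[OF i] order_trans[OF C(2)[OF H'(1)[OF i]] mult_left_mono[OF h2'[OF i] C(1)]]
        by (intro add_mono) auto
      finally show ?thesis by simp
    qed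
    have "(\<lambda>k. C * (\<Sum>j<N. d' k j + h2norm (\<Xi>' j)) + b k) \<longlonglongrightarrow> C * (\<Sum>j<N. 0 + h2norm (\<Xi>' j)) + 0"
      by (intro tendsto_intros d' b0) auto
    then have "Bseq (\<lambda>k. C * (\<Sum>j<N. d' k j + h2norm (\<Xi>' j)) + b k)" by (rule convergent_imp_Bseq[OF convergentI])
    then obtain K where K: "\<And>k. norm (C * (\<Sum>j<N. d' k j + h2norm (\<Xi>' j)) + b k) \<le> K" unfolding Bseq_def by blast
    show ?thesis unfolding bounded_iff using le K by (auto intro!: exI[of _ K]) (metis abs_le_D1 order_trans norm_of_real real_norm_def)
  qed
  \<comment> \<open>Eigenvalues and matrix entries form one finite family, so that a single
    subsequence serves them all.\<close>
  define Y where "Y c k = (case c of Inl i \<Rightarrow> complex_of_real (eps k i) | Inr (i, j) \<Rightarrow> A' k i j)" for c k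
  have "\<exists>r. strict_mono r \<and> (\<forall>c\<in>{..<N} <+> ({..<N} \<times> {..<N}). convergent (\<lambda>k. Y c (r k)))"
  proof (rule finite_common_subseq)
    fix c assume "c \<in> {..<N} <+> ({..<N} \<times> {..<N})"
    then consider i where "c = Inl i" "i < N" | i j where "c = Inr (i, j)" "i < N" "j < N" by auto
    then show "bounded (range (Y c))"
    proof cases
      case 1
      then show ?thesis using beps[of i] by (simp add: Y_def[abs_def])
    next
      case 2
      then show ?thesis using unitary_entry_le[OF A'] by (auto simp: Y_def[abs_def] bounded_iff)
    qed
  qed auto
  then obtain r where r: "strict_mono r" and rc: "\<And>c. c \<in> {..<N} <+> ({..<N} \<times> {..<N}) \<Longrightarrow> convergent (\<lambda>k. Y c (r k))" by blast
  have "\<exists>l. (\<lambda>k. eps (r k) i) \<longlonglongrightarrow> l" if "i < N" for i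
  proof -
    have "convergent (\<lambda>k. complex_of_real (eps (r k) i))" using rc[OF InlI, of i] that by (simp add: Y_def)
    then obtain z where "(\<lambda>k. complex_of_real (eps (r k) i)) \<longlonglongrightarrow> z" unfolding convergent_def by blast
    from tendsto_Re[OF this] show ?thesis by auto
  qed
  then obtain e where e: "\<And>i. i < N \<Longrightarrow> (\<lambda>k. eps (r k) i) \<longlonglongrightarrow> e i" by metis
  have "\<exists>B. \<forall>i<N. \<forall>j<N. (\<lambda>k. A' (r k) i j) \<longlonglongrightarrow> B i j"
  proof -
    have "(\<lambda>k. A' (r k) i j) \<longlonglongrightarrow> lim (\<lambda>k. A' (r k) i j)" if "i < N" "j < N" for i j
      using rc[OF InrI, of "(i, j)"] that by (simp add: Y_def convergent_LIMSEQ_iff)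
    then show ?thesis by (intro exI[of _ "\<lambda>i j. lim (\<lambda>k. A' (r k) i j)"]) blast
  qed
  then obtain B where B: "\<And>i j. i < N \<Longrightarrow> j < N \<Longrightarrow> (\<lambda>k. A' (r k) i j) \<longlonglongrightarrow> B i j" by blast
  have BU: "unitary_mat N B" unfolding unitary_mat_def
  proof (intro allI impI)
    fix i j assume ij: "i < N" "j < N"
    have "(\<lambda>k. \<Sum>l<N. cnj (A' (r k) l i) * A' (r k) l j) \<longlonglongrightarrow> (\<Sum>l<N. cnj (B l i) * B l j)"
      by (intro tendsto_intros B ij) auto
    moreover have "(\<Sum>l<N. cnj (A' (r k) l i) * A' (r k) l j) = (if i = j then 1 else 0)" for k
      using A' ij by (simp add: unitary_mat_def)
    ultimately show "(\<Sum>l<N. cnj (B l i) * B l j) = (if i = j then 1 else 0)" by (simp add: LIMSEQ_const_iff)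
  qed
  \<comment> \<open>The rotated iterates tend to \<open>\<Xi>'\<close> and the rotations to
    \<open>B\<close>, so the iterates tend to \<open>\<Xi>'\<close> rotated back by the inverse of
    \<open>B\<close>.\<close>
  define \<Psi> where "\<Psi> i x = (\<Sum>j<N. cnj (B j i) * \<Xi>' j x)" for i x
  have HPsi: "H2 (\<Psi> i)" for i unfolding \<Psi>_def by (intro H2_sum H2_scale) (use H' in auto)
  have onX': "orthonormal_fam N \<Xi>'" using X' by (rule inW_orthonormal)
  have PsiW: "inW N \<Psi>" unfolding inW_def
  proof (intro conjI allI impI)
    fix i j assume ij: "i < N" "j < N"
    have "inner_L2 (\<Psi> i) (\<Psi> j) = (\<Sum>l<N. cnj (cnj (B l i)) * cnj (B l j))"
      unfolding \<Psi>_def by (rule inner_lincomb[OF onX'])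
    also have "\<dots> = cnj (\<Sum>l<N. cnj (B l i) * B l j)" by simp
    also have "\<dots> = (if i = j then 1 else 0)" using BU ij by (simp add: unitary_mat_def)
    finally show "inner_L2 (\<Psi> i) (\<Psi> j) = (if i = j then 1 else 0)" .
  qed (rule HPsi)
  have span: "in_span N \<Psi> (\<Xi>' i)" if i: "i < N" for i
    unfolding in_span_def
  proof (intro exI[of _ "B i"])
    show "ae_eq (\<Xi>' i) (\<lambda>x. \<Sum>j<N. B i j * \<Psi> j x)"
      unfolding \<Psi>_def unitary_inverse'[OF BU i] by simp
  qed
  have cPsi: "(\<lambda>k. h2norm (\<lambda>x. \<Phi>' (r k) i x - \<Psi> i x)) \<longlonglongrightarrow> 0" if i: "i < N" for i
  proof (rule Lim_null_comparison)
    show "\<forall>\<^sub>F k in sequentially. norm (h2norm (\<lambda>x. \<Phi>' (r k) i x - \<Psi> i x))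
       \<le> (\<Sum>j<N. d' (r k) j) + (\<Sum>j<N. cmod (cnj (A' (r k) j i) - cnj (B j i)) * h2norm (\<Xi>' j))"
    proof (intro always_eventually allI)
      fix k
      let ?M = "mat_act N (A' (r k)) (\<Phi>' (r k))"
      have "\<Phi>' (r k) i x - \<Psi> i x = (\<Sum>j<N. cnj (A' (r k) j i) * (?M j x - \<Xi>' j x))
          + 1 * (\<Sum>j<N. (cnj (A' (r k) j i) - cnj (B j i)) * \<Xi>' j x)" for x
        unfolding rec[OF i, of "r k" x] \<Psi>_def by (simp add: sum.distrib[symmetric] sum_subtractf[symmetric] algebra_simps)
      then have "h2norm (\<lambda>x. \<Phi>' (r k) i x - \<Psi> i x) = h2norm (\<lambda>x. (\<Sum>j<N. cnj (A' (r k) j i) * (?M j x - \<Xi>' j x))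
          + 1 * (\<Sum>j<N. (cnj (A' (r k) j i) - cnj (B j i)) * \<Xi>' j x))" by simp
      also have "\<dots> \<le> h2norm (\<lambda>x. \<Sum>j<N. cnj (A' (r k) j i) * (?M j x - \<Xi>' j x))
          + cmod 1 * h2norm (\<lambda>x. \<Sum>j<N. (cnj (A' (r k) j i) - cnj (B j i)) * \<Xi>' j x)"
        by (intro h2norm_lin H2_sum H2_scale H2_diff) (use H' in auto)
      also have "h2norm (\<lambda>x. \<Sum>j<N. cnj (A' (r k) j i) * (?M j x - \<Xi>' j x)) \<le> (\<Sum>j<N. cmod (cnj (A' (r k) j i)) * d' (r k) j)"
        unfolding d'_def by (intro h2norm_sum H2_diff) (use H' in auto)
      also have "\<dots> \<le> (\<Sum>j<N. 1 * d' (r k) j)"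
        using unitary_entry_le[OF A' _ i] by (intro sum_mono mult_right_mono) (auto simp: d'_def)
      also have "h2norm (\<lambda>x. \<Sum>j<N. (cnj (A' (r k) j i) - cnj (B j i)) * \<Xi>' j x)
          \<le> (\<Sum>j<N. cmod (cnj (A' (r k) j i) - cnj (B j i)) * h2norm (\<Xi>' j))"
        by (intro h2norm_sum) (use H' in auto)
      finally show "norm (h2norm (\<lambda>x. \<Phi>' (r k) i x - \<Psi> i x))
         \<le> (\<Sum>j<N. d' (r k) j) + (\<Sum>j<N. cmod (cnj (A' (r k) j i) - cnj (B j i)) * h2norm (\<Xi>' j))" by simp
    qed
    have dr: "(\<lambda>k. d' (r k) j) \<longlonglongrightarrow> 0" if "j < N" for j
      using LIMSEQ_subseq_LIMSEQ[OF d'[OF that] r] by (simp add: o_def)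
    have "(\<lambda>k. (\<Sum>j<N. d' (r k) j) + (\<Sum>j<N. cmod (cnj (A' (r k) j i) - cnj (B j i)) * h2norm (\<Xi>' j)))
        \<longlonglongrightarrow> (\<Sum>j<N. 0) + (\<Sum>j<N. cmod (cnj (B j i) - cnj (B j i)) * h2norm (\<Xi>' j))"
      by (intro tendsto_intros dr B i) auto
    then show "(\<lambda>k. (\<Sum>j<N. d' (r k) j) + (\<Sum>j<N. cmod (cnj (A' (r k) j i) - cnj (B j i)) * h2norm (\<Xi>' j))) \<longlonglongrightarrow> 0"
      by simp
  qed
  have br: "(\<lambda>k. b (r k)) \<longlonglongrightarrow> 0" using LIMSEQ_subseq_LIMSEQ[OF b0 r] by (simp add: o_def)
  have cl: "(\<lambda>k. cls (\<Phi>' (r k) i)) \<longlonglongrightarrow> cls (\<Psi> i)" if i: "i < N" for i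
  proof (rule LIM_zero_cancel, rule Lim_null_comparison[OF _ cPsi[OF i]], intro always_eventually allI)
    fix k
    have L: "L2 (\<Phi>' (r k) i)" "L2 (\<Psi> i)" "H2 (\<lambda>x. \<Phi>' (r k) i x - \<Psi> i x)"
      using H'[OF i] HPsi H2_L2[OF HPsi] H2_diff by auto
    show "norm (cls (\<Phi>' (r k) i) - cls (\<Psi> i)) \<le> h2norm (\<lambda>x. \<Phi>' (r k) i x - \<Psi> i x)"
      unfolding cls_diff[OF L(1,2)] cls_norm[OF H2_L2[OF L(3)]] by (rule h2norm_bounds(1)[OF L(3)])
  qed
  interpret T: sym_op H2cls ?T by (rule sym_op_Fock[OF HX])
  interpret F: fn_op ?F by (rule fn_op_Fock[OF HX])
  have closeT: "norm (?Tk k x - ?T x) \<le> b k * norm x" if x: "x \<in> H2cls" for k x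
  proof -
    obtain w where w: "x = cls w" "H2 w" using x by (auto simp: H2cls_def)
    have L: "L2 (?Fk k w)" "L2 (?F w)" using L2_Fock HP HX w(2) by auto
    show ?thesis unfolding w(1) lift_Fock[OF HP w(2)] lift_Fock[OF HX w(2)] cls_diff[OF L] cls_norm[OF L2_diff[OF L]]
        cls_norm[OF H2_L2[OF w(2)]] by (rule close[OF w(2)])
  qed
  have eigk: "?Tk k (cls (\<Phi>' k i)) = eps k i *\<^sub>R cls (\<Phi>' k i)" if "i < N" for k i
    using eigvec_iff[OF HP H'(1)[OF that]] eig[OF that] H'(1)[OF that] by (simp add: eigvec_def)
  \<comment> \<open>Two limits of \<open>?T (cls (\<Phi>' (r k) i))\<close> are compared: one from
    the bound of \<open>?F\<close> in the Sobolev norm, the other from the eigenvalue equation for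
    index \<open>r k\<close>.\<close>
  have eigT: "?T (cls (\<Psi> i)) = e i *\<^sub>R cls (\<Psi> i)" if i: "i < N" for i
  proof (rule LIMSEQ_unique)
    have "(\<lambda>k. ?T (cls (\<Phi>' (r k) i)) - ?T (cls (\<Psi> i))) \<longlonglongrightarrow> 0"
    proof (rule Lim_null_comparison, intro always_eventually allI)
      fix k
      have D: "H2 (\<lambda>x. \<Phi>' (r k) i x - \<Psi> i x)" using H'[OF i] HPsi H2_diff by auto
      have "?T (cls (\<Phi>' (r k) i)) - ?T (cls (\<Psi> i)) = ?T (cls (\<Phi>' (r k) i) - cls (\<Psi> i))"
        using T.diff[OF cls_in_H2cls[OF H'(1)[OF i]] cls_in_H2cls[OF HPsi]] by simp
      also have "\<dots> = cls (?F (\<lambda>x. \<Phi>' (r k) i x - \<Psi> i x))"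
        unfolding cls_diff[OF H'(2)[OF i] H2_L2[OF HPsi]] by (rule lift_Fock[OF HX D])
      finally show "norm (?T (cls (\<Phi>' (r k) i)) - ?T (cls (\<Psi> i))) \<le> C * h2norm (\<lambda>x. \<Phi>' (r k) i x - \<Psi> i x)"
        using C(2)[OF D] by (simp add: cls_norm[OF L2_Fock[OF HX D]])
      show "(\<lambda>k. C * h2norm (\<lambda>x. \<Phi>' (r k) i x - \<Psi> i x)) \<longlonglongrightarrow> 0" using tendsto_mult_right_zero[OF cPsi[OF i]] by simp
    qed
    then show "(\<lambda>k. ?T (cls (\<Phi>' (r k) i))) \<longlonglongrightarrow> ?T (cls (\<Psi> i))" by (rule LIM_zero_cancel)
    have "(\<lambda>k. ?Tk (r k) (cls (\<Phi>' (r k) i)) - ?T (cls (\<Phi>' (r k) i))) \<longlonglongrightarrow> 0"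
    proof (rule Lim_null_comparison[OF _ br], intro always_eventually allI)
      fix k
      show "norm (?Tk (r k) (cls (\<Phi>' (r k) i)) - ?T (cls (\<Phi>' (r k) i))) \<le> b (r k)"
        using closeT[OF cls_in_H2cls[OF H'(1)[OF i]], of "r k" "r k"] by (simp add: cls_norm[OF H'(2)[OF i]] n1[OF i])
    qed
    moreover have "(\<lambda>k. ?Tk (r k) (cls (\<Phi>' (r k) i))) \<longlonglongrightarrow> e i *\<^sub>R cls (\<Psi> i)"
      unfolding eigk[OF i] by (intro tendsto_intros e cl i)
    ultimately show "(\<lambda>k. ?T (cls (\<Phi>' (r k) i))) \<longlonglongrightarrow> e i *\<^sub>R cls (\<Psi> i)"
      using tendsto_diff by fastforce
  qed
  have eigPsi: "eigvec ?F (e i) (\<Psi> i)" if "i < N" for i using eigvec_iff[OF HX HPsi] eigT[OF that] by blast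
  have mono: "e i \<le> e j" if "i \<le> j" "j < N" for i j
  proof (rule LIMSEQ_le[OF e e])
    show "\<exists>K. \<forall>k\<ge>K. eps (r k) i \<le> eps (r k) j" using N_lowestD(1)[OF low that] by blast
  qed (use that in auto)
  \<comment> \<open>An orbital and its multiple by \<i> are orthogonal for the real inner product
    and span its complex line over the reals; the Boolean component selects the factor.\<close>
  define J where "J = {..<N} \<times> (UNIV :: bool set)"
  define \<phi> where "\<phi> k c = cls (\<lambda>x. (if snd c then 1 else \<i>) * \<Phi>' k (fst c) x)" for k and c :: "nat \<times> bool"
  define \<epsilon> where "\<epsilon> k c = eps k (fst c)" for k and c :: "nat \<times> bool"
  have J: "finite J" by (simp add: J_def)
  have Jlt: "fst c < N" if "c \<in> J" for c using that by (auto simp: J_def)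
  have imJ: "(\<lambda>c. f (fst c)) ` J = f ` {..<N}" for f :: "nat \<Rightarrow> real"
    unfolding J_def by (force simp: image_iff)
  \<comment> \<open>By \<open>spec_structure\<close>, the spectrum of the operator of index
    \<open>r k\<close> below this threshold consists of the listed eigenvalues.\<close>
  have Lam: "(\<lambda>k. eps (r k) (N - 1) + \<gamma>) \<longlonglongrightarrow> e (N - 1) + \<gamma>" by (intro tendsto_intros e) (use N in auto)
  have resk: "l \<in> resolvent_set H2cls (?Tk (r k)) \<or> l \<in> \<epsilon> (r k) ` J" if l: "l < eps (r k) (N - 1) + \<gamma>" for k l
  proof (cases "l \<in> spec (?Fk (r k))")
    case True
    then have "l \<in> eps (r k) ` {..<N}" using spec_structure[OF low gap N, of l "r k"] l by auto
    then show ?thesis unfolding \<epsilon>_def imJ by blast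
  qed (use spec_iff_resolvent_set[OF HP] in blast)
  have epsJ: "(\<lambda>k. \<epsilon> (r k) c) \<longlonglongrightarrow> e (fst c)" if "c \<in> J" for c
    unfolding \<epsilon>_def by (rule e[OF Jlt[OF that]])
  have spT: "\<mu> \<in> e ` {..<N} \<or> e (N - 1) + \<gamma> \<le> \<mu>" if "\<mu> \<in> spec ?F" for \<mu>
  proof (rule ccontr)
    assume "\<not> ?thesis"
    then have a: "\<mu> < e (N - 1) + \<gamma>" "\<mu> \<notin> (\<lambda>c. e (fst c)) ` J" unfolding imJ by auto
    have "\<mu> \<in> resolvent_set H2cls ?T"
      by (rule limit_resolvent_set[OF T.sym_op_axioms sym_op_Fock[OF HP] closeT br J epsJ Lam resk a])
    then show False using spec_iff_resolvent_set[OF HX] that by blast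
  qed
  have ex: "F.exhausts N e \<Psi>"
    unfolding F.exhausts_def
  proof (intro allI impI)
    fix i u assume i: "i < N" and "eigvec ?F (e i) u \<and> (\<forall>j<N. inner_L2 (\<Psi> j) u = 0)"
    then have u: "eigvec ?F (e i) u" and orth: "\<And>j. j < N \<Longrightarrow> inner_L2 (\<Psi> j) u = 0" by auto
    have uH: "H2 u" and uL: "L2 u" using u by (auto simp: eigvec_def)
    have phi: "H2 (\<lambda>x. (if snd c then 1 else \<i>) * \<Phi>' k (fst c) x)" if "c \<in> J" for k c
      using H'[OF Jlt[OF that]] by (intro H2_scale)
    have "cls u = 0"
    proof (rule limit_eigenvector_zero[where Tk="\<lambda>k. ?Tk (r k)" and \<phi>="\<lambda>k. \<phi> (r k)",
          OF T.sym_op_axioms sym_op_Fock[OF HP] closeT br J epsJ Lam resk])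
      show "\<phi> (r k) c \<in> H2cls" if "c \<in> J" for k c
        unfolding \<phi>_def by (rule cls_in_H2cls[OF phi[OF that]])
      show "?Tk (r k) (\<phi> (r k) c) = \<epsilon> (r k) c *\<^sub>R \<phi> (r k) c" if c: "c \<in> J" for k c
      proof -
        interpret Fk: fn_op "?Fk (r k)" by (rule fn_op_Fock[OF HP])
        have "eigvec (?Fk (r k)) (eps (r k) (fst c)) (\<Phi>' (r k) (fst c))"
          using eig[OF Jlt[OF c]] H'[OF Jlt[OF c]] by (simp add: eigvec_def)
        from Fk.eigvec_scale[OF this] show ?thesis
          unfolding \<phi>_def \<epsilon>_def using eigvec_iff[OF HP phi[OF c]] by blast
      qed
      show "\<phi> (r k) c \<bullet> \<phi> (r k) c' = (if c = c' then 1 else 0)" if c: "c \<in> J" and c': "c' \<in> J" for k c c'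
        unfolding \<phi>_def cls_inner[OF H2_L2[OF phi[OF c]] H2_L2[OF phi[OF c']]] inner_L2_scale_left inner_L2_scale_right
          on'[OF Jlt[OF c] Jlt[OF c']] by (auto simp: prod_eq_iff)
      \<comment> \<open>Real orthogonality to an orbital and to its multiple by \<i> is complex
        orthogonality. The gap makes the counts exact at each index, so \<open>exhausts\<close>
        holds there.\<close>
      show "v = 0" if v: "v \<in> H2cls" and c: "c \<in> J" and Tv: "?Tk (r k) v = \<epsilon> (r k) c *\<^sub>R v"
        and o: "\<And>c'. c' \<in> J \<Longrightarrow> \<phi> (r k) c' \<bullet> v = 0" for k v c
      proof -
        interpret Fk: fn_op "?Fk (r k)" by (rule fn_op_Fock[OF HP])
        obtain w where w: "v = cls w" "H2 w" using v by (auto simp: H2cls_def)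
        have ow: "inner_L2 (\<Phi>' (r k) j) w = 0" if j: "j < N" for j
        proof -
          have m: "(j, True) \<in> J" "(j, False) \<in> J" using j by (auto simp: J_def)
          have "Re (cnj 1 * inner_L2 (\<Phi>' (r k) j) w) = 0" "Re (cnj \<i> * inner_L2 (\<Phi>' (r k) j) w) = 0"
            using o[OF m(1)] o[OF m(2)] cls_inner[OF H2_L2[OF phi[OF m(1)]] H2_L2[OF w(2)], of "r k"]
              cls_inner[OF H2_L2[OF phi[OF m(2)]] H2_L2[OF w(2)], of "r k"]
            unfolding \<phi>_def w(1) inner_L2_scale_left by simp_all
          then show ?thesis by (simp add: complex_eq_iff)
        qed
        have "Fk.exhausts N (eps (r k)) (\<Phi>' (r k))"
        proof (rule Fk.exhaustsI)
          show "orthonormal_fam N (\<Phi>' (r k))" using P' by (rule inW_orthonormal)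
          show "eigvec (?Fk (r k)) (eps (r k) j) (\<Phi>' (r k) j)" if "j < N" for j
            using eig[OF that] H'[OF that] by (simp add: eigvec_def)
          show "mult (?Fk (r k)) (eps (r k) j) \<le> enat (card {i. i < N \<and> eps (r k) i = eps (r k) j})" if "j < N" for j
            using mult_exact[OF low gap g that] by simp
        qed
        moreover have "eigvec (?Fk (r k)) (eps (r k) (fst c)) w"
          using eigvec_iff[OF HP w(2)] Tv unfolding w(1) \<epsilon>_def by blast
        ultimately have "ae_eq w (\<lambda>x. 0)" unfolding Fk.exhausts_def using ow Jlt[OF c] by blast
        then show ?thesis using cls_eq_iff[OF H2_L2[OF w(2)] L2_zero] by (simp add: w(1) cls_zero)
      qed
      show "cls u \<in> H2cls" by (rule cls_in_H2cls[OF uH])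
      show "?T (cls u) = e i *\<^sub>R cls u" using eigvec_iff[OF HX uH] u by blast
      show "e i < e (N - 1) + \<gamma>" 
      proof -
        have "e i \<le> e (N - 1)" by (rule mono) (use i N in auto)
        then show ?thesis using g by simp
      qed
      \<comment> \<open>The factor 1 or \<i> is moved onto \<open>u\<close>, so that the convergence
        \<open>cl\<close> of the iterates applies and the limit vanishes by
        \<open>orth\<close>.\<close>
      show "(\<lambda>k. \<phi> (r k) c \<bullet> cls u) \<longlonglongrightarrow> 0" if c: "c \<in> J" for c
      proof -
        let ?z = "if snd c then 1 else \<i>"
        have "\<phi> (r k) c \<bullet> cls u = cls (\<Phi>' (r k) (fst c)) \<bullet> cls (\<lambda>x. cnj ?z * u x)" for k
          unfolding \<phi>_def cls_inner[OF H2_L2[OF phi[OF c]] uL] cls_inner[OF H'(2)[OF Jlt[OF c]] L2_mult_const[OF uL]]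
            inner_L2_scale_left inner_L2_scale_right ..
        moreover have "(\<lambda>k. cls (\<Phi>' (r k) (fst c)) \<bullet> cls (\<lambda>x. cnj ?z * u x)) \<longlonglongrightarrow> cls (\<Psi> (fst c)) \<bullet> cls (\<lambda>x. cnj ?z * u x)"
          by (intro tendsto_intros cl Jlt c)
        moreover have "cls (\<Psi> (fst c)) \<bullet> cls (\<lambda>x. cnj ?z * u x) = 0"
          unfolding cls_inner[OF H2_L2[OF HPsi] L2_mult_const[OF uL]] inner_L2_scale_right orth[OF Jlt[OF c]] by simp
        ultimately show ?thesis by simp
      qed
    qed
    then show "ae_eq u (\<lambda>x. 0)" using cls_eq_iff[OF uL L2_zero] by (simp add: cls_zero)
  qed
  have "N_lowest N ?F e" "gap_ok N ?F e \<gamma>"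
    using F.N_lowest_gapI[OF inW_orthonormal[OF PsiW] eigPsi N g ex mono spT] by blast+
  then show ?thesis using r PsiW eigPsi span e by blast
qed

text \<open>The gap makes the counts exact, so \<open>\<Psi>\<close> exhausts the eigenspaces and
  every eigenvector expands in it.\<close>

lemma lowest_eigvec_in_span:
  assumes X: "H2tup N \<Xi>" and g: "\<gamma> > 0" and W: "inW N \<Psi>"
    and low: "N_lowest N (Fock n R Z N \<Xi>) e" and gap: "gap_ok N (Fock n R Z N \<Xi>) e \<gamma>"
    and eig: "\<And>i. i < N \<Longrightarrow> eigvec (Fock n R Z N \<Xi>) (e i) (\<Psi> i)"
    and i: "i < N" and u: "eigvec (Fock n R Z N \<Xi>) (e i) u"
  shows "in_span N \<Psi> u"
proof -
  interpret fn_op "Fock n R Z N \<Xi>" by (rule fn_op_Fock[OF X])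
  have "exhausts N e \<Psi>"
    by (rule exhaustsI[OF inW_orthonormal[OF W] eig]) (use mult_exact[OF low gap g] in auto)
  from eigvec_expansion[OF inW_orthonormal[OF W] eig this i u] show ?thesis
    unfolding in_span_def by (rule exI[of _ "\<lambda>j. inner_L2 (\<Psi> j) u"])
qed

section \<open>Comparison of the even and odd limits\<close>

theorem theorem1p2:
  fixes n N :: nat and R :: "nat \<Rightarrow> real^3" and Z :: "nat \<Rightarrow> real"
    and \<Phi> :: "nat \<Rightarrow> tup" and eps :: "nat \<Rightarrow> nat \<Rightarrow> real" and \<gamma> C0 :: real
    and \<Xi> \<Xi>t :: tup and A :: "nat \<Rightarrow> nat \<Rightarrow> nat \<Rightarrow> complex"
  assumes N_pos: "1 \<le> N"
    and Z_pos: "\<forall>l<n. 0 < Z l"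
    and gamma_pos: "0 < \<gamma>"
    and scf: "uwp_SCF n R Z N \<Phi> eps \<gamma>"
    and C0_pos: "0 < C0"
    and init: "\<forall>i<N. L2 (\<lambda>x. complex_of_real (sqrt (1 + (norm x)^2)) * \<Phi> 0 i x)
                 \<and> norm_L2 (\<lambda>x. complex_of_real (sqrt (1 + (norm x)^2)) * \<Phi> 0 i x) \<le> C0"
    and Xi_W: "inW N \<Xi>" and Xit_W: "inW N \<Xi>t"
    and A_unit: "\<forall>k. unitary_mat N (A k)"
    and conv_even: "(\<lambda>k. H2_tup_norm N (\<lambda>i x. mat_act N (A (2*k)) (\<Phi> (2*k)) i x - \<Xi> i x))
                      \<longlonglongrightarrow> 0"
    and conv_odd: "(\<lambda>k. H2_tup_norm N (\<lambda>i x. mat_act N (A (2*k+1)) (\<Phi> (2*k+1)) i x - \<Xi>t i x))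
                      \<longlonglongrightarrow> 0"
    and D_even: "(\<lambda>k. hs_norm (\<lambda>w x. Dmat N (\<Phi> (2*k)) w x - Dmat N \<Xi> w x)) \<longlonglongrightarrow> 0"
    and D_odd: "(\<lambda>k. hs_norm (\<lambda>w x. Dmat N (\<Phi> (2*k+1)) w x - Dmat N \<Xi>t w x)) \<longlonglongrightarrow> 0"
  shows
    "(\<exists>e. N_lowest N (Fock n R Z N \<Xi>) e \<and> gap_ok N (Fock n R Z N \<Xi>) e \<gamma>)
   \<and> (\<exists>e. N_lowest N (Fock n R Z N \<Xi>t) e \<and> gap_ok N (Fock n R Z N \<Xi>t) e \<gamma>)
   \<and> (\<exists>\<Phi>h eh. inW N \<Phi>h \<and> N_lowest N (Fock n R Z N \<Xi>) eh
         \<and> (\<forall>i<N. ae_eq (Fock n R Z N \<Xi> (\<Phi>h i)) (\<lambda>x. of_real (eh i) * \<Phi>h i x)))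
   \<and> (\<forall>\<Phi>h eh. inW N \<Phi>h \<and> N_lowest N (Fock n R Z N \<Xi>) eh
         \<and> (\<forall>i<N. ae_eq (Fock n R Z N \<Xi> (\<Phi>h i)) (\<lambda>x. of_real (eh i) * \<Phi>h i x)) \<longrightarrow>
        (\<exists>Ainf. unitary_mat N Ainf \<and> tup_eq N \<Xi>t (mat_act N Ainf \<Phi>h))
      \<and> (\<forall>i<N. (\<lambda>k. eps (2*k+1) i) \<longlonglongrightarrow> eh i)
      \<and> ((\<exists>\<Theta>. unitary_mat N \<Theta> \<and> tup_eq N \<Xi> (mat_act N \<Theta> \<Xi>t)) \<longrightarrow>
          (\<forall>i<N. ae_eq (Fock n R Z N \<Phi>h (\<Phi>h i)) (\<lambda>x. of_real (eh i) * \<Phi>h i x)))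
      \<and> ((\<exists>e'. N_lowest N (Fock n R Z N \<Phi>h) e'
              \<and> (\<forall>u. in_span N \<Phi>h u \<longleftrightarrow> in_eig_sum N (Fock n R Z N \<Phi>h) e' u)) \<longrightarrow>
          (\<exists>\<Theta>. unitary_mat N \<Theta> \<and> tup_eq N \<Xi> (mat_act N \<Theta> \<Xi>t)))
      \<and> ((\<forall>w. L2 w \<longrightarrow> ae_eq (Dmat N \<Phi>h w) (Dmat N \<Xi> w)) \<longrightarrow>
          (\<exists>\<Theta>. unitary_mat N \<Theta> \<and> tup_eq N \<Xi> (mat_act N \<Theta> \<Xi>t))))"
proof -
  let ?F = "\<lambda>X. Fock n R Z N X"
  have W: "inW N (\<Phi> k)" and low: "N_lowest N (?F (\<Phi> k)) (eps (Suc k))"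
    and gap: "gap_ok N (?F (\<Phi> k)) (eps (Suc k)) \<gamma>"
    and eig: "\<And>i. i < N \<Longrightarrow> ae_eq (?F (\<Phi> k) (\<Phi> (Suc k) i)) (\<lambda>x. of_real (eps (Suc k) i) * \<Phi> (Suc k) i x)" for k
    using scf by (simp_all add: uwp_SCF_def)
  have HX: "H2tup N \<Xi>" and HXt: "H2tup N \<Xi>t" using Xi_W Xit_W inW_H2tup by auto
  have onX: "orthonormal_fam N \<Xi>" and onXt: "orthonormal_fam N \<Xi>t" using Xi_W Xit_W inW_orthonormal by auto
  \<comment> \<open>Stated along an arbitrary subsequence \<open>s\<close>, as convergence of the
    full sequence of eigenvalues will be tested on subsequences.\<close>
  have even: "\<exists>e \<Psi> r. strict_mono r \<and> inW N \<Psi> \<and> N_lowest N (?F \<Xi>) e \<and> gap_ok N (?F \<Xi>) e \<gamma>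
    \<and> (\<forall>i<N. eigvec (?F \<Xi>) (e i) (\<Psi> i)) \<and> (\<forall>i<N. in_span N \<Psi> (\<Xi>t i))
    \<and> (\<forall>i<N. (\<lambda>k. eps (2 * s (r k) + 1) i) \<longlonglongrightarrow> e i)" if s: "strict_mono s" for s :: "nat \<Rightarrow> nat"
  proof (rule limit_of_iteration[where \<Phi>="\<lambda>k. \<Phi> (2 * s k)" and \<Phi>'="\<lambda>k. \<Phi> (2 * s k + 1)"
        and eps="\<lambda>k. eps (2 * s k + 1)" and A="\<lambda>k. A (2 * s k)" and A'="\<lambda>k. A (2 * s k + 1)", OF N_pos gamma_pos W W])
    show "(\<lambda>k. H2_tup_norm N (\<lambda>i x. mat_act N (A (2 * s k)) (\<Phi> (2 * s k)) i x - \<Xi> i x)) \<longlonglongrightarrow> 0"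
      using LIMSEQ_subseq_LIMSEQ[OF conv_even s] by (simp add: o_def)
    show "(\<lambda>k. H2_tup_norm N (\<lambda>i x. mat_act N (A (2 * s k + 1)) (\<Phi> (2 * s k + 1)) i x - \<Xi>t i x)) \<longlonglongrightarrow> 0"
      using LIMSEQ_subseq_LIMSEQ[OF conv_odd s] by (simp add: o_def)
  qed (use low gap eig Xi_W Xit_W A_unit in auto)
  have "strict_mono (\<lambda>k::nat. k)" by (simp add: strict_mono_def)
  from even[OF this] obtain e \<Psi> where e: "inW N \<Psi>" "N_lowest N (?F \<Xi>) e" "gap_ok N (?F \<Xi>) e \<gamma>"
    "\<And>i. i < N \<Longrightarrow> eigvec (?F \<Xi>) (e i) (\<Psi> i)" "\<And>i. i < N \<Longrightarrow> in_span N \<Psi> (\<Xi>t i)" by blast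
  \<comment> \<open>Starting at the odd index \<open>2 * k + 1\<close>, the step leads to
    \<open>2 * k + 2\<close>, so the roles are interchanged: the operator belongs to
    \<open>\<Xi>t\<close> and the rotated orbitals tend to \<open>\<Xi>\<close>.\<close>
  have "\<exists>e \<Psi> r. strict_mono r \<and> inW N \<Psi> \<and> N_lowest N (?F \<Xi>t) e \<and> gap_ok N (?F \<Xi>t) e \<gamma>
    \<and> (\<forall>i<N. eigvec (?F \<Xi>t) (e i) (\<Psi> i)) \<and> (\<forall>i<N. in_span N \<Psi> (\<Xi> i))
    \<and> (\<forall>i<N. (\<lambda>k. eps (2 * r k + 2) i) \<longlonglongrightarrow> e i)"
  proof (rule limit_of_iteration[where \<Phi>="\<lambda>k. \<Phi> (2 * k + 1)" and \<Phi>'="\<lambda>k. \<Phi> (2 * k + 2)"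
        and eps="\<lambda>k. eps (2 * k + 2)" and A="\<lambda>k. A (2 * k + 1)" and A'="\<lambda>k. A (2 * k + 2)", OF N_pos gamma_pos W W])
    show "(\<lambda>k. H2_tup_norm N (\<lambda>i x. mat_act N (A (2 * k + 2)) (\<Phi> (2 * k + 2)) i x - \<Xi> i x)) \<longlonglongrightarrow> 0"
      using LIMSEQ_Suc[OF conv_even] by simp
    show "N_lowest N (?F (\<Phi> (2 * k + 1))) (eps (2 * k + 2))" for k using low[of "2 * k + 1"] by simp
    show "gap_ok N (?F (\<Phi> (2 * k + 1))) (eps (2 * k + 2)) \<gamma>" for k using gap[of "2 * k + 1"] by simp
    show "ae_eq (?F (\<Phi> (2 * k + 1)) (\<Phi> (2 * k + 2) i)) (\<lambda>x. of_real (eps (2 * k + 2) i) * \<Phi> (2 * k + 2) i x)"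
      if "i < N" for k i using eig[OF that, of "2 * k + 1"] by simp
  qed (use Xi_W Xit_W A_unit conv_odd in auto)
  then obtain e2 \<Psi>2 where e2: "inW N \<Psi>2" "N_lowest N (?F \<Xi>t) e2" "gap_ok N (?F \<Xi>t) e2 \<gamma>"
    "\<And>i. i < N \<Longrightarrow> eigvec (?F \<Xi>t) (e2 i) (\<Psi>2 i)" "\<And>i. i < N \<Longrightarrow> in_span N \<Psi>2 (\<Xi> i)" by blast
  have main: "(\<exists>Ainf. unitary_mat N Ainf \<and> tup_eq N \<Xi>t (mat_act N Ainf \<Phi>h))
      \<and> (\<forall>i<N. (\<lambda>k. eps (2*k+1) i) \<longlonglongrightarrow> eh i)
      \<and> ((\<exists>\<Theta>. unitary_mat N \<Theta> \<and> tup_eq N \<Xi> (mat_act N \<Theta> \<Xi>t)) \<longrightarrow>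
          (\<forall>i<N. ae_eq (?F \<Phi>h (\<Phi>h i)) (\<lambda>x. of_real (eh i) * \<Phi>h i x)))
      \<and> ((\<exists>e'. N_lowest N (?F \<Phi>h) e'
              \<and> (\<forall>u. in_span N \<Phi>h u \<longleftrightarrow> in_eig_sum N (?F \<Phi>h) e' u)) \<longrightarrow>
          (\<exists>\<Theta>. unitary_mat N \<Theta> \<and> tup_eq N \<Xi> (mat_act N \<Theta> \<Xi>t)))
      \<and> ((\<forall>w. L2 w \<longrightarrow> ae_eq (Dmat N \<Phi>h w) (Dmat N \<Xi> w)) \<longrightarrow>
          (\<exists>\<Theta>. unitary_mat N \<Theta> \<and> tup_eq N \<Xi> (mat_act N \<Theta> \<Xi>t)))"
    if hW: "inW N \<Phi>h" and hl: "N_lowest N (?F \<Xi>) eh"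
      and he: "\<forall>i<N. ae_eq (?F \<Xi> (\<Phi>h i)) (\<lambda>x. of_real (eh i) * \<Phi>h i x)" for \<Phi>h eh
  proof -
    have Hh: "H2tup N \<Phi>h" and onh: "orthonormal_fam N \<Phi>h" using hW inW_H2tup inW_orthonormal by auto
    have eh: "eh i = e i" if "i < N" for i
      by (rule N_lowest_unique[OF e(2,3) gamma_pos N_pos hl that])
    have hPsi: "in_span N \<Psi> (\<Phi>h i)" if "i < N" for i
    proof (rule lowest_eigvec_in_span[OF HX gamma_pos e(1-4) that])
      show "eigvec (?F \<Xi>) (e i) (\<Phi>h i)" 
        unfolding eigvec_def eh[OF that, symmetric] using he Hh that by (simp add: H2tup_def)
    qed
    obtain U where U: "unitary_mat N U" "tup_eq N \<Phi>h (mat_act N U \<Psi>)"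
      using span_unitary[OF inW_orthonormal[OF e(1)] onh hPsi] by blast
    have Psih: "in_span N \<Phi>h (\<Psi> i)" if "i < N" for i by (rule unitary_in_span_sym[OF U that])
    have Xth: "in_span N \<Phi>h (\<Xi>t i)" if "i < N" for i by (rule in_span_trans[OF e(5)[OF that] Psih])
    obtain Ainf where Ainf: "unitary_mat N Ainf" "tup_eq N \<Xi>t (mat_act N Ainf \<Phi>h)"
      using span_unitary[OF onh onXt Xth] by blast
    have hXt: "in_span N \<Xi>t (\<Phi>h i)" if "i < N" for i by (rule unitary_in_span_sym[OF Ainf that])
    \<comment> \<open>\<open>\<Xi>t\<close> and the chosen eigenfunctions span the same space, so
      the last two claims reduce to placing \<open>\<Xi>\<close> in the span of
      \<open>\<Phi>h\<close>.\<close>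
    have theta: "\<exists>\<Theta>. unitary_mat N \<Theta> \<and> tup_eq N \<Xi> (mat_act N \<Theta> \<Xi>t)" if "\<And>i. i < N \<Longrightarrow> in_span N \<Phi>h (\<Xi> i)"
      by (rule span_unitary[OF onXt onX in_span_trans[OF that hXt]])
    have lim: "(\<lambda>k. eps (2*k+1) i) \<longlonglongrightarrow> eh i" if i: "i < N" for i
    proof (rule tendsto_if_subseqs)
      fix s :: "nat \<Rightarrow> nat" assume "strict_mono s"
      from even[OF this] obtain f r where f: "strict_mono r" "N_lowest N (?F \<Xi>) f"
        "\<And>i. i < N \<Longrightarrow> (\<lambda>k. eps (2 * s (r k) + 1) i) \<longlonglongrightarrow> f i" by blast
      have "f i = eh i" using N_lowest_unique[OF e(2,3) gamma_pos N_pos f(2) i] eh[OF i] by simp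
      then show "\<exists>r :: nat \<Rightarrow> nat. strict_mono r \<and> (\<lambda>k. eps (2 * s (r k) + 1) i) \<longlonglongrightarrow> eh i" using f(1) f(3)[OF i] by auto
    qed
    \<comment> \<open>Under the hypothesis \<open>\<Xi>\<close> is a rotation of
      \<open>\<Phi>h\<close>, so both generate the same Fock operator and the equation for
      \<open>\<Xi>\<close> becomes self-consistent.\<close>
    have p3: "\<forall>i<N. ae_eq (?F \<Phi>h (\<Phi>h i)) (\<lambda>x. of_real (eh i) * \<Phi>h i x)"
      if "unitary_mat N \<Theta>" "tup_eq N \<Xi> (mat_act N \<Theta> \<Xi>t)" for \<Theta>
    proof (intro allI impI)
      fix i assume i: "i < N"
      have "in_span N \<Phi>h (\<Xi> j)" if "j < N" for j
        by (rule in_span_trans[OF unitary_in_span[OF \<open>tup_eq N \<Xi> (mat_act N \<Theta> \<Xi>t)\<close> that] Xth])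
      then obtain M where M: "unitary_mat N M" "tup_eq N \<Xi> (mat_act N M \<Phi>h)" using span_unitary[OF onh onX] by blast
      have "H2 (\<Phi>h i)" using Hh i by (simp add: H2tup_def)
      then have "ae_eq (?F \<Phi>h (\<Phi>h i)) (?F \<Xi> (\<Phi>h i))" by (rule ae_eq_sym[OF Fock_unitary[OF Hh HX M]])
      then show "ae_eq (?F \<Phi>h (\<Phi>h i)) (\<lambda>x. of_real (eh i) * \<Phi>h i x)" using he i ae_eq_trans by blast
    qed
    \<comment> \<open>\<open>\<Phi>h\<close> and \<open>\<Xi>t\<close> generate the same Fock
      operator. The family \<open>\<Psi>2\<close> consists of its lowest eigenvectors and spans
      \<open>\<Xi>\<close>, so the hypothesis carries \<open>\<Xi>\<close> into the span of
      \<open>\<Phi>h\<close>.\<close>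
    have p4: "\<exists>\<Theta>. unitary_mat N \<Theta> \<and> tup_eq N \<Xi> (mat_act N \<Theta> \<Xi>t)"
      if e': "N_lowest N (?F \<Phi>h) e'" and sp: "\<forall>u. in_span N \<Phi>h u \<longleftrightarrow> in_eig_sum N (?F \<Phi>h) e' u" for e'
    proof (rule theta)
      fix i assume i: "i < N"
      have FF: "ae_eq (?F \<Xi>t w) (?F \<Phi>h w)" if "H2 w" for w by (rule Fock_unitary[OF Hh HXt Ainf that])
      have l': "N_lowest N (?F \<Xi>t) e'" using N_lowest_cong(1)[of "?F \<Xi>t" "?F \<Phi>h", OF FF] e' by blast
      interpret Fh: fn_op "?F \<Phi>h" by (rule fn_op_Fock[OF Hh])
      have "in_span N \<Phi>h (\<Psi>2 j)" if j: "j < N" for j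
      proof -
        have "e' j = e2 j" by (rule N_lowest_unique[OF e2(2,3) gamma_pos N_pos l' j])
        then have "eigvec (?F \<Phi>h) (e' j) (\<Psi>2 j)"
          using e2(4)[OF j] N_lowest_cong(2)[of "?F \<Xi>t" "?F \<Phi>h", OF FF] by simp
        \<comment> \<open>A single eigenvector as an element of the direct sum: all other summands
          are zero.\<close>
        then have "eigvec (?F \<Phi>h) (e' i) (\<lambda>x. if i = j then \<Psi>2 j x else 0)" for i
          using Fh.eigvec_zero by (cases "i = j") simp_all
        then have "in_eig_sum N (?F \<Phi>h) e' (\<Psi>2 j)"
          unfolding in_eig_sum_def using j
          by (intro exI[of _ "\<lambda>i x. if i = j then \<Psi>2 j x else 0"]) simp
        then show ?thesis using sp by blast
      qed
      then show "in_span N \<Phi>h (\<Xi> i)" by (rule in_span_trans[OF e2(5)[OF i]])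
    qed
    have p5: "\<exists>\<Theta>. unitary_mat N \<Theta> \<and> tup_eq N \<Xi> (mat_act N \<Theta> \<Xi>t)"
      if D: "\<forall>w. L2 w \<longrightarrow> ae_eq (Dmat N \<Phi>h w) (Dmat N \<Xi> w)"
    proof (rule theta)
      fix i assume i: "i < N"
      \<comment> \<open>The projection fixes its own orbitals; by hypothesis so does that of
        \<open>\<Phi>h\<close>, whose values lie in the span of \<open>\<Phi>h\<close>.\<close>
      have "Dmat N \<Xi> (\<Xi> i) = \<Xi> i"
      proof
        fix x
        have "Dmat N \<Xi> (\<Xi> i) x = (\<Sum>j<N. if j = i then \<Xi> j x else 0)"
          unfolding Dmat_def using onX i by (intro sum.cong) (auto simp: orthonormal_fam_def)
        then show "Dmat N \<Xi> (\<Xi> i) x = \<Xi> i x" using i by simp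
      qed
      moreover have "L2 (\<Xi> i)" using onX i by (simp add: orthonormal_fam_def)
      ultimately have "ae_eq (\<Xi> i) (Dmat N \<Phi>h (\<Xi> i))" using D ae_eq_sym by metis
      then show "in_span N \<Phi>h (\<Xi> i)"
        unfolding in_span_def Dmat_def by (intro exI[of _ "\<lambda>j. inner_L2 (\<Phi>h j) (\<Xi> i)"])
    qed
    show ?thesis using Ainf lim p3 p4 p5 by blast
  qed
  have "\<exists>\<Phi>h eh. inW N \<Phi>h \<and> N_lowest N (?F \<Xi>) eh \<and> (\<forall>i<N. ae_eq (?F \<Xi> (\<Phi>h i)) (\<lambda>x. of_real (eh i) * \<Phi>h i x))"
    using e(1,2,4) unfolding eigvec_def by blast
  then show ?thesis using e(2,3) e2(2,3) main by blast
qed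

end
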